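(* Let $N\ge1$, $0<\mu\le1$, and let $0\le V\in L^{p_0}_U(\mathbb{R}^N)$ with $p_0>\max\{\frac{N}{2\mu},1\}$. Then $$\omega_2=a_*:=\inf\Big\{\int_{\mathbb{R}^N}|(-\Delta)^{\mu/2}\phi|^2+\int_{\mathbb{R}^N}V|\phi|^2:\ \phi\in C^\infty_c(\mathbb{R}^N),\ \|\phi\|_{L^2(\mathbb{R}^N)}=1\Big\}\ge0.$$ Moreover, if $a_*>0$ then $$\int_GV(x)\,dx=\infty\quad\text{for all }G\in\mathcal{G}.$$ Conversely, if $V$ can be approximated in $L^1_U(\mathbb{R}^N)$ by bounded functions, then the condition $\int_GV(x)\,dx=\infty$ for all $G\in\mathcal{G}$ implies $a_*>0$.
   Context: For $1\le q<\infty$, $L^{q}_U(\mathbb{R}^N)$ is the space of $V\in L^{q}_{loc}(\mathbb{R}^N)$ with $\|V\|_{L^{q}_U(\mathbb{R}^N)}=\sup_{x_0\in\mathbb{R}^N}\|V\|_{L^{q}(B(x_0,1))}<\infty$; $L^\infty_U(\mathbb{R}^N)=L^\infty(\mathbb{R}^N)$. "$V$ can be approximated in $L^1_U(\mathbb{R}^N)$ by bounded functions" means that there is a sequence $W_n\in L^\infty(\mathbb{R}^N)$ with $\|W_n-V\|_{L^1_U(\mathbb{R}^N)}\to0$. $\mathcal{G}$ is the class of all open subsets $G\subset\mathbb{R}^N$ containing arbitrarily large balls, i.e. such that for every $r>0$ there is $x_0\in\mathbb{R}^N$ with $B(x_0,r)\subset G$. $(-\Delta)^s$ is the Fourier multiplier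 operator with symbol $|\xi|^{2s}$, and $H^\mu(\mathbb{R}^N)$ is the $L^2$-based Bessel potential space of order $\mu$. $S_{\mu,V}(t)$ in $L^2(\mathbb{R}^N)$ is the semigroup generated by $-A$, where $A$ is the nonnegative self-adjoint operator associated with the form $a(\phi,\psi)=\int(-\Delta)^{\mu/2}\phi(-\Delta)^{\mu/2}\psi+\int V\phi\psi$ with domain $H^\mu(\mathbb{R}^N)$. Its exponential type is $\omega_2=\sup\{a\in\mathbb{R}:\ \|S_{\mu,V}(t)\|_{\mathcal{L}(L^2(\mathbb{R}^N))}\le Me^{-at}\ \text{for all }t\ge0,\ \text{for some }M\ge1\}$. *)

theory Defs
  imports "HOL-Analysis.Analysis"
begin

section \<open>The Hilbert space $L^2$ of equivalence classes\<close>

definition sq_integrable :: "('a::euclidean_space \<Rightarrow> 'b::euclidean_space) \<Rightarrow> bool" where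
  "sq_integrable f \<longleftrightarrow>
     f \<in> borel_measurable lebesgue \<and> integrable lebesgue (\<lambda>x. (norm (f x))\<^sup>2)"

definition ae_rel :: "('a::euclidean_space \<Rightarrow> 'b::euclidean_space) \<Rightarrow> ('a \<Rightarrow> 'b) \<Rightarrow> bool" where
  "ae_rel f g \<longleftrightarrow> sq_integrable f \<and> sq_integrable g \<and> (AE x in lebesgue. f x = g x)"

lemma sq_integrable_zero: "sq_integrable (\<lambda>_. 0)"
  by (simp add: sq_integrable_def)

lemma sq_integrable_add:
  assumes "sq_integrable f" "sq_integrable g"
  shows "sq_integrable (\<lambda>x. f x + g x)"
proof -
  have [measurable]: "f \<in> borel_measurable lebesgue" "g \<in> borel_measurable lebesgue"
    using assms by (auto simp: sq_integrable_def)
  have i: "integrable lebesgue (\<lambda>x. 2 * (norm (f x))\<^sup>2 + 2 * (norm (g x))\<^sup>2)"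
    using assms by (auto simp: sq_integrable_def)
  have b: "(norm (a + b))\<^sup>2 \<le> 2 * (norm a)\<^sup>2 + 2 * (norm b)\<^sup>2" for a b :: 'b
  proof -
    have "(norm (a + b))\<^sup>2 \<le> (norm a + norm b)\<^sup>2"
      by (simp add: norm_triangle_ineq power_mono)
    also have "\<dots> \<le> 2 * (norm a)\<^sup>2 + 2 * (norm b)\<^sup>2"
      using sum_squares_bound[of "norm a" "norm b"] by (simp add: power2_sum)
    finally show ?thesis .
  qed
  have "integrable lebesgue (\<lambda>x. (norm (f x + g x))\<^sup>2)"
    by (rule Bochner_Integration.integrable_bound[OF i]) (use b in auto)
  then show ?thesis by (simp add: sq_integrable_def)
qed

lemma sq_integrable_scaleR:
  assumes "sq_integrable f"
  shows "sq_integrable (\<lambda>x. c *\<^sub>R f x)"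
  using assms by (auto simp: sq_integrable_def power_mult_distrib)

lemma sq_integrable_uminus: "sq_integrable f \<Longrightarrow> sq_integrable (\<lambda>x. - f x)"
  using sq_integrable_scaleR[of f "-1"] by simp

lemma sq_integrable_diff:
  "sq_integrable f \<Longrightarrow> sq_integrable g \<Longrightarrow> sq_integrable (\<lambda>x. f x - g x)"
  using sq_integrable_add[of f "\<lambda>x. - g x"] sq_integrable_uminus[of g] by simp

lemma integrable_inner_sq:
  assumes "sq_integrable f" "sq_integrable g"
  shows "integrable lebesgue (\<lambda>x. f x \<bullet> g x)"
proof -
  have [measurable]: "f \<in> borel_measurable lebesgue" "g \<in> borel_measurable lebesgue"
    using assms by (auto simp: sq_integrable_def)
  have i: "integrable lebesgue (\<lambda>x. (norm (f x))\<^sup>2 + (norm (g x))\<^sup>2)"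
    using assms by (auto simp: sq_integrable_def)
  have b: "\<bar>a \<bullet> b\<bar> \<le> (norm a)\<^sup>2 + (norm b)\<^sup>2" for a b :: 'b
  proof -
    have "\<bar>a \<bullet> b\<bar> \<le> norm a * norm b" by (rule Cauchy_Schwarz_ineq2)
    also have "\<dots> \<le> 2 * norm a * norm b" by simp
    also have "\<dots> \<le> (norm a)\<^sup>2 + (norm b)\<^sup>2" by (rule sum_squares_bound)
    finally show ?thesis .
  qed
  show ?thesis
    by (rule Bochner_Integration.integrable_bound[OF i]) (use b in auto)
qed

quotient_type (overloaded) ('a, 'b) L2 = "'a::euclidean_space \<Rightarrow> 'b::euclidean_space" / partial: ae_rel
proof (rule part_equivpI)
  show "\<exists>f::'a \<Rightarrow> 'b. ae_rel f f"
    using sq_integrable_zero by (auto simp: ae_rel_def)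
  show "symp (ae_rel :: ('a \<Rightarrow> 'b) \<Rightarrow> _)"
    by (auto simp: symp_def ae_rel_def eq_commute)
  show "transp (ae_rel :: ('a \<Rightarrow> 'b) \<Rightarrow> _)"
    by (auto simp: transp_def ae_rel_def)
qed

instantiation L2 :: (euclidean_space, euclidean_space) real_inner
begin

lift_definition zero_L2 :: "('a, 'b) L2" is "\<lambda>_. 0"
  by (simp add: ae_rel_def sq_integrable_zero)

lift_definition plus_L2 :: "('a, 'b) L2 \<Rightarrow> ('a, 'b) L2 \<Rightarrow> ('a, 'b) L2" is "\<lambda>f g x. f x + g x"
  by (auto simp: ae_rel_def intro: sq_integrable_add)

lift_definition minus_L2 :: "('a, 'b) L2 \<Rightarrow> ('a, 'b) L2 \<Rightarrow> ('a, 'b) L2" is "\<lambda>f g x. f x - g x"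
  by (auto simp: ae_rel_def intro: sq_integrable_diff)

lift_definition uminus_L2 :: "('a, 'b) L2 \<Rightarrow> ('a, 'b) L2" is "\<lambda>f x. - f x"
  by (auto simp: ae_rel_def intro: sq_integrable_uminus)

lift_definition scaleR_L2 :: "real \<Rightarrow> ('a, 'b) L2 \<Rightarrow> ('a, 'b) L2" is "\<lambda>c f x. c *\<^sub>R f x"
  by (auto simp: ae_rel_def intro: sq_integrable_scaleR)

lift_definition inner_L2 :: "('a, 'b) L2 \<Rightarrow> ('a, 'b) L2 \<Rightarrow> real"
  is "\<lambda>f g. \<integral>x. f x \<bullet> g x \<partial>lebesgue"
proof -
  fix f f' g g' :: "'a \<Rightarrow> 'b"
  assume a: "ae_rel f f'" "ae_rel g g'"
  have [measurable]: "f \<in> borel_measurable lebesgue" "g \<in> borel_measurable lebesgue"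
    "f' \<in> borel_measurable lebesgue" "g' \<in> borel_measurable lebesgue"
    using a by (auto simp: ae_rel_def sq_integrable_def)
  show "(\<integral>x. f x \<bullet> g x \<partial>lebesgue) = (\<integral>x. f' x \<bullet> g' x \<partial>lebesgue)"
    by (rule integral_cong_AE) (use a in \<open>auto simp: ae_rel_def\<close>)
qed

definition norm_L2 :: "('a, 'b) L2 \<Rightarrow> real" where
  "norm_L2 u = sqrt (u \<bullet> u)"

definition dist_L2 :: "('a, 'b) L2 \<Rightarrow> ('a, 'b) L2 \<Rightarrow> real" where
  "dist_L2 u v = norm (u - v)"

definition sgn_L2 :: "('a, 'b) L2 \<Rightarrow> ('a, 'b) L2" where
  "sgn_L2 u = inverse (norm u) *\<^sub>R u"

definition uniformity_L2 :: "(('a, 'b) L2 \<times> ('a, 'b) L2) filter" where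
  "uniformity_L2 = (INF e\<in>{0<..}. principal {(u, v). dist u v < e})"

definition open_L2 :: "('a, 'b) L2 set \<Rightarrow> bool" where
  "open_L2 U \<longleftrightarrow> (\<forall>x\<in>U. \<forall>\<^sub>F (x', y) in uniformity. x' = x \<longrightarrow> y \<in> U)"

instance
proof
  fix u v w :: "('a, 'b) L2" and r s :: real
  show "u + v + w = u + (v + w)"
    by transfer (auto simp: ae_rel_def add.assoc intro!: sq_integrable_add)
  show "u + v = v + u"
    by transfer (auto simp: ae_rel_def add.commute intro!: sq_integrable_add)
  show "0 + u = u"
    by transfer (auto simp: ae_rel_def)
  show "- u + u = 0"
    by transfer (auto simp: ae_rel_def sq_integrable_zero)
  show "u - v = u + - v"
    by transfer (auto simp: ae_rel_def intro: sq_integrable_diff)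
  show "r *\<^sub>R (u + v) = r *\<^sub>R u + r *\<^sub>R v"
    by transfer
      (auto simp: ae_rel_def scaleR_add_right intro!: sq_integrable_add sq_integrable_scaleR)
  show "(r + s) *\<^sub>R u = r *\<^sub>R u + s *\<^sub>R u"
    by transfer
      (auto simp: ae_rel_def scaleR_add_left intro!: sq_integrable_add sq_integrable_scaleR)
  show "r *\<^sub>R s *\<^sub>R u = (r * s) *\<^sub>R u"
    by transfer (auto simp: ae_rel_def intro!: sq_integrable_scaleR)
  show "1 *\<^sub>R u = u"
    by transfer (auto simp: ae_rel_def)
  show "dist u v = norm (u - v)" by (rule dist_L2_def)
  show "sgn u = inverse (norm u) *\<^sub>R u" by (rule sgn_L2_def)
  show "(uniformity :: (('a, 'b) L2 \<times> ('a, 'b) L2) filter)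
      = (INF e\<in>{0<..}. principal {(u, v). dist u v < e})"
    by (rule uniformity_L2_def)
  show "open U \<longleftrightarrow> (\<forall>x\<in>U. \<forall>\<^sub>F (x', y) in uniformity. x' = x \<longrightarrow> y \<in> U)"
    for U :: "('a, 'b) L2 set"
    by (rule open_L2_def)
  show "u \<bullet> v = v \<bullet> u"
    by transfer (simp add: inner_commute)
  show "(u + v) \<bullet> w = u \<bullet> w + v \<bullet> w"
    by transfer (simp add: ae_rel_def inner_add_left integrable_inner_sq)
  show "(r *\<^sub>R u) \<bullet> v = r * (u \<bullet> v)"
    by transfer simp
  show "0 \<le> u \<bullet> u"
    by transfer simp
  show "u \<bullet> u = 0 \<longleftrightarrow> u = 0"
  proof transfer
    fix f :: "'a \<Rightarrow> 'b"
    assume f: "ae_rel f f"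
    then have "integrable lebesgue (\<lambda>x. f x \<bullet> f x)"
      by (simp add: ae_rel_def integrable_inner_sq)
    then have "(\<integral>x. f x \<bullet> f x \<partial>lebesgue) = 0 \<longleftrightarrow> (AE x in lebesgue. f x \<bullet> f x = 0)"
      by (intro integral_nonneg_eq_0_iff_AE) auto
    then show "(\<integral>x. f x \<bullet> f x \<partial>lebesgue) = 0 \<longleftrightarrow> ae_rel f (\<lambda>_. 0)"
      using f by (auto simp: ae_rel_def sq_integrable_zero)
  qed
  show "norm u = sqrt (u \<bullet> u)" by (rule norm_L2_def)
qed

end

lift_definition complexify :: "('a::euclidean_space, real) L2 \<Rightarrow> ('a, complex) L2"
  is "\<lambda>f x. complex_of_real (f x)"
  by (auto simp: ae_rel_def sq_integrable_def)


section \<open>Fourier transform, fractional Laplacian and Bessel potential spaces\<close>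

definition fourier_integral :: "('a::euclidean_space \<Rightarrow> complex) \<Rightarrow> 'a \<Rightarrow> complex" where
  "fourier_integral f \<xi> =
     (2 * pi) powr (- (real DIM('a) / 2)) *\<^sub>R (\<integral>x. f x * cis (- (x \<bullet> \<xi>)) \<partial>lebesgue)"

text \<open>Plancherel's extension to \<open>L\<^sup>2\<close>: the limit in the \<open>L\<^sup>2\<close> norm of the Fourier integrals
  of the truncations, which lie in \<open>L\<^sup>1 \<inter> L\<^sup>2\<close>.\<close>

definition fourier :: "('a::euclidean_space, complex) L2 \<Rightarrow> ('a, complex) L2" where
  "fourier u =
     lim (\<lambda>n. abs_L2 (fourier_integral (\<lambda>x. indicator (ball 0 (real n)) x *\<^sub>R rep_L2 u x)))"

definition bessel_space :: "real \<Rightarrow> ('a::euclidean_space, real) L2 set" where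
  "bessel_space \<mu> =
     {u. sq_integrable
           (\<lambda>\<xi>. (1 + (norm \<xi>)\<^sup>2) powr (\<mu> / 2) *\<^sub>R rep_L2 (fourier (complexify u)) \<xi>)}"

text \<open>Meaningful for \<open>s > 0\<close> and \<open>u \<in> bessel_space (2 * s)\<close>. The multiplier is real and even, so
  the operator maps real-valued functions to real-valued functions.\<close>

definition frac_laplacian ::
    "real \<Rightarrow> ('a::euclidean_space, real) L2 \<Rightarrow> ('a, real) L2" where
  "frac_laplacian s u =
     (THE f. fourier (complexify f) =
             abs_L2 (\<lambda>\<xi>. (norm \<xi> powr (2 * s)) *\<^sub>R rep_L2 (fourier (complexify u)) \<xi>))"


section \<open>Operators associated with forms, semigroups, exponential type\<close>

text \<open>Unbounded operators are represented by their graphs.\<close>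

definition form_operator ::
    "'h::real_inner set \<Rightarrow> ('h \<Rightarrow> 'h \<Rightarrow> real) \<Rightarrow> ('h \<times> 'h) set" where
  "form_operator D a = {(u, f). u \<in> D \<and> (\<forall>v\<in>D. a u v = f \<bullet> v)}"

text \<open>Only the values of \<open>S\<close> at times \<open>t \<ge> 0\<close> are relevant.\<close>

definition C0_semigroup :: "(real \<Rightarrow> 'h::real_normed_vector \<Rightarrow>\<^sub>L 'h) \<Rightarrow> bool" where
  "C0_semigroup S \<longleftrightarrow>
     S 0 = id_blinfun \<and>
     (\<forall>s\<ge>0. \<forall>t\<ge>0. S (s + t) = S s o\<^sub>L S t) \<and>
     (\<forall>u. ((\<lambda>t. S t u) \<longlongrightarrow> u) (at_right 0))"

definition generator :: "(real \<Rightarrow> 'h::real_normed_vector \<Rightarrow>\<^sub>L 'h) \<Rightarrow> ('h \<times> 'h) set" where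
  "generator S = {(u, g). ((\<lambda>t. (S t u - u) /\<^sub>R t) \<longlongrightarrow> g) (at_right 0)}"

definition exponential_type :: "(real \<Rightarrow> 'h::real_normed_vector \<Rightarrow>\<^sub>L 'h) \<Rightarrow> ereal" where
  "exponential_type S =
     Sup (ereal ` {a. \<exists>M\<ge>1. \<forall>t\<ge>0. norm (S t) \<le> M * exp (- a * t)})"

definition schroedinger_form ::
    "real \<Rightarrow> ('a::euclidean_space \<Rightarrow> real) \<Rightarrow> ('a, real) L2 \<Rightarrow> ('a, real) L2 \<Rightarrow> real" where
  "schroedinger_form \<mu> V \<phi> \<psi> =
     (\<integral>x. rep_L2 (frac_laplacian (\<mu> / 2) \<phi>) x * rep_L2 (frac_laplacian (\<mu> / 2) \<psi>) x \<partial>lebesgue)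
     + (\<integral>x. V x * rep_L2 \<phi> x * rep_L2 \<psi> x \<partial>lebesgue)"

definition schroedinger_operator ::
    "real \<Rightarrow> ('a::euclidean_space \<Rightarrow> real) \<Rightarrow> (('a, real) L2 \<times> ('a, real) L2) set" where
  "schroedinger_operator \<mu> V = form_operator (bessel_space \<mu>) (schroedinger_form \<mu> V)"

definition is_schroedinger_semigroup ::
    "real \<Rightarrow> ('a::euclidean_space \<Rightarrow> real) \<Rightarrow> (real \<Rightarrow> ('a, real) L2 \<Rightarrow>\<^sub>L ('a, real) L2) \<Rightarrow> bool"
  where
  "is_schroedinger_semigroup \<mu> V S \<longleftrightarrow>
     C0_semigroup S \<and> generator S = {(u, - f) | u f. (u, f) \<in> schroedinger_operator \<mu> V}"


section \<open>Test functions and the variational quantity\<close>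

primrec C_k :: "nat \<Rightarrow> ('a::euclidean_space \<Rightarrow> real) \<Rightarrow> bool" where
  "C_k 0 f \<longleftrightarrow> continuous_on UNIV f"
| "C_k (Suc k) f \<longleftrightarrow>
     (\<forall>x. f differentiable (at x)) \<and> (\<forall>b\<in>Basis. C_k k (\<lambda>x. frechet_derivative f (at x) b))"

definition test_functions :: "('a::euclidean_space \<Rightarrow> real) set" where
  "test_functions = {\<phi>. (\<forall>k. C_k k \<phi>) \<and> compact (closure {x. \<phi> x \<noteq> 0})}"

definition a_star :: "real \<Rightarrow> ('a::euclidean_space \<Rightarrow> real) \<Rightarrow> real" where
  "a_star \<mu> V =
     Inf {(\<integral>x. \<bar>rep_L2 (frac_laplacian (\<mu> / 2) (abs_L2 \<phi>)) x\<bar>\<^sup>2 \<partial>lebesgue)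
          + (\<integral>x. V x * \<bar>\<phi> x\<bar>\<^sup>2 \<partial>lebesgue) | \<phi>.
          \<phi> \<in> test_functions \<and> norm (abs_L2 \<phi>) = 1}"


section \<open>Locally uniform Lebesgue spaces\<close>

definition L_inf :: "('a::euclidean_space \<Rightarrow> real) set" where
  "L_inf = {f \<in> borel_measurable lebesgue. \<exists>C. AE x in lebesgue. \<bar>f x\<bar> \<le> C}"

definition L_loc :: "real \<Rightarrow> ('a::euclidean_space \<Rightarrow> real) set" where
  "L_loc q = {f \<in> borel_measurable lebesgue.
     \<forall>K. compact K \<longrightarrow> set_integrable lebesgue K (\<lambda>x. \<bar>f x\<bar> powr q)}"

definition L_ball_norm :: "real \<Rightarrow> ('a::euclidean_space \<Rightarrow> real) \<Rightarrow> 'a \<Rightarrow> real" where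
  "L_ball_norm q f x\<^sub>0 = (LINT x:ball x\<^sub>0 1|lebesgue. \<bar>f x\<bar> powr q) powr (1 / q)"

definition L_U_norm :: "real \<Rightarrow> ('a::euclidean_space \<Rightarrow> real) \<Rightarrow> real" where
  "L_U_norm q f = (SUP x\<^sub>0. L_ball_norm q f x\<^sub>0)"

definition L_U :: "ereal \<Rightarrow> ('a::euclidean_space \<Rightarrow> real) set" where
  "L_U q = (if q = \<infinity> then L_inf
            else {f \<in> L_loc (real_of_ereal q).
                    bdd_above (range (L_ball_norm (real_of_ereal q) f))})"

definition L1_U_approximable :: "('a::euclidean_space \<Rightarrow> real) \<Rightarrow> bool" where
  "L1_U_approximable V \<longleftrightarrow>
     (\<exists>W :: nat \<Rightarrow> 'a \<Rightarrow> real. (\<forall>n. W n \<in> L_inf) \<and>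
        (\<lambda>n. L_U_norm 1 (\<lambda>x. W n x - V x)) \<longlonglongrightarrow> 0)"

definition large_ball_sets :: "'a::euclidean_space set set" where
  "large_ball_sets = {G. open G \<and> (\<forall>r>0. \<exists>x\<^sub>0. ball x\<^sub>0 r \<subseteq> G)}"

end

theory Submission
  imports Defs "HOL-Probability.Probability"
begin

text \<open>The exponential type is governed by the form alone: \<open>t \<mapsto> S\<^sub>t u\<close> decays at the rate of the lower
  bound \<open>a\<^sub>*\<close> of the form, while a faster decay would raise that bound. That the form lives on the
  Bessel space and that test functions form a core follow from the estimate
  \<open>\<integral> V f\<^sup>2 \<le> C (\<parallel>f\<parallel>\<^sup>2 + energy f)\<close>, which is obtained without Sobolev embeddings: by Hoelder's
  inequality \<open>\<integral> V\<close> over a ball of radius \<open>r \<le> 1\<close> is at most \<open>A r\<^sup>\<beta>\<close> with \<open>\<beta> > N - 2 \<mu>\<close>, and \<open>f\<close> is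
  telescoped over its averages on dyadic balls, whose differences are translations controlled by
  the fractional energy.

  A bump stretched to a ball of radius \<open>R\<close> contained in \<open>G\<close> has negligible energy as
  \<open>R\<close> grows, so \<open>\<integral>\<^sub>G V < \<infinity>\<close> forces \<open>a\<^sub>* = 0\<close>. Conversely, if no \<open>\<integral>\<^sub>G V\<close> is finite, then the integrals of
  \<open>V\<close> over all balls of some fixed radius are bounded below, since otherwise a union of balls with
  summable integrals would be a counterexample. Approximability by bounded functions lets this lower
  bound survive the truncation of \<open>V\<close> at a constant, and for a bounded potential a Poincare-type
  averaging argument yields coercivity.\<close>

section \<open>Completeness of \<open>L\<^sup>2\<close> and orthogonal projection\<close>

text \<open>The semigroup is known only through its generator, and a vector of the form domain need
  not lie in the domain of that generator, so its orbit cannot simply be differentiated at time 0;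
  decay and form are compared through time averages and log-convexity instead.
  \<open>fourier\<close> and \<open>frac_laplacian\<close> are a limit and a definite description,
  which carry no information before convergence, existence and uniqueness are known: Plancherel
  comes from Gaussian regularisation, and the transforms of real-valued functions are identified as
  the Hermitian ones. Lower bounds on the energy all flow through \<integral> |f(x+y) - f(x)|^2 dx
  \<le> 4 |y|^(2 \<mu>) energy(f), which uses \<mu> \<le> 1, as does the membership of Lipschitz
  functions in the Bessel space. The exponent \<beta> is N - N/q for an L^q_U potential, and N - N/q
  > N - 2 \<mu> is the condition q > N/(2 \<mu>). Translations and Tonelli are applied to Borel
  functions, so V is replaced by a nonnegative Borel version \<open>W\<close>.\<close>

lemma sq_integrable_rep_L2 [simp]: "sq_integrable (rep_L2 u)"
  using Quotient_rep_reflp[OF Quotient_L2] by (simp add: ae_rel_def)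

lemma abs_rep_L2 [simp]: "abs_L2 (rep_L2 u) = u"
  by (rule Quotient_abs_rep[OF Quotient_L2])

lemma abs_L2_eq_iff:
  assumes "sq_integrable f" "sq_integrable g"
  shows "abs_L2 f = abs_L2 g \<longleftrightarrow> (AE x in lebesgue. f x = g x)"
  using Quotient_rel[OF Quotient_L2, of f g] assms by (simp add: ae_rel_def)

lemma rep_abs_L2: "sq_integrable f \<Longrightarrow> AE x in lebesgue. rep_L2 (abs_L2 f) x = f x"
  using abs_L2_eq_iff[of "rep_L2 (abs_L2 f)" f] by simp

lemma sq_integrable_measurable: "sq_integrable f \<Longrightarrow> f \<in> borel_measurable lebesgue"
  by (simp add: sq_integrable_def)

lemma rep_L2_measurable [measurable]: "rep_L2 u \<in> borel_measurable lebesgue"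
  by (rule sq_integrable_measurable) simp

lemma abs_L2_add:
  "sq_integrable f \<Longrightarrow> sq_integrable g \<Longrightarrow> abs_L2 f + abs_L2 g = abs_L2 (\<lambda>x. f x + g x)"
  by (rule plus_L2.abs_eq) (auto simp: ae_rel_def)

lemma abs_L2_diff:
  "sq_integrable f \<Longrightarrow> sq_integrable g \<Longrightarrow> abs_L2 f - abs_L2 g = abs_L2 (\<lambda>x. f x - g x)"
  by (rule minus_L2.abs_eq) (auto simp: ae_rel_def)

lemma abs_L2_scaleR: "sq_integrable f \<Longrightarrow> c *\<^sub>R abs_L2 f = abs_L2 (\<lambda>x. c *\<^sub>R f x)"
  by (rule scaleR_L2.abs_eq) (auto simp: ae_rel_def)

lemma abs_L2_inner:
  "sq_integrable f \<Longrightarrow> sq_integrable g \<Longrightarrow> abs_L2 f \<bullet> abs_L2 g = (\<integral>x. f x \<bullet> g x \<partial>lebesgue)"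
  by (rule inner_L2.abs_eq) (auto simp: ae_rel_def)

lemma rep_L2_add: "AE x in lebesgue. rep_L2 (u + v) x = rep_L2 u x + rep_L2 v x"
  using rep_abs_L2[of "\<lambda>x. rep_L2 u x + rep_L2 v x"] abs_L2_add[of "rep_L2 u" "rep_L2 v"]
  by (simp add: sq_integrable_add)

lemma rep_L2_diff: "AE x in lebesgue. rep_L2 (u - v) x = rep_L2 u x - rep_L2 v x"
  using rep_abs_L2[of "\<lambda>x. rep_L2 u x - rep_L2 v x"] abs_L2_diff[of "rep_L2 u" "rep_L2 v"]
  by (simp add: sq_integrable_diff)

lemma rep_L2_scaleR: "AE x in lebesgue. rep_L2 (c *\<^sub>R u) x = c *\<^sub>R rep_L2 u x"
  using rep_abs_L2[of "\<lambda>x. c *\<^sub>R rep_L2 u x"] abs_L2_scaleR[of "rep_L2 u" c]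
  by (simp add: sq_integrable_scaleR)

lemma norm_L2_sq: "(norm u)\<^sup>2 = (\<integral>x. (norm (rep_L2 u x))\<^sup>2 \<partial>lebesgue)"
  by (simp add: power2_norm_eq_inner inner_L2.rep_eq)

lemma nn_integral_rep_L2: "(\<integral>\<^sup>+x. ennreal ((norm (rep_L2 u x))\<^sup>2) \<partial>lebesgue) = ennreal ((norm u)\<^sup>2)"
  unfolding norm_L2_sq
  by (rule nn_integral_eq_integral) (use sq_integrable_rep_L2[of u] in \<open>auto simp: sq_integrable_def\<close>)

lemma norm_abs_L2_sq: "sq_integrable f \<Longrightarrow> (norm (abs_L2 f))\<^sup>2 = (\<integral>x. (norm (f x))\<^sup>2 \<partial>lebesgue)"
  by (simp add: power2_norm_eq_inner abs_L2_inner)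

lemma nn_integral_abs_L2:
  "sq_integrable f \<Longrightarrow> (\<integral>\<^sup>+x. ennreal ((norm (f x))\<^sup>2) \<partial>lebesgue) = ennreal ((norm (abs_L2 f))\<^sup>2)"
  unfolding norm_abs_L2_sq by (rule nn_integral_eq_integral) (auto simp: sq_integrable_def)

lemma sq_integrableI_nn:
  assumes "f \<in> borel_measurable lebesgue" "(\<integral>\<^sup>+x. ennreal ((norm (f x))\<^sup>2) \<partial>lebesgue) < \<infinity>"
  shows "sq_integrable f"
  using assms by (simp add: sq_integrable_def integrable_iff_bounded)

text \<open>Fatou arguments end in a bound on a nonnegative integral; such a bound becomes
  membership in L^2 and a norm estimate at once.\<close>

lemma norm_abs_L2_le:
  assumes "f \<in> borel_measurable lebesgue" "0 \<le> C"
    and "(\<integral>\<^sup>+x. ennreal ((norm (f x))\<^sup>2) \<partial>lebesgue) \<le> ennreal (C\<^sup>2)"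
  shows "sq_integrable f" "norm (abs_L2 f) \<le> C"
proof -
  show f: "sq_integrable f"
    by (rule sq_integrableI_nn[OF assms(1)]) (use assms(3) in \<open>auto intro: le_less_trans\<close>)
  show "norm (abs_L2 f) \<le> C"
    using assms(2,3) nn_integral_abs_L2[OF f] by (auto simp: intro: power2_le_imp_le)
qed

section \<open>Almost everywhere convergence and completeness\<close>

text \<open>By Tonelli the pointwise series has a finite integral, so it is finite almost
  everywhere. The weights \<open>c\<close> allow growing factors: with \<open>2 ^ n\<close> the
  squares decay geometrically at almost every point, which makes the norms summable too.\<close>

lemma AE_summable_L2:
  fixes w :: "nat \<Rightarrow> ('a::euclidean_space, 'b::euclidean_space) L2"
  assumes c: "\<And>n. 0 \<le> c n" and s: "summable (\<lambda>n. c n * (norm (w n))\<^sup>2)"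
  shows "AE x in lebesgue. summable (\<lambda>n. c n * (norm (rep_L2 (w n) x))\<^sup>2)"
proof -
  have "(\<integral>\<^sup>+x. (\<Sum>n. ennreal (c n * (norm (rep_L2 (w n) x))\<^sup>2)) \<partial>lebesgue)
      = (\<Sum>n. \<integral>\<^sup>+x. ennreal (c n * (norm (rep_L2 (w n) x))\<^sup>2) \<partial>lebesgue)"
    by (rule nn_integral_suminf) measurable
  also have "\<dots> = (\<Sum>n. ennreal (c n * (norm (w n))\<^sup>2))"
    using c by (simp add: ennreal_mult nn_integral_cmult nn_integral_rep_L2)
  also have "\<dots> = ennreal (\<Sum>n. c n * (norm (w n))\<^sup>2)"
    by (rule suminf_ennreal2) (use c s in auto)
  finally have "(\<integral>\<^sup>+x. (\<Sum>n. ennreal (c n * (norm (rep_L2 (w n) x))\<^sup>2)) \<partial>lebesgue) \<noteq> \<infinity>" by simp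
  then have "AE x in lebesgue. (\<Sum>n. ennreal (c n * (norm (rep_L2 (w n) x))\<^sup>2)) \<noteq> \<infinity>"
    by (intro nn_integral_PInf_AE) measurable
  then show ?thesis
    by eventually_elim (use c in \<open>auto intro!: summable_suminf_not_top\<close>)
qed

text \<open>Along a subsequence with errors below \<open>(1 / 2) ^ k\<close> the squared errors are
  summable at almost every point, hence tend to 0 there.\<close>

lemma L2_tendsto_AE_subseq:
  fixes X :: "nat \<Rightarrow> ('a::euclidean_space, 'b::euclidean_space) L2"
  assumes "X \<longlonglongrightarrow> u"
  obtains r where "strict_mono r" "AE x in lebesgue. (\<lambda>n. rep_L2 (X (r n)) x) \<longlonglongrightarrow> rep_L2 u x"
proof -
  have "\<forall>e>0. \<exists>N. \<forall>n\<ge>N. norm (X n - u) < e"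
    using assms by (simp add: LIMSEQ_iff)
  then have "\<exists>N. \<forall>n\<ge>N. norm (X n - u) < (1 / 2) ^ k" for k by simp
  then obtain N where N: "\<And>k n. n \<ge> N k \<Longrightarrow> norm (X n - u) < (1 / 2) ^ k" by metis
  \<comment> \<open>The maximum secures both strict monotonicity and
    \<open>r k \<ge> N k\<close>.\<close>
  define r where "r = rec_nat (N 0) (\<lambda>k m. max (Suc m) (N (Suc k)))"
  have rS: "r (Suc k) = max (Suc (r k)) (N (Suc k))" for k by (simp add: r_def)
  have r: "strict_mono r" by (rule strict_monoI_Suc) (simp add: rS)
  have rN: "r k \<ge> N k" for k by (cases k) (auto simp: rS, simp add: r_def)
  have le: "(norm (X (r k) - u))\<^sup>2 \<le> (1 / 4) ^ k" for k
  proof -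
    have "(norm (X (r k) - u))\<^sup>2 \<le> ((1 / 2) ^ k)\<^sup>2"
      using N[OF rN[of k]] by (intro power_mono) auto
    also have "\<dots> = (1 / 4) ^ k" by (simp add: power2_eq_square power_mult_distrib[symmetric])
    finally show ?thesis .
  qed
  have "summable (\<lambda>k. (1 / 4 :: real) ^ k)" by (rule summable_geometric) simp
  then have "summable (\<lambda>k. 1 * (norm (X (r k) - u))\<^sup>2)"
    by (rule summable_comparison_test'[where N = 0]) (simp add: le)
  then have "AE x in lebesgue. summable (\<lambda>k. 1 * (norm (rep_L2 (X (r k) - u) x))\<^sup>2)"
    by (intro AE_summable_L2) auto
  moreover have "AE x in lebesgue. \<forall>k. rep_L2 (X (r k) - u) x = rep_L2 (X (r k)) x - rep_L2 u x"
    by (simp add: AE_all_countable rep_L2_diff)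
  ultimately have "AE x in lebesgue. (\<lambda>n. rep_L2 (X (r n)) x) \<longlonglongrightarrow> rep_L2 u x"
  proof eventually_elim
    case (elim x)
    then have "(\<lambda>k. (norm (rep_L2 (X (r k)) x - rep_L2 u x))\<^sup>2) \<longlonglongrightarrow> 0"
      using summable_LIMSEQ_zero[of "\<lambda>k. (norm (rep_L2 (X (r k)) x - rep_L2 u x))\<^sup>2"] by simp
    then have "(\<lambda>k. sqrt ((norm (rep_L2 (X (r k)) x - rep_L2 u x))\<^sup>2)) \<longlonglongrightarrow> sqrt 0"
      by (rule tendsto_real_sqrt)
    then have "(\<lambda>k. norm (rep_L2 (X (r k)) x - rep_L2 u x)) \<longlonglongrightarrow> 0"
      by (simp only: real_sqrt_abs abs_norm_cancel real_sqrt_zero)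
    then show ?case by (rule LIM_zero_cancel[OF tendsto_norm_zero_cancel])
  qed
  then show ?thesis using r that by blast
qed

text \<open>Riesz-Fischer: a rapidly Cauchy subsequence converges at almost every point, and Fatou
  turns the Cauchy estimates into norm convergence to the pointwise limit.\<close>

lemma L2_Cauchy_convergent:
  fixes X :: "nat \<Rightarrow> ('a::euclidean_space, 'b::euclidean_space) L2"
  assumes X: "Cauchy X"
  shows "convergent X"
proof -
  have "\<exists>N. \<forall>m\<ge>N. \<forall>n\<ge>N. norm (X m - X n) < (1 / 2) ^ k" for k
    using X by (simp add: Cauchy_iff)
  then obtain N where N: "\<And>k m n. m \<ge> N k \<Longrightarrow> n \<ge> N k \<Longrightarrow> norm (X m - X n) < (1 / 2) ^ k" by metis
  define r where "r = rec_nat (N 0) (\<lambda>k m. max (Suc m) (N (Suc k)))"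
  have rS: "r (Suc k) = max (Suc (r k)) (N (Suc k))" for k by (simp add: r_def)
  have r: "strict_mono r" by (rule strict_monoI_Suc) (simp add: rS)
  have rN: "r k \<ge> N k" for k by (cases k) (auto simp: rS, simp add: r_def)
  have close: "norm (X (r k) - X (r j)) < (1 / 2) ^ k" if "k \<le> j" for k j
    using N[of k "r k" "r j"] rN[of k] strict_mono_less_eq[OF r, of k j] that by linarith
  define w where "w k = X (r (Suc k)) - X (r k)" for k
  \<comment> \<open>Increments below \<open>(1 / 2) ^ k\<close> leave room for the weight
    \<open>2 ^ k\<close>; at almost every point they are then O(2^(-k/2)), a summable bound.\<close>
  have w: "2 ^ k * (norm (w k))\<^sup>2 \<le> (1 / 2) ^ k" for k
  proof -
    have "(norm (w k))\<^sup>2 \<le> ((1 / 2) ^ k)\<^sup>2"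
      using close[of k "Suc k"] by (intro power_mono) (auto simp: w_def norm_minus_commute)
    then have "2 ^ k * (norm (w k))\<^sup>2 \<le> 2 ^ k * ((1 / 2) ^ k * (1 / 2) ^ k)"
      by (simp add: power2_eq_square)
    also have "\<dots> = (1 / 2) ^ k" by (simp add: power_divide)
    finally show ?thesis .
  qed
  have "summable (\<lambda>k. 2 ^ k * (norm (w k))\<^sup>2)"
    by (rule summable_comparison_test'[where g = "\<lambda>k. (1/2) ^ k" and N = 0]) (use w in auto)
  then have "AE x in lebesgue. summable (\<lambda>k. 2 ^ k * (norm (rep_L2 (w k) x))\<^sup>2)"
    by (intro AE_summable_L2) auto
  moreover have "AE x in lebesgue. \<forall>k. rep_L2 (w k) x = rep_L2 (X (r (Suc k))) x - rep_L2 (X (r k)) x"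
    by (simp add: AE_all_countable w_def rep_L2_diff)
  ultimately have conv: "AE x in lebesgue. convergent (\<lambda>k. rep_L2 (X (r k)) x)"
  proof eventually_elim
    case (elim x)
    define d where "d k = rep_L2 (X (r (Suc k))) x - rep_L2 (X (r k)) x" for k
    have "(\<lambda>k. 2 ^ k * (norm (d k))\<^sup>2) \<longlonglongrightarrow> 0"
      using summable_LIMSEQ_zero[OF elim(1)] elim(2) by (simp add: d_def)
    then have "Bseq (\<lambda>k. 2 ^ k * (norm (d k))\<^sup>2)" by (intro convergent_imp_Bseq convergentI)
    then obtain C where C: "C > 0" "\<And>k. norm (2 ^ k * (norm (d k))\<^sup>2) \<le> C" by (auto elim: BseqE)
    have nd: "norm (d k) \<le> sqrt C * (1 / sqrt 2) ^ k" for k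
    proof (rule power2_le_imp_le)
      have "(sqrt C * (1 / sqrt 2) ^ k)\<^sup>2 = C / 2 ^ k"
        using C(1) by (simp add: power_mult_distrib power_divide power_mult[symmetric] mult.commute[of k])
          (simp add: power_mult)
      then show "(norm (d k))\<^sup>2 \<le> (sqrt C * (1 / sqrt 2) ^ k)\<^sup>2"
        unfolding \<open>(sqrt C * (1 / sqrt 2) ^ k)\<^sup>2 = C / 2 ^ k\<close>
        using C(2)[of k] by (simp add: field_simps)
    qed (use C(1) in simp)
    have "summable (\<lambda>k. sqrt C * (1 / sqrt 2) ^ k)"
      by (intro summable_mult summable_geometric) simp
    then have "summable d" by (rule summable_comparison_test'[where N = 0]) (rule nd)
    then have "convergent (\<lambda>n. \<Sum>k<n. d k)" by (simp add: summable_iff_convergent)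
    then have "convergent (\<lambda>n. (\<Sum>k<n. d k) + rep_L2 (X (r 0)) x)"
      by (intro convergent_add convergent_const)
    moreover have "(\<Sum>k<n. d k) + rep_L2 (X (r 0)) x = rep_L2 (X (r n)) x" for n
      unfolding d_def by (subst sum_lessThan_telescope) simp
    ultimately show ?case by simp
  qed
  define f where "f x = lim (\<lambda>k. rep_L2 (X (r k)) x)" for x
  have f_meas [measurable]: "f \<in> borel_measurable lebesgue" unfolding f_def by measurable
  have lim: "AE x in lebesgue. (\<lambda>k. rep_L2 (X (r k)) x) \<longlonglongrightarrow> f x"
    using conv by eventually_elim (simp add: f_def convergent_LIMSEQ_iff)
  \<comment> \<open>Fatou with the index \<open>k\<close> kept fixed and \<open>j\<close> sent to
    infinity.\<close>
  have bound: "(\<integral>\<^sup>+x. ennreal ((norm (rep_L2 (X (r k)) x - f x))\<^sup>2) \<partial>lebesgue) \<le> ennreal (((1 / 2) ^ k)\<^sup>2)" for k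
  proof -
    have "(\<integral>\<^sup>+x. ennreal ((norm (rep_L2 (X (r k)) x - f x))\<^sup>2) \<partial>lebesgue)
      = (\<integral>\<^sup>+x. liminf (\<lambda>j. ennreal ((norm (rep_L2 (X (r k)) x - rep_L2 (X (r j)) x))\<^sup>2)) \<partial>lebesgue)"
    proof (rule nn_integral_cong_AE, use lim in eventually_elim)
      case (elim x)
      have "(\<lambda>j. ennreal ((norm (rep_L2 (X (r k)) x - rep_L2 (X (r j)) x))\<^sup>2))
          \<longlonglongrightarrow> ennreal ((norm (rep_L2 (X (r k)) x - f x))\<^sup>2)"
        by (intro tendsto_ennrealI tendsto_intros elim)
      from lim_imp_Liminf[OF sequentially_bot this] show ?case by simp
    qed
    also have "\<dots> \<le> liminf (\<lambda>j. \<integral>\<^sup>+x. ennreal ((norm (rep_L2 (X (r k)) x - rep_L2 (X (r j)) x))\<^sup>2) \<partial>lebesgue)"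
      by (rule nn_integral_liminf) measurable
    also have "\<dots> \<le> ennreal (((1 / 2) ^ k)\<^sup>2)"
    proof (rule Liminf_le)
      show "eventually (\<lambda>j. (\<integral>\<^sup>+x. ennreal ((norm (rep_L2 (X (r k)) x - rep_L2 (X (r j)) x))\<^sup>2) \<partial>lebesgue)
          \<le> ennreal (((1 / 2) ^ k)\<^sup>2)) sequentially"
        unfolding eventually_sequentially
      proof (intro exI[of _ k] allI impI)
        fix j assume "k \<le> j"
        have "(\<integral>\<^sup>+x. ennreal ((norm (rep_L2 (X (r k)) x - rep_L2 (X (r j)) x))\<^sup>2) \<partial>lebesgue)
          = (\<integral>\<^sup>+x. ennreal ((norm (rep_L2 (X (r k) - X (r j)) x))\<^sup>2) \<partial>lebesgue)"
          by (rule nn_integral_cong_AE, use rep_L2_diff[of "X (r k)" "X (r j)"] in eventually_elim) simp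
        also have "\<dots> = ennreal ((norm (X (r k) - X (r j)))\<^sup>2)" by (rule nn_integral_rep_L2)
        also have "\<dots> \<le> ennreal (((1 / 2) ^ k)\<^sup>2)"
          using close[OF \<open>k \<le> j\<close>] by (intro ennreal_leI power_mono) auto
        finally show "(\<integral>\<^sup>+x. ennreal ((norm (rep_L2 (X (r k)) x - rep_L2 (X (r j)) x))\<^sup>2) \<partial>lebesgue)
          \<le> ennreal (((1 / 2) ^ k)\<^sup>2)" .
      qed
    qed simp
    finally show ?thesis .
  qed
  have diff: "sq_integrable (\<lambda>x. rep_L2 (X (r k)) x - f x)"
      "norm (abs_L2 (\<lambda>x. rep_L2 (X (r k)) x - f x)) \<le> (1 / 2) ^ k" for k
    using norm_abs_L2_le[OF _ _ bound] by (auto simp: measurable_abs_UNIV)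
  have f_sq: "sq_integrable f"
    using sq_integrable_diff[OF sq_integrable_rep_L2[of "X (r 0)"] diff(1)[of 0]] by simp
  have "(\<lambda>k. X (r k) - abs_L2 f) \<longlonglongrightarrow> 0"
  proof (rule Lim_null_comparison)
    show "(\<lambda>k. (1 / 2 :: real) ^ k) \<longlonglongrightarrow> 0" by (rule LIMSEQ_power_zero) simp
    show "eventually (\<lambda>k. norm (X (r k) - abs_L2 f) \<le> (1 / 2) ^ k) sequentially"
      using diff(2) abs_L2_diff[OF sq_integrable_rep_L2 f_sq] by simp
  qed
  then have "(X \<circ> r) \<longlonglongrightarrow> abs_L2 f" by (simp add: LIM_zero_iff o_def)
  then show ?thesis using Cauchy_converges_subseq[OF X r] by (auto intro: convergentI)
qed

instance L2 :: (euclidean_space, euclidean_space) banach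
  by standard (rule L2_Cauchy_convergent)

section \<open>Projection onto closed subspaces\<close>

text \<open>The minimum over \<open>c\<close> sits at \<open>- q / r\<close>; for
  \<open>r = 0\<close> the expression is affine in \<open>c\<close> and stays nonnegative only if
  \<open>q = 0\<close>. It yields Cauchy-Schwarz for forms that are merely semidefinite, and
  orthogonality from minimality.\<close>

lemma discriminant_le:
  fixes p q r :: real
  assumes quad: "\<And>c. 0 \<le> p + 2 * c * q + c\<^sup>2 * r" and r: "0 \<le> r"
  shows "q\<^sup>2 \<le> p * r"
proof (cases "r = 0")
  case True
  have "q = 0"
  proof (rule ccontr)
    assume q: "q \<noteq> 0"
    have "2 * (- (p + 1) / (2 * q)) * q = - (p + 1)" using q by simp
    then show False using quad[of "- (p + 1) / (2 * q)"] True by simp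
  qed
  then show ?thesis using True by simp
next
  case False
  then have "0 \<le> p - q\<^sup>2 / r"
    using quad[of "- q / r"] r by (simp add: power2_eq_square field_simps)
  then show ?thesis using False r by (simp add: field_simps)
qed

text \<open>The parallelogram law makes a minimising sequence Cauchy: midpoints stay in
  \<open>M\<close>, hence at distance at least \<open>\<delta>\<close> from \<open>w\<close>.
  Minimality of the limit along every direction of \<open>M\<close> is orthogonality.\<close>

theorem orthogonal_projection:
  fixes M :: "'h::{real_inner, banach} set"
  assumes M: "subspace M" "closed M"
  obtains m where "m \<in> M" "\<And>v. v \<in> M \<Longrightarrow> (w - m) \<bullet> v = 0"
proof -
  define \<delta> where "\<delta> = infdist w M"
  have ne: "M \<noteq> {}" using M(1) subspace_0 by blast
  have lower: "\<delta> \<le> norm (w - v)" if "v \<in> M" for v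
    using infdist_le[OF that, of w] by (simp add: \<delta>_def dist_norm)
  have \<delta>0: "0 \<le> \<delta>" by (simp add: \<delta>_def infdist_nonneg)
  have "\<exists>v\<in>M. norm (w - v) < \<delta> + 1 / Suc n" for n
  proof (rule ccontr)
    assume "\<not> ?thesis"
    then have "\<delta> + 1 / Suc n \<le> infdist w M"
      unfolding infdist_notempty[OF ne] by (intro cINF_greatest ne) (auto simp: dist_norm not_less)
    then show False by (simp add: \<delta>_def)
  qed
  then obtain y where y: "\<And>n. y n \<in> M" "\<And>n. norm (w - y n) < \<delta> + 1 / Suc n" by metis
  have par: "(norm (y m - y n))\<^sup>2 \<le> 2 * (norm (w - y m))\<^sup>2 + 2 * (norm (w - y n))\<^sup>2 - 4 * \<delta>\<^sup>2" for m n
  proof -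
    have "(1 / 2) *\<^sub>R (y m + y n) \<in> M" using M(1) y(1) by (intro subspace_scale subspace_add)
    then have "\<delta> \<le> norm (w - (1 / 2) *\<^sub>R (y m + y n))" by (rule lower)
    then have "\<delta>\<^sup>2 \<le> (norm (w - (1 / 2) *\<^sub>R (y m + y n)))\<^sup>2" using \<delta>0 by (intro power_mono)
    also have "4 * \<dots> = 2 * (norm (w - y m))\<^sup>2 + 2 * (norm (w - y n))\<^sup>2 - (norm (y m - y n))\<^sup>2"
      by (simp add: power2_norm_eq_inner inner_simps inner_commute field_simps)
    finally show ?thesis by linarith
  qed
  have par': "(norm (y m - y n))\<^sup>2 \<le> (8 * \<delta> + 4) / Suc k" if "k \<le> m" "k \<le> n" for k m n
  proof -
    have sq: "(norm (w - y i))\<^sup>2 \<le> \<delta>\<^sup>2 + (2 * \<delta> + 1) / Suc k" if "k \<le> i" for i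
    proof -
      have k1: "1 / Suc i \<le> 1 / Suc k" "1 / real (Suc k) \<le> 1" using that by (auto simp: field_simps)
      have "norm (w - y i) \<le> \<delta> + 1 / Suc k" using y(2)[of i] k1 by linarith
      then have "(norm (w - y i))\<^sup>2 \<le> (\<delta> + 1 / Suc k)\<^sup>2" by (intro power_mono) auto
      also have "\<dots> = \<delta>\<^sup>2 + (2 * \<delta> + 1 / Suc k) * (1 / Suc k)" by (simp add: power2_eq_square algebra_simps)
      also have "\<dots> \<le> \<delta>\<^sup>2 + (2 * \<delta> + 1) * (1 / Suc k)"
        using k1 by (intro add_left_mono mult_right_mono) auto
      finally show ?thesis by simp
    qed
    have "(8 * \<delta> + 4) / Suc k = 4 * ((2 * \<delta> + 1) / Suc k)" by (simp add: algebra_simps)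
    then show ?thesis using par[of m n] sq[OF that(1)] sq[OF that(2)] by linarith
  qed
  have "Cauchy y"
    unfolding Cauchy_iff
  proof (intro allI impI)
    fix e :: real assume e: "e > 0"
    obtain k :: nat where k: "(8 * \<delta> + 4) / e\<^sup>2 < k" using reals_Archimedean2 by blast
    have "norm (y m - y n) < e" if "k \<le> m" "k \<le> n" for m n
    proof (rule power_less_imp_less_base)
      have "(8 * \<delta> + 4) < e\<^sup>2 * Suc k" using k e by (simp add: pos_divide_less_eq algebra_simps add_strict_increasing2)
      then have "(8 * \<delta> + 4) / Suc k < e\<^sup>2" by (simp add: pos_divide_less_eq)
      then show "(norm (y m - y n))\<^sup>2 < e\<^sup>2" using par'[OF that] by linarith
    qed (use e in auto)
    then show "\<exists>M. \<forall>m\<ge>M. \<forall>n\<ge>M. norm (y m - y n) < e" by blast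
  qed
  then obtain m where m: "y \<longlonglongrightarrow> m" using Cauchy_convergent_iff convergent_def by blast
  have mM: "m \<in> M" using closed_sequentially[OF M(2) y(1) m] .
  have "norm (w - m) \<le> \<delta>"
  proof (rule LIMSEQ_le)
    show "(\<lambda>n. norm (w - y n)) \<longlonglongrightarrow> norm (w - m)" by (intro tendsto_intros m)
    have "(\<lambda>n. \<delta> + 1 / Suc n) \<longlonglongrightarrow> \<delta> + 0"
      using LIMSEQ_inverse_real_of_nat by (intro tendsto_add tendsto_const) (simp add: inverse_eq_divide)
    then show "(\<lambda>n. \<delta> + 1 / Suc n) \<longlonglongrightarrow> \<delta>" by simp
    show "\<exists>N. \<forall>n\<ge>N. norm (w - y n) \<le> \<delta> + 1 / Suc n" using y(2) less_imp_le by blast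
  qed
  then have min: "norm (w - m) \<le> norm (w - v)" if "v \<in> M" for v using lower[OF that] by linarith
  have "(w - m) \<bullet> v = 0" if v: "v \<in> M" for v
  proof -
    \<comment> \<open>The constant term is 0, so \<open>discriminant_le\<close> forces the linear
      coefficient to vanish.\<close>
    have "0 \<le> 0 + 2 * c * (- ((w - m) \<bullet> v)) + c\<^sup>2 * (v \<bullet> v)" for c
    proof -
      have "m + c *\<^sub>R v \<in> M" using M(1) mM v by (intro subspace_add subspace_scale)
      from min[OF this] have "(norm (w - m))\<^sup>2 \<le> (norm (w - m - c *\<^sub>R v))\<^sup>2"
        by (intro power_mono) (simp_all add: diff_diff_eq)
      also have "\<dots> = (norm (w - m))\<^sup>2 - 2 * c * ((w - m) \<bullet> v) + c\<^sup>2 * (v \<bullet> v)"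
        unfolding power2_norm_eq_inner using inner_commute[of v "w - m"]
        by (simp only: inner_diff_left[of "w - m" "c *\<^sub>R v"] inner_diff_right[of _ "w - m" "c *\<^sub>R v"]
            inner_scaleR_left inner_scaleR_right power2_eq_square) (simp add: algebra_simps)
      finally show ?thesis by simp
    qed
    from discriminant_le[OF this inner_ge_zero] show ?thesis by simp
  qed
  with mM show ?thesis using that by blast
qed

lemma subspace_closure:
  fixes M :: "'h::real_normed_vector set"
  assumes "subspace M"
  shows "subspace (closure M)"
proof (rule subspaceI)
  show "0 \<in> closure M" using assms subspace_0 closure_subset by blast
  fix x y assume "x \<in> closure M" "y \<in> closure M"
  then obtain f g where "\<And>n. f n \<in> M" "f \<longlonglongrightarrow> x" "\<And>n. g n \<in> M" "g \<longlonglongrightarrow> y"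
    unfolding closure_sequential by blast
  then show "x + y \<in> closure M"
    unfolding closure_sequential using assms
    by (intro exI[of _ "\<lambda>n. f n + g n"]) (auto intro: tendsto_add subspace_add)
next
  fix x c assume "x \<in> closure M"
  then obtain f where "\<And>n. f n \<in> M" "f \<longlonglongrightarrow> x"
    unfolding closure_sequential by blast
  then show "c *\<^sub>R x \<in> closure M"
    unfolding closure_sequential using assms
    by (intro exI[of _ "\<lambda>n. c *\<^sub>R f n"]) (auto intro: tendsto_scaleR subspace_scale)
qed

section \<open>Semigroups of symmetric forms\<close>

text \<open>Doubling \<open>n\<close> times gives
  \<open>b s ^ (2 ^ n) \<le> b 0 ^ (2 ^ n - 1) * b (2 ^ n * s)\<close>; taking roots of order
  \<open>2 ^ n\<close> removes the constant \<open>K\<close>. So a decay rate known up to a factor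
  holds with the initial value as factor.\<close>

lemma log_convex_decay:
  fixes b :: "real \<Rightarrow> real"
  assumes nonneg: "\<And>s. 0 \<le> s \<Longrightarrow> 0 \<le> b s"
    and log_convex: "\<And>s. 0 \<le> s \<Longrightarrow> (b s)\<^sup>2 \<le> b 0 * b (2 * s)"
    and bound: "\<And>s. 0 \<le> s \<Longrightarrow> b s \<le> K * exp (- c * s)"
    and s: "0 \<le> s"
  shows "b s \<le> b 0 * exp (- c * s)"
proof (cases "b 0 = 0")
  case True
  then have "(b s)\<^sup>2 \<le> 0" using log_convex[OF s] by simp
  then show ?thesis using True by simp
next
  case False
  then have b0: "b 0 > 0" using nonneg[of 0] by simp
  \<comment> \<open>The ratio to the claimed bound: its powers of order \<open>2 ^ n\<close> stay
    below \<open>K / b 0\<close>, which excludes a ratio above 1.\<close>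
  define r where "r = b s / (b 0 * exp (- c * s))"
  have r0: "0 \<le> r" using nonneg[OF s] b0 by (simp add: r_def)
  have iter: "b s ^ (2 ^ n) \<le> b 0 ^ (2 ^ n - 1) * b (2 ^ n * s)" for n
  proof (induction n)
    case (Suc n)
    have "b s ^ (2 ^ Suc n) = (b s ^ (2 ^ n))\<^sup>2"
      by (simp add: power_mult[symmetric] mult.commute)
    also have "\<dots> \<le> (b 0 ^ (2 ^ n - 1) * b (2 ^ n * s))\<^sup>2"
      using Suc nonneg[OF s] by (intro power_mono) auto
    also have "\<dots> = (b 0 ^ (2 ^ n - 1))\<^sup>2 * (b (2 ^ n * s))\<^sup>2" by (simp add: power_mult_distrib)
    also have "\<dots> \<le> (b 0 ^ (2 ^ n - 1))\<^sup>2 * (b 0 * b (2 * (2 ^ n * s)))"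
      using log_convex[of "2 ^ n * s"] s by (intro mult_left_mono) auto
    also have "\<dots> = b 0 ^ (2 ^ Suc n - 1) * b (2 ^ Suc n * s)"
    proof -
      have "(2::nat) ^ Suc n - 1 = Suc ((2 ^ n - 1) * 2)"
        using one_le_power[of "2::nat" n] unfolding power_Suc by linarith
      then have "b 0 ^ (2 ^ Suc n - 1) = b 0 * (b 0 ^ (2 ^ n - 1))\<^sup>2"
        by (simp only: power_Suc power_mult)
      then show ?thesis by (simp only: power_Suc mult_ac)
    qed
    finally show ?case .
  qed simp
  have K: "r ^ (2 ^ n) \<le> K / b 0" for n
  proof -
    have e: "exp (- c * (2 ^ n * s)) = exp (- c * s) ^ (2 ^ n)"
      by (simp add: exp_of_nat_mult[symmetric] mult_ac)
    have "b s ^ (2 ^ n) \<le> b 0 ^ (2 ^ n - 1) * (K * exp (- c * (2 ^ n * s)))"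
      using iter[of n] bound[of "2 ^ n * s"] s b0 by (smt (verit) mult_left_mono zero_le_power mult_nonneg_nonneg)
    also have "b 0 ^ (2 ^ n - 1) = b 0 ^ (2 ^ n) / b 0"
      using b0 by (simp add: power_diff)
    finally have "b s ^ (2 ^ n) \<le> (K / b 0) * (b 0 * exp (- c * s)) ^ (2 ^ n)"
      unfolding e by (simp add: power_mult_distrib mult_ac)
    then show ?thesis
      using b0 by (simp add: r_def power_divide pos_divide_le_eq)
  qed
  have "r \<le> 1"
  proof (rule ccontr)
    assume "\<not> r \<le> 1"
    then have r1: "r > 1" by simp
    obtain n where n: "K / b 0 < r ^ n" using real_arch_pow[OF r1] by blast
    have "n \<le> 2 ^ n" using less_exp[of n] by (simp add: less_imp_le)
    then have "r ^ n \<le> r ^ (2 ^ n)" using r1 by (intro power_increasing) auto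
    with K[of n] n show False by simp
  qed
  then show ?thesis using b0 by (simp add: r_def pos_divide_le_eq)
qed

section \<open>Uniform boundedness\<close>

text \<open>The images of \<open>x + h\<close> and \<open>x - h\<close> differ by twice the image of
  \<open>h\<close>, so one of them is at least as long as \<open>T h\<close>; \<open>h\<close> is
  taken of length \<open>r\<close> where \<open>T\<close> nearly attains its norm.\<close>

lemma blinfun_almost_attains:
  fixes T :: "'a::real_normed_vector \<Rightarrow>\<^sub>L 'b::real_normed_vector"
  assumes "r > 0"
  shows "\<exists>y. norm (y - x) \<le> r \<and> norm (T y) \<ge> (2 / 3) * r * norm T"
proof (cases "T = 0")
  case True then show ?thesis using assms by (intro exI[of _ x]) auto
next
  case False
  then have T: "norm T > 0" by simp
  have "\<exists>v. norm (T v) > (2 / 3) * norm T * norm v"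
  proof (rule ccontr)
    assume "\<nexists>v. norm (T v) > (2 / 3) * norm T * norm v"
    then have "norm T \<le> (2 / 3) * norm T" by (intro norm_blinfun_bound) (auto simp: not_less)
    then show False using T by simp
  qed
  then obtain v where v: "norm (T v) > (2 / 3) * norm T * norm v" by blast
  have v0: "norm v > 0" using v by (cases "v = 0") auto
  define h where "h = (r / norm v) *\<^sub>R v"
  have h: "norm h = r" using v0 assms by (simp add: h_def)
  have Th: "norm (T h) \<ge> (2 / 3) * r * norm T"
    using v v0 assms by (simp add: h_def blinfun.scaleR_right field_simps)
  have "2 * norm (T h) \<le> norm (T (x + h)) + norm (T (x - h))"
  proof -
    have "norm (2 *\<^sub>R T h) = norm (T (x + h) - T (x - h))"
      by (simp add: blinfun.add_right blinfun.diff_right scaleR_2)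
    then show ?thesis using norm_triangle_ineq4[of "T (x + h)" "T (x - h)"] by simp
  qed
  then have "norm (T (x + h)) \<ge> norm (T h) \<or> norm (T (x - h)) \<ge> norm (T h)" by linarith
  then show ?thesis
  proof
    assume "norm (T (x + h)) \<ge> norm (T h)"
    then show ?thesis using h Th by (intro exI[of _ "x + h"]) auto
  next
    assume "norm (T (x - h)) \<ge> norm (T h)"
    then show ?thesis using h Th by (intro exI[of _ "x - h"]) auto
  qed
qed

text \<open>Sokal's proof: a gliding hump that needs no category argument.\<close>

theorem uniform_boundedness:
  fixes T :: "'i \<Rightarrow> 'a::banach \<Rightarrow>\<^sub>L 'b::real_normed_vector"
  assumes ptw: "\<And>x. \<exists>C. \<forall>i. norm (T i x) \<le> C"
  shows "\<exists>C. \<forall>i. norm (T i) \<le> C"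
proof (rule ccontr)
  assume "\<nexists>C. \<forall>i. norm (T i) \<le> C"
  \<comment> \<open>Norms above \<open>4 ^ k\<close> against steps of size
    \<open>(1 / 3) ^ k\<close>: the step made for \<open>\<iota> k\<close> gains 2/3 of
    \<open>(1 / 3) ^ k * norm (T (\<iota> k))\<close>, all later steps together lose at most 1/2 of
    it, and the remaining sixth exceeds \<open>(4 / 3) ^ k / 6\<close>.\<close>
  then have "\<forall>k::nat. \<exists>i. norm (T i) > 4 ^ k" by (meson not_le)
  then obtain \<iota> where \<iota>: "\<And>k. norm (T (\<iota> k)) > 4 ^ k" by metis
  obtain nxt where nxt: "\<And>k x. norm (nxt k x - x) \<le> (1 / 3) ^ k"
     "\<And>k x. norm (T (\<iota> k) (nxt k x)) \<ge> (2 / 3) * (1 / 3) ^ k * norm (T (\<iota> k))"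
    using blinfun_almost_attains[of "(1/3) ^ k" _ "T (\<iota> k)" for k] by (metis zero_less_power zero_less_divide_1_iff zero_less_numeral)
  define x where "x = rec_nat 0 (\<lambda>k y. nxt k y)"
  have xS: "x (Suc k) = nxt k (x k)" for k by (simp add: x_def)
  have step: "norm (x (Suc k) - x k) \<le> (1 / 3) ^ k" for k using nxt(1) by (simp add: xS)
  have s: "summable (\<lambda>k. x (Suc k) - x k)"
    by (rule summable_comparison_test'[where g = "\<lambda>k. (1/3) ^ k" and N = 0]) (use step in auto)
  have tail: "norm (\<Sum>j. x (Suc (j + n)) - x (j + n)) \<le> (3 / 2) * (1 / 3) ^ n" for n
  proof -
    have sg: "summable (\<lambda>j. (1 / 3 :: real) ^ (j + n))"
      by (rule summable_ignore_initial_segment) auto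
    have "norm (\<Sum>j. x (Suc (j + n)) - x (j + n)) \<le> (\<Sum>j. (1 / 3) ^ (j + n))"
      by (rule norm_suminf_le[OF _ sg]) (use step[of "_ + n"] in auto)
    also have "\<dots> = (3 / 2) * (1 / 3) ^ n"
      using suminf_mult2[of "\<lambda>j. (1 / 3 :: real) ^ j" "(1 / 3) ^ n"] suminf_geometric[of "1 / 3 :: real"]
      by (simp add: power_add summable_geometric)
    finally show ?thesis .
  qed
  define L where "L = (\<Sum>j. x (Suc j) - x j)"
  have x0: "x 0 = 0" by (simp add: x_def)
  have rem: "L - x n = (\<Sum>j. x (Suc (j + n)) - x (j + n))" for n
    using suminf_minus_initial_segment[OF s, of n] sum_lessThan_telescope[of x n]
    by (simp add: L_def x0)
  obtain C where C: "\<And>i. norm (T i L) \<le> C" using ptw by blast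
  have big: "(4 / 3) ^ k / 6 \<le> C" for k
  proof -
    have "norm (T (\<iota> k) (x (Suc k))) \<le> norm (T (\<iota> k) L) + norm (T (\<iota> k) (L - x (Suc k)))"
      using norm_triangle_ineq4[of "T (\<iota> k) L" "T (\<iota> k) (L - x (Suc k))"]
      by (simp add: blinfun.diff_right)
    also have "norm (T (\<iota> k) (L - x (Suc k))) \<le> norm (T (\<iota> k)) * ((3 / 2) * (1 / 3) ^ Suc k)"
      using norm_blinfun[of "T (\<iota> k)" "L - x (Suc k)"] tail[of "Suc k"] unfolding rem
      by (meson mult_left_mono norm_ge_zero order_trans)
    finally have "(2 / 3) * (1 / 3) ^ k * norm (T (\<iota> k)) \<le> C + norm (T (\<iota> k)) * ((1 / 2) * (1 / 3) ^ k)"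
      using nxt(2)[of k "x k"] C[of "\<iota> k"] by (simp add: xS)
    then have "(1 / 6) * (1 / 3) ^ k * norm (T (\<iota> k)) \<le> C" by (simp add: algebra_simps)
    moreover have "(1 / 6) * (1 / 3) ^ k * 4 ^ k \<le> (1 / 6) * (1 / 3) ^ k * norm (T (\<iota> k))"
      using \<iota>[of k] by (intro mult_left_mono) auto
    ultimately show ?thesis by (simp add: power_divide)
  qed
  obtain k where "6 * C < (4 / 3) ^ k" using real_arch_pow[of "4 / 3 :: real" "6 * C"] by auto
  with big[of k] show False by simp
qed

section \<open>Orbits and generators of C0-semigroups\<close>

locale C0_semigroup_loc =
  fixes S :: "real \<Rightarrow> 'h::{real_inner, banach} \<Rightarrow>\<^sub>L 'h"
  assumes C0: "C0_semigroup S"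
begin

lemma S_0 [simp]: "S 0 u = u"
  using C0 by (simp add: C0_semigroup_def)

lemma S_add: "0 \<le> s \<Longrightarrow> 0 \<le> t \<Longrightarrow> S (s + t) u = S s (S t u)"
  using C0 by (simp add: C0_semigroup_def)

lemma S_tendsto_0: "((\<lambda>t. S t u) \<longlongrightarrow> u) (at_right 0)"
  using C0 by (simp add: C0_semigroup_def)

lemma S_near_0: "e > 0 \<Longrightarrow> \<exists>d>0. \<forall>h. 0 \<le> h \<and> h < d \<longrightarrow> norm (S h u - u) < e"
proof -
  assume "e > 0"
  then have "eventually (\<lambda>h. dist (S h u) u < e) (at_right 0)"
    using S_tendsto_0[of u] by (auto dest: tendstoD)
  then obtain d where d: "d > 0" "\<And>h. h > 0 \<Longrightarrow> h < d \<Longrightarrow> dist (S h u) u < e"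
    unfolding eventually_at_right_field by auto
  show ?thesis
  proof (intro exI[of _ d] conjI allI impI)
    fix h assume "0 \<le> h \<and> h < d"
    then show "norm (S h u - u) < e"
      using d(2)[of h] \<open>e > 0\<close> by (cases "h = 0") (auto simp: dist_norm)
  qed (rule d(1))
qed

text \<open>Norms unbounded near time 0 would be unbounded along a null sequence of times. Strong
  continuity bounds every orbit along that sequence, which contradicts uniform boundedness.\<close>

lemma locally_bounded_near_0: "\<exists>\<delta>>0. \<exists>M. \<forall>t\<in>{0..\<delta>}. norm (S t) \<le> M"
proof (rule ccontr)
  assume "\<not> ?thesis"
  then have "\<forall>\<delta>>0. \<forall>M. \<exists>t\<in>{0..\<delta>}. norm (S t) > M" by (meson not_le)
  then have "\<forall>n::nat. \<exists>t\<in>{0..1 / Suc n}. norm (S t) > n" by simp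
  then obtain t where t: "\<And>n::nat. t n \<in> {0..1 / Suc n}" "\<And>n. norm (S (t n)) > real n" by metis
  have "\<exists>C. \<forall>n. norm (S (t n) x) \<le> C" for x
  proof -
    obtain d where d: "d > 0" "\<And>h. 0 \<le> h \<Longrightarrow> h < d \<Longrightarrow> norm (S h x - x) < 1"
      using S_near_0[of 1 x] by auto
    have ev: "eventually (\<lambda>n. 1 / Suc n < d) sequentially"
      using d(1) LIMSEQ_inverse_real_of_nat by (auto simp: inverse_eq_divide dest: order_tendstoD)
    then obtain N where N: "\<And>n. n \<ge> N \<Longrightarrow> 1 / Suc n < d" by (auto simp: eventually_sequentially)
    have "norm (S (t n) x) \<le> (\<Sum>k<N. norm (S (t k) x)) + (norm x + 1)" for n
    proof (cases "n < N")
      case True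
      then have "norm (S (t n) x) \<le> (\<Sum>k<N. norm (S (t k) x))"
        by (intro member_le_sum) auto
      then show ?thesis by (simp add: add_increasing2)
    next
      case False
      then have "t n < d" using N[of n] t(1)[of n] by auto
      then have "norm (S (t n) x - x) < 1" using d(2) t(1)[of n] by auto
      then have "norm (S (t n) x) \<le> norm x + 1" using norm_triangle_sub[of "S (t n) x" x] by linarith
      then show ?thesis by (simp add: add_increasing sum_nonneg)
    qed
    then show ?thesis by blast
  qed
  then obtain C where C: "\<And>n. norm (S (t n)) \<le> C" using uniform_boundedness[of "\<lambda>n. S (t n)"] by blast
  obtain n :: nat where "C < n" using reals_Archimedean2 by blast
  with C[of n] t(2)[of n] show False by simp
qed

lemma locally_bounded: "\<exists>M. \<forall>t\<in>{0..T}. norm (S t) \<le> M"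
proof -
  obtain \<delta> M where \<delta>: "\<delta> > 0" and M: "\<And>t. t \<in> {0..\<delta>} \<Longrightarrow> norm (S t) \<le> M"
    using locally_bounded_near_0 by blast
  have M0: "0 \<le> M" using order_trans[OF norm_ge_zero M[of 0]] \<delta> by auto
  have *: "\<exists>C\<ge>0. \<forall>t\<in>{0..real n * \<delta>}. norm (S t) \<le> C" for n :: nat
  proof (induction n)
    case 0 show ?case using M[of 0] \<delta> M0 by auto
  next
    case (Suc n)
    then obtain C where C: "C \<ge> 0" "\<And>t. t \<in> {0..real n * \<delta>} \<Longrightarrow> norm (S t) \<le> C" by blast
    \<comment> \<open>The constant \<open>C + M + M * C\<close> dominates both cases below without
      comparing \<open>C\<close> and \<open>M\<close>.\<close>
    show ?case
    proof (intro exI[of _ "C + M + M * C"] conjI ballI)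
      fix t assume t: "t \<in> {0..real (Suc n) * \<delta>}"
      show "norm (S t) \<le> C + M + M * C"
      proof (cases "t \<le> \<delta>")
        case True
        then show ?thesis using M[of t] t M0 C(1) by (auto intro: add_increasing add_increasing2)
      next
        case False
        then have "S t = S \<delta> o\<^sub>L S (t - \<delta>)"
          using C0 \<delta> unfolding C0_semigroup_def by (smt (verit))
        then have "norm (S t) \<le> norm (S \<delta>) * norm (S (t - \<delta>))"
          by (simp add: norm_blinfun_compose)
        also have "\<dots> \<le> M * C"
          using M[of \<delta>] C(2)[of "t - \<delta>"] False t \<delta> M0 by (intro mult_mono) (auto simp: algebra_simps)
        finally show ?thesis using M0 C(1) by linarith
      qed
    qed (use M0 C in auto)
  qed
  obtain n :: nat where n: "T / \<delta> \<le> n" using real_arch_simple by blast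
  then have "T \<le> real n * \<delta>" using \<delta> by (simp add: pos_divide_le_eq)
  then show ?thesis using *[of n] by (meson atLeastAtMost_iff order_trans)
qed

text \<open>The smaller of the two times factors out, so continuity at any time, from either side,
  reduces to continuity at 0.\<close>

lemma S_diff_bound:
  assumes "\<And>t. t \<in> {0..T} \<Longrightarrow> norm (S t) \<le> M" "0 \<le> s" "s \<le> T" "0 \<le> t" "t \<le> T"
  shows "norm (S t u - S s u) \<le> M * norm (S \<bar>t - s\<bar> u - u)"
proof -
  have *: "norm (S t u - S s u) \<le> M * norm (S \<bar>t - s\<bar> u - u)" if "0 \<le> s" "s \<le> t" "t \<le> T" for s t
  proof -
    have "S t u - S s u = S s (S (t - s) u - u)"
      using S_add[of s "t - s" u] that by (simp add: blinfun.diff_right)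
    moreover have "norm (S s (S (t - s) u - u)) \<le> M * norm (S (t - s) u - u)"
      using norm_blinfun[of "S s" "S (t - s) u - u"] assms(1)[of s] that
      by (meson atLeastAtMost_iff mult_right_mono norm_ge_zero order_trans)
    ultimately show ?thesis using that by simp
  qed
  show ?thesis
  proof (cases "s \<le> t")
    case True then show ?thesis using * assms by simp
  next
    case False
    then show ?thesis using *[of t s] assms by (simp add: norm_minus_commute abs_minus_commute)
  qed
qed

lemma S_continuous: "continuous_on {0..} (\<lambda>t. S t u)"
proof (rule continuous_onI)
  fix t e :: real assume t: "t \<in> {0..}" and e: "e > 0"
  obtain M where M: "\<And>s. s \<in> {0..t + 1} \<Longrightarrow> norm (S s) \<le> M" using locally_bounded by blast
  have M0: "0 \<le> M" using order_trans[OF norm_ge_zero M[of t]] t by auto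
  obtain d where d: "d > 0" "\<And>h. 0 \<le> h \<Longrightarrow> h < d \<Longrightarrow> norm (S h u - u) < e / (M + 1)"
    using S_near_0[of "e / (M + 1)" u] e M0 by auto
  show "\<exists>d>0. \<forall>s\<in>{0..}. dist s t < d \<longrightarrow> dist (S s u) (S t u) \<le> e"
  proof (intro exI[of _ "min d 1"] conjI ballI impI)
    fix s :: real assume s: "s \<in> {0..}" "dist s t < min d 1"
    then have s2: "s \<le> t + 1" "\<bar>s - t\<bar> < d" by (auto simp: dist_real_def)
    have "norm (S s u - S t u) \<le> M * norm (S \<bar>s - t\<bar> u - u)"
      by (rule S_diff_bound[OF M]) (use s s2 t in auto)
    also have "\<dots> \<le> M * (e / (M + 1))" using d(2)[of "\<bar>s - t\<bar>"] s2 M0 by (intro mult_left_mono) auto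
    also have "\<dots> \<le> e" using M0 e by (simp add: field_simps)
    finally show "dist (S s u) (S t u) \<le> e" by (simp add: dist_norm)
  qed (use d in auto)
qed

lemma generatorD: "(u, g) \<in> generator S \<Longrightarrow> ((\<lambda>t. (S t u - u) /\<^sub>R t) \<longlongrightarrow> g) (at_right 0)"
  by (simp add: generator_def)

lemma generator_S:
  assumes "(u, g) \<in> generator S" "0 \<le> t"
  shows "(S t u, S t g) \<in> generator S"
proof -
  have "((\<lambda>h. S t ((S h u - u) /\<^sub>R h)) \<longlongrightarrow> S t g) (at_right 0)"
    by (intro blinfun.tendsto tendsto_const generatorD assms)
  moreover have "eventually (\<lambda>h. S t ((S h u - u) /\<^sub>R h) = (S h (S t u) - S t u) /\<^sub>R h) (at_right 0)"
    unfolding eventually_at_right_field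
    using S_add[of t _ u] S_add[of _ t u] assms(2)
    by (intro exI[of _ 1]) (auto simp: blinfun.diff_right blinfun.scaleR_right add.commute)
  ultimately show ?thesis
    unfolding generator_def using tendsto_cong by fastforce
qed

text \<open>The generator only supplies the right derivative at time 0. Factoring out the smaller
  time reduces both one-sided difference quotients at \<open>t\<close> to it, and the local norm
  bound makes the estimate uniform in the factored time.\<close>

lemma S_has_vector_derivative:
  assumes ug: "(u, g) \<in> generator S" and t: "0 \<le> t"
  shows "((\<lambda>t. S t u) has_vector_derivative S t g) (at t within {0..})"
  unfolding has_vector_derivative_def has_derivative_within_alt
proof (intro conjI allI impI)
  show "bounded_linear (\<lambda>x. x *\<^sub>R S t g)" by (rule bounded_linear_scaleR_left)
  fix e :: real assume e: "e > 0"
  obtain M where M: "\<And>s. s \<in> {0..t + 1} \<Longrightarrow> norm (S s) \<le> M" using locally_bounded by blast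
  have M0: "0 \<le> M" using order_trans[OF norm_ge_zero M[of t]] t by auto
  have "eventually (\<lambda>h. dist ((S h u - u) /\<^sub>R h) g < e / (2 * (M + 1))) (at_right 0)"
    using generatorD[OF ug] e M0 by (intro tendstoD) auto
  then obtain d1 where d1: "d1 > 0" "\<And>h. 0 < h \<Longrightarrow> h < d1 \<Longrightarrow> dist ((S h u - u) /\<^sub>R h) g < e / (2 * (M + 1))"
    unfolding eventually_at_right_field by auto
  obtain d2 where d2: "d2 > 0" "\<And>h. 0 \<le> h \<Longrightarrow> h < d2 \<Longrightarrow> norm (S h g - g) < e / (2 * (M + 1))"
    using S_near_0[of "e / (2 * (M + 1))" g] e M0 by auto
  \<comment> \<open>\<open>s1 = t\<close> serves the right derivative and \<open>s2 = t\<close> the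
    left one; \<open>S s1\<close> is factored out in both cases.\<close>
  have key: "norm (S s2 u - S s1 u - (s2 - s1) *\<^sub>R S t g) \<le> e * (s2 - s1)"
    if s: "0 \<le> s1" "s1 < s2" "s2 \<le> t + 1" "s1 = t \<or> s2 = t" "s2 - s1 < min d1 d2" for s1 s2
  proof -
    define h where "h = s2 - s1"
    have h: "0 < h" "h < d1" "h < d2" using s by (auto simp: h_def)
    have "S s2 u = S s1 (S h u)" using S_add[of s1 h u] s by (simp add: h_def)
    then have eq: "S s2 u - S s1 u - h *\<^sub>R S t g
        = h *\<^sub>R (S s1 ((S h u - u) /\<^sub>R h - g) + (S s1 g - S t g))"
      using h by (simp add: blinfun.diff_right blinfun.add_right blinfun.scaleR_right algebra_simps)
    have "norm (S s1 ((S h u - u) /\<^sub>R h - g)) \<le> M * norm ((S h u - u) /\<^sub>R h - g)"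
      using norm_blinfun[of "S s1" "(S h u - u) /\<^sub>R h - g"] M[of s1] s
      by (meson atLeastAtMost_iff less_imp_le mult_right_mono norm_ge_zero order_trans)
    also have "\<dots> \<le> M * (e / (2 * (M + 1)))"
      using d1(2)[of h] h M0 by (intro mult_left_mono) (auto simp: dist_norm)
    also have "\<dots> \<le> e / 2" using M0 e by (simp add: field_simps)
    finally have 1: "norm (S s1 ((S h u - u) /\<^sub>R h - g)) \<le> e / 2" .
    have "norm (S s1 g - S t g) \<le> M * norm (S \<bar>s1 - t\<bar> g - g)"
      by (rule S_diff_bound[OF M]) (use s t in auto)
    also have "\<dots> \<le> M * (e / (2 * (M + 1)))"
      using d2(2)[of "\<bar>s1 - t\<bar>"] s M0 by (intro mult_left_mono less_imp_le[of "norm _"]) auto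
    also have "\<dots> \<le> e / 2" using M0 e by (simp add: field_simps)
    finally have 2: "norm (S s1 g - S t g) \<le> e / 2" .
    have "norm (S s2 u - S s1 u - h *\<^sub>R S t g) \<le> h * (e / 2 + e / 2)"
      unfolding eq using 1 2 h norm_triangle_ineq[of "S s1 ((S h u - u) /\<^sub>R h - g)" "S s1 g - S t g"]
      by simp
    then show ?thesis using h by (simp add: h_def mult.commute)
  qed
  show "\<exists>d>0. \<forall>y\<in>{0..}. norm (y - t) < d \<longrightarrow>
      norm (S y u - S t u - (y - t) *\<^sub>R S t g) \<le> e * norm (y - t)"
  proof (intro exI[of _ "min (min d1 d2) 1"] conjI ballI impI)
    fix y :: real assume y: "y \<in> {0..}" "norm (y - t) < min (min d1 d2) 1"
    consider "y = t" | "t < y" | "y < t" by linarith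
    then show "norm (S y u - S t u - (y - t) *\<^sub>R S t g) \<le> e * norm (y - t)"
    proof cases
      case 2 then show ?thesis using key[of t y] y t by simp
    next
      case 3
      have "norm (S y u - S t u - (y - t) *\<^sub>R S t g) = norm (S t u - S y u - (t - y) *\<^sub>R S t g)"
        by (subst norm_minus_cancel[symmetric]) (simp add: algebra_simps)
      then show ?thesis using 3 key[of y t] y t by simp
    qed simp
  qed (use d1 d2 in auto)
qed

text \<open>Integrating an orbit over time yields a vector in the domain of the generator. It is the
  source of the density of that domain and of the vector on which the form is tested in
  \<open>form_ge_difference_quotient\<close>.\<close>

definition orbit_integral :: "real \<Rightarrow> 'h \<Rightarrow> 'h" where
  "orbit_integral t u = integral {0..t} (\<lambda>s. S s u)"

lemma orbit_integrable: "0 \<le> a \<Longrightarrow> (\<lambda>s. S s u) integrable_on {a..b}"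
  by (rule integrable_continuous_real) (auto intro: continuous_on_subset[OF S_continuous])

lemma orbit_integral_has_vector_derivative:
  assumes "0 \<le> t" "t \<le> T"
  shows "((\<lambda>t. orbit_integral t u) has_vector_derivative S t u) (at t within {0..T})"
  unfolding orbit_integral_def
  by (rule integral_has_vector_derivative)
    (use assms in \<open>auto intro: continuous_on_subset[OF S_continuous]\<close>)

text \<open>Both sides integrate \<open>S (s + h) u\<close> over \<open>s\<close> in
  \<open>{0..t}\<close>: once by moving \<open>S h\<close> under the integral, once with
  \<open>orbit_integral\<close> as antiderivative.\<close>

lemma orbit_integral_shift:
  assumes h: "0 \<le> h" and t: "0 \<le> t"
  shows "S h (orbit_integral t u) = orbit_integral (t + h) u - orbit_integral h u"
proof -
  have "((\<lambda>s. S (s + h) u) has_integral (orbit_integral (t + h) u - orbit_integral (0 + h) u)) {0..t}"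
  proof (rule fundamental_theorem_of_calculus[OF t])
    fix s assume s: "s \<in> {0..t}"
    have "((\<lambda>t. orbit_integral t u) has_vector_derivative S (s + h) u) (at (s + h) within {0..t + h})"
      by (rule orbit_integral_has_vector_derivative) (use s h in auto)
    then have "((\<lambda>t. orbit_integral t u) has_vector_derivative S (s + h) u) (at (s + h) within (\<lambda>s. s + h) ` {0..t})"
      by (rule has_vector_derivative_within_subset) (use h in auto)
    moreover have "((\<lambda>s. s + h) has_real_derivative 1) (at s within {0..t})"
      by (auto intro!: derivative_eq_intros)
    ultimately have "((\<lambda>t. orbit_integral t u) \<circ> (\<lambda>s. s + h) has_vector_derivative 1 *\<^sub>R S (s + h) u) (at s within {0..t})"
      by (intro vector_diff_chain_within) (auto simp: has_real_derivative_iff_has_vector_derivative)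
    then show "((\<lambda>s. orbit_integral (s + h) u) has_vector_derivative S (s + h) u) (at s within {0..t})"
      by (simp add: o_def)
  qed
  moreover have "((\<lambda>s. S (s + h) u) has_integral S h (orbit_integral t u)) {0..t}"
  proof -
    have "((\<lambda>s. S s u) has_integral orbit_integral t u) {0..t}"
      unfolding orbit_integral_def by (rule integrable_integral[OF orbit_integrable]) simp
    then have "((\<lambda>x. S h x) \<circ> (\<lambda>s. S s u) has_integral S h (orbit_integral t u)) {0..t}"
      by (rule has_integral_linear) (rule blinfun.bounded_linear_right)
    then show ?thesis
      by (rule has_integral_eq[rotated]) (use S_add[of h _ u] h in \<open>auto simp: add.commute\<close>)
  qed
  ultimately show ?thesis by (metis add_0 has_integral_unique)
qed

lemma orbit_integral_quotient:
  assumes t: "0 \<le> t"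
  shows "((\<lambda>h. (orbit_integral (t + h) u - orbit_integral t u) /\<^sub>R h) \<longlongrightarrow> S t u) (at_right 0)"
proof (rule tendstoI)
  fix e :: real assume e: "e > 0"
  have "((\<lambda>t. orbit_integral t u) has_vector_derivative S t u) (at t within {0..t + 1})"
    by (rule orbit_integral_has_vector_derivative) (use t in auto)
  then obtain d where d: "d > 0" "\<And>y. y \<in> {0..t + 1} \<Longrightarrow> norm (y - t) < d \<Longrightarrow>
      norm (orbit_integral y u - orbit_integral t u - (y - t) *\<^sub>R S t u) \<le> e / 2 * norm (y - t)"
    unfolding has_vector_derivative_def has_derivative_within_alt using e by (meson half_gt_zero)
  have "dist ((orbit_integral (t + h) u - orbit_integral t u) /\<^sub>R h) (S t u) < e" if h: "0 < h" "h < min d 1" for h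
  proof -
    have "norm (orbit_integral (t + h) u - orbit_integral t u - h *\<^sub>R S t u) \<le> e / 2 * h"
      using d(2)[of "t + h"] h t by simp
    then have "inverse h * norm (orbit_integral (t + h) u - orbit_integral t u - h *\<^sub>R S t u) \<le> e / 2"
      using h by (simp add: field_simps)
    moreover have "(orbit_integral (t + h) u - orbit_integral t u) /\<^sub>R h - S t u
      = (orbit_integral (t + h) u - orbit_integral t u - h *\<^sub>R S t u) /\<^sub>R h"
      using h by (simp add: scaleR_diff_right)
    ultimately have "dist ((orbit_integral (t + h) u - orbit_integral t u) /\<^sub>R h) (S t u) \<le> e / 2"
      using h by (simp add: dist_norm)
    then show ?thesis using e by simp
  qed
  then show "eventually (\<lambda>h. dist ((orbit_integral (t + h) u - orbit_integral t u) /\<^sub>R h) (S t u) < e) (at_right 0)"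
    unfolding eventually_at_right_field using d(1) by (intro exI[of _ "min d 1"]) auto
qed

lemma orbit_integral_0 [simp]: "orbit_integral 0 u = 0"
  by (simp add: orbit_integral_def)

text \<open>By the shift formula the quotient in the generator is the difference of the quotients of
  \<open>orbit_integral\<close> at the times \<open>t\<close> and 0.\<close>

lemma orbit_integral_generator:
  assumes t: "0 \<le> t"
  shows "(orbit_integral t u, S t u - u) \<in> generator S"
proof -
  have "((\<lambda>h. (orbit_integral (t + h) u - orbit_integral t u) /\<^sub>R h
       - (orbit_integral (0 + h) u - orbit_integral 0 u) /\<^sub>R h) \<longlongrightarrow> S t u - S 0 u) (at_right 0)"
    by (intro tendsto_diff orbit_integral_quotient t order_refl)
  moreover have "eventually (\<lambda>h. (orbit_integral (t + h) u - orbit_integral t u) /\<^sub>R h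
       - (orbit_integral (0 + h) u - orbit_integral 0 u) /\<^sub>R h
     = (S h (orbit_integral t u) - orbit_integral t u) /\<^sub>R h) (at_right 0)"
    unfolding eventually_at_right_field
    by (intro exI[of _ 1]) (auto simp: orbit_integral_shift t algebra_simps)
  ultimately show ?thesis
    unfolding generator_def using tendsto_cong by fastforce
qed

lemma generator_scaleR:
  assumes "(u, g) \<in> generator S"
  shows "(c *\<^sub>R u, c *\<^sub>R g) \<in> generator S"
proof -
  have "((\<lambda>t. c *\<^sub>R ((S t u - u) /\<^sub>R t)) \<longlongrightarrow> c *\<^sub>R g) (at_right 0)"
    by (intro tendsto_scaleR tendsto_const generatorD assms)
  then show ?thesis
    by (simp add: generator_def blinfun.scaleR_right scaleR_diff_right mult.commute)
qed

text \<open>The averages of an orbit over \<open>{0..h}\<close> tend to its starting point as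
  \<open>h\<close> tends to 0.\<close>

lemma generator_dense:
  assumes "e > 0"
  shows "\<exists>v g. (v, g) \<in> generator S \<and> norm (v - u) < e"
proof -
  have "((\<lambda>h. orbit_integral h u /\<^sub>R h) \<longlongrightarrow> u) (at_right 0)"
    using orbit_integral_quotient[of 0 u] by simp
  then have "eventually (\<lambda>h. dist (orbit_integral h u /\<^sub>R h) u < e) (at_right 0)"
    using assms by (rule tendstoD)
  then obtain b where "b > 0" and b: "\<And>h. 0 < h \<Longrightarrow> h < b \<Longrightarrow> dist (orbit_integral h u /\<^sub>R h) u < e"
    unfolding eventually_at_right_field by auto
  have "dist (orbit_integral (b / 2) u /\<^sub>R (b / 2)) u < e" using \<open>b > 0\<close> by (intro b) auto
  moreover have "(orbit_integral (b / 2) u /\<^sub>R (b / 2), (S (b / 2) u - u) /\<^sub>R (b / 2)) \<in> generator S"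
    using \<open>b > 0\<close> by (intro generator_scaleR orbit_integral_generator) auto
  ultimately show ?thesis by (auto simp: dist_norm)
qed

lemma generator_dense_seq:
  obtains v g where "\<And>n. (v n, g n) \<in> generator S" "v \<longlonglongrightarrow> u"
proof -
  have "\<forall>n. \<exists>p. p \<in> generator S \<and> norm (fst p - u) < 1 / Suc n"
    using generator_dense[of "1 / Suc n" u for n] by fastforce
  then obtain p where p: "\<And>n. p n \<in> generator S" "\<And>n. norm (fst (p n) - u) < 1 / Suc n" by metis
  have "(\<lambda>n. fst (p n) - u) \<longlonglongrightarrow> 0"
    by (rule Lim_null_comparison[OF _ LIMSEQ_inverse_real_of_nat])
      (use p(2) in \<open>auto intro!: always_eventually less_imp_le simp: inverse_eq_divide\<close>)
  then have "(\<lambda>n. fst (p n)) \<longlonglongrightarrow> u" by (simp add: LIM_zero_iff)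
  then show ?thesis using that[of "\<lambda>n. fst (p n)" "\<lambda>n. snd (p n)"] p(1) by simp
qed

end

section \<open>Decay of semigroups generated by symmetric forms\<close>

text \<open>\<open>\<alpha>\<close> is any nonnegative lower bound of the form; that it is the best
  one is added as a hypothesis in \<open>exponential_type_eq\<close>.\<close>

locale form_semigroup = C0_semigroup_loc S
  for S :: "real \<Rightarrow> 'h::{real_inner, banach} \<Rightarrow>\<^sub>L 'h" +
  fixes D :: "'h set" and a :: "'h \<Rightarrow> 'h \<Rightarrow> real" and \<alpha> :: real
  assumes subspace_D: "subspace D"
    and form_add: "\<And>u v w. u \<in> D \<Longrightarrow> v \<in> D \<Longrightarrow> w \<in> D \<Longrightarrow> a (u + v) w = a u w + a v w"
    and form_scaleR: "\<And>c u w. u \<in> D \<Longrightarrow> w \<in> D \<Longrightarrow> a (c *\<^sub>R u) w = c * a u w"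
    and form_sym: "\<And>u w. a u w = a w u"
    and form_lower: "\<And>u. u \<in> D \<Longrightarrow> \<alpha> * (norm u)\<^sup>2 \<le> a u u"
    and alpha_nonneg: "0 \<le> \<alpha>"
    and generator_form: "generator S = {(u, - f) | u f. (u, f) \<in> form_operator D a}"
begin

lemma generator_in_D: "(u, g) \<in> generator S \<Longrightarrow> u \<in> D"
  by (auto simp: generator_form form_operator_def)

lemma generator_inner: "(u, g) \<in> generator S \<Longrightarrow> v \<in> D \<Longrightarrow> g \<bullet> v = - a u v"
  by (auto simp: generator_form form_operator_def)

lemma form_nonneg: "u \<in> D \<Longrightarrow> 0 \<le> a u u"
  using order_trans[OF mult_nonneg_nonneg[OF alpha_nonneg zero_le_power2] form_lower] .

text \<open>The squared norm of an orbit has derivative \<open>- 2 * a (S s u) (S s u)\<close>, at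
  most \<open>- 2 * \<alpha>\<close> times itself, so its product with
  \<open>exp (2 * \<alpha> * s)\<close> decreases.\<close>

lemma norm_S_le_generator:
  assumes ug: "(u, g) \<in> generator S" and t: "0 \<le> t"
  shows "norm (S t u) \<le> exp (- \<alpha> * t) * norm u"
proof -
  define f where "f s = exp (2 * \<alpha> * s) * (S s u \<bullet> S s u)" for s
  have der: "(f has_real_derivative
      exp (2 * \<alpha> * s) * (2 * \<alpha>) * (S s u \<bullet> S s u) + exp (2 * \<alpha> * s) * (2 * (S s u \<bullet> S s g))) (at s within {0..})"
    if "0 \<le> s" for s
  proof -
    have "((\<lambda>s. S s u \<bullet> S s u) has_vector_derivative (S s u \<bullet> S s g + S s g \<bullet> S s u)) (at s within {0..})"
      by (rule bounded_bilinear.has_vector_derivative[OF bounded_bilinear_inner])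
        (auto intro: S_has_vector_derivative ug that)
    then have *: "((\<lambda>s. S s u \<bullet> S s u) has_real_derivative (2 * (S s u \<bullet> S s g))) (at s within {0..})"
      by (simp add: has_real_derivative_iff_has_vector_derivative inner_commute)
    have "((\<lambda>s. exp (2 * \<alpha> * s)) has_real_derivative exp (2 * \<alpha> * s) * (2 * \<alpha>)) (at s within {0..})"
      by (auto intro!: derivative_eq_intros)
    from DERIV_mult[OF this *] show ?thesis unfolding f_def by (simp add: algebra_simps)
  qed
  have "f t \<le> f 0"
  proof (cases "t = 0")
    case False
    show ?thesis
    proof (rule DERIV_nonpos_imp_decreasing_open[where f = f and a = 0 and b = t])
      show "0 \<le> t" by (rule t)
    next
      show "continuous_on {0..t} f" unfolding f_def
        by (intro continuous_intros continuous_on_subset[OF S_continuous]) auto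
    next
      fix s :: real assume s: "0 < s" "s < t"
      have "a (S s u) (S s u) \<ge> \<alpha> * (S s u \<bullet> S s u)"
        using form_lower[OF generator_in_D[OF generator_S[OF ug]], of s] s by (simp add: power2_norm_eq_inner)
      moreover have "S s u \<bullet> S s g = - a (S s u) (S s u)"
        using generator_inner[OF generator_S[OF ug] generator_in_D[OF generator_S[OF ug]], of s s] s
        by (simp add: inner_commute)
      ultimately have "exp (2 * \<alpha> * s) * (2 * \<alpha> * (S s u \<bullet> S s u) + 2 * (S s u \<bullet> S s g)) \<le> 0"
        by (intro mult_nonneg_nonpos) auto
      then have "exp (2 * \<alpha> * s) * (2 * \<alpha>) * (S s u \<bullet> S s u) + exp (2 * \<alpha> * s) * (2 * (S s u \<bullet> S s g)) \<le> 0"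
        by (simp add: algebra_simps)
      moreover have "(f has_real_derivative
        exp (2 * \<alpha> * s) * (2 * \<alpha>) * (S s u \<bullet> S s u) + exp (2 * \<alpha> * s) * (2 * (S s u \<bullet> S s g))) (at s)"
        using der[of s] s at_within_interior[of s "{0..}"] by simp
      ultimately show "\<exists>y. DERIV f s :> y \<and> y \<le> 0"
        by blast
    qed
  qed simp
  then have "exp (2 * \<alpha> * t) * (norm (S t u))\<^sup>2 \<le> (norm u)\<^sup>2"
    by (simp add: f_def power2_norm_eq_inner)
  then have "(exp (\<alpha> * t) * norm (S t u))\<^sup>2 \<le> (norm u)\<^sup>2"
    by (simp add: power_mult_distrib exp_double[symmetric] mult.assoc)
  then have "exp (\<alpha> * t) * norm (S t u) \<le> norm u" by (rule power2_le_imp_le) simp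
  then show ?thesis by (simp add: exp_minus field_simps)
qed

lemma norm_S_le: "0 \<le> t \<Longrightarrow> norm (S t u) \<le> exp (- \<alpha> * t) * norm u"
proof -
  assume t: "0 \<le> t"
  obtain v g where v: "\<And>n. (v n, g n) \<in> generator S" "v \<longlonglongrightarrow> u"
    by (rule generator_dense_seq[of u]) blast
  show ?thesis
  proof (rule LIMSEQ_le)
    show "(\<lambda>n. norm (S t (v n))) \<longlonglongrightarrow> norm (S t u)"
      by (intro tendsto_norm blinfun.tendsto tendsto_const v)
    show "(\<lambda>n. exp (- \<alpha> * t) * norm (v n)) \<longlonglongrightarrow> exp (- \<alpha> * t) * norm u"
      by (intro tendsto_mult tendsto_norm tendsto_const v)
    show "\<exists>N. \<forall>n\<ge>N. norm (S t (v n)) \<le> exp (- \<alpha> * t) * norm (v n)"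
      using norm_S_le_generator[OF v(1) t] by blast
  qed
qed

lemma S_contraction: "0 \<le> t \<Longrightarrow> norm (S t u) \<le> norm u"
proof -
  assume t: "0 \<le> t"
  have "exp (- \<alpha> * t) \<le> 1" using alpha_nonneg t by simp
  then have "exp (- \<alpha> * t) * norm u \<le> 1 * norm u" by (intro mult_right_mono) auto
  then show ?thesis using norm_S_le[OF t, of u] by simp
qed

text \<open>Symmetry of the form makes \<open>S s u \<bullet> S (t - s) v\<close> constant in
  \<open>s\<close>; its values at \<open>t\<close> and 0 are the two sides.\<close>

lemma S_symmetric_generator:
  assumes ug: "(u, g) \<in> generator S" and vk: "(v, k) \<in> generator S" and t: "0 \<le> t"
  shows "S t u \<bullet> v = u \<bullet> S t v"
proof -
  define F where "F s = S s u \<bullet> S (t - s) v" for s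
  have "(F has_real_derivative 0) (at s within {0..t})" if s: "s \<in> {0..t}" for s
  proof -
    have 1: "((\<lambda>s. S s u) has_vector_derivative S s g) (at s within {0..t})"
      by (rule has_vector_derivative_within_subset[OF S_has_vector_derivative[OF ug]]) (use s in auto)
    have "((\<lambda>s. S s v) has_vector_derivative S (t - s) k) (at (t - s) within ((-) t) ` {0..t})"
      by (rule has_vector_derivative_within_subset[OF S_has_vector_derivative[OF vk]]) (use s in auto)
    then have "((\<lambda>s. S s v) \<circ> ((-) t) has_vector_derivative (-1) *\<^sub>R S (t - s) k) (at s within {0..t})"
      by (intro vector_diff_chain_within) (auto intro!: derivative_eq_intros)
    then have 2: "((\<lambda>s. S (t - s) v) has_vector_derivative - S (t - s) k) (at s within {0..t})"
      by (simp add: o_def)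
    have "(F has_vector_derivative (S s u \<bullet> (- S (t - s) k) + S s g \<bullet> S (t - s) v)) (at s within {0..t})"
      unfolding F_def
      by (rule bounded_bilinear.has_vector_derivative[OF bounded_bilinear_inner 1 2])
    moreover have "S s g \<bullet> S (t - s) v = - a (S s u) (S (t - s) v)"
      using s by (intro generator_inner generator_S[OF ug] generator_in_D[OF generator_S[OF vk]]) auto
    moreover have "S (t - s) k \<bullet> S s u = - a (S (t - s) v) (S s u)"
      using s by (intro generator_inner generator_S[OF vk] generator_in_D[OF generator_S[OF ug]]) auto
    ultimately show ?thesis
      using form_sym[of "S s u" "S (t - s) v"]
      by (simp add: has_real_derivative_iff_has_vector_derivative inner_commute)
  qed
  then obtain c where "\<And>s. s \<in> {0..t} \<Longrightarrow> F s = c"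
    using has_field_derivative_zero_constant[of "{0..t}" F] by auto
  then have "F t = F 0" using t by simp
  then show ?thesis by (simp add: F_def)
qed

lemma S_symmetric: "0 \<le> t \<Longrightarrow> S t u \<bullet> v = u \<bullet> S t v"
proof -
  assume t: "0 \<le> t"
  obtain x g where x: "\<And>n. (x n, g n) \<in> generator S" "x \<longlonglongrightarrow> u" by (rule generator_dense_seq[of u]) blast
  obtain y k where y: "\<And>n. (y n, k n) \<in> generator S" "y \<longlonglongrightarrow> v" by (rule generator_dense_seq[of v]) blast
  have "(\<lambda>n. S t (x n) \<bullet> y n) \<longlonglongrightarrow> S t u \<bullet> v"
    by (intro tendsto_inner blinfun.tendsto tendsto_const x y)
  moreover have "(\<lambda>n. S t (x n) \<bullet> y n) \<longlonglongrightarrow> u \<bullet> S t v"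
    unfolding S_symmetric_generator[OF x(1) y(1) t]
    by (intro tendsto_inner blinfun.tendsto tendsto_const x y)
  ultimately show ?thesis by (rule LIMSEQ_unique)
qed

text \<open>Symmetry and the semigroup law give
  \<open>(norm (S s u))\<^sup>2 = u \<bullet> S (2 * s) u\<close>. The inequality is the doubling
  hypothesis of \<open>log_convex_decay\<close>.\<close>

lemma norm_S_log_convex:
  assumes s: "0 \<le> s"
  shows "(norm (S s u))\<^sup>2 \<le> norm (S 0 u) * norm (S (2 * s) u)"
proof -
  have "(norm (S s u))\<^sup>2 = u \<bullet> S (s + s) u"
    using S_symmetric[OF s, of u "S s u"] S_add[OF s s, of u] by (simp add: power2_norm_eq_inner)
  also have "\<dots> \<le> norm u * norm (S (s + s) u)" by (rule norm_cauchy_schwarz)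
  finally show ?thesis unfolding mult_2 S_0 .
qed

lemma form_Cauchy_Schwarz:
  assumes u: "u \<in> D" and v: "v \<in> D"
  shows "(a u v)\<^sup>2 \<le> a u u * a v v"
proof -
  have quad: "0 \<le> a u u + 2 * c * a u v + c\<^sup>2 * a v v" for c
  proof -
    have cv: "c *\<^sub>R v \<in> D" using subspace_D v by (simp add: subspace_scale)
    then have "0 \<le> a (u + c *\<^sub>R v) (u + c *\<^sub>R v)"
      using subspace_D u by (intro form_nonneg subspace_add)
    also have "\<dots> = a u (u + c *\<^sub>R v) + c * a v (u + c *\<^sub>R v)"
      using u v cv subspace_D by (simp add: form_add form_scaleR subspace_add)
    also have "a u (u + c *\<^sub>R v) = a u u + c * a u v"
      by (subst form_sym) (use u v cv in \<open>simp add: form_add form_scaleR form_sym[of v u]\<close>)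
    also have "a v (u + c *\<^sub>R v) = a u v + c * a v v"
      by (subst form_sym) (use u v cv in \<open>simp add: form_add form_scaleR\<close>)
    finally show ?thesis by (simp add: algebra_simps power2_eq_square)
  qed
  show ?thesis by (rule discriminant_le[OF quad form_nonneg[OF v]])
qed

lemma orbit_integral_inner:
  "0 \<le> t \<Longrightarrow> w \<bullet> orbit_integral t u = integral {0..t} (\<lambda>s. w \<bullet> S s u)"
  unfolding orbit_integral_def
  using integral_linear[OF orbit_integrable[of 0 u t] bounded_linear_inner_right[of w]]
  by (simp add: o_def)

text \<open>The form dominates its regularisations \<open>\<langle>\<phi> - S\<^sub>t \<phi>, \<phi>\<rangle> / t\<close>, without any spectral theorem:
  \<open>\<langle>\<phi> - S\<^sub>t \<phi>, S\<^sub>s \<phi>\<rangle>\<close> is bounded and log-convex in \<open>s\<close>, hence maximal at \<open>s = 0\<close>.\<close>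

lemma form_ge_difference_quotient:
  assumes \<phi>: "\<phi> \<in> D" and t: "0 \<le> t"
  shows "(\<phi> - S t \<phi>) \<bullet> \<phi> \<le> t * a \<phi> \<phi>"
proof -
  define X where "X = (\<phi> - S t \<phi>) \<bullet> \<phi>"
  have psd: "0 \<le> (x - S t x) \<bullet> x" for x
  proof -
    have "S t x \<bullet> x \<le> norm x * norm x"
      using norm_cauchy_schwarz[of "S t x" x] S_contraction[OF t, of x]
      by (meson mult_right_mono norm_ge_zero order_trans)
    then show ?thesis by (simp add: inner_diff_left power2_norm_eq_inner[symmetric] power2_eq_square)
  qed
  \<comment> \<open>The semi-inner product of the operator 1 - \<open>S t\<close>. Each
    \<open>S s\<close> is symmetric for it, so \<open>b s\<close> is the value of \<open>B\<close>
    on the diagonal at time \<open>s / 2\<close>; this gives both the sign and the log-convexity of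
    \<open>b\<close>.\<close>
  define B where "B x y = (x - S t x) \<bullet> y" for x y
  have B_sym: "B x y = B y x" for x y
    unfolding B_def inner_diff_left using S_symmetric[OF t, of x y] inner_commute by metis
  have B_CS: "(B x y)\<^sup>2 \<le> B x x * B y y" for x y
  proof -
    have quad: "0 \<le> B x x + 2 * c * B x y + c\<^sup>2 * B y y" for c
    proof -
      have "0 \<le> B (x + c *\<^sub>R y) (x + c *\<^sub>R y)" unfolding B_def by (rule psd)
      also have "\<dots> = B x x + c * B x y + c * B y x + c\<^sup>2 * B y y"
        by (simp add: B_def blinfun.add_right blinfun.scaleR_right inner_simps algebra_simps power2_eq_square)
      finally show ?thesis by (simp add: B_sym[of y x])
    qed
    show ?thesis by (rule discriminant_le[OF quad]) (simp add: B_def psd)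
  qed
  have comm: "S t (S s x) = S s (S t x)" if "0 \<le> s" for s x
    using S_add[OF t that, of x] S_add[OF that t, of x] by (simp add: add.commute)
  have B_S: "B (S s x) y = B x (S s y)" if "0 \<le> s" for s x y
    unfolding B_def by (simp add: comm[OF that] inner_diff_left S_symmetric[OF that])
  define b where "b s = B \<phi> (S s \<phi>)" for s
  have b_half: "b s = B (S (s / 2) \<phi>) (S (s / 2) \<phi>)" if "0 \<le> s" for s
    using B_S[of "s / 2" \<phi> "S (s / 2) \<phi>"] S_add[of "s / 2" "s / 2" \<phi>] that by (simp add: b_def)
  \<comment> \<open>Rate 0 in \<open>log_convex_decay\<close>: boundedness in \<open>s\<close>
    already yields \<open>b s \<le> b 0\<close>.\<close>
  have b_le: "b s \<le> b 0 * exp (- 0 * s)" if s: "0 \<le> s" for s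
  proof (rule log_convex_decay[OF _ _ _ s])
    fix s :: real assume s: "0 \<le> s"
    show "0 \<le> b s" unfolding b_half[OF s] B_def by (rule psd)
    have "(b s)\<^sup>2 \<le> B \<phi> \<phi> * B (S s \<phi>) (S s \<phi>)" unfolding b_def by (rule B_CS)
    then show "(b s)\<^sup>2 \<le> b 0 * b (2 * s)" using b_half[of "2 * s"] s by (simp add: b_def)
    have "b s \<le> norm (\<phi> - S t \<phi>) * norm (S s \<phi>)" unfolding b_def B_def by (rule norm_cauchy_schwarz)
    also have "\<dots> \<le> norm (\<phi> - S t \<phi>) * norm \<phi>" by (intro mult_left_mono S_contraction s) auto
    finally show "b s \<le> (norm (\<phi> - S t \<phi>) * norm \<phi>) * exp (- 0 * s)" by simp
  qed
  \<comment> \<open>\<open>\<phi>\<close> need not be in the domain of the generator, but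
    \<open>u\<close> is, and the form pairs it with \<open>v\<close> to
    \<open>(\<phi> - S t \<phi>) \<bullet> v\<close>. So \<open>a u u\<close> is the integral of
    \<open>b\<close>, at most \<open>t * X\<close>, while \<open>a u \<phi> = X\<close>;
    Cauchy-Schwarz and division by \<open>X\<close> finish.\<close>
  define u where "u = orbit_integral t \<phi>"
  have gen: "(u, S t \<phi> - \<phi>) \<in> generator S" unfolding u_def by (rule orbit_integral_generator[OF t])
  then have uD: "u \<in> D" by (rule generator_in_D)
  have au: "a u v = (\<phi> - S t \<phi>) \<bullet> v" if "v \<in> D" for v
    using generator_inner[OF gen that] by (simp add: inner_diff_left)
  have "a u u = integral {0..t} b"
    using au[OF uD] orbit_integral_inner[OF t, of "\<phi> - S t \<phi>" \<phi>] by (simp add: b_def[abs_def] B_def u_def)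
  also have "\<dots> \<le> integral {0..t} (\<lambda>_. X)"
  proof (rule integral_le)
    show "b integrable_on {0..t}" unfolding b_def[abs_def] B_def
      by (intro integrable_continuous_real continuous_intros continuous_on_subset[OF S_continuous]) auto
    show "(\<lambda>_. X) integrable_on {0..t}" by (rule integrable_const_ivl)
    show "b s \<le> X" if "s \<in> {0..t}" for s
      using b_le[of s] that by (simp add: X_def b_def B_def)
  qed
  also have "\<dots> = t * X" using t by simp
  finally have auu: "a u u \<le> t * X" .
  have X0: "0 \<le> X" unfolding X_def by (rule psd)
  have "X\<^sup>2 \<le> a u u * a \<phi> \<phi>"
    using form_Cauchy_Schwarz[OF uD \<phi>] au[OF \<phi>] by (simp add: X_def)
  also have "\<dots> \<le> t * X * a \<phi> \<phi>" using auu form_nonneg[OF \<phi>] by (rule mult_right_mono)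
  finally have "X * X \<le> X * (t * a \<phi> \<phi>)" by (simp add: power2_eq_square mult_ac)
  then show ?thesis
    using X0 form_nonneg[OF \<phi>] t by (cases "X = 0") (auto simp: X_def[symmetric])
qed

text \<open>Log-convexity first replaces the constant \<open>M\<close> by 1 on each orbit. Then
  \<open>(\<phi> - S t \<phi>) \<bullet> \<phi>\<close> is at least
  \<open>(1 - exp (- c * t)) * (norm \<phi>)\<^sup>2\<close>; dividing by \<open>t\<close> and
  letting it tend to 0 compares \<open>c\<close> with the form.\<close>

lemma form_ge_decay_rate:
  assumes M: "\<And>t. 0 \<le> t \<Longrightarrow> norm (S t) \<le> M * exp (- c * t)" and \<phi>: "\<phi> \<in> D"
  shows "c * (norm \<phi>)\<^sup>2 \<le> a \<phi> \<phi>"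
proof -
  have decay: "norm (S t \<phi>) \<le> norm \<phi> * exp (- c * t)" if t: "0 \<le> t" for t
  proof -
    have "norm (S t \<phi>) \<le> norm (S 0 \<phi>) * exp (- c * t)"
    proof (rule log_convex_decay[where b = "\<lambda>t. norm (S t \<phi>)" and K = "M * norm \<phi>", OF _ _ _ t])
      fix s :: real assume s: "0 \<le> s"
      show "(norm (S s \<phi>))\<^sup>2 \<le> norm (S 0 \<phi>) * norm (S (2 * s) \<phi>)" by (rule norm_S_log_convex[OF s])
      have "norm (S s \<phi>) \<le> norm (S s) * norm \<phi>" by (rule norm_blinfun)
      also have "\<dots> \<le> M * exp (- c * s) * norm \<phi>" by (intro mult_right_mono M s) auto
      finally show "norm (S s \<phi>) \<le> M * norm \<phi> * exp (- c * s)" by (simp add: mult_ac)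
    qed simp
    then show ?thesis by simp
  qed
  have quot: "(norm \<phi>)\<^sup>2 * ((exp (- c * t) - 1) / t) \<ge> - a \<phi> \<phi>" if t: "0 < t" for t
  proof -
    have "S t \<phi> \<bullet> \<phi> \<le> (norm \<phi> * exp (- c * t)) * norm \<phi>"
      using norm_cauchy_schwarz[of "S t \<phi>" \<phi>] decay[of t] t
      by (meson less_imp_le mult_right_mono norm_ge_zero order_trans)
    moreover have "(\<phi> - S t \<phi>) \<bullet> \<phi> \<le> t * a \<phi> \<phi>"
      using form_ge_difference_quotient[OF \<phi>] t by simp
    ultimately have "(norm \<phi>)\<^sup>2 * (1 - exp (- c * t)) \<le> t * a \<phi> \<phi>"
      by (simp add: inner_diff_left power2_norm_eq_inner[symmetric] power2_eq_square algebra_simps)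
    then show ?thesis using t by (simp add: field_simps)
  qed
  \<comment> \<open>The limit of the quotient on the right of 0 is the derivative of the exponential
    there.\<close>
  have "((\<lambda>t. exp (- c * t)) has_real_derivative - c) (at 0)"
    by (auto intro!: derivative_eq_intros)
  then have "((\<lambda>t. (exp (- c * t) - 1) / t) \<longlongrightarrow> - c) (at_right 0)"
    unfolding has_field_derivative_iff filterlim_at_split by simp
  then have "((\<lambda>t. (norm \<phi>)\<^sup>2 * ((exp (- c * t) - 1) / t)) \<longlongrightarrow> (norm \<phi>)\<^sup>2 * (- c)) (at_right 0)"
    by (intro tendsto_mult tendsto_const)
  moreover have "eventually (\<lambda>t. - a \<phi> \<phi> \<le> (norm \<phi>)\<^sup>2 * ((exp (- c * t) - 1) / t)) (at_right 0)"
    unfolding eventually_at_right_field using quot by (intro exI[of _ 1]) auto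
  ultimately have "- a \<phi> \<phi> \<le> (norm \<phi>)\<^sup>2 * (- c)"
    by (intro tendsto_lowerbound) (auto simp: trivial_limit_at_right_real)
  then show ?thesis by (simp add: mult.commute)
qed

text \<open>The rate \<open>\<alpha>\<close> is attained with constant 1; any admissible rate is a
  lower bound of the form, and near-minimisers keep it below \<open>\<alpha> + e\<close>.\<close>

theorem exponential_type_eq:
  assumes "\<And>e. e > 0 \<Longrightarrow> \<exists>\<phi>\<in>D. norm \<phi> = 1 \<and> a \<phi> \<phi> < \<alpha> + e"
  shows "exponential_type S = ereal \<alpha>"
  unfolding exponential_type_def
proof (rule Sup_eqI)
  fix y assume "y \<in> ereal ` {c. \<exists>M\<ge>1. \<forall>t\<ge>0. norm (S t) \<le> M * exp (- c * t)}"
  then obtain c M where y: "y = ereal c" and M: "\<And>t. 0 \<le> t \<Longrightarrow> norm (S t) \<le> M * exp (- c * t)" by auto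
  have "c \<le> \<alpha> + e" if e: "e > 0" for e
  proof -
    obtain \<phi> where "\<phi> \<in> D" "norm \<phi> = 1" "a \<phi> \<phi> < \<alpha> + e" using assms[OF e] by blast
    then show ?thesis using form_ge_decay_rate[OF M, of \<phi>] by simp
  qed
  then show "y \<le> ereal \<alpha>" unfolding y by (simp add: field_le_epsilon)
next
  fix y assume y: "\<And>z. z \<in> ereal ` {c. \<exists>M\<ge>1. \<forall>t\<ge>0. norm (S t) \<le> M * exp (- c * t)} \<Longrightarrow> z \<le> y"
  have "norm (S t) \<le> 1 * exp (- \<alpha> * t)" if "0 \<le> t" for t
    using norm_S_le[OF that] by (intro norm_blinfun_bound) auto
  then show "ereal \<alpha> \<le> y" by (intro y imageI CollectI exI[of _ 1]) auto
qed

end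

section \<open>Smooth bumps and compactly supported Lipschitz functions\<close>

text \<open>Uniqueness of the derivative lets an explicit formula stand in for the choice operator
  \<open>frechet_derivative\<close>.\<close>

lemma C_k_Suc_I:
  assumes "\<And>x. (f has_derivative f' x) (at x)" "\<And>b. b \<in> Basis \<Longrightarrow> C_k k (\<lambda>x. f' x b)"
  shows "C_k (Suc k) f"
proof -
  have "frechet_derivative f (at x) = f' x" for x
    using frechet_derivative_at[OF assms(1)[of x]] by simp
  then show ?thesis using assms by (auto simp: differentiable_def)
qed

lemma C_k_has_derivative:
  "C_k (Suc k) f \<Longrightarrow> (f has_derivative frechet_derivative f (at x)) (at x)"
  using frechet_derivative_works by auto

lemma C_k_continuous: "C_k k f \<Longrightarrow> continuous_on UNIV f"
  by (cases k) (auto intro!: continuous_at_imp_continuous_on differentiable_imp_continuous_within)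

lemma C_k_SucD: "C_k (Suc k) f \<Longrightarrow> C_k k f"
proof (induction k arbitrary: f)
  case 0 then show ?case using C_k_continuous[of "Suc 0" f] by simp
next
  case (Suc k)
  then show ?case by simp
qed

lemma C_k_const [simp]: "C_k k (\<lambda>_. c)"
proof (induction k arbitrary: c)
  case (Suc k)
  then show ?case by (intro C_k_Suc_I[where f' = "\<lambda>_ _. 0"]) auto
qed simp

lemma C_k_add: "C_k k f \<Longrightarrow> C_k k g \<Longrightarrow> C_k k (\<lambda>x. f x + g x)"
proof (induction k arbitrary: f g)
  case (Suc k)
  show ?case
    by (rule C_k_Suc_I[OF has_derivative_add[OF C_k_has_derivative[OF Suc.prems(1)] C_k_has_derivative[OF Suc.prems(2)]]])
      (use Suc in auto)
qed (auto intro: continuous_on_add)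

lemma C_k_mult: "C_k k f \<Longrightarrow> C_k k g \<Longrightarrow> C_k k (\<lambda>x. f x * g x)"
proof (induction k arbitrary: f g)
  case (Suc k)
  have "C_k k f" "C_k k g" using Suc.prems C_k_SucD by blast+
  then show ?case
    by (intro C_k_Suc_I[OF has_derivative_mult[OF C_k_has_derivative[OF Suc.prems(1)] C_k_has_derivative[OF Suc.prems(2)]]]
        C_k_add Suc.IH) (use Suc.prems in auto)
qed (auto intro: continuous_on_mult)

lemma C_k_inner [simp]: "C_k k (\<lambda>x. x \<bullet> b)"
proof (cases k)
  case (Suc m)
  show ?thesis unfolding Suc
    by (rule C_k_Suc_I[where f' = "\<lambda>_ h. h \<bullet> b"]) (auto intro!: derivative_eq_intros)
qed (auto intro!: continuous_intros)

text \<open>The chain rule pulls the scalar \<open>c\<close> out of the derivative, so the induction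
  stays among functions of the same affine argument.\<close>

lemma C_k_affine: "C_k k f \<Longrightarrow> C_k k (\<lambda>x. f (c *\<^sub>R (x - y)))"
proof (induction k arbitrary: f)
  case 0
  then show ?case by (auto intro!: continuous_on_compose2[of UNIV f] continuous_intros)
next
  case (Suc k)
  have lin: "linear (frechet_derivative f (at x))" for x
    using C_k_has_derivative[OF Suc.prems] has_derivative_linear by blast
  have "((\<lambda>x. f (c *\<^sub>R (x - y))) has_derivative (\<lambda>h. frechet_derivative f (at (c *\<^sub>R (x - y))) (c *\<^sub>R h))) (at x)" for x
    by (rule has_derivative_compose[OF _ C_k_has_derivative[OF Suc.prems]]) (auto intro!: derivative_eq_intros)
  then show ?case
  proof (rule C_k_Suc_I)
    fix b :: 'a assume "b \<in> Basis"
    then show "C_k k (\<lambda>x. frechet_derivative f (at (c *\<^sub>R (x - y))) (c *\<^sub>R b))"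
      unfolding linear_scale[OF lin] real_scaleR_def
      using Suc.IH[of "\<lambda>x. frechet_derivative f (at x) b"] Suc.prems by (intro C_k_mult) auto
  qed
qed

section \<open>Flat functions and the smooth bump\<close>

text \<open>The powers of 1/x are those produced by differentiating exp(-1/x); the family over
  \<open>n\<close> is closed under differentiation up to linear combinations, which makes smoothness
  an induction.\<close>

definition flat_exp :: "nat \<Rightarrow> real \<Rightarrow> real" where
  "flat_exp n x = (if x \<le> 0 then 0 else exp (- 1 / x) / x ^ n)"

text \<open>Quadratic smallness gives the derivative 0 at the origin. It comes from
  \<open>y \<le> exp y\<close> at \<open>y = 1 / (m * x)\<close>, raised to the power
  \<open>m = n + 2\<close>.\<close>

lemma flat_exp_le: "\<bar>flat_exp n x\<bar> \<le> real (n + 2) ^ (n + 2) * x\<^sup>2"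
proof (cases "x \<le> 0")
  case False
  then have x: "x > 0" by simp
  define m where "m = n + 2"
  have "1 / (m * x) \<le> exp (1 / (m * x))" using exp_ge_add_one_self[of "1 / (m * x)"] by linarith
  then have "(1 / (m * x)) ^ m \<le> exp (1 / (m * x)) ^ m" using x by (intro power_mono) auto
  also have "\<dots> = exp (real m * (1 / (m * x)))" by (rule exp_of_nat_mult[symmetric])
  also have "real m * (1 / (m * x)) = 1 / x" by (simp add: m_def)
  finally have le: "1 / (m * x) ^ m \<le> exp (1 / x)" by (simp add: power_divide)
  have inv: "1 / E \<le> q" if "1 / q \<le> E" "0 < q" "0 < E" for q E :: real
    using that by (simp add: field_simps)
  have "exp (- 1 / x) = 1 / exp (1 / x)" by (simp add: exp_minus inverse_eq_divide)
  then have "exp (- 1 / x) \<le> (m * x) ^ m"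
    using inv[OF le] x by (simp add: m_def)
  then have "exp (- 1 / x) / x ^ n \<le> (m * x) ^ m / x ^ n" using x by (intro divide_right_mono) auto
  also have "\<dots> = real m ^ m * x\<^sup>2"
  proof -
    have "x ^ m = x ^ n * x\<^sup>2" by (simp add: m_def power_add power2_eq_square)
    then show ?thesis using x by (simp add: power_mult_distrib)
  qed
  finally show ?thesis using x by (simp add: flat_exp_def m_def)
qed (auto simp: flat_exp_def)

lemma flat_exp_has_derivative:
  "(flat_exp n has_real_derivative flat_exp (n + 2) x - n * flat_exp (n + 1) x) (at x)"
proof -
  consider "x < 0" | "x = 0" | "x > 0" by linarith
  then show ?thesis
  proof cases
    case 1
    have "((\<lambda>_. 0) has_real_derivative 0) (at x)" by simp
    then have "(flat_exp n has_real_derivative 0) (at x)"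
      by (rule has_field_derivative_transform_within_open[where S = "{..<0}"])
        (use 1 in \<open>auto simp: flat_exp_def\<close>)
    then show ?thesis using 1 by (simp add: flat_exp_def)
  next
    case 2
    have "((\<lambda>y. flat_exp n y / y) \<longlongrightarrow> 0) (at 0)"
    proof (rule Lim_null_comparison)
      show "eventually (\<lambda>y. norm (flat_exp n y / y) \<le> real (n + 2) ^ (n + 2) * \<bar>y\<bar>) (at 0)"
      proof (rule always_eventually, rule allI)
        fix y :: real
        have "\<bar>flat_exp n y\<bar> / \<bar>y\<bar> \<le> (real (n + 2) ^ (n + 2) * y\<^sup>2) / \<bar>y\<bar>"
          by (intro divide_right_mono flat_exp_le) auto
        also have "\<dots> = real (n + 2) ^ (n + 2) * \<bar>y\<bar>"
          by (cases "y = 0") (auto simp: power2_eq_square abs_if)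
        finally show "norm (flat_exp n y / y) \<le> real (n + 2) ^ (n + 2) * \<bar>y\<bar>" by simp
      qed
      show "((\<lambda>y. real (n + 2) ^ (n + 2) * \<bar>y\<bar>) \<longlongrightarrow> 0) (at 0)"
        by (auto intro!: tendsto_eq_intros)
    qed
    then show ?thesis using 2 by (simp add: has_field_derivative_iff flat_exp_def)
  next
    case 3
    have "((\<lambda>x. exp (- 1 / x) / x ^ n) has_real_derivative exp (- 1 / x) / x ^ (n + 2) - n * (exp (- 1 / x) / x ^ (n + 1))) (at x)"
    proof (cases n)
      case 0
      then show ?thesis using 3
        by (auto intro!: derivative_eq_intros simp: field_simps power2_eq_square)
    next
      case (Suc k)
      have p: "((\<lambda>x. x ^ n) has_real_derivative n * x ^ k) (at x)"
        using DERIV_pow[of n x UNIV] by (simp add: Suc)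
      have e: "((\<lambda>x. exp (- 1 / x)) has_real_derivative exp (- 1 / x) / x\<^sup>2) (at x)"
        using 3 by (auto intro!: derivative_eq_intros simp: power2_eq_square)
      have "exp (- 1 / x) / x\<^sup>2 / x ^ n - n * x ^ k * exp (- 1 / x) / (x ^ n * x ^ n)
          = exp (- 1 / x) / x ^ (n + 2) - n * (exp (- 1 / x) / x ^ (n + 1))"
        using 3 by (simp add: Suc power_add power2_eq_square field_simps)
      moreover have "((\<lambda>x. exp (- 1 / x) / x ^ n) has_real_derivative
          (exp (- 1 / x) / x\<^sup>2 * x ^ n - exp (- 1 / x) * (n * x ^ k)) / (x ^ n * x ^ n)) (at x)"
        using 3 by (intro DERIV_divide e p) simp
      moreover have "(exp (- 1 / x) / x\<^sup>2 * x ^ n - exp (- 1 / x) * (n * x ^ k)) / (x ^ n * x ^ n)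
          = exp (- 1 / x) / x\<^sup>2 / x ^ n - n * x ^ k * exp (- 1 / x) / (x ^ n * x ^ n)"
        using 3 by (simp add: diff_divide_distrib mult_ac)
      ultimately show ?thesis by simp
    qed
    then have "(flat_exp n has_real_derivative exp (- 1 / x) / x ^ (n + 2) - n * (exp (- 1 / x) / x ^ (n + 1))) (at x)"
      by (rule has_field_derivative_transform_within_open[where S = "{0<..}"])
        (use 3 in \<open>auto simp: flat_exp_def\<close>)
    then show ?thesis using 3 by (simp add: flat_exp_def)
  qed
qed

definition bump :: "'a::euclidean_space \<Rightarrow> real" where
  "bump x = flat_exp 0 (1 - x \<bullet> x)"

text \<open>The index \<open>n\<close> stays arbitrary in the induction because differentiation
  raises it by 1 and by 2.\<close>

lemma C_k_flat_exp: "C_k k (\<lambda>x::'a::euclidean_space. flat_exp n (1 - x \<bullet> x))"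
proof (induction k arbitrary: n)
  case 0
  have "isCont (flat_exp n) x" for x using flat_exp_has_derivative DERIV_isCont by blast
  then have "continuous_on UNIV (flat_exp n)" by (simp add: continuous_at_imp_continuous_on)
  then show ?case by (auto intro!: continuous_on_compose2[of UNIV "flat_exp n"] continuous_intros)
next
  case (Suc k)
  show ?case
  proof (rule C_k_Suc_I)
    fix x :: 'a
    have "((\<lambda>x. 1 - x \<bullet> x) has_derivative (\<lambda>h. - 2 * (x \<bullet> h))) (at x)"
      by (auto intro!: derivative_eq_intros simp: inner_commute)
    then show "((\<lambda>x. flat_exp n (1 - x \<bullet> x)) has_derivative
        (\<lambda>h. (flat_exp (n + 2) (1 - x \<bullet> x) + - n * flat_exp (n + 1) (1 - x \<bullet> x)) * (- 2 * (x \<bullet> h)))) (at x)"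
      using has_derivative_compose[OF _ flat_exp_has_derivative[unfolded has_field_derivative_def]]
      by fastforce
  qed (intro C_k_mult C_k_add Suc.IH C_k_const C_k_inner)
qed

lemma bump_nonneg: "0 \<le> bump x"
  by (simp add: bump_def flat_exp_def)

lemma bump_le_1: "bump x \<le> 1"
  by (simp add: bump_def flat_exp_def)

lemma bump_eq_0: "norm x \<ge> 1 \<Longrightarrow> bump x = 0"
  using one_le_power[of "norm x" 2] by (simp add: bump_def flat_exp_def power2_norm_eq_inner)

lemma bump_ge: "norm x \<le> 1 / 2 \<Longrightarrow> exp (- 2) \<le> bump x"
proof -
  assume "norm x \<le> 1 / 2"
  then have "(norm x)\<^sup>2 \<le> (1 / 2)\<^sup>2" by (intro power_mono) auto
  then have "x \<bullet> x \<le> 1 / 4" unfolding power2_norm_eq_inner by (simp add: power2_eq_square)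
  then have "1 - x \<bullet> x \<ge> 1 / 2" "1 / (1 - x \<bullet> x) \<le> 2" by (auto simp: field_simps)
  then show ?thesis by (simp add: bump_def flat_exp_def)
qed

lemma bump_test_function:
  assumes "c > 0"
  shows "(\<lambda>x. bump (c *\<^sub>R (x - y))) \<in> test_functions"
  unfolding test_functions_def
proof (intro CollectI conjI allI)
  show "C_k k (\<lambda>x. bump (c *\<^sub>R (x - y)))" for k
    unfolding bump_def by (rule C_k_affine[OF C_k_flat_exp])
  have "{x. bump (c *\<^sub>R (x - y)) \<noteq> 0} \<subseteq> cball y (1 / c)"
  proof
    fix x assume "x \<in> {x. bump (c *\<^sub>R (x - y)) \<noteq> 0}"
    then have "norm (c *\<^sub>R (x - y)) < 1" using bump_eq_0[of "c *\<^sub>R (x - y)"] by (meson mem_Collect_eq not_le)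
    then have "c * dist y x < 1" using assms by (simp add: dist_norm norm_minus_commute del: scaleR_diff_right)
    then show "x \<in> cball y (1 / c)" using assms by (simp add: pos_le_divide_eq mult.commute)
  qed
  then have "bounded {x. bump (c *\<^sub>R (x - y)) \<noteq> 0}" by (rule bounded_subset[OF bounded_cball])
  then show "compact (closure {x. bump (c *\<^sub>R (x - y)) \<noteq> 0})"
    by (simp add: compact_closure)
qed

section \<open>Lipschitz functions with compact support\<close>

text \<open>A class wide enough for the distance ramps below and still regular enough for finite
  Dirichlet energy. It contains the test functions and carries the approximation and the energy
  estimates.\<close>

definition lip_compact_supp :: "('a::euclidean_space \<Rightarrow> real) \<Rightarrow> bool" where
  "lip_compact_supp f \<longleftrightarrow>
     (\<exists>L\<ge>0. \<forall>x y. \<bar>f x - f y\<bar> \<le> L * norm (x - y)) \<and> (\<exists>R. \<forall>x. f x \<noteq> 0 \<longrightarrow> norm x \<le> R)"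

text \<open>The partial derivatives are continuous on the compact support and vanish off it; the sum
  of their bounds over \<open>Basis\<close> bounds the derivative, and the mean value inequality
  applies.\<close>

lemma test_function_lip:
  assumes \<phi>: "\<phi> \<in> test_functions"
  shows "lip_compact_supp \<phi>"
  unfolding lip_compact_supp_def
proof
  let ?K = "closure {x. \<phi> x \<noteq> 0}"
  have K: "compact ?K" and C: "\<And>k. C_k k \<phi>" using \<phi> by (auto simp: test_functions_def)
  obtain R where R: "\<And>x. x \<in> ?K \<Longrightarrow> norm x \<le> R"
    using compact_imp_bounded[OF K] by (auto simp: bounded_iff)
  show "\<exists>R. \<forall>x. \<phi> x \<noteq> 0 \<longrightarrow> norm x \<le> R"
    using R closure_subset[of "{x. \<phi> x \<noteq> 0}"] by auto
  have der: "(\<phi> has_derivative frechet_derivative \<phi> (at x)) (at x)" for x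
    by (rule C_k_has_derivative[OF C[of "Suc 0"]])
  have zero: "frechet_derivative \<phi> (at x) = (\<lambda>_. 0)" if x: "x \<notin> ?K" for x
  proof -
    have "((\<lambda>_. 0) has_derivative (\<lambda>_. 0)) (at x)" by simp
    then have "(\<phi> has_derivative (\<lambda>_. 0)) (at x)"
      by (rule has_derivative_transform_within_open[where s = "- ?K"])
        (use x closure_subset[of "{x. \<phi> x \<noteq> 0}"] in auto)
    then show ?thesis using frechet_derivative_at by metis
  qed
  have "\<exists>B\<ge>0. \<forall>x. \<bar>frechet_derivative \<phi> (at x) b\<bar> \<le> B" if b: "b \<in> Basis" for b
  proof -
    have "continuous_on ?K (\<lambda>x. frechet_derivative \<phi> (at x) b)"
      using C[of "Suc 0"] b continuous_on_subset[OF _ subset_UNIV] by auto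
    then have "bounded ((\<lambda>x. frechet_derivative \<phi> (at x) b) ` ?K)"
      using K by (intro compact_imp_bounded compact_continuous_image)
    then obtain B where "B > 0" "\<And>x. x \<in> ?K \<Longrightarrow> \<bar>frechet_derivative \<phi> (at x) b\<bar> \<le> B"
      by (auto simp: bounded_pos)
    then have "\<bar>frechet_derivative \<phi> (at x) b\<bar> \<le> B" for x
      using zero[of x] by (cases "x \<in> ?K") auto
    then show ?thesis using \<open>B > 0\<close> by (meson less_imp_le)
  qed
  then obtain B where B: "\<And>b x. b \<in> Basis \<Longrightarrow> 0 \<le> B b \<and> \<bar>frechet_derivative \<phi> (at x) b\<bar> \<le> B b" by metis
  show "\<exists>L\<ge>0. \<forall>x y. \<bar>\<phi> x - \<phi> y\<bar> \<le> L * norm (x - y)"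
  proof (intro exI[of _ "\<Sum>b\<in>Basis. B b"] conjI allI)
    show "0 \<le> (\<Sum>b\<in>Basis. B b)" using B by (auto intro: sum_nonneg)
    have on: "onorm (frechet_derivative \<phi> (at x)) \<le> (\<Sum>b\<in>Basis. B b)" for x
    proof (rule onorm_bound)
      show "0 \<le> (\<Sum>b\<in>Basis. B b)" using B by (auto intro: sum_nonneg)
      fix h :: 'a
      have lin: "linear (frechet_derivative \<phi> (at x))" using der has_derivative_linear by blast
      have "frechet_derivative \<phi> (at x) h = frechet_derivative \<phi> (at x) (\<Sum>b\<in>Basis. (h \<bullet> b) *\<^sub>R b)"
        by (simp add: euclidean_representation)
      also have "\<dots> = (\<Sum>b\<in>Basis. (h \<bullet> b) * frechet_derivative \<phi> (at x) b)"
        by (simp add: linear_sum[OF lin] linear_scale[OF lin])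
      finally have "\<bar>frechet_derivative \<phi> (at x) h\<bar> \<le> (\<Sum>b\<in>Basis. \<bar>(h \<bullet> b) * frechet_derivative \<phi> (at x) b\<bar>)"
        by (simp add: sum_abs)
      also have "\<dots> \<le> (\<Sum>b\<in>Basis. norm h * B b)"
        unfolding abs_mult using B Basis_le_norm by (intro sum_mono mult_mono) auto
      finally show "norm (frechet_derivative \<phi> (at x) h) \<le> (\<Sum>b\<in>Basis. B b) * norm h"
        by (simp add: sum_distrib_right mult.commute[of "norm h"])
    qed
    fix x y
    show "\<bar>\<phi> x - \<phi> y\<bar> \<le> (\<Sum>b\<in>Basis. B b) * norm (x - y)"
      using differentiable_bound[of UNIV \<phi> "\<lambda>x. frechet_derivative \<phi> (at x)" "\<Sum>b\<in>Basis. B b" x y] der on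
      by simp
  qed
qed

lemma lip_continuous: "lip_compact_supp f \<Longrightarrow> continuous_on UNIV f"
proof -
  assume "lip_compact_supp f"
  then obtain L where L: "L \<ge> 0" "\<And>x y. \<bar>f x - f y\<bar> \<le> L * norm (x - y)" by (auto simp: lip_compact_supp_def)
  then have "L-lipschitz_on UNIV f" by (auto simp: lipschitz_on_def dist_norm)
  then show ?thesis by (rule lipschitz_on_continuous_on)
qed

lemma lip_bounded:
  assumes f: "lip_compact_supp f"
  obtains B where "B > 0" "\<And>x. \<bar>f x\<bar> \<le> B"
proof -
  obtain R where R: "\<And>x. f x \<noteq> 0 \<Longrightarrow> norm x \<le> R" using f by (auto simp: lip_compact_supp_def)
  have "bounded (f ` cball 0 R)"
    by (intro compact_imp_bounded compact_continuous_image continuous_on_subset[OF lip_continuous[OF f]]) auto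
  then obtain B where B: "B > 0" "\<And>x. x \<in> cball 0 R \<Longrightarrow> \<bar>f x\<bar> \<le> B" by (auto simp: bounded_pos)
  have "\<bar>f x\<bar> \<le> B" for x using B(1) B(2)[of x] R[of x] by (cases "f x = 0") auto
  with B(1) that show ?thesis by blast
qed

lemma lip_measurable: "lip_compact_supp f \<Longrightarrow> f \<in> borel_measurable borel"
  by (intro borel_measurable_continuous_onI lip_continuous)

lemma bounded_supp_integrable:
  fixes f :: "'a::euclidean_space \<Rightarrow> 'b::{banach, second_countable_topology}"
  assumes "f \<in> borel_measurable borel" "\<And>x. norm (f x) \<le> B" "\<And>x. f x \<noteq> 0 \<Longrightarrow> norm x \<le> R"
  shows "integrable lborel f"
proof (rule Bochner_Integration.integrable_bound)
  show "integrable lborel (\<lambda>x. indicator (cball 0 R) x *\<^sub>R B)"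
    using emeasure_lborel_cball_finite[of 0 R] by (intro integrable_scaleR_left integrable_real_indicator) auto
  have "norm (f x) \<le> norm (indicator (cball 0 R) x *\<^sub>R B)" for x
    using assms(2)[of x] assms(3)[of x] by (cases "f x = 0") (auto split: split_indicator)
  then show "AE x in lborel. norm (f x) \<le> norm (indicator (cball 0 R) x *\<^sub>R B)" by simp
qed (use assms in simp)

lemma lip_integrable: "lip_compact_supp f \<Longrightarrow> integrable lborel f"
proof -
  assume f: "lip_compact_supp f"
  obtain B where "\<And>x. \<bar>f x\<bar> \<le> B" using lip_bounded[OF f] by blast
  then show ?thesis using f
    by (auto simp: lip_compact_supp_def intro!: bounded_supp_integrable[of f B] lip_measurable[OF f])
qed

lemma lip_sq_integrable_lborel: "lip_compact_supp f \<Longrightarrow> integrable lborel (\<lambda>x. (f x)\<^sup>2)"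
proof -
  assume f: "lip_compact_supp f"
  obtain B where B: "\<And>x. \<bar>f x\<bar> \<le> B" using lip_bounded[OF f] by blast
  then have B2: "norm ((f x)\<^sup>2) \<le> B\<^sup>2" for x by (simp add: abs_le_square_iff[symmetric] order_trans[OF B])
  obtain R where R: "\<And>x. f x \<noteq> 0 \<Longrightarrow> norm x \<le> R" using f by (auto simp: lip_compact_supp_def)
  have [measurable]: "f \<in> borel_measurable borel" by (rule lip_measurable[OF f])
  show ?thesis by (rule bounded_supp_integrable[OF _ B2 R]) auto
qed

lemma lip_sq_integrable: "lip_compact_supp f \<Longrightarrow> sq_integrable f"
  using lip_sq_integrable_lborel[of f] lip_measurable[of f]
  by (simp add: sq_integrable_def integrable_completion measurable_completion)

lemma lip_add:
  assumes "lip_compact_supp f" "lip_compact_supp g"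
  shows "lip_compact_supp (\<lambda>x. f x + g x)"
proof -
  obtain L1 R1 L2 R2 where
    L: "L1 \<ge> 0" "\<And>x y. \<bar>f x - f y\<bar> \<le> L1 * norm (x - y)" "L2 \<ge> 0" "\<And>x y. \<bar>g x - g y\<bar> \<le> L2 * norm (x - y)"
    and R: "\<And>x. f x \<noteq> 0 \<Longrightarrow> norm x \<le> R1" "\<And>x. g x \<noteq> 0 \<Longrightarrow> norm x \<le> R2"
    using assms unfolding lip_compact_supp_def by blast
  have "\<bar>(f x + g x) - (f y + g y)\<bar> \<le> (L1 + L2) * norm (x - y)" for x y
    using L(2)[of x y] L(4)[of x y] by (simp add: algebra_simps)
  moreover have "norm x \<le> max R1 R2" if "f x + g x \<noteq> 0" for x
    using R[of x] that by (cases "f x = 0") (auto simp: le_max_iff_disj)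
  ultimately show ?thesis unfolding lip_compact_supp_def using L by (meson add_nonneg_nonneg)
qed

lemma lip_cmult:
  assumes "lip_compact_supp f"
  shows "lip_compact_supp (\<lambda>x. c * f x)"
proof -
  obtain L R where L: "L \<ge> 0" "\<And>x y. \<bar>f x - f y\<bar> \<le> L * norm (x - y)" and R: "\<And>x. f x \<noteq> 0 \<Longrightarrow> norm x \<le> R"
    using assms unfolding lip_compact_supp_def by blast
  have "\<bar>c * f x - c * f y\<bar> \<le> (\<bar>c\<bar> * L) * norm (x - y)" for x y
    using mult_left_mono[OF L(2)[of x y], of "\<bar>c\<bar>"]
    by (simp add: abs_mult[symmetric] right_diff_distrib[symmetric] mult.assoc)
  moreover have "norm x \<le> R" if "c * f x \<noteq> 0" for x
    using R[of x] that by auto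
  ultimately show ?thesis unfolding lip_compact_supp_def using L by (meson abs_ge_zero mult_nonneg_nonneg)
qed

section \<open>Ramps and the density of Lipschitz functions\<close>

text \<open>A Urysohn function of \<open>K\<close>; for nonempty compact \<open>K\<close> it
  decreases to the indicator as \<open>n\<close> grows.\<close>

definition ramp :: "'a::euclidean_space set \<Rightarrow> nat \<Rightarrow> 'a \<Rightarrow> real" where
  "ramp K n x = max 0 (1 - real n * infdist x K)"

lemma ramp_lip:
  assumes "compact K" "K \<noteq> {}" "n > 0"
  shows "lip_compact_supp (ramp K n)"
  unfolding lip_compact_supp_def
proof
  have "\<bar>ramp K n x - ramp K n y\<bar> \<le> real n * norm (x - y)" for x y
  proof -
    have "\<bar>ramp K n x - ramp K n y\<bar> \<le> \<bar>real n * infdist x K - real n * infdist y K\<bar>"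
      unfolding ramp_def by linarith
    also have "\<dots> = real n * \<bar>infdist x K - infdist y K\<bar>" by (simp add: right_diff_distrib[symmetric] abs_mult)
    also have "\<dots> \<le> real n * norm (x - y)"
      using infdist_triangle_abs[of x K y] by (intro mult_left_mono) (auto simp: dist_norm)
    finally show ?thesis .
  qed
  then show "\<exists>L\<ge>0. \<forall>x y. \<bar>ramp K n x - ramp K n y\<bar> \<le> L * norm (x - y)"
    by (intro exI[of _ "real n"]) auto
  obtain B where B: "\<And>y. y \<in> K \<Longrightarrow> norm y \<le> B"
    using compact_imp_bounded[OF assms(1)] by (auto simp: bounded_iff)
  have "norm x \<le> B + 1" if "ramp K n x \<noteq> 0" for x
  proof -
    have "real n * infdist x K < 1" using that by (auto simp: ramp_def max_def split: if_splits)
    then have "infdist x K < 1"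
      using assms(3) infdist_nonneg[of x K] mult_right_mono[of 1 "real n" "infdist x K"] by simp
    moreover obtain y where "y \<in> K" "infdist x K = dist x y"
      using infdist_attains_inf[OF compact_imp_closed[OF assms(1)] assms(2), of x] by blast
    ultimately show ?thesis using B[of y] norm_triangle_sub[of x y] by (simp add: dist_norm)
  qed
  then show "\<exists>R. \<forall>x. ramp K n x \<noteq> 0 \<longrightarrow> norm x \<le> R" by blast
qed

lemma ramp_tendsto:
  assumes "compact K" "K \<noteq> {}"
  shows "(\<lambda>n. ramp K n x) \<longlonglongrightarrow> indicator K x"
proof (cases "x \<in> K")
  case True then show ?thesis by (simp add: ramp_def)
next
  case False
  then have d: "infdist x K > 0"
    using in_closed_iff_infdist_zero[OF compact_imp_closed[OF assms(1)] assms(2)] infdist_nonneg[of x K]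
    by (metis less_eq_real_def)
  obtain N :: nat where N: "1 / infdist x K < N" using reals_Archimedean2 by blast
  have "ramp K n x = 0" if "n \<ge> N" for n
  proof -
    have "1 / infdist x K < n" using N that by linarith
    then have "1 < n * infdist x K" using d by (simp add: pos_divide_less_eq)
    then show ?thesis by (simp add: ramp_def)
  qed
  then have "eventually (\<lambda>n. ramp K n x = indicator K x) sequentially"
    using False by (auto simp: eventually_sequentially)
  then show ?thesis by (rule tendsto_eventually)
qed

lemma ramp_bounds: "0 \<le> ramp K n x" "ramp K n x \<le> 1"
  using infdist_nonneg[of x K] by (auto simp: ramp_def)

lemma ramp_antimono: "m \<le> n \<Longrightarrow> ramp K n x \<le> ramp K m x"
  using mult_right_mono[of "real m" "real n" "infdist x K"] infdist_nonneg[of x K] by (auto simp: ramp_def)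

text \<open>Ramps pass the vanishing on to indicators of compact sets. If a component of
  \<open>h\<close> had a strict sign on a set of positive measure, inner regularity would supply a
  compact subset of positive measure on which its integral is both zero and nonzero.\<close>

lemma AE_zero_if_orthogonal_to_lip:
  fixes h :: "'a::euclidean_space \<Rightarrow> 'b::euclidean_space"
  assumes h: "h \<in> borel_measurable lebesgue"
    and int: "\<And>\<psi>. lip_compact_supp \<psi> \<Longrightarrow> integrable lebesgue (\<lambda>x. \<psi> x *\<^sub>R h x)"
    and zero: "\<And>\<psi>. lip_compact_supp \<psi> \<Longrightarrow> (\<integral>x. \<psi> x *\<^sub>R h x \<partial>lebesgue) = 0"
  shows "AE x in lebesgue. h x = 0"
proof -
  have compact_zero: "(\<integral>x. indicator K x *\<^sub>R h x \<partial>lebesgue) = 0 \<and> integrable lebesgue (\<lambda>x. indicator K x *\<^sub>R h x)"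
    if K: "compact K" "K \<noteq> {}" for K
  proof -
    have i1: "integrable lebesgue (\<lambda>x. norm (ramp K 1 x *\<^sub>R h x))"
      by (intro integrable_norm int ramp_lip K) simp
    have meas: "(\<lambda>x. ramp K n x *\<^sub>R h x) \<in> borel_measurable lebesgue" if "n > 0" for n
      using int[OF ramp_lip[OF K that]] by simp
    have K_meas: "(\<lambda>x. indicator K x *\<^sub>R h x) \<in> borel_measurable lebesgue"
      using h lmeasurable_compact[OF K(1)] by (intro borel_measurable_scaleR borel_measurable_indicator) auto
    have lim: "AE x in lebesgue. (\<lambda>n. ramp K (Suc n) x *\<^sub>R h x) \<longlonglongrightarrow> indicator K x *\<^sub>R h x"
      by (intro AE_I2 tendsto_scaleR tendsto_const LIMSEQ_Suc ramp_tendsto K)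
    have dom: "AE x in lebesgue. norm (ramp K (Suc n) x *\<^sub>R h x) \<le> norm (ramp K 1 x *\<^sub>R h x)" for n
      using ramp_antimono[of 1 "Suc n" K] ramp_bounds[of K] by (auto intro!: mult_right_mono)
    have "(\<lambda>n. \<integral>x. ramp K (Suc n) x *\<^sub>R h x \<partial>lebesgue) \<longlonglongrightarrow> (\<integral>x. indicator K x *\<^sub>R h x \<partial>lebesgue)"
      by (rule integral_dominated_convergence[OF K_meas meas i1 lim dom]) simp
    moreover have "integrable lebesgue (\<lambda>x. indicator K x *\<^sub>R h x)"
      by (rule integrable_dominated_convergence[OF K_meas meas i1 lim dom]) simp
    ultimately show ?thesis
      using zero[OF ramp_lip[OF K]] by (simp add: LIMSEQ_const_iff)
  qed
  \<comment> \<open>Components \<open>b\<close> and signs \<open>s\<close> reduce the vector-valued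
    claim to real functions that are almost nowhere positive.\<close>
  have comp: "AE x in lebesgue. \<not> 0 < s * (h x \<bullet> b)" if s: "s = 1 \<or> s = -1" for b s
  proof (rule ccontr)
    define A where "A = {x. 0 < s * (h x \<bullet> b)}"
    assume "\<not> (AE x in lebesgue. \<not> 0 < s * (h x \<bullet> b))"
    moreover have A: "A \<in> sets lebesgue"
    proof -
      have "{x \<in> space lebesgue. 0 < s * (h x \<bullet> b)} \<in> sets lebesgue"
        using h by measurable
      then show ?thesis by (simp add: A_def)
    qed
    ultimately have pos: "emeasure lebesgue A > 0"
      using AE_iff_measurable[of A lebesgue "\<lambda>x. \<not> 0 < s * (h x \<bullet> b)"] by (auto simp: A_def zero_less_iff_neq_zero)
    \<comment> \<open>\<open>A\<close> may have infinite measure; a finite \<open>e\<close> below it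
      suffices, since a closed subset missing less than \<open>e\<close> cannot be null.\<close>
    obtain e where e: "e > 0" "ennreal e \<le> emeasure lebesgue A"
    proof -
      from dense[OF pos] obtain z where z: "0 < z" "z < emeasure lebesgue A" by (elim exE conjE)
      then have "z < top" using less_le_trans[OF z(2) top_greatest] by simp
      then have "ennreal (enn2real z) = z" "0 < enn2real z"
        using z(1) by (auto simp: enn2real_positive_iff)
      then show ?thesis using z(2) by (intro that[of "enn2real z"]) auto
    qed
    obtain T where T: "closed T" "T \<subseteq> A" "emeasure lebesgue (A - T) < ennreal e"
      by (rule sets_lebesgue_inner_closed[OF A e(1)])
    have "emeasure lebesgue T \<noteq> 0"
    proof
      assume "emeasure lebesgue T = 0"
      then have "emeasure lebesgue A \<le> emeasure lebesgue (A - T)"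
        using emeasure_subadditive[of "A - T" lebesgue T] A T(1,2) by (simp add: Un_absorb2 borel_closed)
      then show False using T(3) e(2) by simp
    qed
    \<comment> \<open>Balls cut the closed set into compact pieces, to which the vanishing integrals
      apply.\<close>
    moreover have "T = (\<Union>n::nat. T \<inter> cball 0 (real n))"
      using real_arch_simple by auto
    moreover have "T \<inter> cball 0 (real n) \<in> null_sets lebesgue" for n :: nat
    proof (cases "T \<inter> cball 0 (real n) = {}")
      case False
      let ?K = "T \<inter> cball 0 (real n)"
      have K: "compact ?K" using T(1) by (simp add: closed_Int_compact)
      have Km: "?K \<in> sets lebesgue" using lmeasurable_compact[OF K] by auto
      have "(\<integral>x. (indicator ?K x *\<^sub>R h x) \<bullet> b \<partial>lebesgue) = 0"
        using compact_zero[OF K False] integral_inner_left[of b lebesgue "\<lambda>x. indicator ?K x *\<^sub>R h x"]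
        by (simp del: inner_scaleR_left)
      then have "(\<integral>x. s * ((indicator ?K x *\<^sub>R h x) \<bullet> b) \<partial>lebesgue) = 0" by simp
      moreover have "integrable lebesgue (\<lambda>x. s * ((indicator ?K x *\<^sub>R h x) \<bullet> b))"
        using integrable_inner_left[of b lebesgue "\<lambda>x. indicator ?K x *\<^sub>R h x"] compact_zero[OF K False]
        by (intro integrable_mult_right) blast
      moreover have "0 \<le> s * ((indicator ?K x *\<^sub>R h x) \<bullet> b)" for x
        using T(2) by (auto simp: A_def split: split_indicator)
      ultimately have "AE x in lebesgue. s * ((indicator ?K x *\<^sub>R h x) \<bullet> b) = 0"
        using integral_nonneg_eq_0_iff_AE[of lebesgue "\<lambda>x. s * ((indicator ?K x *\<^sub>R h x) \<bullet> b)"] by simp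
      then have "AE x in lebesgue. x \<notin> ?K"
      proof eventually_elim
        case (elim x)
        show ?case
        proof
          assume x: "x \<in> ?K"
          then have "x \<in> A" using T(2) by blast
          then show False using elim x by (auto simp: A_def)
        qed
      qed
      then show ?thesis using Km AE_iff_null_sets[of ?K lebesgue] by simp
    qed simp
    then have "(\<Union>n::nat. T \<inter> cball 0 (real n)) \<in> null_sets lebesgue" by (rule null_sets_UN)
    ultimately show False by auto
  qed
  have "AE x in lebesgue. \<forall>b\<in>Basis. \<not> 0 < 1 * (h x \<bullet> b) \<and> \<not> 0 < -1 * (h x \<bullet> b)"
    by (intro AE_finite_allI AE_conjI comp) auto
  then show ?thesis
  proof eventually_elim
    case (elim x)
    show ?case
    proof (rule euclidean_eqI)
      fix b :: 'b assume "b \<in> Basis"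
      then have "\<not> 0 < 1 * (h x \<bullet> b)" "\<not> 0 < -1 * (h x \<bullet> b)" using elim by blast+
      then show "h x \<bullet> b = 0 \<bullet> b" by simp
    qed
  qed
qed

text \<open>The component of \<open>u\<close> orthogonal to the closure is orthogonal to every
  Lipschitz function of the class, hence zero.\<close>

lemma lip_dense_L2:
  fixes u :: "('a::euclidean_space, real) L2"
  shows "u \<in> closure (abs_L2 ` {f. lip_compact_supp f})"
proof -
  let ?M = "abs_L2 ` {f::'a \<Rightarrow> real. lip_compact_supp f}"
  have "subspace ?M"
  proof (rule subspaceI)
    have "lip_compact_supp (\<lambda>_::'a. 0)" by (auto simp: lip_compact_supp_def)
    then show "0 \<in> ?M" unfolding zero_L2_def by blast
    fix x y assume "x \<in> ?M" "y \<in> ?M"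
    then obtain f g where fg: "x = abs_L2 f" "y = abs_L2 g" "lip_compact_supp f" "lip_compact_supp g" by blast
    then have "x + y = abs_L2 (\<lambda>x. f x + g x)" by (simp add: abs_L2_add lip_sq_integrable)
    then show "x + y \<in> ?M" using fg lip_add by blast
  next
    fix x c assume "x \<in> ?M"
    then obtain f where fg: "x = abs_L2 f" "lip_compact_supp f" by blast
    then have "c *\<^sub>R x = abs_L2 (\<lambda>x. c * f x)" by (simp add: abs_L2_scaleR lip_sq_integrable)
    then show "c *\<^sub>R x \<in> ?M" using fg lip_cmult by blast
  qed
  then have "subspace (closure ?M)" "closed (closure ?M)" by (auto intro: subspace_closure)
  then obtain m where m: "m \<in> closure ?M" "\<And>v. v \<in> closure ?M \<Longrightarrow> (u - m) \<bullet> v = 0"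
    using orthogonal_projection[of "closure ?M" u] by blast
  have 0: "AE x in lebesgue. rep_L2 (u - m) x = 0"
  proof (rule AE_zero_if_orthogonal_to_lip)
    show "rep_L2 (u - m) \<in> borel_measurable lebesgue" by simp
    fix \<psi> :: "'a \<Rightarrow> real" assume \<psi>: "lip_compact_supp \<psi>"
    show "integrable lebesgue (\<lambda>x. \<psi> x *\<^sub>R rep_L2 (u - m) x)"
      using integrable_inner_sq[OF lip_sq_integrable[OF \<psi>] sq_integrable_rep_L2[of "u - m"]] by simp
    have "(u - m) \<bullet> abs_L2 \<psi> = 0" 
      using \<psi> by (intro m(2) subsetD[OF closure_subset] imageI) simp
    then have "abs_L2 \<psi> \<bullet> abs_L2 (rep_L2 (u - m)) = 0" by (simp add: inner_commute)
    then show "(\<integral>x. \<psi> x *\<^sub>R rep_L2 (u - m) x \<partial>lebesgue) = 0"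
      by (simp add: abs_L2_inner lip_sq_integrable[OF \<psi>] del: abs_rep_L2)
  qed
  have "u - m = abs_L2 (\<lambda>_. 0)"
    using abs_L2_eq_iff[OF sq_integrable_rep_L2[of "u - m"] sq_integrable_zero] 0 by simp
  then have "u = m" by (simp add: zero_L2_def[symmetric])
  then show ?thesis using m(1) by simp
qed

section \<open>Gaussian kernels\<close>

lemma cis_measurable [measurable]: "cis \<in> borel_measurable borel"
  by (intro borel_measurable_continuous_onI continuous_intros)

lemma cnj_measurable [measurable]: "cnj \<in> borel_measurable borel"
  by (intro borel_measurable_continuous_onI continuous_intros)

lemma lborel_integral_affine:
  fixes f :: "'a::euclidean_space \<Rightarrow> 'b::{banach, second_countable_topology}"
  assumes c: "c \<noteq> 0" and [measurable]: "f \<in> borel_measurable borel"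
  shows "(\<integral>x. f x \<partial>lborel) = \<bar>c\<bar> ^ DIM('a) *\<^sub>R (\<integral>x. f (t + c *\<^sub>R x) \<partial>lborel)"
  by (subst lborel_affine[OF c, of t]) (simp add: integral_density integral_distr)

lemma lborel_nn_integral_affine:
  fixes f :: "'a::euclidean_space \<Rightarrow> ennreal"
  assumes c: "c \<noteq> 0" and [measurable]: "f \<in> borel_measurable borel"
  shows "(\<integral>\<^sup>+x. f x \<partial>lborel) = ennreal (\<bar>c\<bar> ^ DIM('a)) * (\<integral>\<^sup>+x. f (t + c *\<^sub>R x) \<partial>lborel)"
  by (subst lborel_affine[OF c, of t]) (simp add: nn_integral_density nn_integral_distr nn_integral_cmult ennreal_power)

lemma lborel_nn_integral_shift:
  fixes f :: "'a::euclidean_space \<Rightarrow> ennreal"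
  assumes "f \<in> borel_measurable borel"
  shows "(\<integral>\<^sup>+x. f (t + x) \<partial>lborel) = (\<integral>\<^sup>+x. f x \<partial>lborel)"
  using lborel_nn_integral_affine[OF _ assms, of 1 t] by simp

lemma lborel_nn_integral_shift':
  fixes f :: "'a::euclidean_space \<Rightarrow> ennreal"
  assumes "f \<in> borel_measurable borel"
  shows "(\<integral>\<^sup>+x. f (x + t) \<partial>lborel) = (\<integral>\<^sup>+x. f x \<partial>lborel)"
  using lborel_nn_integral_shift[OF assms, of t] by (simp add: add.commute)

lemma lborel_integral_shift:
  fixes f :: "'a::euclidean_space \<Rightarrow> 'b::{banach, second_countable_topology}"
  assumes "f \<in> borel_measurable borel"
  shows "(\<integral>x. f (t + x) \<partial>lborel) = (\<integral>x. f x \<partial>lborel)"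
  using lborel_integral_affine[OF _ assms, of 1 t] by simp

text \<open>\<open>lborel\<close> is the image of a product of one-dimensional Lebesgue measures, so
  Gaussian integrals factor over the coordinates.\<close>

lemma lborel_integral_prod:
  fixes f :: "'a::euclidean_space \<Rightarrow> real \<Rightarrow> 'b::{real_normed_field, banach, second_countable_topology}"
  assumes f: "\<And>b. b \<in> Basis \<Longrightarrow> integrable lborel (f b)"
  shows "integrable lborel (\<lambda>x. \<Prod>b\<in>Basis. f b (x \<bullet> b))"
    and "(\<integral>x. (\<Prod>b\<in>Basis. f b (x \<bullet> b)) \<partial>lborel) = (\<Prod>b\<in>Basis. \<integral>x. f b x \<partial>lborel)"
proof -
  interpret P: product_sigma_finite "\<lambda>_::'a. lborel :: real measure" ..
  have [measurable]: "\<And>b. b \<in> Basis \<Longrightarrow> f b \<in> borel_measurable borel"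
    using f by (auto dest: borel_measurable_integrable)
  have eq: "(\<Prod>b\<in>Basis. f b ((\<Sum>c\<in>Basis. g c *\<^sub>R c) \<bullet> b)) = (\<Prod>b\<in>Basis. f b (g b))" for g :: "'a \<Rightarrow> real"
    by (rule prod.cong) auto
  have i: "integrable (\<Pi>\<^sub>M b\<in>Basis. lborel) (\<lambda>g. \<Prod>b\<in>Basis. f b (g b))"
    by (rule P.product_integrable_prod) (use f in auto)
  then show "integrable lborel (\<lambda>x. \<Prod>b\<in>Basis. f b (x \<bullet> b))"
    by (subst lborel_eq) (simp add: integrable_distr_eq eq)
  show "(\<integral>x. (\<Prod>b\<in>Basis. f b (x \<bullet> b)) \<partial>lborel) = (\<Prod>b\<in>Basis. \<integral>x. f b x \<partial>lborel)"
    by (subst lborel_eq) (simp add: integral_distr eq P.product_integral_prod f)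
qed

section \<open>The Gaussian and its Fourier transform\<close>

definition gauss_kernel :: "real \<Rightarrow> 'a::euclidean_space \<Rightarrow> real" where
  "gauss_kernel \<epsilon> z = (\<Prod>b\<in>Basis. normal_density 0 \<epsilon> (z \<bullet> b))"

text \<open>The characteristic function of \<open>gauss_kernel \<epsilon>\<close>. As a factor it
  makes Fourier integrals converge absolutely, and it increases to 1 as \<epsilon> decreases to
  0.\<close>

definition gauss_weight :: "real \<Rightarrow> 'a::euclidean_space \<Rightarrow> real" where
  "gauss_weight \<epsilon> \<xi> = exp (- (\<epsilon> * norm \<xi>)\<^sup>2 / 2)"

lemma gauss_kernel_measurable [measurable]: "gauss_kernel \<epsilon> \<in> borel_measurable borel"
  unfolding gauss_kernel_def[abs_def] by measurable

lemma gauss_weight_measurable [measurable]: "gauss_weight \<epsilon> \<in> borel_measurable borel"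
  unfolding gauss_weight_def[abs_def] by measurable

lemma gauss_kernel_nonneg: "0 \<le> gauss_kernel \<epsilon> z"
  unfolding gauss_kernel_def by (intro prod_nonneg) auto

lemma gauss_kernel_integrable: "\<epsilon> > 0 \<Longrightarrow> integrable lborel (gauss_kernel \<epsilon> :: 'a::euclidean_space \<Rightarrow> real)"
  and gauss_kernel_integral: "\<epsilon> > 0 \<Longrightarrow> (\<integral>z. gauss_kernel \<epsilon> (z::'a::euclidean_space) \<partial>lborel) = 1"
  unfolding gauss_kernel_def[abs_def]
  using lborel_integral_prod[of "\<lambda>_. normal_density 0 \<epsilon>"] by auto

lemma gauss_weight_bounds: "0 < gauss_weight \<epsilon> \<xi>" "gauss_weight \<epsilon> \<xi> \<le> 1"
  by (auto simp: gauss_weight_def)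

text \<open>The characteristic function of the standard normal law at \<open>t / \<epsilon>\<close>,
  rescaled by \<epsilon>. Of the factor \<open>2 * pi\<close>, one square root is the normalisation
  absent on the left, the other undoes that of the density on the right.\<close>

lemma gauss_fourier_1D:
  assumes \<epsilon>: "\<epsilon> > 0"
  shows "integrable lborel (\<lambda>s. complex_of_real (exp (- (\<epsilon> * s)\<^sup>2 / 2)) * cis (t * s))"
    and "(\<integral>s. complex_of_real (exp (- (\<epsilon> * s)\<^sup>2 / 2)) * cis (t * s) \<partial>lborel)
      = complex_of_real (2 * pi * normal_density 0 \<epsilon> t)"
proof -
  have e: "exp (- (\<epsilon> * s)\<^sup>2 / 2) = (sqrt (2 * pi) / \<epsilon>) * normal_density 0 (1 / \<epsilon>) s" for s
    using \<epsilon> by (simp add: normal_density_def real_sqrt_mult real_sqrt_divide power_divide power_mult_distrib)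
  have "integrable lborel (\<lambda>s. (sqrt (2 * pi) / \<epsilon>) * normal_density 0 (1 / \<epsilon>) s)"
    using \<epsilon> by (intro integrable_mult_right integrable_normal_density) simp
  then have i0: "integrable lborel (\<lambda>s. exp (- (\<epsilon> * s)\<^sup>2 / 2))" unfolding e .
  then show "integrable lborel (\<lambda>s. complex_of_real (exp (- (\<epsilon> * s)\<^sup>2 / 2)) * cis (t * s))"
    by (rule Bochner_Integration.integrable_bound) (auto simp: norm_mult)
  have "complex_of_real (exp (- ((t / \<epsilon>)\<^sup>2) / 2)) = char std_normal_distribution (t / \<epsilon>)"
    by (simp add: char_std_normal_distribution)
  also have "\<dots> = (\<integral>x. std_normal_density x *\<^sub>R iexp (t / \<epsilon> * x) \<partial>lborel)"
    unfolding char_def by (subst integral_density) auto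
  also have "\<dots> = \<epsilon> *\<^sub>R (\<integral>s. std_normal_density (\<epsilon> * s) *\<^sub>R iexp (t / \<epsilon> * (\<epsilon> * s)) \<partial>lborel)"
    using \<epsilon> by (subst lborel_integral_real_affine[where c = \<epsilon> and t = 0]) auto
  also have "(\<lambda>s. std_normal_density (\<epsilon> * s) *\<^sub>R iexp (t / \<epsilon> * (\<epsilon> * s)))
      = (\<lambda>s. complex_of_real (1 / sqrt (2 * pi)) * (complex_of_real (exp (- (\<epsilon> * s)\<^sup>2 / 2)) * cis (t * s)))"
    using \<epsilon> by (auto simp: fun_eq_iff std_normal_density_def scaleR_conv_of_real cis_conv_exp mult_ac)
  finally have "complex_of_real (exp (- ((t / \<epsilon>)\<^sup>2) / 2)) = complex_of_real (\<epsilon> / sqrt (2 * pi)) *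
      (\<integral>s. complex_of_real (exp (- (\<epsilon> * s)\<^sup>2 / 2)) * cis (t * s) \<partial>lborel)"
    by (simp add: scaleR_conv_of_real)
  then have "(\<integral>s. complex_of_real (exp (- (\<epsilon> * s)\<^sup>2 / 2)) * cis (t * s) \<partial>lborel)
      = complex_of_real (sqrt (2 * pi) / \<epsilon> * exp (- ((t / \<epsilon>)\<^sup>2) / 2))"
    using \<epsilon> by (simp add: field_simps)
  also have "sqrt (2 * pi) / \<epsilon> * exp (- ((t / \<epsilon>)\<^sup>2) / 2) = 2 * pi * normal_density 0 \<epsilon> t"
  proof -
    have "2 * pi = sqrt (2 * pi) * sqrt (2 * pi)" by simp
    then have "2 * pi / sqrt (2 * pi * \<epsilon>\<^sup>2) = sqrt (2 * pi) / \<epsilon>"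
      using \<epsilon> by (simp add: real_sqrt_mult field_simps)
    then have "2 * pi / sqrt (2 * pi * \<epsilon>\<^sup>2) * exp (- (t\<^sup>2 / (2 * \<epsilon>\<^sup>2))) = sqrt (2 * pi) / \<epsilon> * exp (- (t\<^sup>2 / (2 * \<epsilon>\<^sup>2)))"
      by (simp only:)
    then show ?thesis by (simp add: normal_density_def power_divide mult.commute[of "\<epsilon>\<^sup>2"])
  qed
  finally show "(\<integral>s. complex_of_real (exp (- (\<epsilon> * s)\<^sup>2 / 2)) * cis (t * s) \<partial>lborel)
      = complex_of_real (2 * pi * normal_density 0 \<epsilon> t)" .
qed

lemma cis_sum: "finite A \<Longrightarrow> cis (\<Sum>b\<in>A. g b) = (\<Prod>b\<in>A. cis (g b))"
  by (induction A rule: finite_induct) (auto simp: cis_mult[symmetric])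

lemma gauss_weight_cis_prod:
  "complex_of_real (gauss_weight \<epsilon> \<xi>) * cis (z \<bullet> \<xi>)
     = (\<Prod>b\<in>Basis. complex_of_real (exp (- (\<epsilon> * (\<xi> \<bullet> b))\<^sup>2 / 2)) * cis ((z \<bullet> b) * (\<xi> \<bullet> b)))"
proof -
  have "(norm \<xi>)\<^sup>2 = (\<Sum>b\<in>Basis. (\<xi> \<bullet> b)\<^sup>2)"
    unfolding power2_norm_eq_inner by (subst euclidean_inner) (simp add: power2_eq_square)
  then have "- (\<epsilon> * norm \<xi>)\<^sup>2 / 2 = (\<Sum>b\<in>Basis. - (\<epsilon> * (\<xi> \<bullet> b))\<^sup>2 / 2)"
    by (simp add: power_mult_distrib sum_distrib_left sum_divide_distrib sum_negf)
  then have "gauss_weight \<epsilon> \<xi> = (\<Prod>b\<in>Basis. exp (- (\<epsilon> * (\<xi> \<bullet> b))\<^sup>2 / 2))"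
    unfolding gauss_weight_def by (simp add: exp_sum)
  moreover have "cis (z \<bullet> \<xi>) = (\<Prod>b\<in>Basis. cis ((z \<bullet> b) * (\<xi> \<bullet> b)))"
    by (subst euclidean_inner) (simp add: cis_sum)
  ultimately show ?thesis by (simp add: prod.distrib)
qed

lemma gauss_weight_cis_integrable:
  "\<epsilon> > 0 \<Longrightarrow> integrable lborel (\<lambda>\<xi>. complex_of_real (gauss_weight \<epsilon> \<xi>) * cis (z \<bullet> \<xi>))"
  unfolding gauss_weight_cis_prod by (intro lborel_integral_prod gauss_fourier_1D)

lemma gauss_fourier:
  fixes z :: "'a::euclidean_space"
  assumes "\<epsilon> > 0"
  shows "(\<integral>\<xi>. complex_of_real (gauss_weight \<epsilon> \<xi>) * cis (z \<bullet> \<xi>) \<partial>lborel)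
    = complex_of_real ((2 * pi) ^ DIM('a) * gauss_kernel \<epsilon> z)"
  unfolding gauss_weight_cis_prod gauss_kernel_def
  by (subst lborel_integral_prod(2)[OF gauss_fourier_1D(1)[OF assms]])
    (simp only: gauss_fourier_1D(2)[OF assms], simp add: prod.distrib power_mult_distrib)

lemma gauss_weight_integrable: "\<epsilon> > 0 \<Longrightarrow> integrable lborel (gauss_weight \<epsilon> :: 'a::euclidean_space \<Rightarrow> real)"
  using integrable_norm[OF gauss_weight_cis_integrable[of \<epsilon> "0::'a"]]
  by (simp add: norm_mult abs_of_pos[OF gauss_weight_bounds(1)])

lemma gauss_kernel_scale:
  fixes z :: "'a::euclidean_space"
  assumes "\<epsilon> > 0"
  shows "\<epsilon> ^ DIM('a) * gauss_kernel \<epsilon> (\<epsilon> *\<^sub>R z) = gauss_kernel 1 z"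
proof -
  have "\<epsilon> * normal_density 0 \<epsilon> (\<epsilon> * t) = normal_density 0 1 t" for t
    using assms by (simp add: normal_density_def real_sqrt_mult power_mult_distrib)
  then have "gauss_kernel 1 z = (\<Prod>b\<in>Basis. \<epsilon> * normal_density 0 \<epsilon> (\<epsilon> *\<^sub>R z \<bullet> b))"
    by (simp add: gauss_kernel_def)
  then show ?thesis by (simp add: prod.distrib gauss_kernel_def)
qed

text \<open>Rescaling moves \<epsilon> from the kernel into the argument of \<open>r\<close>;
  dominated convergence with the single kernel \<open>gauss_kernel 1\<close> then applies.\<close>

lemma gauss_kernel_tendsto:
  fixes r :: "'a::euclidean_space \<Rightarrow> 'b::{banach, second_countable_topology}"
  assumes [measurable]: "r \<in> borel_measurable borel" and B: "\<And>z. norm (r z) \<le> B" and cont: "isCont r 0"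
  shows "(\<lambda>n. \<integral>z. gauss_kernel (1 / Suc n) z *\<^sub>R r z \<partial>lborel) \<longlonglongrightarrow> r 0"
proof -
  have eq: "(\<integral>z. gauss_kernel (1 / Suc n) z *\<^sub>R r z \<partial>lborel)
      = (\<integral>z. gauss_kernel 1 z *\<^sub>R r ((1 / Suc n) *\<^sub>R z) \<partial>lborel)" for n
  proof -
    have "(\<integral>z. gauss_kernel (1 / Suc n) z *\<^sub>R r z \<partial>lborel)
      = \<bar>1 / Suc n\<bar> ^ DIM('a) *\<^sub>R (\<integral>z. gauss_kernel (1 / Suc n) (0 + (1 / Suc n) *\<^sub>R z) *\<^sub>R r (0 + (1 / Suc n) *\<^sub>R z) \<partial>lborel)"
      by (rule lborel_integral_affine) auto
    also have "\<dots> = (\<integral>z. (\<bar>1 / Suc n\<bar> ^ DIM('a) * gauss_kernel (1 / Suc n) ((1 / Suc n) *\<^sub>R z)) *\<^sub>R r ((1 / Suc n) *\<^sub>R z) \<partial>lborel)"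
      by (simp add: integral_scaleR_right[symmetric] del: integral_scaleR_right)
    also have "\<dots> = (\<integral>z. gauss_kernel 1 z *\<^sub>R r ((1 / Suc n) *\<^sub>R z) \<partial>lborel)"
      using gauss_kernel_scale[of "1 / Suc n", where 'a='a] by simp
    finally show ?thesis .
  qed
  have "(\<lambda>n. \<integral>z. gauss_kernel 1 z *\<^sub>R r ((1 / Suc n) *\<^sub>R z) \<partial>lborel)
      \<longlonglongrightarrow> (\<integral>z. gauss_kernel 1 (z::'a) *\<^sub>R r 0 \<partial>lborel)"
  proof (rule integral_dominated_convergence[where w = "\<lambda>z. gauss_kernel 1 z * B"])
    show "AE z in lborel. (\<lambda>n. gauss_kernel 1 z *\<^sub>R r ((1 / Suc n) *\<^sub>R z)) \<longlonglongrightarrow> gauss_kernel 1 z *\<^sub>R r 0"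
    proof (intro AE_I2 tendsto_scaleR tendsto_const)
      fix z :: 'a
      have "(\<lambda>n. (1 / Suc n) *\<^sub>R z) \<longlonglongrightarrow> 0 *\<^sub>R z"
        using LIMSEQ_inverse_real_of_nat by (intro tendsto_scaleR tendsto_const) (simp add: inverse_eq_divide)
      then show "(\<lambda>n. r ((1 / Suc n) *\<^sub>R z)) \<longlonglongrightarrow> r 0"
        using isCont_tendsto_compose[OF cont] by simp
    qed
    show "integrable lborel (\<lambda>z::'a. gauss_kernel 1 z * B)"
      by (intro integrable_mult_left gauss_kernel_integrable) simp
    show "AE z in lborel. norm (gauss_kernel 1 z *\<^sub>R r ((1 / Suc n) *\<^sub>R z)) \<le> gauss_kernel 1 z * B" for n
      by (intro AE_I2) (simp add: abs_of_nonneg[OF gauss_kernel_nonneg] mult_left_mono[OF B gauss_kernel_nonneg])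
  qed simp_all
  also have "(\<integral>z. gauss_kernel 1 (z::'a) *\<^sub>R r 0 \<partial>lborel) = r 0"
    using gauss_kernel_integral[of 1, where 'a='a] gauss_kernel_integrable[of 1, where 'a='a] by simp
  finally show ?thesis unfolding eq .
qed

section \<open>The Plancherel theorem\<close>

text \<open>The product \<open>g x * h y\<close> is integrable and a bounded kernel keeps it so; the
  kernels in mind are the oscillating factors \<open>cis\<close>.\<close>

lemma Fubini_bounded_kernel:
  fixes g :: "'a::euclidean_space \<Rightarrow> complex" and h :: "'b::euclidean_space \<Rightarrow> complex"
  assumes g: "integrable lborel g" and h: "integrable lborel h"
    and k[measurable]: "case_prod k \<in> borel_measurable (borel \<Otimes>\<^sub>M borel)"
    and B: "\<And>x y. norm (k x y) \<le> B"
  shows "(\<integral>x. g x * (\<integral>y. h y * k x y \<partial>lborel) \<partial>lborel) = (\<integral>y. h y * (\<integral>x. g x * k x y \<partial>lborel) \<partial>lborel)"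
proof -
  have [measurable]: "g \<in> borel_measurable borel" "h \<in> borel_measurable borel"
    using g h by (auto dest: borel_measurable_integrable)
  have inner: "integrable lborel (\<lambda>y. B * norm (h y))" using h by (intro integrable_mult_right integrable_norm)
  have hk: "integrable lborel (\<lambda>y. h y * k x y)" for x
    by (rule Bochner_Integration.integrable_bound[OF inner])
      (auto simp: norm_mult mult.commute[of B] intro!: mult_left_mono B order_trans[OF _ abs_ge_self])
  have int: "integrable (lborel \<Otimes>\<^sub>M lborel) (case_prod (\<lambda>x y. g x * (h y * k x y)))"
  proof (rule lborel_pair.Fubini_integrable)
    show "AE x in lborel. integrable lborel (\<lambda>y. case (x, y) of (x, y) \<Rightarrow> g x * (h y * k x y))"
      using hk by auto
    show "integrable lborel (\<lambda>x. \<integral>y. norm (case (x, y) of (x, y) \<Rightarrow> g x * (h y * k x y)) \<partial>lborel)"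
    proof (rule Bochner_Integration.integrable_bound)
      show "integrable lborel (\<lambda>x. norm (g x) * (\<integral>y. B * norm (h y) \<partial>lborel))"
        using g by (intro integrable_mult_left integrable_norm)
      have "(\<integral>y. norm (g x * (h y * k x y)) \<partial>lborel) \<le> norm (g x) * (\<integral>y. B * norm (h y) \<partial>lborel)" for x
      proof -
        have "(\<integral>y. norm (g x * (h y * k x y)) \<partial>lborel) = norm (g x) * (\<integral>y. norm (h y * k x y) \<partial>lborel)"
          by (simp add: norm_mult)
        also have "\<dots> \<le> norm (g x) * (\<integral>y. B * norm (h y) \<partial>lborel)"
          by (intro mult_left_mono integral_mono integrable_norm hk inner)
            (auto simp: norm_mult mult.commute[of B] intro!: mult_left_mono B)
        finally show ?thesis .
      qed
      then show "AE x in lborel. norm (\<integral>y. norm (case (x, y) of (x, y) \<Rightarrow> g x * (h y * k x y)) \<partial>lborel)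
          \<le> norm (norm (g x) * (\<integral>y. B * norm (h y) \<partial>lborel))"
        by (intro AE_I2) (auto intro: order_trans[OF _ abs_ge_self] simp: integral_nonneg_AE)
    qed measurable
  qed measurable
  have "(\<integral>x. g x * (\<integral>y. h y * k x y \<partial>lborel) \<partial>lborel) = (\<integral>x. (\<integral>y. g x * (h y * k x y) \<partial>lborel) \<partial>lborel)"
    by simp
  also have "\<dots> = (\<integral>y. (\<integral>x. g x * (h y * k x y) \<partial>lborel) \<partial>lborel)"
    using lborel_pair.Fubini_integral[OF int] by simp
  also have "\<dots> = (\<integral>y. (\<integral>x. h y * (g x * k x y) \<partial>lborel) \<partial>lborel)"
    by (simp add: mult_ac)
  finally show ?thesis by simp
qed

lemma cnj_lborel_integral:
  fixes f :: "'a::euclidean_space \<Rightarrow> complex"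
  shows "cnj (\<integral>x. f x \<partial>lborel) = (\<integral>x. cnj (f x) \<partial>lborel)"
  by simp

text \<open>The squared modulus is expanded as \<open>F\<close> times its conjugate. The weight
  makes all integrals absolutely convergent, so \<xi> may be integrated first, which produces
  \<open>gauss_kernel\<close> at \<open>y - x\<close>.\<close>

lemma gauss_weighted_energy:
  fixes f :: "'a::euclidean_space \<Rightarrow> real"
  assumes f: "integrable lborel f" and \<epsilon>: "\<epsilon> > 0"
  defines "F \<equiv> \<lambda>\<xi>. \<integral>x. complex_of_real (f x) * cis (- (x \<bullet> \<xi>)) \<partial>lborel"
  shows "integrable lborel (\<lambda>\<xi>. gauss_weight \<epsilon> \<xi> * (norm (F \<xi>))\<^sup>2)"
    and "(\<integral>\<xi>. gauss_weight \<epsilon> \<xi> * (norm (F \<xi>))\<^sup>2 \<partial>lborel)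
      = (2 * pi) ^ DIM('a) * (\<integral>x. f x * (\<integral>y. f y * gauss_kernel \<epsilon> (y - x) \<partial>lborel) \<partial>lborel)"
proof -
  have [measurable]: "f \<in> borel_measurable borel" using f by (auto dest: borel_measurable_integrable)
  have fc: "integrable lborel (\<lambda>x. complex_of_real (f x))" using f by simp
  have F_meas [measurable]: "F \<in> borel_measurable borel" unfolding F_def by measurable
  have F_eq: "(\<integral>x. complex_of_real (f x) * cis (- (x \<bullet> \<xi>)) \<partial>lborel) = F \<xi>" for \<xi> by (simp add: F_def)
  define C where "C = (\<integral>x. \<bar>f x\<bar> \<partial>lborel)"
  have FC: "norm (F \<xi>) \<le> C" for \<xi>
  proof -
    have "norm (F \<xi>) \<le> (\<integral>x. norm (complex_of_real (f x) * cis (- (x \<bullet> \<xi>))) \<partial>lborel)"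
      unfolding F_def by (rule integral_norm_bound)
    then show ?thesis by (simp add: norm_mult C_def)
  qed
  have gw: "integrable lborel (\<lambda>\<xi>::'a. complex_of_real (gauss_weight \<epsilon> \<xi>))"
    by (rule integrable_of_real[OF gauss_weight_integrable[OF \<epsilon>]])
  show int: "integrable lborel (\<lambda>\<xi>. gauss_weight \<epsilon> \<xi> * (norm (F \<xi>))\<^sup>2)"
  proof (rule Bochner_Integration.integrable_bound)
    show "integrable lborel (\<lambda>\<xi>::'a. gauss_weight \<epsilon> \<xi> * C\<^sup>2)"
      by (intro integrable_mult_left gauss_weight_integrable \<epsilon>)
    show "AE \<xi> in lborel. norm (gauss_weight \<epsilon> \<xi> * (norm (F \<xi>))\<^sup>2) \<le> norm (gauss_weight \<epsilon> \<xi> * C\<^sup>2)"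
      using FC gauss_weight_bounds(1) by (auto simp: abs_mult intro!: mult_left_mono power_mono)
  qed measurable
  have gF: "integrable lborel (\<lambda>\<xi>. complex_of_real (gauss_weight \<epsilon> \<xi>) * cnj (F \<xi>))"
  proof (rule Bochner_Integration.integrable_bound)
    show "integrable lborel (\<lambda>\<xi>::'a. gauss_weight \<epsilon> \<xi> * C)"
      by (intro integrable_mult_left gauss_weight_integrable \<epsilon>)
    show "AE \<xi> in lborel. norm (complex_of_real (gauss_weight \<epsilon> \<xi>) * cnj (F \<xi>)) \<le> norm (gauss_weight \<epsilon> \<xi> * C)"
      using FC gauss_weight_bounds(1) by (auto simp: abs_mult norm_mult intro!: mult_left_mono order_trans[OF FC abs_ge_self])
  qed measurable
  have "complex_of_real (\<integral>\<xi>. gauss_weight \<epsilon> \<xi> * (norm (F \<xi>))\<^sup>2 \<partial>lborel)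
      = (\<integral>\<xi>. complex_of_real (gauss_weight \<epsilon> \<xi> * (norm (F \<xi>))\<^sup>2) \<partial>lborel)"
    by (rule integral_complex_of_real[symmetric])
  also have "\<dots> = (\<integral>\<xi>. (complex_of_real (gauss_weight \<epsilon> \<xi>) * cnj (F \<xi>)) * (\<integral>x. complex_of_real (f x) * cis (- (x \<bullet> \<xi>)) \<partial>lborel) \<partial>lborel)"
    unfolding F_eq of_real_mult complex_norm_square by (simp add: mult_ac)
  also have "\<dots> = (\<integral>x. complex_of_real (f x) * (\<integral>\<xi>. (complex_of_real (gauss_weight \<epsilon> \<xi>) * cnj (F \<xi>)) * cis (- (x \<bullet> \<xi>)) \<partial>lborel) \<partial>lborel)"
    by (rule Fubini_bounded_kernel[where B = 1, OF gF fc]) auto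
  also have "(\<lambda>x. \<integral>\<xi>. (complex_of_real (gauss_weight \<epsilon> \<xi>) * cnj (F \<xi>)) * cis (- (x \<bullet> \<xi>)) \<partial>lborel)
    = (\<lambda>x. complex_of_real ((2 * pi) ^ DIM('a) * (\<integral>y. f y * gauss_kernel \<epsilon> (y - x) \<partial>lborel)))"
  proof
    fix x
    have "(\<integral>\<xi>. (complex_of_real (gauss_weight \<epsilon> \<xi>) * cnj (F \<xi>)) * cis (- (x \<bullet> \<xi>)) \<partial>lborel)
       = (\<integral>\<xi>. complex_of_real (gauss_weight \<epsilon> \<xi>) * (\<integral>y. complex_of_real (f y) * cis ((y - x) \<bullet> \<xi>) \<partial>lborel) \<partial>lborel)"
    proof (rule Bochner_Integration.integral_cong[OF refl])
      fix \<xi>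
      have "cnj (F \<xi>) * cis (- (x \<bullet> \<xi>)) = (\<integral>y. complex_of_real (f y) * cis (y \<bullet> \<xi>) \<partial>lborel) * cis (- (x \<bullet> \<xi>))"
        unfolding F_def cnj_lborel_integral by (simp add: cis_cnj)
      also have "\<dots> = (\<integral>y. complex_of_real (f y) * cis (y \<bullet> \<xi>) * cis (- (x \<bullet> \<xi>)) \<partial>lborel)" by simp
      also have "\<dots> = (\<integral>y. complex_of_real (f y) * cis ((y - x) \<bullet> \<xi>) \<partial>lborel)"
        by (simp add: mult.assoc cis_mult inner_diff_left)
      finally show "(complex_of_real (gauss_weight \<epsilon> \<xi>) * cnj (F \<xi>)) * cis (- (x \<bullet> \<xi>))
        = complex_of_real (gauss_weight \<epsilon> \<xi>) * (\<integral>y. complex_of_real (f y) * cis ((y - x) \<bullet> \<xi>) \<partial>lborel)"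
        by (simp add: mult.assoc)
    qed
    also have "\<dots> = (\<integral>y. complex_of_real (f y) * (\<integral>\<xi>. complex_of_real (gauss_weight \<epsilon> \<xi>) * cis ((y - x) \<bullet> \<xi>) \<partial>lborel) \<partial>lborel)"
      by (rule Fubini_bounded_kernel[where B = 1, OF gw fc]) auto
    also have "\<dots> = (\<integral>y. complex_of_real ((2 * pi) ^ DIM('a) * (f y * gauss_kernel \<epsilon> (y - x))) \<partial>lborel)"
      unfolding gauss_fourier[OF \<epsilon>] by (simp add: mult_ac)
    also have "\<dots> = complex_of_real (\<integral>y. (2 * pi) ^ DIM('a) * (f y * gauss_kernel \<epsilon> (y - x)) \<partial>lborel)"
      by (rule integral_complex_of_real)
    finally show "(\<integral>\<xi>. (complex_of_real (gauss_weight \<epsilon> \<xi>) * cnj (F \<xi>)) * cis (- (x \<bullet> \<xi>)) \<partial>lborel)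
       = complex_of_real ((2 * pi) ^ DIM('a) * (\<integral>y. f y * gauss_kernel \<epsilon> (y - x) \<partial>lborel))"
      by simp
  qed
  also have "(\<integral>x. complex_of_real (f x) * complex_of_real ((2 * pi) ^ DIM('a) * (\<integral>y. f y * gauss_kernel \<epsilon> (y - x) \<partial>lborel)) \<partial>lborel)
     = (\<integral>x. complex_of_real ((2 * pi) ^ DIM('a) * (f x * (\<integral>y. f y * gauss_kernel \<epsilon> (y - x) \<partial>lborel))) \<partial>lborel)"
    by (simp add: mult_ac)
  also have "\<dots> = complex_of_real ((2 * pi) ^ DIM('a) * (\<integral>x. f x * (\<integral>y. f y * gauss_kernel \<epsilon> (y - x) \<partial>lborel) \<partial>lborel))"
    unfolding integral_complex_of_real by simp
  finally show "(\<integral>\<xi>. gauss_weight \<epsilon> \<xi> * (norm (F \<xi>))\<^sup>2 \<partial>lborel)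
      = (2 * pi) ^ DIM('a) * (\<integral>x. f x * (\<integral>y. f y * gauss_kernel \<epsilon> (y - x) \<partial>lborel) \<partial>lborel)"
    by (simp only: of_real_eq_iff)
qed

lemma gauss_autocorrelation_shift:
  fixes f :: "'a::euclidean_space \<Rightarrow> real"
  assumes [measurable]: "f \<in> borel_measurable borel"
  shows "(\<integral>y. f y * gauss_kernel \<epsilon> (y - x) \<partial>lborel) = (\<integral>z. f (x + z) * gauss_kernel \<epsilon> z \<partial>lborel)"
  using lborel_integral_shift[of "\<lambda>y. f y * gauss_kernel \<epsilon> (y - x)" x] by simp

lemma norm_integral_le_nn_integral:
  fixes f :: "'a \<Rightarrow> 'b::{banach, second_countable_topology}"
  shows "ennreal (norm (\<integral>x. f x \<partial>M)) \<le> (\<integral>\<^sup>+x. ennreal (norm (f x)) \<partial>M)"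
  by (cases "integrable M f") (auto simp: integral_norm_bound_ennreal not_integrable_integral_eq)

text \<open>After the substitution \<open>y = x + z\<close>, the inequality ab \<le> (a^2 + b^2)/2
  and translation invariance bound every autocorrelation by the squared norm, and the kernel has
  mass 1.\<close>

lemma gauss_energy_le:
  fixes f :: "'a::euclidean_space \<Rightarrow> real"
  assumes f: "integrable lborel f" and f2: "integrable lborel (\<lambda>x. (f x)\<^sup>2)" and \<epsilon>: "\<epsilon> > 0"
  shows "(\<integral>x. f x * (\<integral>y. f y * gauss_kernel \<epsilon> (y - x) \<partial>lborel) \<partial>lborel) \<le> (\<integral>x. (f x)\<^sup>2 \<partial>lborel)"
proof -
  have [measurable]: "f \<in> borel_measurable borel" using f by (auto dest: borel_measurable_integrable)
  have c: "ennreal \<bar>f x\<bar> * ennreal \<bar>f (x + z)\<bar> \<le> ennreal (1 / 2) * (ennreal ((f x)\<^sup>2) + ennreal ((f (x + z))\<^sup>2))" for x z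
  proof -
    have "\<bar>f x\<bar> * \<bar>f (x + z)\<bar> \<le> 1 / 2 * ((f x)\<^sup>2 + (f (x + z))\<^sup>2)"
      using sum_squares_bound[of "\<bar>f x\<bar>" "\<bar>f (x + z)\<bar>"] by simp
    then have "ennreal (\<bar>f x\<bar> * \<bar>f (x + z)\<bar>) \<le> ennreal (1 / 2 * ((f x)\<^sup>2 + (f (x + z))\<^sup>2))" by (rule ennreal_leI)
    then show ?thesis by (simp only: ennreal_mult ennreal_plus zero_le_power2 abs_ge_zero add_nonneg_nonneg zero_le_divide_1_iff zero_le_numeral)
  qed
  define A where "A = (\<integral>\<^sup>+x. ennreal ((f x)\<^sup>2) \<partial>lborel)"
  have A: "A = ennreal (\<integral>x. (f x)\<^sup>2 \<partial>lborel)" unfolding A_def by (rule nn_integral_eq_integral[OF f2]) simp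
  have "ennreal (\<integral>x. f x * (\<integral>y. f y * gauss_kernel \<epsilon> (y - x) \<partial>lborel) \<partial>lborel)
      \<le> ennreal (norm (\<integral>x. f x * (\<integral>z. f (x + z) * gauss_kernel \<epsilon> z \<partial>lborel) \<partial>lborel))"
    unfolding gauss_autocorrelation_shift[OF \<open>f \<in> borel_measurable borel\<close>] by (intro ennreal_leI) simp
  also have "\<dots> \<le> (\<integral>\<^sup>+x. ennreal (norm (f x * (\<integral>z. f (x + z) * gauss_kernel \<epsilon> z \<partial>lborel))) \<partial>lborel)"
    by (rule norm_integral_le_nn_integral)
  also have "\<dots> \<le> (\<integral>\<^sup>+x. (\<integral>\<^sup>+z. ennreal \<bar>f x\<bar> * ennreal \<bar>f (x + z)\<bar> * ennreal (gauss_kernel \<epsilon> z) \<partial>lborel) \<partial>lborel)"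
  proof (rule nn_integral_mono)
    fix x
    have "ennreal (norm (f x * (\<integral>z. f (x + z) * gauss_kernel \<epsilon> z \<partial>lborel)))
        = ennreal \<bar>f x\<bar> * ennreal (norm (\<integral>z. f (x + z) * gauss_kernel \<epsilon> z \<partial>lborel))"
      by (simp add: abs_mult ennreal_mult)
    also have "\<dots> \<le> ennreal \<bar>f x\<bar> * (\<integral>\<^sup>+z. ennreal (norm (f (x + z) * gauss_kernel \<epsilon> z)) \<partial>lborel)"
      by (intro mult_left_mono norm_integral_le_nn_integral) simp
    also have "\<dots> = (\<integral>\<^sup>+z. ennreal \<bar>f x\<bar> * ennreal \<bar>f (x + z)\<bar> * ennreal (gauss_kernel \<epsilon> z) \<partial>lborel)"
      by (subst nn_integral_cmult[symmetric])
        (auto simp: abs_mult ennreal_mult gauss_kernel_nonneg mult.assoc intro!: nn_integral_cong)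
    finally show "ennreal (norm (f x * (\<integral>z. f (x + z) * gauss_kernel \<epsilon> z \<partial>lborel)))
      \<le> (\<integral>\<^sup>+z. ennreal \<bar>f x\<bar> * ennreal \<bar>f (x + z)\<bar> * ennreal (gauss_kernel \<epsilon> z) \<partial>lborel)" .
  qed
  also have "\<dots> = (\<integral>\<^sup>+z. (\<integral>\<^sup>+x. ennreal \<bar>f x\<bar> * ennreal \<bar>f (x + z)\<bar> * ennreal (gauss_kernel \<epsilon> z) \<partial>lborel) \<partial>lborel)"
    by (rule lborel_pair.Fubini') measurable
  also have "\<dots> \<le> (\<integral>\<^sup>+z. A * ennreal (gauss_kernel \<epsilon> z) \<partial>(lborel :: 'a measure))"
  proof (rule nn_integral_mono)
    fix z
    have "(\<integral>\<^sup>+x. ennreal \<bar>f x\<bar> * ennreal \<bar>f (x + z)\<bar> * ennreal (gauss_kernel \<epsilon> z) \<partial>lborel)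
      = (\<integral>\<^sup>+x. ennreal \<bar>f x\<bar> * ennreal \<bar>f (x + z)\<bar> \<partial>lborel) * ennreal (gauss_kernel \<epsilon> z)"
      by (rule nn_integral_multc) measurable
    also have "(\<integral>\<^sup>+x. ennreal \<bar>f x\<bar> * ennreal \<bar>f (x + z)\<bar> \<partial>lborel)
      \<le> (\<integral>\<^sup>+x. ennreal (1 / 2) * (ennreal ((f x)\<^sup>2) + ennreal ((f (x + z))\<^sup>2)) \<partial>lborel)"
      by (intro nn_integral_mono c)
    also have "\<dots> = ennreal (1 / 2) * (A + (\<integral>\<^sup>+x. ennreal ((f (x + z))\<^sup>2) \<partial>lborel))"
      unfolding A_def by (subst nn_integral_cmult) (auto simp: nn_integral_add)
    also have "(\<integral>\<^sup>+x. ennreal ((f (x + z))\<^sup>2) \<partial>lborel) = A"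
      unfolding A_def by (rule lborel_nn_integral_shift'[of "\<lambda>x. ennreal ((f x)\<^sup>2)"]) measurable
    also have "ennreal (1 / 2) * (A + A) = A"
    proof -
      have "ennreal (1 / 2 * (a + a)) = ennreal (1 / 2) * (ennreal a + ennreal a)" if "0 \<le> a" for a
        using that by (simp only: ennreal_mult ennreal_plus add_nonneg_nonneg zero_le_divide_1_iff zero_le_numeral)
      from this[of "\<integral>x. (f x)\<^sup>2 \<partial>lborel"] show ?thesis unfolding A by simp
    qed
    finally show "(\<integral>\<^sup>+x. ennreal \<bar>f x\<bar> * ennreal \<bar>f (x + z)\<bar> * ennreal (gauss_kernel \<epsilon> z) \<partial>lborel)
      \<le> A * ennreal (gauss_kernel \<epsilon> z)"
      by (simp add: mult_right_mono)
  qed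
  also have "\<dots> = A * (\<integral>\<^sup>+z. ennreal (gauss_kernel \<epsilon> (z::'a)) \<partial>lborel)"
    by (rule nn_integral_cmult) measurable
  also have "(\<integral>\<^sup>+z. ennreal (gauss_kernel \<epsilon> (z::'a)) \<partial>lborel) = 1"
    using nn_integral_eq_integral[OF gauss_kernel_integrable[OF \<epsilon>, where 'a='a]]
      gauss_kernel_integral[OF \<epsilon>, where 'a='a] by (simp add: gauss_kernel_nonneg)
  finally show ?thesis unfolding A by simp
qed

lemma lip_isCont_shift:
  assumes "lip_compact_supp f"
  shows "isCont (\<lambda>z. f (x + z)) 0"
proof -
  have "isCont f y" for y
    using lip_continuous[OF assms] by (simp add: continuous_on_eq_continuous_at)
  then show ?thesis by (intro isCont_o2[where f = "\<lambda>z. x + z" and g = f]) (auto intro: continuous_intros)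
qed

text \<open>The inner integral is the Gaussian average of \<open>f\<close> around \<open>x\<close>;
  it tends to \<open>f x\<close> and is dominated by the bound of \<open>f\<close>.\<close>

lemma gauss_energy_tendsto:
  fixes f :: "'a::euclidean_space \<Rightarrow> real"
  assumes f: "lip_compact_supp f"
  shows "(\<lambda>n. \<integral>x. f x * (\<integral>y. f y * gauss_kernel (1 / Suc n) (y - x) \<partial>lborel) \<partial>lborel)
    \<longlonglongrightarrow> (\<integral>x. (f x)\<^sup>2 \<partial>lborel)"
proof -
  have [measurable]: "f \<in> borel_measurable borel" by (rule lip_measurable[OF f])
  obtain B where B: "B > 0" "\<And>x. \<bar>f x\<bar> \<le> B" by (rule lip_bounded[OF f]) blast
  define I where "I n x = (\<integral>z. gauss_kernel (1 / Suc n) z *\<^sub>R f (x + z) \<partial>lborel)" for n x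
  have I_eq: "(\<integral>y. f y * gauss_kernel (1 / Suc n) (y - x) \<partial>lborel) = I n x" for n x
    unfolding I_def by (subst gauss_autocorrelation_shift) (simp_all add: mult.commute)
  have I_meas [measurable]: "I n \<in> borel_measurable borel" for n unfolding I_def[abs_def] by measurable
  have I_le: "\<bar>I n x\<bar> \<le> B" for n x
  proof -
    have "\<bar>I n x\<bar> \<le> (\<integral>z. norm (gauss_kernel (1 / Suc n) z *\<^sub>R f (x + z)) \<partial>lborel)"
      unfolding I_def using integral_norm_bound[of lborel "\<lambda>z. gauss_kernel (1 / Suc n) z *\<^sub>R f (x + z)"] by simp
    also have "\<dots> \<le> (\<integral>z. gauss_kernel (1 / Suc n) (z::'a) * B \<partial>lborel)"
    proof (rule integral_mono)
      show i: "integrable lborel (\<lambda>z::'a. gauss_kernel (1 / Suc n) z * B)"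
        by (intro integrable_mult_left gauss_kernel_integrable) simp
      show le: "norm (gauss_kernel (1 / Suc n) z *\<^sub>R f (x + z)) \<le> gauss_kernel (1 / Suc n) z * B" for z
        by (simp add: abs_mult abs_of_nonneg[OF gauss_kernel_nonneg] mult_left_mono[OF B(2) gauss_kernel_nonneg])
      show "integrable lborel (\<lambda>z. norm (gauss_kernel (1 / Suc n) z *\<^sub>R f (x + z)))"
        by (rule Bochner_Integration.integrable_bound[OF i]) (use le in \<open>auto intro: order_trans[OF _ abs_ge_self]\<close>)
    qed
    also have "\<dots> = B" using gauss_kernel_integral[of "1 / Suc n", where 'a='a] by simp
    finally show ?thesis .
  qed
  have "(\<lambda>n. \<integral>x. f x * I n x \<partial>lborel) \<longlonglongrightarrow> (\<integral>x. f x * f x \<partial>lborel)"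
  proof (rule integral_dominated_convergence[where w = "\<lambda>x. \<bar>f x\<bar> * B"])
    show "integrable lborel (\<lambda>x. \<bar>f x\<bar> * B)"
      using lip_integrable[OF f] by (intro integrable_mult_left integrable_abs)
    show "AE x in lborel. (\<lambda>n. f x * I n x) \<longlonglongrightarrow> f x * f x"
    proof (intro AE_I2 tendsto_mult tendsto_const)
      fix x
      have "isCont (\<lambda>z. f (x + z)) 0" by (rule lip_isCont_shift[OF f])
      then have "(\<lambda>n. I n x) \<longlonglongrightarrow> f (x + 0)"
        unfolding I_def by (rule gauss_kernel_tendsto[where B = B, rotated 2]) (use B(2) in simp_all)
      then show "(\<lambda>n. I n x) \<longlonglongrightarrow> f x" by simp
    qed
    show "AE x in lborel. norm (f x * I n x) \<le> \<bar>f x\<bar> * B" for n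
      by (intro AE_I2) (simp add: abs_mult mult_left_mono[OF I_le])
  qed measurable
  then show ?thesis unfolding I_eq power2_eq_square .
qed

section \<open>Fourier integrals and the two Plancherel inequalities\<close>

lemma fourier_integral_integrable:
  fixes f :: "'a::euclidean_space \<Rightarrow> real"
  assumes "integrable lebesgue f"
  shows "integrable lebesgue (\<lambda>x. complex_of_real (f x) * cis (- (x \<bullet> \<xi>)))"
proof (rule Bochner_Integration.integrable_bound[OF assms])
  have [measurable]: "f \<in> borel_measurable lebesgue" using assms by simp
  have [measurable]: "(\<lambda>x. cis (- (x \<bullet> \<xi>))) \<in> borel_measurable lebesgue"
    by (rule measurable_completion) measurable
  show "(\<lambda>x. complex_of_real (f x) * cis (- (x \<bullet> \<xi>))) \<in> borel_measurable lebesgue" by measurable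
qed (auto simp: norm_mult)

lemma fourier_integral_diff:
  fixes f g :: "'a::euclidean_space \<Rightarrow> real"
  assumes "integrable lebesgue f" "integrable lebesgue g"
  shows "fourier_integral (\<lambda>x. complex_of_real (f x - g x)) \<xi>
    = fourier_integral (\<lambda>x. complex_of_real (f x)) \<xi> - fourier_integral (\<lambda>x. complex_of_real (g x)) \<xi>"
  unfolding fourier_integral_def
  by (simp add: left_diff_distrib fourier_integral_integrable assms scaleR_diff_right)

lemma fourier_integral_cong_AE:
  assumes "AE x in lebesgue. f x = g x" "f \<in> borel_measurable lebesgue" "g \<in> borel_measurable lebesgue"
  shows "fourier_integral f = fourier_integral g"
proof
  fix \<xi> :: 'a
  have [measurable]: "(\<lambda>x. cis (- (x \<bullet> \<xi>))) \<in> borel_measurable lebesgue"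
    by (rule measurable_completion) measurable
  have "(\<integral>x. f x * cis (- (x \<bullet> \<xi>)) \<partial>lebesgue) = (\<integral>x. g x * cis (- (x \<bullet> \<xi>)) \<partial>lebesgue)"
    by (rule integral_cong_AE) (use assms in auto)
  then show "fourier_integral f \<xi> = fourier_integral g \<xi>" by (simp add: fourier_integral_def)
qed

lemma fourier_integral_measurable:
  fixes f :: "'a::euclidean_space \<Rightarrow> complex"
  assumes [measurable]: "f \<in> borel_measurable borel"
  shows "fourier_integral f \<in> borel_measurable borel"
proof -
  have "fourier_integral f = (\<lambda>\<xi>. (2 * pi) powr (- (real DIM('a) / 2)) *\<^sub>R (\<integral>x. f x * cis (- (x \<bullet> \<xi>)) \<partial>lborel))"
    by (simp add: fun_eq_iff fourier_integral_def integral_completion)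
  then show ?thesis by simp
qed

lemma fourier_integral_energy:
  fixes f :: "'a::euclidean_space \<Rightarrow> real"
  assumes f: "integrable lborel f" and \<epsilon>: "\<epsilon> > 0"
  defines "F \<equiv> fourier_integral (\<lambda>x. complex_of_real (f x))"
  shows "integrable lborel (\<lambda>\<xi>. gauss_weight \<epsilon> \<xi> * (norm (F \<xi>))\<^sup>2)"
    and "(\<integral>\<xi>. gauss_weight \<epsilon> \<xi> * (norm (F \<xi>))\<^sup>2 \<partial>lborel)
      = (\<integral>x. f x * (\<integral>y. f y * gauss_kernel \<epsilon> (y - x) \<partial>lborel) \<partial>lborel)"
proof -
  have [measurable]: "f \<in> borel_measurable borel" using f by (auto dest: borel_measurable_integrable)
  have c: "((2 * pi) powr (- (real DIM('a) / 2)))\<^sup>2 = 1 / (2 * pi) ^ DIM('a)"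
  proof -
    have "((2 * pi) powr (- (real DIM('a) / 2)))\<^sup>2 = (2 * pi) powr (- real DIM('a))"
      by (simp add: power2_eq_square powr_add[symmetric])
    then show ?thesis by (simp add: powr_minus powr_realpow inverse_eq_divide)
  qed
  have F: "gauss_weight \<epsilon> \<xi> * (norm (F \<xi>))\<^sup>2
      = gauss_weight \<epsilon> \<xi> * (norm (\<integral>x. complex_of_real (f x) * cis (- (x \<bullet> \<xi>)) \<partial>lborel))\<^sup>2 * (1 / (2 * pi) ^ DIM('a))" for \<xi>
    unfolding F_def fourier_integral_def norm_scaleR power_mult_distrib power2_abs c by (simp add: integral_completion)
  show "integrable lborel (\<lambda>\<xi>. gauss_weight \<epsilon> \<xi> * (norm (F \<xi>))\<^sup>2)"
    unfolding F by (intro integrable_mult_left gauss_weighted_energy f \<epsilon>)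
  show "(\<integral>\<xi>. gauss_weight \<epsilon> \<xi> * (norm (F \<xi>))\<^sup>2 \<partial>lborel)
      = (\<integral>x. f x * (\<integral>y. f y * gauss_kernel \<epsilon> (y - x) \<partial>lborel) \<partial>lborel)"
    unfolding F integral_mult_left_zero gauss_weighted_energy(2)[OF f \<epsilon>] by simp
qed

lemma gauss_weight_tendsto: "(\<lambda>n. gauss_weight (1 / Suc n) \<xi>) \<longlonglongrightarrow> 1"
proof -
  have "(\<lambda>n. 1 / Suc n) \<longlonglongrightarrow> (0::real)"
    using LIMSEQ_inverse_real_of_nat by (simp add: inverse_eq_divide)
  then have "(\<lambda>n. exp (- ((1 / Suc n) * norm \<xi>)\<^sup>2 / 2)) \<longlonglongrightarrow> exp (- (0 * norm \<xi>)\<^sup>2 / 2)"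
    by (intro tendsto_intros) auto
  then show ?thesis by (simp add: gauss_weight_def)
qed

lemma ex_borel_version_real:
  fixes f :: "'a::euclidean_space \<Rightarrow> real"
  assumes "f \<in> borel_measurable lebesgue"
  obtains g where "g \<in> borel_measurable borel" "AE x in lebesgue. f x = g x"
  using completion_ex_borel_measurable_real[OF assms] by (auto simp: AE_completion)

context
  fixes f :: "'a::euclidean_space \<Rightarrow> real"
  assumes f1: "integrable lebesgue f" and f2: "sq_integrable f"
begin

text \<open>Fatou, as the Gaussian weight tends to 1, preserves only an inequality, but square
  integrability of the transform comes with it. A Borel version of \<open>f\<close> is used because
  the Gaussian identities live on \<open>lborel\<close>.\<close>

lemma fourier_integral_sq_integrable: "sq_integrable (fourier_integral (\<lambda>x. complex_of_real (f x)))"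
  and fourier_integral_norm_le: "norm (abs_L2 (fourier_integral (\<lambda>x. complex_of_real (f x)))) \<le> norm (abs_L2 f)"
proof -
  have fm: "f \<in> borel_measurable lebesgue" using f1 by simp
  obtain g where g[measurable]: "g \<in> borel_measurable borel" and fg: "AE x in lebesgue. f x = g x"
    by (rule ex_borel_version_real[OF fm])
  have gm: "g \<in> borel_measurable lebesgue" by (rule measurable_completion) simp
  have "integrable lebesgue g" using f1 integrable_cong_AE[OF fm gm fg] by simp
  then have g1: "integrable lborel g" by (simp add: integrable_completion)
  have fg2: "AE x in lebesgue. (f x)\<^sup>2 = (g x)\<^sup>2" using fg by eventually_elim simp
  have "integrable lebesgue (\<lambda>x. (g x)\<^sup>2)"
    using f2 fg2 integrable_cong_AE[of "\<lambda>x. (f x)\<^sup>2" lebesgue "\<lambda>x. (g x)\<^sup>2"] fm gm fg by (simp add: sq_integrable_def)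
  then have g2: "integrable lborel (\<lambda>x. (g x)\<^sup>2)" by (simp add: integrable_completion)
  have gsq: "sq_integrable g" using gm \<open>integrable lebesgue (\<lambda>x. (g x)\<^sup>2)\<close> by (simp add: sq_integrable_def)
  have eq: "fourier_integral (\<lambda>x. complex_of_real (f x)) = fourier_integral (\<lambda>x. complex_of_real (g x))" (is "_ = ?G")
    by (rule fourier_integral_cong_AE) (use fg fm gm in auto)
  have G[measurable]: "?G \<in> borel_measurable borel" by (rule fourier_integral_measurable) measurable
  have normg: "(norm (abs_L2 g))\<^sup>2 = (\<integral>x. (g x)\<^sup>2 \<partial>lborel)"
    using norm_abs_L2_sq[OF gsq] by (simp add: integral_completion)
  have "(\<integral>\<^sup>+\<xi>. ennreal ((norm (?G \<xi>))\<^sup>2) \<partial>lborel)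
     = (\<integral>\<^sup>+\<xi>. liminf (\<lambda>n. ennreal (gauss_weight (1 / Suc n) \<xi> * (norm (?G \<xi>))\<^sup>2)) \<partial>lborel)"
  proof (rule nn_integral_cong)
    fix \<xi>
    have "(\<lambda>n. ennreal (gauss_weight (1 / Suc n) \<xi> * (norm (?G \<xi>))\<^sup>2)) \<longlonglongrightarrow> ennreal (1 * (norm (?G \<xi>))\<^sup>2)"
      by (intro tendsto_ennrealI tendsto_mult tendsto_const gauss_weight_tendsto)
    from lim_imp_Liminf[OF sequentially_bot this]
    show "ennreal ((norm (?G \<xi>))\<^sup>2) = liminf (\<lambda>n. ennreal (gauss_weight (1 / Suc n) \<xi> * (norm (?G \<xi>))\<^sup>2))" by simp
  qed
  also have "\<dots> \<le> liminf (\<lambda>n. \<integral>\<^sup>+\<xi>. ennreal (gauss_weight (1 / Suc n) \<xi> * (norm (?G \<xi>))\<^sup>2) \<partial>lborel)"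
    by (rule nn_integral_liminf) measurable
  also have "\<dots> \<le> ennreal ((norm (abs_L2 g))\<^sup>2)"
  proof -
    have "(\<integral>\<^sup>+\<xi>. ennreal (gauss_weight (1 / Suc n) \<xi> * (norm (?G \<xi>))\<^sup>2) \<partial>lborel)
      \<le> ennreal ((norm (abs_L2 g))\<^sup>2)" for n
    proof -
    have "(\<integral>\<^sup>+\<xi>. ennreal (gauss_weight (1 / Suc n) \<xi> * (norm (?G \<xi>))\<^sup>2) \<partial>lborel)
      = ennreal (\<integral>\<xi>. gauss_weight (1 / Suc n) \<xi> * (norm (?G \<xi>))\<^sup>2 \<partial>lborel)"
      by (rule nn_integral_eq_integral[OF fourier_integral_energy(1)[OF g1]])
        (auto simp: less_imp_le[OF gauss_weight_bounds(1)])
    also have "\<dots> \<le> ennreal (\<integral>x. (g x)\<^sup>2 \<partial>lborel)"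
      by (intro ennreal_leI) (simp add: fourier_integral_energy(2)[OF g1] gauss_energy_le[OF g1 g2])
    finally show ?thesis by (simp add: normg)
    qed
    then show ?thesis by (intro Liminf_le always_eventually allI) simp_all
  qed
  finally have bound: "(\<integral>\<^sup>+\<xi>. ennreal ((norm (?G \<xi>))\<^sup>2) \<partial>lebesgue) \<le> ennreal ((norm (abs_L2 g))\<^sup>2)"
    by (simp add: nn_integral_completion)
  have ab: "abs_L2 f = abs_L2 g" by (rule iffD2[OF abs_L2_eq_iff[OF f2 gsq] fg])
  have Gm: "?G \<in> borel_measurable lebesgue" by (rule measurable_completion) simp
  show "sq_integrable (fourier_integral (\<lambda>x. complex_of_real (f x)))"
    unfolding eq by (rule norm_abs_L2_le(1)[OF Gm norm_ge_zero bound])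
  show "norm (abs_L2 (fourier_integral (\<lambda>x. complex_of_real (f x)))) \<le> norm (abs_L2 f)"
    unfolding eq ab by (rule norm_abs_L2_le(2)[OF Gm norm_ge_zero bound])
qed

end

lemma lip_integrable_lebesgue: "lip_compact_supp f \<Longrightarrow> integrable lebesgue f"
  using lip_integrable[of f] lip_measurable[of f] by (simp add: integrable_completion)

text \<open>The reverse inequality: the weight is at most 1, and for Lipschitz functions the
  Gaussian energy converges to the squared norm.\<close>

lemma plancherel_lip:
  fixes f :: "'a::euclidean_space \<Rightarrow> real"
  assumes f: "lip_compact_supp f"
  shows "norm (abs_L2 f) \<le> norm (abs_L2 (fourier_integral (\<lambda>x. complex_of_real (f x))))"
proof -
  let ?F = "fourier_integral (\<lambda>x. complex_of_real (f x))"
  have [measurable]: "f \<in> borel_measurable borel" by (rule lip_measurable[OF f])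
  have [measurable]: "?F \<in> borel_measurable borel" by (rule fourier_integral_measurable) measurable
  have F: "sq_integrable ?F"
    by (rule fourier_integral_sq_integrable[OF lip_integrable_lebesgue[OF f] lip_sq_integrable[OF f]])
  then have Fi: "integrable lborel (\<lambda>\<xi>. (norm (?F \<xi>))\<^sup>2)"
    by (simp add: sq_integrable_def integrable_completion)
  have "(\<integral>x. (f x)\<^sup>2 \<partial>lborel) \<le> (\<integral>\<xi>. (norm (?F \<xi>))\<^sup>2 \<partial>lborel)"
  proof (rule LIMSEQ_le_const2[OF gauss_energy_tendsto[OF f]], intro exI allI impI)
    fix n :: nat
    have "(\<integral>x. f x * (\<integral>y. f y * gauss_kernel (1 / Suc n) (y - x) \<partial>lborel) \<partial>lborel)
        = (\<integral>\<xi>. gauss_weight (1 / Suc n) \<xi> * (norm (?F \<xi>))\<^sup>2 \<partial>lborel)"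
      by (rule fourier_integral_energy(2)[OF lip_integrable[OF f], symmetric]) simp
    also have "\<dots> \<le> (\<integral>\<xi>. (norm (?F \<xi>))\<^sup>2 \<partial>lborel)"
    proof (rule integral_mono[OF _ Fi])
      show "integrable lborel (\<lambda>\<xi>. gauss_weight (1 / Suc n) \<xi> * (norm (?F \<xi>))\<^sup>2)"
        by (rule fourier_integral_energy(1)[OF lip_integrable[OF f]]) simp
      show "gauss_weight (1 / Suc n) \<xi> * (norm (?F \<xi>))\<^sup>2 \<le> (norm (?F \<xi>))\<^sup>2" for \<xi>
        using mult_right_mono[OF gauss_weight_bounds(2) zero_le_power2] by fastforce
    qed
    finally show "(\<integral>x. f x * (\<integral>y. f y * gauss_kernel (1 / Suc n) (y - x) \<partial>lborel) \<partial>lborel)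
        \<le> (\<integral>\<xi>. (norm (?F \<xi>))\<^sup>2 \<partial>lborel)" .
  qed
  then have "(norm (abs_L2 f))\<^sup>2 \<le> (norm (abs_L2 ?F))\<^sup>2"
    using norm_abs_L2_sq[OF lip_sq_integrable[OF f]] norm_abs_L2_sq[OF F] by (simp add: integral_completion)
  then show ?thesis by (rule power2_le_imp_le) simp
qed

text \<open>The reverse inequality extends from the dense Lipschitz class, the error being
  controlled by the first inequality applied to \<open>f - g n\<close>.\<close>

theorem plancherel_L1_L2:
  fixes f :: "'a::euclidean_space \<Rightarrow> real"
  assumes f1: "integrable lebesgue f" and f2: "sq_integrable f"
  shows "norm (abs_L2 (fourier_integral (\<lambda>x. complex_of_real (f x)))) = norm (abs_L2 f)"
proof (rule antisym)
  let ?F = "\<lambda>f. fourier_integral (\<lambda>x. complex_of_real (f x))"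
  show "norm (abs_L2 (?F f)) \<le> norm (abs_L2 f)" by (rule fourier_integral_norm_le[OF f1 f2])
  obtain X where X: "\<And>n. X n \<in> abs_L2 ` {f. lip_compact_supp f}" "X \<longlonglongrightarrow> abs_L2 f"
    using lip_dense_L2[of "abs_L2 f"] unfolding closure_sequential by blast
  then obtain g where g: "\<And>n. lip_compact_supp (g n)" "\<And>n. X n = abs_L2 (g n)"
    unfolding image_iff by (metis mem_Collect_eq)
  have le: "2 * norm (X n) \<le> norm (X n) + norm (abs_L2 f - X n) + norm (abs_L2 (?F f))" for n
  proof -
    have g1: "integrable lebesgue (g n)" and g2: "sq_integrable (g n)"
      using lip_integrable_lebesgue lip_sq_integrable g(1) by blast+
    have d1: "integrable lebesgue (\<lambda>x. f x - g n x)" and d2: "sq_integrable (\<lambda>x. f x - g n x)"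
      using f1 f2 g1 g2 by (auto intro: sq_integrable_diff)
    have "norm (X n) \<le> norm (abs_L2 (?F (g n)))" unfolding g(2) by (rule plancherel_lip[OF g(1)])
    also have "abs_L2 (?F (g n)) = abs_L2 (?F f) - abs_L2 (?F (\<lambda>x. f x - g n x))"
      by (subst abs_L2_diff[OF fourier_integral_sq_integrable[OF f1 f2] fourier_integral_sq_integrable[OF d1 d2]])
        (simp add: fourier_integral_diff[OF f1 g1] del: of_real_diff)
    also have "norm \<dots> \<le> norm (abs_L2 (?F f)) + norm (abs_L2 (?F (\<lambda>x. f x - g n x)))"
      by (rule norm_triangle_ineq4)
    also have "norm (abs_L2 (?F (\<lambda>x. f x - g n x))) \<le> norm (abs_L2 (\<lambda>x. f x - g n x))"
      by (rule fourier_integral_norm_le[OF d1 d2])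
    also have "abs_L2 (\<lambda>x. f x - g n x) = abs_L2 f - X n" by (simp add: g(2) abs_L2_diff f2 g2)
    finally show ?thesis by simp
  qed
  have r: "(\<lambda>n. norm (X n) + norm (abs_L2 f - X n) + norm (abs_L2 (?F f)))
      \<longlonglongrightarrow> norm (abs_L2 f) + norm (abs_L2 f - abs_L2 f) + norm (abs_L2 (?F f))"
    by (intro tendsto_intros X)
  have l: "(\<lambda>n. 2 * norm (X n)) \<longlonglongrightarrow> 2 * norm (abs_L2 f)" by (intro tendsto_intros X)
  have "2 * norm (abs_L2 f) \<le> norm (abs_L2 f) + norm (abs_L2 f - abs_L2 f) + norm (abs_L2 (?F f))"
    using LIMSEQ_le[OF l r] le by blast
  then show "norm (abs_L2 f) \<le> norm (abs_L2 (?F f))" by simp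
qed

section \<open>Uniqueness of Fourier transforms of integrable functions\<close>

lemma ex_borel_version_complex:
  fixes h :: "'a::euclidean_space \<Rightarrow> complex"
  assumes [measurable]: "h \<in> borel_measurable lebesgue"
  obtains g where "g \<in> borel_measurable borel" "AE x in lebesgue. h x = g x"
proof -
  have "(\<lambda>x. Re (h x)) \<in> borel_measurable lebesgue" "(\<lambda>x. Im (h x)) \<in> borel_measurable lebesgue" by measurable
  from ex_borel_version_real[OF this(1)] ex_borel_version_real[OF this(2)]
  obtain a b where ab[measurable]: "a \<in> borel_measurable borel" "b \<in> borel_measurable borel"
    and a: "AE x in lebesgue. Re (h x) = a x" and b: "AE x in lebesgue. Im (h x) = b x"
    by metis
  from a b have "AE x in lebesgue. h x = Complex (a x) (b x)"
    by eventually_elim (simp add: complex_eq_iff)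
  moreover have "(\<lambda>x. Complex (a x) (b x)) \<in> borel_measurable borel"
    unfolding Complex_eq by measurable
  ultimately show ?thesis using that by blast
qed

text \<open>Testing against \<open>\<psi> * gauss_kernel\<close>, whose Fourier representation turns the pairing with \<open>h\<close>
  into an average of the vanishing transform of \<open>h\<close>.\<close>

theorem L1_fourier_unique:
  fixes h :: "'a::euclidean_space \<Rightarrow> complex"
  assumes h: "integrable lebesgue h" and zero: "\<And>y. (\<integral>\<xi>. h \<xi> * cis (y \<bullet> \<xi>) \<partial>lebesgue) = 0"
  shows "AE \<xi> in lebesgue. h \<xi> = 0"
proof -
  have hm: "h \<in> borel_measurable lebesgue" using h by simp
  obtain g where g[measurable]: "g \<in> borel_measurable borel" and hg: "AE x in lebesgue. h x = g x"
    by (rule ex_borel_version_complex[OF hm])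
  have gm: "g \<in> borel_measurable lebesgue" by (rule measurable_completion) simp
  have "integrable lebesgue g" using h integrable_cong_AE[OF hm gm hg] by simp
  then have gi: "integrable lborel g" by (simp add: integrable_completion)
  have gz: "(\<integral>\<xi>. g \<xi> * cis (y \<bullet> \<xi>) \<partial>lborel) = 0" for y
  proof -
    have [measurable]: "(\<lambda>x. cis (y \<bullet> x)) \<in> borel_measurable lebesgue"
      by (rule measurable_completion) measurable
    have "(\<integral>\<xi>. h \<xi> * cis (y \<bullet> \<xi>) \<partial>lebesgue) = (\<integral>\<xi>. g \<xi> * cis (y \<bullet> \<xi>) \<partial>lebesgue)"
      by (rule integral_cong_AE) (use hm gm hg in auto)
    then show ?thesis using zero by (simp add: integral_completion)
  qed
  have "AE \<xi> in lebesgue. g \<xi> = 0"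
  proof (rule AE_zero_if_orthogonal_to_lip[OF gm])
    fix \<psi> :: "'a \<Rightarrow> real" assume \<psi>: "lip_compact_supp \<psi>"
    have [measurable]: "\<psi> \<in> borel_measurable borel" by (rule lip_measurable[OF \<psi>])
    obtain B where B: "B > 0" "\<And>x. \<bar>\<psi> x\<bar> \<le> B" by (rule lip_bounded[OF \<psi>]) blast
    have "integrable lborel (\<lambda>x. B *\<^sub>R g x)" using gi by simp
    then have "integrable lborel (\<lambda>x. \<psi> x *\<^sub>R g x)"
      by (rule Bochner_Integration.integrable_bound)
        (use B in \<open>auto intro!: mult_right_mono order_trans[OF B(2) abs_ge_self]\<close>)
    then show "integrable lebesgue (\<lambda>x. \<psi> x *\<^sub>R g x)" by (simp add: integrable_completion)
    define I where "I n x = (\<integral>z. gauss_kernel (1 / Suc n) z *\<^sub>R complex_of_real (\<psi> (x + z)) \<partial>lborel)" for n x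
    have I_meas [measurable]: "I n \<in> borel_measurable borel" for n unfolding I_def[abs_def] by measurable
    have I_le: "norm (I n x) \<le> B" for n x
    proof -
      have "norm (I n x) \<le> (\<integral>z. norm (gauss_kernel (1 / Suc n) z *\<^sub>R complex_of_real (\<psi> (x + z))) \<partial>lborel)"
        unfolding I_def by (rule integral_norm_bound)
      also have "\<dots> \<le> (\<integral>z. gauss_kernel (1 / Suc n) (z::'a) * B \<partial>lborel)"
      proof (rule integral_mono)
        show i: "integrable lborel (\<lambda>z::'a. gauss_kernel (1 / Suc n) z * B)"
          by (intro integrable_mult_left gauss_kernel_integrable) simp
        show le: "norm (gauss_kernel (1 / Suc n) z *\<^sub>R complex_of_real (\<psi> (x + z))) \<le> gauss_kernel (1 / Suc n) z * B" for z
          by (simp add: abs_mult abs_of_nonneg[OF gauss_kernel_nonneg] mult_left_mono[OF B(2) gauss_kernel_nonneg])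
        show "integrable lborel (\<lambda>z. norm (gauss_kernel (1 / Suc n) z *\<^sub>R complex_of_real (\<psi> (x + z))))"
          by (rule Bochner_Integration.integrable_bound[OF i]) (use le in \<open>auto intro: order_trans[OF _ abs_ge_self]\<close>)
      qed
      also have "\<dots> = B" using gauss_kernel_integral[of "1 / Suc n", where 'a='a] by simp
      finally show ?thesis .
    qed
    have "(\<lambda>n. \<integral>x. I n x * g x \<partial>lborel) \<longlonglongrightarrow> (\<integral>x. complex_of_real (\<psi> x) * g x \<partial>lborel)"
    proof (rule integral_dominated_convergence[where w = "\<lambda>x. B * norm (g x)"])
      show "integrable lborel (\<lambda>x. B * norm (g x))" using gi by (intro integrable_mult_right integrable_norm)
      show "AE x in lborel. (\<lambda>n. I n x * g x) \<longlonglongrightarrow> complex_of_real (\<psi> x) * g x"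
      proof (intro AE_I2 tendsto_mult tendsto_const)
        fix x
        have "isCont (\<lambda>z. complex_of_real (\<psi> (x + z))) 0"
          by (rule continuous_of_real[OF lip_isCont_shift[OF \<psi>]])
        then have "(\<lambda>n. I n x) \<longlonglongrightarrow> complex_of_real (\<psi> (x + 0))"
          unfolding I_def by (rule gauss_kernel_tendsto[where B = B, rotated 2]) (use B(2) in simp_all)
        then show "(\<lambda>n. I n x) \<longlonglongrightarrow> complex_of_real (\<psi> x)" by simp
      qed
      show "AE x in lborel. norm (I n x * g x) \<le> B * norm (g x)" for n
        by (intro AE_I2) (simp add: norm_mult mult_right_mono[OF I_le])
    qed measurable
    moreover have "(\<integral>x. I n x * g x \<partial>lborel) = 0" for n
    proof -
      define \<epsilon> where "\<epsilon> = 1 / real (Suc n)"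
      have \<epsilon>: "\<epsilon> > 0" by (simp add: \<epsilon>_def)
      define W where "W y = complex_of_real (gauss_weight \<epsilon> y)" for y :: 'a
      define \<Psi> where "\<Psi> y = (\<integral>\<eta>. complex_of_real (\<psi> \<eta>) * cis (y \<bullet> \<eta>) \<partial>lborel)" for y :: 'a
      have Wi: "integrable lborel W"
        unfolding W_def[abs_def] by (rule integrable_of_real[OF gauss_weight_integrable[OF \<epsilon>]])
      have [measurable]: "W \<in> borel_measurable borel" "\<Psi> \<in> borel_measurable borel"
        unfolding W_def[abs_def] \<Psi>_def[abs_def] by measurable
      have \<psi>i: "integrable lborel (\<lambda>x. complex_of_real (\<psi> x))" using lip_integrable[OF \<psi>] by simp
      have \<Psi>_le: "norm (\<Psi> y) \<le> (\<integral>x. \<bar>\<psi> x\<bar> \<partial>lborel)" for y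
        using integral_norm_bound[of lborel "\<lambda>\<eta>. complex_of_real (\<psi> \<eta>) * cis (y \<bullet> \<eta>)"]
        by (simp add: \<Psi>_def norm_mult)
      have W\<Psi>: "integrable lborel (\<lambda>y. W y * \<Psi> y)"
        by (rule Bochner_Integration.integrable_bound[OF integrable_mult_left[OF integrable_norm[OF Wi], of "\<integral>x. \<bar>\<psi> x\<bar> \<partial>lborel"]])
          (use \<Psi>_le in \<open>auto simp: norm_mult abs_mult intro!: mult_left_mono order_trans[OF \<Psi>_le abs_ge_self]\<close>)
      \<comment> \<open>The kernel is written as the Fourier integral of the weight; exchanging
        integrals exhibits the smoothed \<open>\<psi>\<close> as a superposition of exponentials in
        \<open>x\<close> with an integrable density.\<close>
      have "complex_of_real ((2 * pi) ^ DIM('a)) * I n x = (\<integral>y. (W y * \<Psi> y) * cis (- (x \<bullet> y)) \<partial>lborel)" for x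
      proof -
        have "I n x = (\<integral>z. complex_of_real (\<psi> (x + z)) * complex_of_real (gauss_kernel \<epsilon> (x + z - x)) \<partial>lborel)"
          unfolding I_def \<epsilon>_def by (simp add: scaleR_conv_of_real mult.commute)
        also have "\<dots> = (\<integral>\<eta>. complex_of_real (\<psi> \<eta>) * complex_of_real (gauss_kernel \<epsilon> (\<eta> - x)) \<partial>lborel)"
          by (rule lborel_integral_shift[of "\<lambda>\<eta>. complex_of_real (\<psi> \<eta>) * complex_of_real (gauss_kernel \<epsilon> (\<eta> - x))" x]) measurable
        finally have "complex_of_real ((2 * pi) ^ DIM('a)) * I n x
            = (\<integral>\<eta>. complex_of_real (\<psi> \<eta>) * complex_of_real ((2 * pi) ^ DIM('a) * gauss_kernel \<epsilon> (\<eta> - x)) \<partial>lborel)"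
          by (simp only: integral_mult_right_zero[symmetric] of_real_mult mult_ac)
        also have "\<dots> = (\<integral>\<eta>. complex_of_real (\<psi> \<eta>) * (\<integral>y. W y * cis ((\<eta> - x) \<bullet> y) \<partial>lborel) \<partial>lborel)"
          unfolding gauss_fourier[OF \<epsilon>, symmetric] W_def ..
        also have "\<dots> = (\<integral>y. W y * (\<integral>\<eta>. complex_of_real (\<psi> \<eta>) * cis ((\<eta> - x) \<bullet> y) \<partial>lborel) \<partial>lborel)"
          by (rule Fubini_bounded_kernel[where B = 1, OF \<psi>i Wi]) auto
        also have "\<dots> = (\<integral>y. (W y * \<Psi> y) * cis (- (x \<bullet> y)) \<partial>lborel)"
        proof (rule Bochner_Integration.integral_cong[OF refl])
          fix y
          have "\<Psi> y * cis (- (x \<bullet> y)) = (\<integral>\<eta>. complex_of_real (\<psi> \<eta>) * cis (y \<bullet> \<eta>) * cis (- (x \<bullet> y)) \<partial>lborel)"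
            by (simp add: \<Psi>_def)
          then show "W y * (\<integral>\<eta>. complex_of_real (\<psi> \<eta>) * cis ((\<eta> - x) \<bullet> y) \<partial>lborel) = (W y * \<Psi> y) * cis (- (x \<bullet> y))"
            by (simp add: mult.assoc cis_mult inner_diff_left inner_commute[of y])
        qed
        finally show ?thesis .
      qed
      then have "complex_of_real ((2 * pi) ^ DIM('a)) * (\<integral>x. I n x * g x \<partial>lborel)
          = (\<integral>x. g x * (\<integral>y. (W y * \<Psi> y) * cis (- (x \<bullet> y)) \<partial>lborel) \<partial>lborel)"
        by (subst integral_mult_right_zero[symmetric]) (simp add: mult_ac)
      also have "\<dots> = (\<integral>y. (W y * \<Psi> y) * (\<integral>x. g x * cis (- (x \<bullet> y)) \<partial>lborel) \<partial>lborel)"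
        by (rule Fubini_bounded_kernel[where B = 1, OF gi W\<Psi>]) auto
      \<comment> \<open>The inner integral is the vanishing transform of \<open>g\<close>, taken at
        \<open>- y\<close>.\<close>
      also have "\<dots> = 0" using gz[of "- _"] by (simp add: inner_commute)
      finally show ?thesis by simp
    qed
    ultimately have "(\<integral>x. complex_of_real (\<psi> x) * g x \<partial>lborel) = 0" by (simp add: LIMSEQ_const_iff)
    then show "(\<integral>x. \<psi> x *\<^sub>R g x \<partial>lebesgue) = 0"
      by (simp add: integral_completion scaleR_conv_of_real)
  qed
  with hg show ?thesis by eventually_elim simp
qed

section \<open>The Fourier transform on \<open>L\<^sup>2\<close>\<close>

abbreviation real_fourier :: "('a::euclidean_space \<Rightarrow> real) \<Rightarrow> 'a \<Rightarrow> complex" where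
  "real_fourier f \<equiv> fourier_integral (\<lambda>x. complex_of_real (f x))"

abbreviation rfourier :: "('a::euclidean_space, real) L2 \<Rightarrow> ('a, complex) L2" where
  "rfourier u \<equiv> fourier (complexify u)"

lemma rep_complexify: "AE x in lebesgue. rep_L2 (complexify u) x = complex_of_real (rep_L2 u x)"
proof -
  have sq: "sq_integrable (\<lambda>x. complex_of_real (rep_L2 u x))"
    using sq_integrable_rep_L2[of u] by (simp add: sq_integrable_def)
  have "complexify (abs_L2 (rep_L2 u)) = abs_L2 (\<lambda>x. complex_of_real (rep_L2 u x))"
    by (rule complexify.abs_eq) (simp add: ae_rel_def)
  then have "complexify u = abs_L2 (\<lambda>x. complex_of_real (rep_L2 u x))" by simp
  then show ?thesis using rep_abs_L2[OF sq] by simp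
qed

text \<open>The real-valued counterpart of the cut-off in \<open>fourier\<close>; it brings a square
  integrable function into L^1, where the Fourier integral makes sense.\<close>

definition truncate :: "nat \<Rightarrow> ('a::euclidean_space \<Rightarrow> real) \<Rightarrow> 'a \<Rightarrow> real" where
  "truncate n f x = indicator (ball 0 (real n)) x * f x"

lemma truncate_measurable:
  "f \<in> borel_measurable lebesgue \<Longrightarrow> truncate n f \<in> borel_measurable lebesgue"
  unfolding truncate_def[abs_def] by (intro borel_measurable_times borel_measurable_indicator) auto

lemma truncate_sq_integrable:
  assumes "sq_integrable f"
  shows "sq_integrable (truncate n f)"
  unfolding sq_integrable_def
proof
  show m: "truncate n f \<in> borel_measurable lebesgue"
    by (rule truncate_measurable[OF sq_integrable_measurable[OF assms]])
  have i: "integrable lebesgue (\<lambda>x. (norm (f x))\<^sup>2)" using assms by (simp add: sq_integrable_def)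
  show "integrable lebesgue (\<lambda>x. (norm (truncate n f x))\<^sup>2)"
  proof (rule Bochner_Integration.integrable_bound[OF i])
    show "(\<lambda>x. (norm (truncate n f x))\<^sup>2) \<in> borel_measurable lebesgue"
      by (rule borel_measurable_power) (rule measurable_compose[OF m borel_measurable_norm])
  qed (auto simp: truncate_def split: split_indicator)
qed

lemma truncate_integrable:
  assumes "sq_integrable f"
  shows "integrable lebesgue (truncate n f)"
proof (rule Bochner_Integration.integrable_bound)
  show "integrable lebesgue (\<lambda>x. indicator (ball 0 (real n)) x + (norm (f x))\<^sup>2)"
    using assms lmeasurable_ball[of 0 "real n"]
    by (intro Bochner_Integration.integrable_add) (simp_all add: sq_integrable_def lmeasurable_iff_integrable)
  show "truncate n f \<in> borel_measurable lebesgue"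
    by (rule truncate_measurable[OF sq_integrable_measurable[OF assms]])
  have "\<bar>f x\<bar> \<le> 1 + (f x)\<^sup>2" for x
    using sum_squares_bound[of 1 "\<bar>f x\<bar>"] abs_ge_zero[of "f x"] by simp
  then show "AE x in lebesgue. norm (truncate n f x) \<le> norm (indicator (ball 0 (real n)) x + (norm (f x))\<^sup>2)"
    by (intro AE_I2) (auto simp: truncate_def split: split_indicator)
qed

lemma truncate_tendsto:
  fixes f :: "'a::euclidean_space \<Rightarrow> real"
  assumes f: "sq_integrable f"
  shows "(\<lambda>n. abs_L2 (truncate n f)) \<longlonglongrightarrow> abs_L2 f"
proof -
  have [measurable]: "f \<in> borel_measurable lebesgue" by (rule sq_integrable_measurable[OF f])
  have [measurable]: "truncate n f \<in> borel_measurable lebesgue" for n by (rule truncate_measurable) fact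
  have i: "integrable lebesgue (\<lambda>x. (norm (f x))\<^sup>2)" using f by (simp add: sq_integrable_def)
  have "(\<lambda>n. \<integral>x. (norm (truncate n f x - f x))\<^sup>2 \<partial>lebesgue) \<longlonglongrightarrow> (\<integral>x. 0 \<partial>(lebesgue :: 'a measure))"
  proof (rule integral_dominated_convergence[where w = "\<lambda>x. (norm (f x))\<^sup>2"])
    show "AE x in lebesgue. (\<lambda>n. (norm (truncate n f x - f x))\<^sup>2) \<longlonglongrightarrow> 0"
    proof (intro AE_I2 tendsto_eventually)
      fix x :: 'a
      obtain m :: nat where "norm x < m" using reals_Archimedean2 by blast
      then have "(norm (truncate n f x - f x))\<^sup>2 = 0" if "n \<ge> m" for n
        using that by (simp add: truncate_def)
      then show "eventually (\<lambda>n. (norm (truncate n f x - f x))\<^sup>2 = 0) sequentially"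
        unfolding eventually_sequentially by blast
    qed
    show "AE x in lebesgue. norm ((norm (truncate n f x - f x))\<^sup>2) \<le> (norm (f x))\<^sup>2" for n
      by (intro AE_I2) (simp add: truncate_def split: split_indicator)
    show "integrable lebesgue (\<lambda>x. (norm (f x))\<^sup>2)" by (rule i)
  qed measurable
  moreover have "(\<integral>x. (norm (truncate n f x - f x))\<^sup>2 \<partial>lebesgue) = (norm (abs_L2 (truncate n f) - abs_L2 f))\<^sup>2" for n
    using norm_abs_L2_sq[OF sq_integrable_diff[OF truncate_sq_integrable[OF f] f]]
    by (simp add: abs_L2_diff[OF truncate_sq_integrable[OF f] f])
  ultimately have "(\<lambda>n. sqrt ((norm (abs_L2 (truncate n f) - abs_L2 f))\<^sup>2)) \<longlonglongrightarrow> sqrt 0"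
    by (intro tendsto_real_sqrt) simp
  then have "(\<lambda>n. norm (abs_L2 (truncate n f) - abs_L2 f)) \<longlonglongrightarrow> 0"
    by (simp only: real_sqrt_abs abs_norm_cancel real_sqrt_zero)
  then show ?thesis by (rule LIM_zero_cancel[OF tendsto_norm_zero_cancel])
qed

lemma real_fourier_dist:
  fixes f g :: "'a::euclidean_space \<Rightarrow> real"
  assumes f: "integrable lebesgue f" "sq_integrable f" and g: "integrable lebesgue g" "sq_integrable g"
  shows "norm (abs_L2 (real_fourier f) - abs_L2 (real_fourier g)) = norm (abs_L2 f - abs_L2 g)"
proof -
  have d1: "integrable lebesgue (\<lambda>x. f x - g x)" using f(1) g(1) by simp
  have d2: "sq_integrable (\<lambda>x. f x - g x)" by (rule sq_integrable_diff[OF f(2) g(2)])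
  have "abs_L2 (real_fourier f) - abs_L2 (real_fourier g) = abs_L2 (real_fourier (\<lambda>x. f x - g x))"
    by (subst abs_L2_diff[OF fourier_integral_sq_integrable[OF f] fourier_integral_sq_integrable[OF g]])
      (simp only: fourier_integral_diff[OF f(1) g(1), symmetric])
  then show ?thesis by (simp only: plancherel_L1_L2[OF d1 d2] abs_L2_diff[OF f(2) g(2)])
qed

text \<open>\<open>fourier\<close> is a \<open>lim\<close>, which says nothing before convergence is
  known. Plancherel makes the transforms of the truncations as Cauchy as the truncations
  themselves.\<close>

lemma rfourier_tendsto: "(\<lambda>n. abs_L2 (real_fourier (truncate n (rep_L2 u)))) \<longlonglongrightarrow> rfourier u"
proof -
  let ?X = "\<lambda>n. abs_L2 (real_fourier (truncate n (rep_L2 u)))"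
  have eq: "fourier_integral (\<lambda>x. indicator (ball 0 (real n)) x *\<^sub>R rep_L2 (complexify u) x) = real_fourier (truncate n (rep_L2 u))" for n
  proof (rule fourier_integral_cong_AE)
    show "AE x in lebesgue. indicator (ball 0 (real n)) x *\<^sub>R rep_L2 (complexify u) x = complex_of_real (truncate n (rep_L2 u) x)"
      using rep_complexify[of u] by eventually_elim (simp add: truncate_def scaleR_conv_of_real)
    show "(\<lambda>x. indicator (ball 0 (real n)) x *\<^sub>R rep_L2 (complexify u) x) \<in> borel_measurable lebesgue"
      by (intro borel_measurable_scaleR borel_measurable_indicator) auto
    show "(\<lambda>x. complex_of_real (truncate n (rep_L2 u) x)) \<in> borel_measurable lebesgue"
      using truncate_measurable[OF rep_L2_measurable[of u], of n] by measurable
  qed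
  have d: "norm (?X m - ?X n) = norm (abs_L2 (truncate m (rep_L2 u)) - abs_L2 (truncate n (rep_L2 u)))" for m n
    by (rule real_fourier_dist) (simp_all add: truncate_integrable truncate_sq_integrable)
  have "Cauchy (\<lambda>n. abs_L2 (truncate n (rep_L2 u)))"
    by (rule LIMSEQ_imp_Cauchy[OF truncate_tendsto[OF sq_integrable_rep_L2]])
  then have "Cauchy ?X" unfolding Cauchy_iff d .
  then have "convergent ?X" by (rule Cauchy_convergent)
  then have "?X \<longlonglongrightarrow> lim ?X" by (simp add: convergent_LIMSEQ_iff)
  moreover have "rfourier u = lim ?X" unfolding fourier_def eq ..
  ultimately show ?thesis by simp
qed

text \<open>On integrable functions the abstract limit is the Fourier integral itself, so explicit
  transforms are available for Lipschitz and test functions.\<close>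

lemma rfourier_abs_L2:
  assumes f: "integrable lebesgue f" "sq_integrable f"
  shows "rfourier (abs_L2 f) = abs_L2 (real_fourier f)"
proof (rule LIMSEQ_unique[OF rfourier_tendsto])
  let ?t = "\<lambda>n. truncate n (rep_L2 (abs_L2 f))"
  have d: "norm (abs_L2 (real_fourier (?t n)) - abs_L2 (real_fourier f)) = norm (abs_L2 (?t n) - abs_L2 f)" for n
    by (rule real_fourier_dist[OF _ _ f]) (simp_all add: truncate_integrable truncate_sq_integrable)
  have "(\<lambda>n. norm (abs_L2 (?t n) - abs_L2 f)) \<longlonglongrightarrow> 0"
    using truncate_tendsto[OF sq_integrable_rep_L2[of "abs_L2 f"]] by (simp add: LIM_zero tendsto_norm_zero)
  then have "(\<lambda>n. norm (abs_L2 (real_fourier (?t n)) - abs_L2 (real_fourier f))) \<longlonglongrightarrow> 0" unfolding d .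
  then show "(\<lambda>n. abs_L2 (real_fourier (?t n))) \<longlonglongrightarrow> abs_L2 (real_fourier f)"
    by (rule LIM_zero_cancel[OF tendsto_norm_zero_cancel])
qed

lemma rep_rfourier:
  assumes f: "integrable lebesgue f" "sq_integrable f"
  shows "AE \<xi> in lebesgue. rep_L2 (rfourier (abs_L2 f)) \<xi> = real_fourier f \<xi>"
  unfolding rfourier_abs_L2[OF f] by (rule rep_abs_L2[OF fourier_integral_sq_integrable[OF f]])

lemma norm_rfourier: "norm (rfourier u) = norm u"
proof (rule LIMSEQ_unique)
  show "(\<lambda>n. norm (abs_L2 (real_fourier (truncate n (rep_L2 u))))) \<longlonglongrightarrow> norm (rfourier u)"
    by (intro tendsto_norm rfourier_tendsto)
  have "norm (abs_L2 (real_fourier (truncate n (rep_L2 u)))) = norm (abs_L2 (truncate n (rep_L2 u)))" for n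
    by (rule plancherel_L1_L2) (simp_all add: truncate_integrable truncate_sq_integrable)
  then show "(\<lambda>n. norm (abs_L2 (real_fourier (truncate n (rep_L2 u))))) \<longlonglongrightarrow> norm u"
    using tendsto_norm[OF truncate_tendsto[OF sq_integrable_rep_L2[of u]]] by simp
qed

lemma rfourier_diff: "rfourier (u - v) = rfourier u - rfourier v"
proof (rule LIMSEQ_unique[OF rfourier_tendsto])
  have eq: "real_fourier (truncate n (rep_L2 (u - v)))
    = (\<lambda>\<xi>. real_fourier (truncate n (rep_L2 u)) \<xi> - real_fourier (truncate n (rep_L2 v)) \<xi>)" for n
  proof -
    have "real_fourier (truncate n (rep_L2 (u - v))) = real_fourier (\<lambda>x. truncate n (rep_L2 u) x - truncate n (rep_L2 v) x)"
    proof (rule fourier_integral_cong_AE)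
      show "AE x in lebesgue. complex_of_real (truncate n (rep_L2 (u - v)) x)
          = complex_of_real (truncate n (rep_L2 u) x - truncate n (rep_L2 v) x)"
        using rep_L2_diff[of u v] by eventually_elim (simp add: truncate_def right_diff_distrib)
    qed (use truncate_measurable[OF rep_L2_measurable, of n] in measurable)
    then show ?thesis
      by (simp only: fourier_integral_diff truncate_integrable sq_integrable_rep_L2 fun_eq_iff) simp
  qed
  have "abs_L2 (real_fourier (truncate n (rep_L2 (u - v))))
      = abs_L2 (real_fourier (truncate n (rep_L2 u))) - abs_L2 (real_fourier (truncate n (rep_L2 v)))" for n
    unfolding eq
    by (rule abs_L2_diff[symmetric])
      (intro fourier_integral_sq_integrable truncate_integrable truncate_sq_integrable sq_integrable_rep_L2)+
  then show "(\<lambda>n. abs_L2 (real_fourier (truncate n (rep_L2 (u - v))))) \<longlonglongrightarrow> rfourier u - rfourier v"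
    by (simp only:) (intro tendsto_diff rfourier_tendsto)
qed

lemma rfourier_0: "rfourier 0 = 0"
  using rfourier_diff[of 0 0] by simp

lemma rfourier_add: "rfourier (u + v) = rfourier u + rfourier v"
proof -
  have "rfourier (- v) = - rfourier v" for v :: "('a, real) L2"
    using rfourier_diff[of 0 v] by (simp add: rfourier_0)
  then show ?thesis using rfourier_diff[of u "- v"] by simp
qed

lemma fourier_integral_scaleR:
  "real_fourier (\<lambda>x. c * f x) = (\<lambda>\<xi>. c *\<^sub>R real_fourier f \<xi>)"
  by (simp add: fun_eq_iff fourier_integral_def scaleR_conv_of_real mult.assoc)

lemma rfourier_scaleR: "rfourier (c *\<^sub>R u) = c *\<^sub>R rfourier u"
proof (rule LIMSEQ_unique[OF rfourier_tendsto])
  have eq: "real_fourier (truncate n (rep_L2 (c *\<^sub>R u))) = (\<lambda>\<xi>. c *\<^sub>R real_fourier (truncate n (rep_L2 u)) \<xi>)" for n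
  proof -
    have "real_fourier (truncate n (rep_L2 (c *\<^sub>R u))) = real_fourier (\<lambda>x. c * truncate n (rep_L2 u) x)"
    proof (rule fourier_integral_cong_AE)
      show "AE x in lebesgue. complex_of_real (truncate n (rep_L2 (c *\<^sub>R u)) x)
          = complex_of_real (c * truncate n (rep_L2 u) x)"
        using rep_L2_scaleR[of c u] by eventually_elim (simp add: truncate_def)
    qed (use truncate_measurable[OF rep_L2_measurable, of n] in measurable)
    then show ?thesis by (simp only: fourier_integral_scaleR)
  qed
  have "abs_L2 (real_fourier (truncate n (rep_L2 (c *\<^sub>R u)))) = c *\<^sub>R abs_L2 (real_fourier (truncate n (rep_L2 u)))" for n
    unfolding eq
    by (rule abs_L2_scaleR[symmetric])
      (intro fourier_integral_sq_integrable truncate_integrable truncate_sq_integrable sq_integrable_rep_L2)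
  then show "(\<lambda>n. abs_L2 (real_fourier (truncate n (rep_L2 (c *\<^sub>R u))))) \<longlonglongrightarrow> c *\<^sub>R rfourier u"
    by (simp only:) (intro tendsto_scaleR tendsto_const rfourier_tendsto)
qed

section \<open>Hermitian symmetry and translations\<close>

lemma AE_lebesgue_uminus:
  fixes P :: "'a::euclidean_space \<Rightarrow> bool"
  assumes "AE x in lebesgue. P x"
  shows "AE x in lebesgue. P (- x)"
proof -
  have "AE x in lborel. P x" using assms by (simp add: AE_completion_iff)
  then obtain N where N: "{x \<in> space lborel. \<not> P x} \<subseteq> N" "emeasure lborel N = 0" "N \<in> sets lborel"
    by (rule AE_E)
  have [measurable]: "N \<in> sets borel" using N(3) by simp
  have "(\<integral>\<^sup>+x. indicator N x \<partial>lborel) = ennreal (\<bar>-1\<bar> ^ DIM('a)) * (\<integral>\<^sup>+x. indicator N (0 + (-1) *\<^sub>R x) \<partial>lborel)"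
    by (rule lborel_nn_integral_affine) auto
  then have "(\<integral>\<^sup>+x. indicator N (- x) \<partial>lborel) = 0" using N(2) by simp
  then have "AE x in lborel. (indicator N (- x) :: ennreal) = 0"
    by (subst (asm) nn_integral_0_iff_AE) auto
  then have "AE x in lborel. P (- x)"
    by eventually_elim (use N(1) in \<open>auto simp: indicator_eq_0_iff\<close>)
  then show ?thesis by (rule AE_completion)
qed

text \<open>Reality of a function seen on the Fourier side. By \<open>hermitian_rfourier\<close> and
  \<open>rfourier_surj\<close> these are exactly the transforms of real-valued functions, which is
  what makes \<open>frac_laplacian\<close> well defined.\<close>

definition hermitian :: "('a::euclidean_space, complex) L2 \<Rightarrow> bool" where
  "hermitian g \<longleftrightarrow> (AE \<xi> in lebesgue. rep_L2 g (- \<xi>) = cnj (rep_L2 g \<xi>))"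

lemma hermitian_abs_L2:
  assumes f: "sq_integrable f" and h: "AE \<xi> in lebesgue. f (- \<xi>) = cnj (f \<xi>)"
  shows "hermitian (abs_L2 f)"
  unfolding hermitian_def
  using rep_abs_L2[OF f] AE_lebesgue_uminus[OF rep_abs_L2[OF f]] h
  by eventually_elim simp

lemma real_fourier_uminus: "real_fourier f (- \<xi>) = cnj (real_fourier f \<xi>)"
proof -
  have "(\<integral>x. complex_of_real (f x) * cis (- (x \<bullet> (- \<xi>))) \<partial>lebesgue)
      = (\<integral>x. cnj (complex_of_real (f x) * cis (- (x \<bullet> \<xi>))) \<partial>lebesgue)"
    by (simp add: cis_cnj)
  also have "\<dots> = cnj (\<integral>x. complex_of_real (f x) * cis (- (x \<bullet> \<xi>)) \<partial>lebesgue)"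
    by (rule Bochner_Integration.integral_cnj)
  finally show ?thesis by (simp add: fourier_integral_def)
qed

text \<open>An L^2 limit is an almost everywhere limit along a subsequence, used both at \<xi> and
  at its reflection, since reflection preserves null sets.\<close>

lemma hermitian_closed:
  assumes X: "\<And>n. hermitian (X n)" "X \<longlonglongrightarrow> g"
  shows "hermitian g"
proof -
  obtain r where r: "AE x in lebesgue. (\<lambda>n. rep_L2 (X (r n)) x) \<longlonglongrightarrow> rep_L2 g x"
    by (rule L2_tendsto_AE_subseq[OF X(2)])
  have "AE \<xi> in lebesgue. \<forall>n. rep_L2 (X (r n)) (- \<xi>) = cnj (rep_L2 (X (r n)) \<xi>)"
    using X(1) by (simp add: AE_all_countable hermitian_def)
  then show ?thesis unfolding hermitian_def using r AE_lebesgue_uminus[OF r]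
  proof eventually_elim
    case (elim \<xi>)
    have "(\<lambda>n. cnj (rep_L2 (X (r n)) \<xi>)) \<longlonglongrightarrow> cnj (rep_L2 g \<xi>)" using elim(2) by (rule tendsto_cnj)
    then have "(\<lambda>n. rep_L2 (X (r n)) (- \<xi>)) \<longlonglongrightarrow> cnj (rep_L2 g \<xi>)" using elim(1) by simp
    then show ?case by (rule LIMSEQ_unique[OF elim(3)])
  qed
qed

lemma hermitian_diff:
  assumes "hermitian g" "hermitian h"
  shows "hermitian (g - h)"
  using assms rep_L2_diff[of g h] AE_lebesgue_uminus[OF rep_L2_diff[of g h]] unfolding hermitian_def
  by eventually_elim simp

lemma hermitian_rfourier: "hermitian (rfourier u)"
proof (rule hermitian_closed[OF _ rfourier_tendsto])
  show "hermitian (abs_L2 (real_fourier (truncate n (rep_L2 u))))" for n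
    by (rule hermitian_abs_L2[OF fourier_integral_sq_integrable])
      (simp_all add: truncate_integrable truncate_sq_integrable real_fourier_uminus)
qed

lemma real_fourier_translate:
  fixes f :: "'a::euclidean_space \<Rightarrow> real"
  assumes [measurable]: "f \<in> borel_measurable borel"
  shows "real_fourier (\<lambda>x. f (x + y)) \<xi> = cis (y \<bullet> \<xi>) * real_fourier f \<xi>"
proof -
  have "(\<integral>x. complex_of_real (f (x + y)) * cis (- (x \<bullet> \<xi>)) \<partial>lborel)
      = (\<integral>x. cis (y \<bullet> \<xi>) * (complex_of_real (f (y + x)) * cis (- ((y + x) \<bullet> \<xi>))) \<partial>lborel)"
    by (rule Bochner_Integration.integral_cong[OF refl])
      (simp add: cis_mult inner_add_left add.commute mult.left_commute)
  also have "\<dots> = cis (y \<bullet> \<xi>) * (\<integral>x. complex_of_real (f (y + x)) * cis (- ((y + x) \<bullet> \<xi>)) \<partial>lborel)"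
    by (rule integral_mult_right_zero)
  also have "(\<integral>x. complex_of_real (f (y + x)) * cis (- ((y + x) \<bullet> \<xi>)) \<partial>lborel)
      = (\<integral>x. complex_of_real (f x) * cis (- (x \<bullet> \<xi>)) \<partial>lborel)"
    by (rule lborel_integral_shift) measurable
  finally show ?thesis by (simp add: fourier_integral_def integral_completion)
qed

lemma lip_translate:
  assumes "lip_compact_supp f"
  shows "lip_compact_supp (\<lambda>x. f (x + y))"
proof -
  obtain L R where L: "L \<ge> 0" "\<And>x y. \<bar>f x - f y\<bar> \<le> L * norm (x - y)" and R: "\<And>x. f x \<noteq> 0 \<Longrightarrow> norm x \<le> R"
    using assms unfolding lip_compact_supp_def by blast
  have "\<bar>f (x + y) - f (z + y)\<bar> \<le> L * norm (x - z)" for x z using L(2)[of "x + y" "z + y"] by simp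
  moreover have "norm x \<le> R + norm y" if "f (x + y) \<noteq> 0" for x
    using R[OF that] norm_triangle_ineq4[of "x + y" y] by simp
  ultimately show ?thesis unfolding lip_compact_supp_def using L(1) by blast
qed

text \<open>Translation multiplies the transform by \<open>cis (y \<bullet> \<xi>)\<close>. The
  Dirichlet bound for Lipschitz functions and the fractional translation estimate both rest on this
  identity.\<close>

lemma plancherel_translation:
  fixes f :: "'a::euclidean_space \<Rightarrow> real"
  assumes f: "lip_compact_supp f"
  shows "(\<integral>\<^sup>+\<xi>. ennreal ((norm (cis (y \<bullet> \<xi>) - 1))\<^sup>2 * (norm (real_fourier f \<xi>))\<^sup>2) \<partial>lebesgue)
    = (\<integral>\<^sup>+x. ennreal ((f (x + y) - f x)\<^sup>2) \<partial>lebesgue)"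
proof -
  have i: "integrable lebesgue f" "integrable lebesgue (\<lambda>x. f (x + y))"
    by (intro lip_integrable_lebesgue f lip_translate)+
  have i': "integrable lebesgue (\<lambda>x. f (x + y) - f x)" using i by simp
  have s: "sq_integrable (\<lambda>x. f (x + y) - f x)"
    by (intro sq_integrable_diff lip_sq_integrable f lip_translate)
  have eq: "real_fourier (\<lambda>x. f (x + y) - f x) \<xi> = (cis (y \<bullet> \<xi>) - 1) * real_fourier f \<xi>" for \<xi>
    unfolding fourier_integral_diff[OF i(2,1)] real_fourier_translate[OF lip_measurable[OF f]]
    by (simp add: algebra_simps)
  have "(\<integral>\<^sup>+\<xi>. ennreal ((norm (real_fourier (\<lambda>x. f (x + y) - f x) \<xi>))\<^sup>2) \<partial>lebesgue)
     = ennreal ((norm (abs_L2 (\<lambda>x. f (x + y) - f x)))\<^sup>2)"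
    by (simp only: nn_integral_abs_L2[OF fourier_integral_sq_integrable[OF i' s]] plancherel_L1_L2[OF i' s])
  also have "\<dots> = (\<integral>\<^sup>+x. ennreal ((norm (f (x + y) - f x))\<^sup>2) \<partial>lebesgue)"
    by (rule nn_integral_abs_L2[OF s, symmetric])
  finally show ?thesis unfolding eq by (simp add: norm_mult power_mult_distrib)
qed

section \<open>Bessel potential spaces\<close>

lemma norm_cis_minus_1_sq: "(norm (cis t - 1))\<^sup>2 = 4 * (sin (t / 2))\<^sup>2"
proof -
  have "(norm (cis t - 1))\<^sup>2 = (cos t - 1)\<^sup>2 + (sin t)\<^sup>2" by (simp add: cmod_power2)
  also have "\<dots> = (cos t)\<^sup>2 + (sin t)\<^sup>2 + 1 - 2 * cos t" by (simp add: power2_eq_square algebra_simps)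
  also have "\<dots> = 2 - 2 * cos (2 * (t / 2))" by simp
  also have "\<dots> = 4 * (sin (t / 2))\<^sup>2" unfolding cos_double_sin by simp
  finally show ?thesis .
qed

text \<open>The left side equals \<open>2 * \<bar>sin (t / 2)\<bar>\<close>, which is bounded by 2
  and by |t|; for an exponent in (0, 1] the power |t|^\<mu> dominates 1 when |t| \<ge> 1 and |t|
  when |t| \<le> 1.\<close>

lemma norm_cis_minus_1_le: "norm (cis t - 1) \<le> 2 * \<bar>t\<bar> powr \<mu>" if "0 < \<mu>" "\<mu> \<le> 1"
proof -
  have "(norm (cis t - 1))\<^sup>2 = (2 * \<bar>sin (t / 2)\<bar>)\<^sup>2" unfolding norm_cis_minus_1_sq by (simp add: power_mult_distrib)
  then have eq: "norm (cis t - 1) = 2 * \<bar>sin (t / 2)\<bar>"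
    by (rule power2_eq_imp_eq) auto
  show ?thesis
  proof (cases "\<bar>t\<bar> \<ge> 1")
    case True
    then have "1 \<le> \<bar>t\<bar> powr \<mu>" using that by (simp add: ge_one_powr_ge_zero)
    then show ?thesis unfolding eq using abs_sin_le_one[of "t / 2"] by linarith
  next
    case False
    have "\<bar>sin (t / 2)\<bar> \<le> \<bar>t\<bar>" using abs_sin_x_le_abs_x[of "t / 2"] by simp
    also have "\<bar>t\<bar> \<le> \<bar>t\<bar> powr \<mu>"
    proof (cases "t = 0")
      case False
      then have "\<bar>t\<bar> powr 1 \<le> \<bar>t\<bar> powr \<mu>" using that \<open>\<not> 1 \<le> \<bar>t\<bar>\<close> by (intro powr_mono') auto
      then show ?thesis by simp
    qed simp
    finally show ?thesis unfolding eq by simp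
  qed
qed

text \<open>Up to sign this is the modulus of the multiplier of a difference quotient with step
  \<open>1 / Suc n\<close>; its limit is the multiplier of the derivative.\<close>

lemma sin_quotient_tendsto: "(\<lambda>n. 2 * real (Suc n) * sin (a / (2 * real (Suc n)))) \<longlonglongrightarrow> a"
proof (cases "a = 0")
  case False
  have "((\<lambda>h. sin h / h) \<longlongrightarrow> 1) (at (0::real))"
    using DERIV_sin[of 0] by (simp add: has_field_derivative_iff)
  moreover have "filterlim (\<lambda>n. a / (2 * real (Suc n))) (at 0) sequentially"
    unfolding filterlim_at
  proof
    have "(\<lambda>n. (a / 2) * (1 / real (Suc n))) \<longlonglongrightarrow> (a / 2) * 0"
      using LIMSEQ_inverse_real_of_nat by (intro tendsto_mult tendsto_const) (simp add: inverse_eq_divide)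
    then show "(\<lambda>n. a / (2 * real (Suc n))) \<longlonglongrightarrow> 0" by simp
  qed (use False in simp)
  ultimately have "(\<lambda>n. sin (a / (2 * real (Suc n))) / (a / (2 * real (Suc n)))) \<longlonglongrightarrow> 1"
    by (rule filterlim_compose)
  then have "(\<lambda>n. a * (sin (a / (2 * real (Suc n))) / (a / (2 * real (Suc n))))) \<longlonglongrightarrow> a * 1"
    by (intro tendsto_mult tendsto_const)
  moreover have "a * (sin (a / (2 * real (Suc n))) / (a / (2 * real (Suc n)))) = 2 * real (Suc n) * sin (a / (2 * real (Suc n)))" for n
    using False by (simp add: field_simps)
  ultimately show ?thesis by simp
qed simp

lemma real_fourier_borel_lip: "lip_compact_supp f \<Longrightarrow> real_fourier f \<in> borel_measurable borel"
  using lip_measurable[of f] by (intro fourier_integral_measurable) measurable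

text \<open>The Dirichlet energy is bounded through difference quotients and Fatou's lemma, which avoids
  differentiating under the Fourier integral.\<close>

lemma dirichlet_energy_le:
  fixes f :: "'a::euclidean_space \<Rightarrow> real"
  assumes f: "lip_compact_supp f"
    and L: "0 \<le> L" "\<And>x y. \<bar>f x - f y\<bar> \<le> L * norm (x - y)"
    and supp: "\<And>x. f x \<noteq> 0 \<Longrightarrow> x \<in> ball x\<^sub>0 \<rho>"
  shows "(\<integral>\<^sup>+\<xi>. ennreal ((norm \<xi>)\<^sup>2 * (norm (real_fourier f \<xi>))\<^sup>2) \<partial>lebesgue)
    \<le> ennreal (real DIM('a) * L\<^sup>2) * emeasure lebesgue (ball x\<^sub>0 (\<rho> + 1))"
proof -
  let ?F = "real_fourier f"
  have [measurable]: "?F \<in> borel_measurable borel" by (rule real_fourier_borel_lip[OF f])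
  have comp: "(\<integral>\<^sup>+\<xi>. ennreal ((\<xi> \<bullet> b)\<^sup>2 * (norm (?F \<xi>))\<^sup>2) \<partial>lebesgue)
      \<le> ennreal (L\<^sup>2) * emeasure lebesgue (ball x\<^sub>0 (\<rho> + 1))" if b: "b \<in> Basis" for b
  proof -
    let ?y = "\<lambda>n. (1 / real (Suc n)) *\<^sub>R b"
    let ?G = "\<lambda>n \<xi>. ennreal ((real (Suc n))\<^sup>2 * ((norm (cis (?y n \<bullet> \<xi>) - 1))\<^sup>2 * (norm (?F \<xi>))\<^sup>2))"
    have "(\<integral>\<^sup>+\<xi>. ennreal ((\<xi> \<bullet> b)\<^sup>2 * (norm (?F \<xi>))\<^sup>2) \<partial>lborel) = (\<integral>\<^sup>+\<xi>. liminf (\<lambda>n. ?G n \<xi>) \<partial>lborel)"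
    proof (rule nn_integral_cong)
      fix \<xi>
      have "(\<lambda>n. (2 * real (Suc n) * sin ((\<xi> \<bullet> b) / (2 * real (Suc n))))\<^sup>2 * (norm (?F \<xi>))\<^sup>2) \<longlonglongrightarrow> (\<xi> \<bullet> b)\<^sup>2 * (norm (?F \<xi>))\<^sup>2"
        by (intro tendsto_mult tendsto_const tendsto_power sin_quotient_tendsto)
      moreover have "(2 * real (Suc n) * sin ((\<xi> \<bullet> b) / (2 * real (Suc n))))\<^sup>2 * (norm (?F \<xi>))\<^sup>2
          = (real (Suc n))\<^sup>2 * ((norm (cis (?y n \<bullet> \<xi>) - 1))\<^sup>2 * (norm (?F \<xi>))\<^sup>2)" for n
        unfolding norm_cis_minus_1_sq by (simp add: power_mult_distrib inner_commute mult.commute del: of_nat_Suc)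
      ultimately have "(\<lambda>n. (real (Suc n))\<^sup>2 * ((norm (cis (?y n \<bullet> \<xi>) - 1))\<^sup>2 * (norm (?F \<xi>))\<^sup>2))
          \<longlonglongrightarrow> (\<xi> \<bullet> b)\<^sup>2 * (norm (?F \<xi>))\<^sup>2" by (simp only:)
      then have "(\<lambda>n. ?G n \<xi>) \<longlonglongrightarrow> ennreal ((\<xi> \<bullet> b)\<^sup>2 * (norm (?F \<xi>))\<^sup>2)" by (rule tendsto_ennrealI)
      from lim_imp_Liminf[OF sequentially_bot this]
      show "ennreal ((\<xi> \<bullet> b)\<^sup>2 * (norm (?F \<xi>))\<^sup>2) = liminf (\<lambda>n. ?G n \<xi>)" by simp
    qed
    also have "\<dots> \<le> liminf (\<lambda>n. \<integral>\<^sup>+\<xi>. ?G n \<xi> \<partial>lborel)"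
      by (rule nn_integral_liminf) measurable
    also have "\<dots> \<le> ennreal (L\<^sup>2) * emeasure lebesgue (ball x\<^sub>0 (\<rho> + 1))"
    proof -
      have "(\<integral>\<^sup>+\<xi>. ?G n \<xi> \<partial>lborel) \<le> ennreal (L\<^sup>2) * emeasure lebesgue (ball x\<^sub>0 (\<rho> + 1))" for n
      proof -
        have "(\<integral>\<^sup>+\<xi>. ?G n \<xi> \<partial>lborel)
          = ennreal ((real (Suc n))\<^sup>2) * (\<integral>\<^sup>+\<xi>. ennreal ((norm (cis (?y n \<bullet> \<xi>) - 1))\<^sup>2 * (norm (?F \<xi>))\<^sup>2) \<partial>lborel)"
          by (subst nn_integral_cmult[symmetric]) (simp_all only: ennreal_mult zero_le_power2 mult_nonneg_nonneg, measurable)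
        also have "\<dots> = ennreal ((real (Suc n))\<^sup>2) * (\<integral>\<^sup>+x. ennreal ((f (x + ?y n) - f x)\<^sup>2) \<partial>lebesgue)"
          using plancherel_translation[OF f, of "?y n"] by (simp only: nn_integral_completion)
        \<comment> \<open>The step length is at most 1, so the difference vanishes outside the ball
          of radius \<open>\<rho> + 1\<close>; the squared step in the Lipschitz bound cancels the
          factor in front.\<close>
        also have "\<dots> \<le> ennreal ((real (Suc n))\<^sup>2) * (\<integral>\<^sup>+x. ennreal (L\<^sup>2 / (real (Suc n))\<^sup>2) * indicator (ball x\<^sub>0 (\<rho> + 1)) x \<partial>lebesgue)"
        proof (intro mult_left_mono nn_integral_mono)
          fix x
          show "ennreal ((f (x + ?y n) - f x)\<^sup>2) \<le> ennreal (L\<^sup>2 / (real (Suc n))\<^sup>2) * indicator (ball x\<^sub>0 (\<rho> + 1)) x"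
          proof (cases "f (x + ?y n) - f x = 0")
            case False
            have ny: "norm (?y n) \<le> 1" using b by simp
            have "x \<in> ball x\<^sub>0 (\<rho> + 1)"
            proof (cases "f x = 0")
              case True
              then have "dist x\<^sub>0 (x + ?y n) < \<rho>" using False supp[of "x + ?y n"] by simp
              moreover have "dist x\<^sub>0 x \<le> dist x\<^sub>0 (x + ?y n) + norm (?y n)"
                using dist_triangle[of x\<^sub>0 x "x + ?y n"] by (simp add: dist_norm)
              ultimately have "dist x\<^sub>0 x < \<rho> + 1" using ny by linarith
              then show ?thesis by simp
            next
              case False
              then show ?thesis using supp[of x] by simp
            qed
            moreover have "(f (x + ?y n) - f x)\<^sup>2 \<le> L\<^sup>2 / (real (Suc n))\<^sup>2"
            proof -
              have "\<bar>f (x + ?y n) - f x\<bar> \<le> L / real (Suc n)" using L(2)[of "x + ?y n" x] b by simp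
              then have "\<bar>f (x + ?y n) - f x\<bar>\<^sup>2 \<le> (L / real (Suc n))\<^sup>2" by (intro power_mono) auto
              then show ?thesis by (simp add: power_divide)
            qed
            ultimately show ?thesis by (simp add: ennreal_leI)
          qed simp
        qed simp
        also have "\<dots> = ennreal ((real (Suc n))\<^sup>2) * (ennreal (L\<^sup>2 / (real (Suc n))\<^sup>2) * emeasure lebesgue (ball x\<^sub>0 (\<rho> + 1)))"
          by (subst nn_integral_cmult) (auto intro!: borel_measurable_indicator)
        also have "\<dots> = ennreal (L\<^sup>2) * emeasure lebesgue (ball x\<^sub>0 (\<rho> + 1))"
          by (simp add: mult.assoc[symmetric] ennreal_mult[symmetric] del: of_nat_Suc)
        finally show ?thesis .
      qed
      then show ?thesis by (intro Liminf_le always_eventually allI) simp_all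
    qed
    finally show ?thesis by (simp add: nn_integral_completion)
  qed
  have nsq: "(norm \<xi>)\<^sup>2 = (\<Sum>b\<in>Basis. (\<xi> \<bullet> b)\<^sup>2)" for \<xi> :: 'a
    unfolding power2_norm_eq_inner by (subst euclidean_inner) (simp add: power2_eq_square)
  have "(\<integral>\<^sup>+\<xi>. ennreal ((norm \<xi>)\<^sup>2 * (norm (?F \<xi>))\<^sup>2) \<partial>lebesgue)
      = (\<integral>\<^sup>+\<xi>. (\<Sum>b\<in>Basis. ennreal ((\<xi> \<bullet> b)\<^sup>2 * (norm (?F \<xi>))\<^sup>2)) \<partial>lebesgue)"
    by (rule nn_integral_cong) (simp add: nsq sum_distrib_right sum_nonneg)
  also have "\<dots> = (\<Sum>b\<in>Basis. \<integral>\<^sup>+\<xi>. ennreal ((\<xi> \<bullet> b)\<^sup>2 * (norm (?F \<xi>))\<^sup>2) \<partial>lebesgue)"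
    by (subst nn_integral_completion, subst nn_integral_sum) (auto simp: nn_integral_completion)
  also have "\<dots> \<le> (\<Sum>b\<in>(Basis::'a set). ennreal (L\<^sup>2) * emeasure lebesgue (ball x\<^sub>0 (\<rho> + 1)))"
    by (intro sum_mono comp)
  also have "\<dots> = ennreal (real DIM('a) * L\<^sup>2) * emeasure lebesgue (ball x\<^sub>0 (\<rho> + 1))"
    by (simp add: ennreal_mult mult.assoc ennreal_of_nat_eq_real_of_nat)
  finally show ?thesis .
qed

lemma closure_sequenceE:
  fixes S :: "'h::real_normed_vector set"
  assumes "l \<in> closure S"
  obtains X where "\<forall>n. X n \<in> S" "X \<longlonglongrightarrow> l"
  using assms closure_sequential by blast

lemma test_functions_add:
  assumes "f \<in> test_functions" "g \<in> test_functions"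
  shows "(\<lambda>x. f x + g x) \<in> test_functions"
proof -
  have "{x. f x + g x \<noteq> 0} \<subseteq> {x. f x \<noteq> 0} \<union> {x. g x \<noteq> 0}" by auto
  moreover have "bounded ({x. f x \<noteq> 0} \<union> {x. g x \<noteq> 0})"
    using assms by (simp add: test_functions_def)
  ultimately have "bounded {x. f x + g x \<noteq> 0}" by (rule bounded_subset[rotated])
  then show ?thesis using assms by (simp add: test_functions_def C_k_add)
qed

lemma test_functions_cmult:
  assumes "f \<in> test_functions"
  shows "(\<lambda>x. c * f x) \<in> test_functions"
proof -
  have "{x. c * f x \<noteq> 0} \<subseteq> {x. f x \<noteq> 0}" by auto
  moreover have "bounded {x. f x \<noteq> 0}"
    using assms by (simp add: test_functions_def)
  ultimately have "bounded {x. c * f x \<noteq> 0}" by (rule bounded_subset[rotated])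
  then show ?thesis using assms by (simp add: test_functions_def C_k_mult)
qed

lemma rep_rfourier_lip:
  "lip_compact_supp f \<Longrightarrow> AE \<xi> in lebesgue. rep_L2 (rfourier (abs_L2 f)) \<xi> = real_fourier f \<xi>"
  by (rule rep_rfourier[OF lip_integrable_lebesgue lip_sq_integrable])

section \<open>The Bessel norm\<close>

definition bessel_weight :: "real \<Rightarrow> 'a::euclidean_space \<Rightarrow> real" where
  "bessel_weight s \<xi> = (1 + (norm \<xi>)\<^sup>2) powr (s / 2)"

lemma bessel_weight_measurable [measurable]: "bessel_weight s \<in> borel_measurable borel"
  unfolding bessel_weight_def[abs_def] by measurable

lemma bessel_weight_lebesgue: "bessel_weight s \<in> borel_measurable lebesgue"
  by (rule measurable_completion) simp

lemma bessel_weight_pos: "0 < bessel_weight s \<xi>"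
proof -
  have "0 < 1 + (norm \<xi>)\<^sup>2" by (rule add_pos_nonneg) auto
  then show ?thesis by (simp add: bessel_weight_def)
qed

lemma bessel_weight_ge_1: "0 \<le> s \<Longrightarrow> 1 \<le> bessel_weight s \<xi>"
  by (simp add: bessel_weight_def ge_one_powr_ge_zero)

lemma bessel_weight_sq_le: "s \<le> 1 \<Longrightarrow> (bessel_weight s \<xi>)\<^sup>2 \<le> 1 + (norm \<xi>)\<^sup>2"
proof -
  assume s: "s \<le> 1"
  have "(bessel_weight s \<xi>)\<^sup>2 = (1 + (norm \<xi>)\<^sup>2) powr s"
    by (simp add: bessel_weight_def power2_eq_square powr_add[symmetric])
  also have "\<dots> \<le> (1 + (norm \<xi>)\<^sup>2) powr 1" using s by (intro powr_mono) auto
  also have "\<dots> = 1 + (norm \<xi>)\<^sup>2" by (simp add: add_nonneg_nonneg)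
  finally show ?thesis .
qed

lemma powr_le_bessel_weight: "0 < \<mu> \<Longrightarrow> norm \<xi> powr \<mu> \<le> bessel_weight \<mu> \<xi>"
proof -
  assume \<mu>: "0 < \<mu>"
  have "norm \<xi> powr \<mu> = norm \<xi> powr (2 * (\<mu> / 2))" by simp
  also have "\<dots> = (norm \<xi> powr 2) powr (\<mu> / 2)" by (rule powr_powr[symmetric])
  also have "norm \<xi> powr 2 = (norm \<xi>)\<^sup>2" by simp
  also have "((norm \<xi>)\<^sup>2) powr (\<mu> / 2) \<le> bessel_weight \<mu> \<xi>" unfolding bessel_weight_def using \<mu> by (intro powr_mono2) auto
  finally show ?thesis .
qed

lemma bessel_weight_uminus [simp]: "bessel_weight s (- \<xi>) = bessel_weight s \<xi>"
  by (simp add: bessel_weight_def)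

lemma mem_bessel_space: "u \<in> bessel_space s \<longleftrightarrow> sq_integrable (\<lambda>\<xi>. bessel_weight s \<xi> *\<^sub>R rep_L2 (rfourier u) \<xi>)"
  by (simp add: bessel_space_def bessel_weight_def)

text \<open>The norm of the image is the Bessel norm of \<open>u\<close>: convergence in the Bessel
  space is expressed as L^2 convergence of these images.\<close>

definition bessel_map :: "real \<Rightarrow> ('a::euclidean_space, real) L2 \<Rightarrow> ('a, complex) L2" where
  "bessel_map s u = abs_L2 (\<lambda>\<xi>. bessel_weight s \<xi> *\<^sub>R rep_L2 (rfourier u) \<xi>)"

lemma rep_bessel_map:
  "u \<in> bessel_space s \<Longrightarrow> AE \<xi> in lebesgue. rep_L2 (bessel_map s u) \<xi> = bessel_weight s \<xi> *\<^sub>R rep_L2 (rfourier u) \<xi>"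
  unfolding bessel_map_def mem_bessel_space by (rule rep_abs_L2)

lemma sq_integrable_cong_AE:
  assumes "sq_integrable f" "g \<in> borel_measurable lebesgue" "AE x in lebesgue. g x = f x"
  shows "sq_integrable g"
proof (rule sq_integrableI_nn[OF assms(2)])
  have "(\<integral>\<^sup>+x. ennreal ((norm (g x))\<^sup>2) \<partial>lebesgue) = (\<integral>\<^sup>+x. ennreal ((norm (f x))\<^sup>2) \<partial>lebesgue)"
    by (rule nn_integral_cong_AE, use assms(3) in eventually_elim) simp
  then show "(\<integral>\<^sup>+x. ennreal ((norm (g x))\<^sup>2) \<partial>lebesgue) < \<infinity>"
    by (simp add: nn_integral_abs_L2[OF assms(1)])
qed

lemma weighted_rep_measurable:
  fixes g :: "('a::euclidean_space, complex) L2"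
  assumes "w \<in> borel_measurable lebesgue"
  shows "(\<lambda>\<xi>. (w \<xi> :: real) *\<^sub>R rep_L2 g \<xi>) \<in> borel_measurable lebesgue"
  by (rule borel_measurable_scaleR[OF assms rep_L2_measurable])

lemma bessel_add:
  assumes u: "u \<in> bessel_space s" and v: "v \<in> bessel_space s"
  shows "u + v \<in> bessel_space s" "bessel_map s (u + v) = bessel_map s u + bessel_map s v"
proof -
  have su: "sq_integrable (\<lambda>\<xi>. bessel_weight s \<xi> *\<^sub>R rep_L2 (rfourier u) \<xi>)"
    and sv: "sq_integrable (\<lambda>\<xi>. bessel_weight s \<xi> *\<^sub>R rep_L2 (rfourier v) \<xi>)"
    using u v by (simp_all add: mem_bessel_space)
  have ae: "AE \<xi> in lebesgue. bessel_weight s \<xi> *\<^sub>R rep_L2 (rfourier (u + v)) \<xi>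
      = bessel_weight s \<xi> *\<^sub>R rep_L2 (rfourier u) \<xi> + bessel_weight s \<xi> *\<^sub>R rep_L2 (rfourier v) \<xi>"
    unfolding rfourier_add using rep_L2_add[of "rfourier u" "rfourier v"]
    by eventually_elim (simp add: scaleR_add_right)
  show uv: "u + v \<in> bessel_space s" unfolding mem_bessel_space
    by (rule sq_integrable_cong_AE[OF sq_integrable_add[OF su sv] weighted_rep_measurable[OF bessel_weight_lebesgue] ae])
  show "bessel_map s (u + v) = bessel_map s u + bessel_map s v"
    unfolding bessel_map_def abs_L2_add[OF su sv]
    by (rule iffD2[OF abs_L2_eq_iff[OF uv[unfolded mem_bessel_space] sq_integrable_add[OF su sv]] ae])
qed

lemma bessel_scaleR:
  assumes u: "u \<in> bessel_space s"
  shows "c *\<^sub>R u \<in> bessel_space s" "bessel_map s (c *\<^sub>R u) = c *\<^sub>R bessel_map s u"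
proof -
  have su: "sq_integrable (\<lambda>\<xi>. bessel_weight s \<xi> *\<^sub>R rep_L2 (rfourier u) \<xi>)"
    using u by (simp_all add: mem_bessel_space)
  have ae: "AE \<xi> in lebesgue. bessel_weight s \<xi> *\<^sub>R rep_L2 (rfourier (c *\<^sub>R u)) \<xi>
      = c *\<^sub>R (bessel_weight s \<xi> *\<^sub>R rep_L2 (rfourier u) \<xi>)"
    unfolding rfourier_scaleR using rep_L2_scaleR[of c "rfourier u"]
    by eventually_elim (simp add: mult.commute)
  show cu: "c *\<^sub>R u \<in> bessel_space s" unfolding mem_bessel_space
    by (rule sq_integrable_cong_AE[OF sq_integrable_scaleR[OF su] weighted_rep_measurable[OF bessel_weight_lebesgue] ae])
  show "bessel_map s (c *\<^sub>R u) = c *\<^sub>R bessel_map s u"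
    unfolding bessel_map_def abs_L2_scaleR[OF su]
    by (rule iffD2[OF abs_L2_eq_iff[OF cu[unfolded mem_bessel_space] sq_integrable_scaleR[OF su]] ae])
qed

lemma bessel_0:
  "(0 :: ('a::euclidean_space, real) L2) \<in> bessel_space s"
  "bessel_map s (0 :: ('a::euclidean_space, real) L2) = 0"
proof -
  have z: "AE \<xi> in lebesgue. rep_L2 (0 :: ('a, complex) L2) \<xi> = 0"
    unfolding zero_L2_def by (rule rep_abs_L2[OF sq_integrable_zero])
  have ae: "AE \<xi> in lebesgue. bessel_weight s \<xi> *\<^sub>R rep_L2 (rfourier (0 :: ('a, real) L2)) \<xi> = 0"
    unfolding rfourier_0 using z by eventually_elim simp
  show m: "(0 :: ('a, real) L2) \<in> bessel_space s" unfolding mem_bessel_space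
    by (rule sq_integrable_cong_AE[OF sq_integrable_zero weighted_rep_measurable[OF bessel_weight_lebesgue] ae])
  show "bessel_map s (0 :: ('a, real) L2) = 0" using bessel_scaleR(2)[OF m, of 0] by simp
qed

lemma subspace_bessel: "subspace (bessel_space s)"
  by (rule subspaceI) (simp_all add: bessel_0 bessel_add bessel_scaleR)

lemma hermitian_bessel_map: "u \<in> bessel_space s \<Longrightarrow> hermitian (bessel_map s u)"
  unfolding bessel_map_def mem_bessel_space
proof (rule hermitian_abs_L2, assumption)
  show "AE \<xi> in lebesgue. bessel_weight s (- \<xi>) *\<^sub>R rep_L2 (rfourier u) (- \<xi>) = cnj (bessel_weight s \<xi> *\<^sub>R rep_L2 (rfourier u) \<xi>)"
    using hermitian_rfourier[of u] unfolding hermitian_def by eventually_elim (simp add: scaleR_conv_of_real)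
qed

text \<open>For \<open>s \<le> 1\<close> the squared weight is at most 1 + |\<xi>|^2, so finite L^2
  norm and finite Dirichlet energy suffice.\<close>

lemma lip_in_bessel:
  fixes f :: "'a::euclidean_space \<Rightarrow> real"
  assumes f: "lip_compact_supp f" and s: "s \<le> 1"
  shows "abs_L2 f \<in> bessel_space s"
proof -
  let ?F = "real_fourier f"
  obtain L R where L: "L \<ge> 0" "\<And>x y. \<bar>f x - f y\<bar> \<le> L * norm (x - y)" and R: "\<And>x. f x \<noteq> 0 \<Longrightarrow> norm x \<le> R"
    using f unfolding lip_compact_supp_def by blast
  have Fsq: "sq_integrable ?F" by (rule fourier_integral_sq_integrable[OF lip_integrable_lebesgue[OF f] lip_sq_integrable[OF f]])
  have [measurable]: "?F \<in> borel_measurable borel" by (rule real_fourier_borel_lip[OF f])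
  have "(\<integral>\<^sup>+\<xi>. ennreal ((norm \<xi>)\<^sup>2 * (norm (?F \<xi>))\<^sup>2) \<partial>lebesgue)
      \<le> ennreal (real DIM('a) * L\<^sup>2) * emeasure lebesgue (ball (0::'a) ((R + 1) + 1))"
    by (rule dirichlet_energy_le[OF f L]) (use R in force)
  also have "\<dots> < \<infinity>"
    using emeasure_lborel_ball_finite[of "0::'a" "R + 1 + 1"] by (simp add: ennreal_mult_less_top)
  finally have fin: "(\<integral>\<^sup>+\<xi>. ennreal ((norm \<xi>)\<^sup>2 * (norm (?F \<xi>))\<^sup>2) \<partial>lborel) < \<infinity>" by (simp add: nn_integral_completion)
  have fin0: "(\<integral>\<^sup>+\<xi>. ennreal ((norm (?F \<xi>))\<^sup>2) \<partial>lborel) < \<infinity>"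
    using nn_integral_abs_L2[OF Fsq] by (simp add: nn_integral_completion)
  have wm: "(\<lambda>\<xi>. bessel_weight s \<xi> *\<^sub>R ?F \<xi>) \<in> borel_measurable borel" by measurable
  have "sq_integrable (\<lambda>\<xi>. bessel_weight s \<xi> *\<^sub>R ?F \<xi>)"
  proof (rule sq_integrableI_nn)
    show "(\<lambda>\<xi>. bessel_weight s \<xi> *\<^sub>R ?F \<xi>) \<in> borel_measurable lebesgue"
      by (rule measurable_completion) (use wm in simp)
    have "(\<integral>\<^sup>+\<xi>. ennreal ((norm (bessel_weight s \<xi> *\<^sub>R ?F \<xi>))\<^sup>2) \<partial>lebesgue)
      = (\<integral>\<^sup>+\<xi>. ennreal ((norm (bessel_weight s \<xi> *\<^sub>R ?F \<xi>))\<^sup>2) \<partial>lborel)"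
      by (rule nn_integral_completion)
    also have "\<dots> \<le> (\<integral>\<^sup>+\<xi>. ennreal ((norm (?F \<xi>))\<^sup>2) + ennreal ((norm \<xi>)\<^sup>2 * (norm (?F \<xi>))\<^sup>2) \<partial>lborel)"
    proof (rule nn_integral_mono)
      fix \<xi> :: 'a
      have "(norm (bessel_weight s \<xi> *\<^sub>R ?F \<xi>))\<^sup>2 = (bessel_weight s \<xi>)\<^sup>2 * (norm (?F \<xi>))\<^sup>2"
        by (simp add: power_mult_distrib)
      also have "\<dots> \<le> (1 + (norm \<xi>)\<^sup>2) * (norm (?F \<xi>))\<^sup>2"
        by (intro mult_right_mono bessel_weight_sq_le s) simp
      also have "\<dots> = (norm (?F \<xi>))\<^sup>2 + (norm \<xi>)\<^sup>2 * (norm (?F \<xi>))\<^sup>2" by (simp add: algebra_simps)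
      finally show "ennreal ((norm (bessel_weight s \<xi> *\<^sub>R ?F \<xi>))\<^sup>2)
          \<le> ennreal ((norm (?F \<xi>))\<^sup>2) + ennreal ((norm \<xi>)\<^sup>2 * (norm (?F \<xi>))\<^sup>2)"
        by (simp only: ennreal_plus[symmetric] zero_le_power2 mult_nonneg_nonneg ennreal_leI)
    qed
    also have "\<dots> = (\<integral>\<^sup>+\<xi>. ennreal ((norm (?F \<xi>))\<^sup>2) \<partial>lborel) + (\<integral>\<^sup>+\<xi>. ennreal ((norm \<xi>)\<^sup>2 * (norm (?F \<xi>))\<^sup>2) \<partial>lborel)"
      by (rule nn_integral_add) measurable
    also have "\<dots> < \<infinity>" using fin fin0 by simp
    finally show "(\<integral>\<^sup>+\<xi>. ennreal ((norm (bessel_weight s \<xi> *\<^sub>R ?F \<xi>))\<^sup>2) \<partial>lebesgue) < \<infinity>" .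
  qed
  then show ?thesis unfolding mem_bessel_space
    by (rule sq_integrable_cong_AE[OF _ weighted_rep_measurable[OF bessel_weight_lebesgue]])
      (use rep_rfourier_lip[OF f] in eventually_elim, simp)
qed

section \<open>Density of test functions and the range of the transform\<close>

lemma integrable_mult_cnj:
  fixes f g :: "'a::euclidean_space \<Rightarrow> complex"
  assumes f: "sq_integrable f" and g: "sq_integrable g"
  shows "integrable lebesgue (\<lambda>x. f x * cnj (g x))"
proof (rule Bochner_Integration.integrable_bound)
  show "integrable lebesgue (\<lambda>x. (norm (f x))\<^sup>2 + (norm (g x))\<^sup>2)"
    using assms by (intro Bochner_Integration.integrable_add) (simp_all add: sq_integrable_def)
  have [measurable]: "f \<in> borel_measurable lebesgue" "g \<in> borel_measurable lebesgue"
    using assms by (simp_all add: sq_integrable_def)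
  show "(\<lambda>x. f x * cnj (g x)) \<in> borel_measurable lebesgue" by measurable
  have "norm a * norm b \<le> (norm a)\<^sup>2 + (norm b)\<^sup>2" for a b :: complex
    using sum_squares_bound[of "norm a" "norm b"] mult_nonneg_nonneg[OF norm_ge_zero norm_ge_zero, of a b] by linarith
  then show "AE x in lebesgue. norm (f x * cnj (g x)) \<le> norm ((norm (f x))\<^sup>2 + (norm (g x))\<^sup>2)"
    by (intro AE_I2) (simp add: norm_mult)
qed

lemma lebesgue_integral_uminus:
  fixes h :: "'a::euclidean_space \<Rightarrow> complex"
  assumes h: "h \<in> borel_measurable lebesgue"
  shows "(\<integral>x. h (- x) \<partial>lebesgue) = (\<integral>x. h x \<partial>lebesgue)"
proof -
  obtain g where g[measurable]: "g \<in> borel_measurable borel" and hg: "AE x in lebesgue. h x = g x"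
    by (rule ex_borel_version_complex[OF h])
  have gm: "g \<in> borel_measurable lebesgue" by (rule measurable_completion) simp
  have gm': "(\<lambda>x. g (- x)) \<in> borel_measurable lebesgue" by (rule measurable_completion) simp
  have "(\<lambda>x. h ((-1) *\<^sub>R x)) \<in> borel_measurable lebesgue"
    by (rule measurable_compose[OF lebesgue_measurable_scaling h])
  then have hm': "(\<lambda>x. h (- x)) \<in> borel_measurable lebesgue" by simp
  have "(\<integral>x. h (- x) \<partial>lebesgue) = (\<integral>x. g (- x) \<partial>lebesgue)"
    by (rule integral_cong_AE[OF hm' gm' AE_lebesgue_uminus[OF hg]])
  also have "\<dots> = (\<integral>x. g (- x) \<partial>lborel)" by (rule integral_completion) measurable
  also have "\<dots> = (\<integral>x. g x \<partial>lborel)" using lborel_integral_affine[of "-1" g 0] by simp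
  also have "\<dots> = (\<integral>x. g x \<partial>lebesgue)" by (rule integral_completion[symmetric]) measurable
  also have "\<dots> = (\<integral>x. h x \<partial>lebesgue)" by (rule integral_cong_AE[OF gm h]) (use hg in eventually_elim, simp)
  finally show ?thesis .
qed

text \<open>On the support of the shrunken bump the phase \<open>x \<bullet> \<xi>\<close> stays
  within 1, so its cosine is at least cos 1 > 0 and the real part of the integral is
  positive.\<close>

lemma bump_fourier_nonzero:
  fixes \<xi> :: "'a::euclidean_space"
  assumes n: "norm \<xi> < real n"
  shows "real_fourier (\<lambda>x. bump (real n *\<^sub>R x)) \<xi> \<noteq> 0"
proof -
  let ?f = "\<lambda>x::'a. bump (real n *\<^sub>R x)"
  have n0: "real n > 0" using n norm_ge_zero[of \<xi>] by linarith
  have lip: "lip_compact_supp ?f"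
    using test_function_lip[OF bump_test_function[OF n0, of 0]] by simp
  have i: "integrable lebesgue (\<lambda>x. complex_of_real (?f x) * cis (- (x \<bullet> \<xi>)))"
    by (rule fourier_integral_integrable[OF lip_integrable_lebesgue[OF lip]])
  have c1: "0 < cos (1::real)" by (rule cos_gt_zero) (use pi_gt3 in auto)
  let ?b = "ball (0::'a) (1 / (2 * real n))"
  have ge: "exp (- 2) * cos 1 * indicator ?b x \<le> Re (complex_of_real (?f x) * cis (- (x \<bullet> \<xi>)))" for x
  proof (cases "norm (real n *\<^sub>R x) < 1")
    case True
    have "\<bar>x \<bullet> \<xi>\<bar> \<le> norm x * norm \<xi>" by (rule Cauchy_Schwarz_ineq2)
    also have "\<dots> \<le> norm x * real n" using n by (intro mult_left_mono) auto
    also have "\<dots> \<le> 1" using True n0 by (simp add: mult.commute)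
    finally have "cos 1 \<le> cos \<bar>x \<bullet> \<xi>\<bar>" using pi_gt3 by (intro cos_monotone_0_pi_le) auto
    then have cc: "cos 1 \<le> cos (x \<bullet> \<xi>)" by simp
    show ?thesis
    proof (cases "x \<in> ?b")
      case True
      then have "real n * norm x \<le> 1 / 2" using n0 by (simp add: field_simps)
      then have "exp (- 2) \<le> ?f x" using n0 by (intro bump_ge) simp
      then have "exp (- 2) * cos 1 \<le> ?f x * cos (x \<bullet> \<xi>)" using cc c1 bump_nonneg[of "real n *\<^sub>R x"] by (intro mult_mono) auto
      then show ?thesis using True by simp
    next
      case False
      then show ?thesis using cc c1 bump_nonneg[of "real n *\<^sub>R x"] by simp
    qed
  next
    case False
    then have "?f x = 0" by (intro bump_eq_0) simp
    moreover have "x \<notin> ?b"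
    proof
      assume "x \<in> ?b"
      then have "real n * norm x < 1 / 2" using n0 by (simp add: field_simps)
      then show False using False n0 by simp
    qed
    ultimately show ?thesis by simp
  qed
  have "0 < exp (- 2) * cos 1 * measure lebesgue ?b"
  proof -
    have "0 < measure lebesgue ?b" using n0 by (simp add: content_ball_pos)
    then show ?thesis using c1 by simp
  qed
  also have "\<dots> = (\<integral>x. exp (- 2) * cos 1 * indicator ?b x \<partial>lebesgue)" by simp
  also have "\<dots> \<le> (\<integral>x. Re (complex_of_real (?f x) * cis (- (x \<bullet> \<xi>))) \<partial>lebesgue)"
  proof (rule integral_mono[OF _ _ ge])
    show "integrable lebesgue (\<lambda>x. exp (- 2) * cos 1 * indicat_real ?b x)"
      using lmeasurable_ball[of "0::'a" "1 / (2 * real n)"] unfolding lmeasurable_iff_integrable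
      by (rule integrable_mult_right)
    show "integrable lebesgue (\<lambda>x. Re (complex_of_real (?f x) * cis (- (x \<bullet> \<xi>))))"
      using i by (rule integrable_Re)
  qed
  also have "\<dots> = Re (\<integral>x. complex_of_real (?f x) * cis (- (x \<bullet> \<xi>)) \<partial>lebesgue)"
    by (rule integral_Re[OF i])
  finally have "(\<integral>x. complex_of_real (?f x) * cis (- (x \<bullet> \<xi>)) \<partial>lebesgue) \<noteq> 0" by auto
  then show ?thesis by (simp add: fourier_integral_def)
qed

text \<open>If \<open>d\<close> is orthogonal to the images of all translates of a bump, the transform of \<open>d\<close> times the
  conjugate symbol of the bump vanishes; small bumps have nonvanishing symbol on large balls.\<close>

theorem test_functions_dense:
  fixes g :: "('a::euclidean_space, complex) L2"
  assumes g: "hermitian g" and s: "s \<le> 1"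
  shows "g \<in> closure (bessel_map s ` abs_L2 ` test_functions)"
proof -
  define T where "T = bessel_map s ` abs_L2 ` (test_functions :: ('a \<Rightarrow> real) set)"
  have T_I: "bessel_map s (abs_L2 f) \<in> T" if "f \<in> test_functions" for f :: "'a \<Rightarrow> real"
    unfolding T_def by (intro imageI that)
  have T_E: "\<exists>f. f \<in> test_functions \<and> x = bessel_map s (abs_L2 f)" if "x \<in> T" for x
    using that unfolding T_def by auto
  have tb: "abs_L2 f \<in> bessel_space s" if "f \<in> test_functions" for f :: "'a \<Rightarrow> real"
    by (rule lip_in_bessel[OF test_function_lip[OF that] s])
  have tsq: "sq_integrable f" if "f \<in> test_functions" for f :: "'a \<Rightarrow> real"
    by (rule lip_sq_integrable[OF test_function_lip[OF that]])
  have "subspace T"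
  proof (rule subspaceI)
    have "(\<lambda>x::'a. 0 * bump (1 *\<^sub>R (x - 0))) \<in> test_functions"
      by (intro test_functions_cmult bump_test_function) simp
    then have "(\<lambda>x::'a. 0) \<in> test_functions" by simp
    then have "bessel_map s (abs_L2 (\<lambda>x. 0)) \<in> T" by (rule T_I)
    then show "0 \<in> T" by (simp only: zero_L2_def[symmetric] bessel_0)
  next
    fix x y assume "x \<in> T" "y \<in> T"
    then obtain f h where fh: "f \<in> test_functions" "h \<in> test_functions" "x = bessel_map s (abs_L2 f)" "y = bessel_map s (abs_L2 h)"
      using T_E by metis
    have "x + y = bessel_map s (abs_L2 (\<lambda>x. f x + h x))"
      unfolding fh by (simp only: bessel_add(2)[OF tb[OF fh(1)] tb[OF fh(2)], symmetric] abs_L2_add[OF tsq[OF fh(1)] tsq[OF fh(2)]])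
    then show "x + y \<in> T" using T_I[OF test_functions_add[OF fh(1,2)]] by simp
  next
    fix x c assume "x \<in> T"
    then obtain f where f: "f \<in> test_functions" "x = bessel_map s (abs_L2 f)" using T_E by metis
    have "c *\<^sub>R x = bessel_map s (abs_L2 (\<lambda>x. c * f x))"
      unfolding f(2) bessel_scaleR(2)[OF tb[OF f(1)], symmetric] abs_L2_scaleR[OF tsq[OF f(1)]] by simp
    then show "c *\<^sub>R x \<in> T" using T_I[OF test_functions_cmult[OF f(1)]] by simp
  qed
  then have sub: "subspace (closure T)" by (rule subspace_closure)
  obtain m where m: "m \<in> closure T" "\<And>v. v \<in> closure T \<Longrightarrow> (g - m) \<bullet> v = 0"
  proof (rule orthogonal_projection[OF sub closed_closure, where w = g])
    fix m assume "m \<in> closure T" "\<And>v. v \<in> closure T \<Longrightarrow> (g - m) \<bullet> v = 0"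
    then show thesis by (rule that)
  qed
  define d where "d = g - m"
  obtain X where X: "\<forall>n. X n \<in> T" "X \<longlonglongrightarrow> m"
    using m(1) by (rule closure_sequenceE)
  have "hermitian (X n)" for n
  proof -
    obtain f where "f \<in> test_functions" "X n = bessel_map s (abs_L2 f)" using T_E X(1) by metis
    then show ?thesis using hermitian_bessel_map[OF tb] by simp
  qed
  then have "hermitian m" by (rule hermitian_closed[OF _ X(2)])
  then have d_herm: "hermitian d" unfolding d_def by (rule hermitian_diff[OF g])
  have dm: "rep_L2 d \<in> borel_measurable lebesgue" by simp
  have prod_zero: "AE \<xi> in lebesgue. rep_L2 d \<xi> * cnj (bessel_weight s \<xi> *\<^sub>R real_fourier (\<lambda>x. bump (real (Suc n) *\<^sub>R x)) \<xi>) = 0" for n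
  proof -
    let ?f = "\<lambda>x::'a. bump (real (Suc n) *\<^sub>R x)"
    let ?F = "real_fourier ?f"
    have ft: "?f \<in> test_functions" using bump_test_function[of "real (Suc n)" 0] by simp
    have lip: "lip_compact_supp ?f" by (rule test_function_lip[OF ft])
    have Fb: "?F \<in> borel_measurable borel" by (rule real_fourier_borel_lip[OF lip])
    have wF: "sq_integrable (\<lambda>\<xi>. bessel_weight s \<xi> *\<^sub>R ?F \<xi>)"
    proof (rule sq_integrable_cong_AE[OF iffD1[OF mem_bessel_space tb[OF ft]]])
      show "(\<lambda>\<xi>. bessel_weight s \<xi> *\<^sub>R ?F \<xi>) \<in> borel_measurable lebesgue"
        by (intro borel_measurable_scaleR bessel_weight_lebesgue) (rule measurable_completion, use Fb in simp)
      show "AE \<xi> in lebesgue. bessel_weight s \<xi> *\<^sub>R ?F \<xi> = bessel_weight s \<xi> *\<^sub>R rep_L2 (rfourier (abs_L2 ?f)) \<xi>"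
        using rep_rfourier_lip[OF lip] by eventually_elim simp
    qed
    define h where "h \<xi> = rep_L2 d \<xi> * cnj (bessel_weight s \<xi> *\<^sub>R ?F \<xi>)" for \<xi>
    have hi: "integrable lebesgue h" unfolding h_def by (rule integrable_mult_cnj[OF sq_integrable_rep_L2 wF])
    have hm: "h \<in> borel_measurable lebesgue" using hi by (rule borel_measurable_integrable)
    have h_herm: "AE \<xi> in lebesgue. h (- \<xi>) = cnj (h \<xi>)"
      using d_herm unfolding hermitian_def
      by eventually_elim (simp add: h_def real_fourier_uminus scaleR_conv_of_real)
    have hy: "integrable lebesgue (\<lambda>\<xi>. h \<xi> * cis (y \<bullet> \<xi>))" for y
    proof (rule Bochner_Integration.integrable_bound[OF hi])
      have "(\<lambda>\<xi>. cis (y \<bullet> \<xi>)) \<in> borel_measurable lebesgue" by (rule measurable_completion) measurable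
      then show "(\<lambda>\<xi>. h \<xi> * cis (y \<bullet> \<xi>)) \<in> borel_measurable lebesgue" using hm by (rule borel_measurable_times[rotated])
    qed (simp add: norm_mult)
    \<comment> \<open>The inner product of L^2 is real, so orthogonality to the bump translated to
      \<open>y\<close> kills only the real part; the imaginary part vanishes because
      \<open>h\<close> is Hermitian and the reflection of \<xi> turns the integral into its
      conjugate.\<close>
    have "(\<integral>\<xi>. h \<xi> * cis (y \<bullet> \<xi>) \<partial>lebesgue) = 0" (is "?I = 0") for y
    proof -
      have "?I = (\<integral>\<xi>. h (- \<xi>) * cis (y \<bullet> (- \<xi>)) \<partial>lebesgue)"
        by (rule lebesgue_integral_uminus[OF borel_measurable_integrable[OF hy], symmetric])
      also have "\<dots> = (\<integral>\<xi>. cnj (h \<xi> * cis (y \<bullet> \<xi>)) \<partial>lebesgue)"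
      proof (rule integral_cong_AE)
        have "(\<lambda>x. h ((-1) *\<^sub>R x) * cis (y \<bullet> ((-1) *\<^sub>R x))) \<in> borel_measurable lebesgue"
          by (rule measurable_compose[OF lebesgue_measurable_scaling borel_measurable_integrable[OF hy]])
        then show "(\<lambda>\<xi>. h (- \<xi>) * cis (y \<bullet> (- \<xi>))) \<in> borel_measurable lebesgue" by simp
        show "(\<lambda>\<xi>. cnj (h \<xi> * cis (y \<bullet> \<xi>))) \<in> borel_measurable lebesgue"
          by (rule measurable_compose[OF borel_measurable_integrable[OF hy] cnj_measurable])
        show "AE \<xi> in lebesgue. h (- \<xi>) * cis (y \<bullet> (- \<xi>)) = cnj (h \<xi> * cis (y \<bullet> \<xi>))"
          using h_herm by eventually_elim (simp add: cis_cnj)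
      qed
      also have "\<dots> = cnj ?I" by (rule Bochner_Integration.integral_cnj)
      finally have Im0: "Im ?I = 0" by (simp add: complex_eq_iff)
      let ?p = "\<lambda>x. bump (real (Suc n) *\<^sub>R (x - y))"
      have pt: "?p \<in> test_functions" by (rule bump_test_function) simp
      have pF: "real_fourier ?p \<xi> = cis (- (y \<bullet> \<xi>)) * ?F \<xi>" for \<xi>
        using real_fourier_translate[OF lip_measurable[OF lip], of "- y" \<xi>] by simp
      have rep: "AE \<xi> in lebesgue. rep_L2 (bessel_map s (abs_L2 ?p)) \<xi> = bessel_weight s \<xi> *\<^sub>R (cis (- (y \<bullet> \<xi>)) * ?F \<xi>)"
        using rep_bessel_map[OF tb[OF pt]] rep_rfourier_lip[OF test_function_lip[OF pt]]
        by eventually_elim (simp only: pF)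
      have "bessel_map s (abs_L2 ?p) \<in> closure T"
        by (rule subsetD[OF closure_subset]) (rule T_I[OF pt])
      then have "0 = d \<bullet> bessel_map s (abs_L2 ?p)" using m(2) by (simp add: d_def)
      also have "\<dots> = (\<integral>\<xi>. rep_L2 d \<xi> \<bullet> rep_L2 (bessel_map s (abs_L2 ?p)) \<xi> \<partial>lebesgue)"
        by (rule inner_L2.rep_eq)
      also have "\<dots> = (\<integral>\<xi>. Re (h \<xi> * cis (y \<bullet> \<xi>)) \<partial>lebesgue)"
      proof (rule integral_cong_AE)
        show "(\<lambda>\<xi>. rep_L2 d \<xi> \<bullet> rep_L2 (bessel_map s (abs_L2 ?p)) \<xi>) \<in> borel_measurable lebesgue" by measurable
        show "(\<lambda>\<xi>. Re (h \<xi> * cis (y \<bullet> \<xi>))) \<in> borel_measurable lebesgue"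
          by (rule borel_measurable_integrable[OF integrable_Re[OF hy]])
        show "AE \<xi> in lebesgue. rep_L2 d \<xi> \<bullet> rep_L2 (bessel_map s (abs_L2 ?p)) \<xi> = Re (h \<xi> * cis (y \<bullet> \<xi>))"
          using rep
        proof eventually_elim
          case (elim \<xi>)
          have inner: "a \<bullet> b = Re (a * cnj b)" for a b :: complex by (simp add: inner_complex_def)
          have "h \<xi> * cis (y \<bullet> \<xi>) = rep_L2 d \<xi> * cnj (bessel_weight s \<xi> *\<^sub>R (cis (- (y \<bullet> \<xi>)) * ?F \<xi>))"
            by (simp add: h_def cis_cnj scaleR_conv_of_real)
          then show ?case unfolding elim inner by simp
        qed
      qed
      also have "\<dots> = Re ?I" by (rule integral_Re[OF hy])
      finally show "?I = 0" using Im0 by (simp add: complex_eq_iff)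
    qed
    then show ?thesis using L1_fourier_unique[OF hi] by (simp add: h_def)
  qed
  \<comment> \<open>Countably many bumps share one null set; at a given \<xi> an index beyond its
    norm has a nonzero symbol.\<close>
  have "AE \<xi> in lebesgue. \<forall>n. rep_L2 d \<xi> * cnj (bessel_weight s \<xi> *\<^sub>R real_fourier (\<lambda>x. bump (real (Suc n) *\<^sub>R x)) \<xi>) = 0"
    unfolding AE_all_countable using prod_zero by blast
  then have d0: "AE \<xi> in lebesgue. rep_L2 d \<xi> = 0"
  proof eventually_elim
    case (elim \<xi>)
    obtain n :: nat where "norm \<xi> < n" using reals_Archimedean2 by blast
    then have n: "norm \<xi> < real (Suc n)" by simp
    have "real_fourier (\<lambda>x. bump (real (Suc n) *\<^sub>R x)) \<xi> \<noteq> 0" by (rule bump_fourier_nonzero[OF n])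
    then show ?case using elim[rule_format, of n] bessel_weight_pos[of s \<xi>]
      by (simp del: of_nat_Suc)
  qed
  have "d = abs_L2 (\<lambda>_. 0)"
    using iffD2[OF abs_L2_eq_iff[OF sq_integrable_rep_L2 sq_integrable_zero] d0] by simp
  then have "g = m" by (simp add: d_def zero_L2_def[symmetric])
  then show ?thesis using m(1) by (simp add: T_def)
qed

lemma rfourier_inj: "rfourier u = rfourier v \<Longrightarrow> u = v"
  using norm_rfourier[of "u - v"] rfourier_diff[of u v] by simp

lemma bessel_map_0_eq: "bessel_map 0 u = rfourier u"
  by (simp add: bessel_map_def bessel_weight_def add_nonneg_eq_0_iff add_pos_nonneg less_imp_neq[symmetric])

text \<open>The range is closed because \<open>rfourier\<close> is isometric on a complete space,
  and dense among Hermitian functions by \<open>test_functions_dense\<close> with the weight of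
  order 0.\<close>

lemma rfourier_surj:
  assumes "hermitian g"
  shows "\<exists>u. rfourier u = g"
proof -
  have "g \<in> closure (range rfourier)"
    using test_functions_dense[OF assms, of 0] closure_mono[of "rfourier ` abs_L2 ` test_functions" "range rfourier"]
    unfolding bessel_map_0_eq[abs_def] by (auto simp: bessel_map_0_eq)
  then obtain X where X: "\<forall>n. X n \<in> range rfourier" "X \<longlonglongrightarrow> g"
    by (rule closure_sequenceE)
  have "\<forall>n. \<exists>v. X n = rfourier v" using X(1) by (simp add: image_iff)
  then obtain u where u: "\<And>n. X n = rfourier (u n)" by (rule choice[THEN exE]) blast
  have "Cauchy X" using X(2) by (rule LIMSEQ_imp_Cauchy)
  then have "Cauchy u"
    unfolding Cauchy_iff u by (simp only: rfourier_diff[symmetric] norm_rfourier)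
  then obtain l where l: "u \<longlonglongrightarrow> l" using Cauchy_convergent_iff convergent_def by blast
  have "(\<lambda>n. norm (rfourier (u n) - rfourier l)) \<longlonglongrightarrow> 0"
    unfolding rfourier_diff[symmetric] norm_rfourier using l by (simp add: LIM_zero tendsto_norm_zero)
  then have "X \<longlonglongrightarrow> rfourier l"
    unfolding u[abs_def] u by (rule LIM_zero_cancel[OF tendsto_norm_zero_cancel])
  then show ?thesis using LIMSEQ_unique[OF X(2)] by blast
qed

section \<open>The fractional Laplacian\<close>

definition frac_multiplier :: "real \<Rightarrow> ('a::euclidean_space, real) L2 \<Rightarrow> ('a, complex) L2" where
  "frac_multiplier \<mu> u = abs_L2 (\<lambda>\<xi>. (norm \<xi> powr \<mu>) *\<^sub>R rep_L2 (rfourier u) \<xi>)"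

lemma norm_powr_lebesgue: "(\<lambda>\<xi>::'a::euclidean_space. norm \<xi> powr \<mu>) \<in> borel_measurable lebesgue"
  by (rule measurable_completion) measurable

lemma frac_multiplier_bound:
  assumes u: "u \<in> bessel_space \<mu>" and \<mu>: "0 < \<mu>"
  shows "sq_integrable (\<lambda>\<xi>. (norm \<xi> powr \<mu>) *\<^sub>R rep_L2 (rfourier u) \<xi>)"
    and "norm (frac_multiplier \<mu> u) \<le> norm (bessel_map \<mu> u)"
proof -
  have m: "(\<lambda>\<xi>. (norm \<xi> powr \<mu>) *\<^sub>R rep_L2 (rfourier u) \<xi>) \<in> borel_measurable lebesgue"
    by (rule weighted_rep_measurable[OF norm_powr_lebesgue])
  have "(\<integral>\<^sup>+\<xi>. ennreal ((norm ((norm \<xi> powr \<mu>) *\<^sub>R rep_L2 (rfourier u) \<xi>))\<^sup>2) \<partial>lebesgue)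
      \<le> (\<integral>\<^sup>+\<xi>. ennreal ((norm (bessel_weight \<mu> \<xi> *\<^sub>R rep_L2 (rfourier u) \<xi>))\<^sup>2) \<partial>lebesgue)"
  proof (intro nn_integral_mono ennreal_leI power_mono)
    fix \<xi> :: 'a
    have "norm \<xi> powr \<mu> * norm (rep_L2 (rfourier u) \<xi>) \<le> bessel_weight \<mu> \<xi> * norm (rep_L2 (rfourier u) \<xi>)"
      by (intro mult_right_mono powr_le_bessel_weight \<mu>) simp
    then show "norm ((norm \<xi> powr \<mu>) *\<^sub>R rep_L2 (rfourier u) \<xi>) \<le> norm (bessel_weight \<mu> \<xi> *\<^sub>R rep_L2 (rfourier u) \<xi>)"
      using bessel_weight_pos[of \<mu> \<xi>] by simp
  qed simp
  also have "\<dots> = ennreal ((norm (bessel_map \<mu> u))\<^sup>2)"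
    using u unfolding bessel_map_def mem_bessel_space by (rule nn_integral_abs_L2)
  finally have b: "(\<integral>\<^sup>+\<xi>. ennreal ((norm ((norm \<xi> powr \<mu>) *\<^sub>R rep_L2 (rfourier u) \<xi>))\<^sup>2) \<partial>lebesgue)
      \<le> ennreal ((norm (bessel_map \<mu> u))\<^sup>2)" .
  show "sq_integrable (\<lambda>\<xi>. (norm \<xi> powr \<mu>) *\<^sub>R rep_L2 (rfourier u) \<xi>)"
    by (rule norm_abs_L2_le(1)[OF m norm_ge_zero b])
  show "norm (frac_multiplier \<mu> u) \<le> norm (bessel_map \<mu> u)"
    unfolding frac_multiplier_def by (rule norm_abs_L2_le(2)[OF m norm_ge_zero b])
qed

lemma norm_le_bessel_map:
  assumes u: "u \<in> bessel_space \<mu>" and \<mu>: "0 \<le> \<mu>"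
  shows "norm u \<le> norm (bessel_map \<mu> u)"
proof -
  have m: "rep_L2 (rfourier u) \<in> borel_measurable lebesgue" by (rule rep_L2_measurable)
  have "(\<integral>\<^sup>+\<xi>. ennreal ((norm (rep_L2 (rfourier u) \<xi>))\<^sup>2) \<partial>lebesgue)
      \<le> (\<integral>\<^sup>+\<xi>. ennreal ((norm (bessel_weight \<mu> \<xi> *\<^sub>R rep_L2 (rfourier u) \<xi>))\<^sup>2) \<partial>lebesgue)"
  proof (intro nn_integral_mono ennreal_leI power_mono)
    fix \<xi> :: 'a
    have "1 * norm (rep_L2 (rfourier u) \<xi>) \<le> bessel_weight \<mu> \<xi> * norm (rep_L2 (rfourier u) \<xi>)"
      by (intro mult_right_mono bessel_weight_ge_1 \<mu>) simp
    then show "norm (rep_L2 (rfourier u) \<xi>) \<le> norm (bessel_weight \<mu> \<xi> *\<^sub>R rep_L2 (rfourier u) \<xi>)"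
      using bessel_weight_pos[of \<mu> \<xi>] by simp
  qed simp
  also have "\<dots> = ennreal ((norm (bessel_map \<mu> u))\<^sup>2)"
    using u unfolding bessel_map_def mem_bessel_space by (rule nn_integral_abs_L2)
  finally have "norm (abs_L2 (rep_L2 (rfourier u))) \<le> norm (bessel_map \<mu> u)"
    by (rule norm_abs_L2_le(2)[OF m norm_ge_zero])
  then show ?thesis by (simp add: norm_rfourier)
qed

text \<open>Existence for the definite description comes from surjectivity onto Hermitian functions,
  the symbol being real and even; uniqueness comes from injectivity.\<close>

lemma rfourier_frac_laplacian:
  assumes u: "u \<in> bessel_space \<mu>" and \<mu>: "0 < \<mu>"
  shows "rfourier (frac_laplacian (\<mu> / 2) u) = frac_multiplier \<mu> u"
proof -
  have "hermitian (frac_multiplier \<mu> u)"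
    unfolding frac_multiplier_def
  proof (rule hermitian_abs_L2[OF frac_multiplier_bound(1)[OF u \<mu>]])
    show "AE \<xi> in lebesgue. (norm (- \<xi>) powr \<mu>) *\<^sub>R rep_L2 (rfourier u) (- \<xi>) = cnj ((norm \<xi> powr \<mu>) *\<^sub>R rep_L2 (rfourier u) \<xi>)"
      using hermitian_rfourier[of u] unfolding hermitian_def by eventually_elim (simp add: scaleR_conv_of_real)
  qed
  then obtain f where f: "rfourier f = frac_multiplier \<mu> u" using rfourier_surj by blast
  have "frac_laplacian (\<mu> / 2) u = (THE f. rfourier f = frac_multiplier \<mu> u)"
    by (simp add: frac_laplacian_def frac_multiplier_def)
  also have "\<dots> = f"
  proof (rule the_equality)
    show "rfourier f = frac_multiplier \<mu> u" by (rule f)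
    fix g assume "rfourier g = frac_multiplier \<mu> u"
    then show "g = f" using f by (intro rfourier_inj) simp
  qed
  finally show ?thesis using f by simp
qed

lemma norm_frac_laplacian: "u \<in> bessel_space \<mu> \<Longrightarrow> 0 < \<mu> \<Longrightarrow> norm (frac_laplacian (\<mu> / 2) u) = norm (frac_multiplier \<mu> u)"
  by (simp only: rfourier_frac_laplacian[symmetric] norm_rfourier)

lemma frac_laplacian_add:
  assumes u: "u \<in> bessel_space \<mu>" and v: "v \<in> bessel_space \<mu>" and \<mu>: "0 < \<mu>"
  shows "frac_laplacian (\<mu> / 2) (u + v) = frac_laplacian (\<mu> / 2) u + frac_laplacian (\<mu> / 2) v"
proof (rule rfourier_inj)
  have s: "sq_integrable (\<lambda>\<xi>. (norm \<xi> powr \<mu>) *\<^sub>R rep_L2 (rfourier w) \<xi>)" if "w \<in> bessel_space \<mu>" for w :: "('a, real) L2"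
    by (rule frac_multiplier_bound(1)[OF that \<mu>])
  have ae: "AE \<xi> in lebesgue. (norm \<xi> powr \<mu>) *\<^sub>R rep_L2 (rfourier (u + v)) \<xi>
      = (norm \<xi> powr \<mu>) *\<^sub>R rep_L2 (rfourier u) \<xi> + (norm \<xi> powr \<mu>) *\<^sub>R rep_L2 (rfourier v) \<xi>"
    unfolding rfourier_add using rep_L2_add[of "rfourier u" "rfourier v"]
    by eventually_elim (simp add: scaleR_add_right)
  have "frac_multiplier \<mu> (u + v) = frac_multiplier \<mu> u + frac_multiplier \<mu> v"
    unfolding frac_multiplier_def abs_L2_add[OF s[OF u] s[OF v]]
    by (rule iffD2[OF abs_L2_eq_iff[OF s[OF bessel_add(1)[OF u v]] sq_integrable_add[OF s[OF u] s[OF v]]] ae])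
  then show "rfourier (frac_laplacian (\<mu> / 2) (u + v)) = rfourier (frac_laplacian (\<mu> / 2) u + frac_laplacian (\<mu> / 2) v)"
    by (simp only: rfourier_add rfourier_frac_laplacian[OF u \<mu>] rfourier_frac_laplacian[OF v \<mu>]
        rfourier_frac_laplacian[OF bessel_add(1)[OF u v] \<mu>])
qed

lemma frac_laplacian_scaleR:
  assumes u: "u \<in> bessel_space \<mu>" and \<mu>: "0 < \<mu>"
  shows "frac_laplacian (\<mu> / 2) (c *\<^sub>R u) = c *\<^sub>R frac_laplacian (\<mu> / 2) u"
proof (rule rfourier_inj)
  have s: "sq_integrable (\<lambda>\<xi>. (norm \<xi> powr \<mu>) *\<^sub>R rep_L2 (rfourier w) \<xi>)" if "w \<in> bessel_space \<mu>" for w :: "('a, real) L2"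
    by (rule frac_multiplier_bound(1)[OF that \<mu>])
  have ae: "AE \<xi> in lebesgue. (norm \<xi> powr \<mu>) *\<^sub>R rep_L2 (rfourier (c *\<^sub>R u)) \<xi>
      = c *\<^sub>R ((norm \<xi> powr \<mu>) *\<^sub>R rep_L2 (rfourier u) \<xi>)"
    unfolding rfourier_scaleR using rep_L2_scaleR[of c "rfourier u"]
    by eventually_elim (simp add: mult.commute)
  have "frac_multiplier \<mu> (c *\<^sub>R u) = c *\<^sub>R frac_multiplier \<mu> u"
    unfolding frac_multiplier_def abs_L2_scaleR[OF s[OF u]]
    by (rule iffD2[OF abs_L2_eq_iff[OF s[OF bessel_scaleR(1)[OF u]] sq_integrable_scaleR[OF s[OF u]]] ae])
  then show "rfourier (frac_laplacian (\<mu> / 2) (c *\<^sub>R u)) = rfourier (c *\<^sub>R frac_laplacian (\<mu> / 2) u)"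
    by (simp only: rfourier_scaleR rfourier_frac_laplacian[OF u \<mu>] rfourier_frac_laplacian[OF bessel_scaleR(1)[OF u] \<mu>])
qed

text \<open>The Bessel norm dominates both the L^2 norm and that of the fractional Laplacian, so
  density in it yields a single sequence converging in both.\<close>

lemma bessel_approximation:
  fixes u :: "('a::euclidean_space, real) L2"
  assumes u: "u \<in> bessel_space \<mu>" and \<mu>: "0 < \<mu>" "\<mu> \<le> 1"
  obtains \<phi> where "\<And>n. \<phi> n \<in> test_functions" "(\<lambda>n. abs_L2 (\<phi> n)) \<longlonglongrightarrow> u"
    "(\<lambda>n. frac_laplacian (\<mu> / 2) (abs_L2 (\<phi> n))) \<longlonglongrightarrow> frac_laplacian (\<mu> / 2) u"
proof -
  have "bessel_map \<mu> u \<in> closure (bessel_map \<mu> ` abs_L2 ` test_functions)"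
    by (rule test_functions_dense[OF hermitian_bessel_map[OF u] \<mu>(2)])
  then obtain X where X: "\<forall>n. X n \<in> bessel_map \<mu> ` abs_L2 ` test_functions" "X \<longlonglongrightarrow> bessel_map \<mu> u"
    by (rule closure_sequenceE)
  have "\<forall>n. \<exists>\<phi>. \<phi> \<in> test_functions \<and> X n = bessel_map \<mu> (abs_L2 \<phi>)"
  proof
    fix n
    from X(1) have "X n \<in> bessel_map \<mu> ` abs_L2 ` test_functions" by (rule spec)
    then show "\<exists>\<phi>. \<phi> \<in> test_functions \<and> X n = bessel_map \<mu> (abs_L2 \<phi>)"
      by (elim imageE) auto
  qed
  then obtain \<phi> where \<phi>': "\<forall>n. \<phi> n \<in> test_functions \<and> X n = bessel_map \<mu> (abs_L2 (\<phi> n))" by (rule choice[THEN exE])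
  then have \<phi>: "\<And>n. \<phi> n \<in> test_functions" "\<And>n. X n = bessel_map \<mu> (abs_L2 (\<phi> n))" by auto
  have b: "abs_L2 (\<phi> n) \<in> bessel_space \<mu>" for n by (rule lip_in_bessel[OF test_function_lip[OF \<phi>(1)] \<mu>(2)])
  have mu: "(- 1) *\<^sub>R u \<in> bessel_space \<mu>" by (rule bessel_scaleR(1)[OF u])
  \<comment> \<open>The difference is written with the factor -1 because linearity of
    \<open>bessel_map\<close> and \<open>frac_laplacian\<close> is stated for sums and
    multiples.\<close>
  define d where "d n = abs_L2 (\<phi> n) + (- 1) *\<^sub>R u" for n
  have db: "d n \<in> bessel_space \<mu>" for n unfolding d_def by (rule bessel_add(1)[OF b mu])
  have "bessel_map \<mu> (d n) = X n - bessel_map \<mu> u" for n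
    unfolding d_def bessel_add(2)[OF b mu] bessel_scaleR(2)[OF u] \<phi>(2) by simp
  then have lim: "(\<lambda>n. norm (bessel_map \<mu> (d n))) \<longlonglongrightarrow> 0"
    using X(2) by (simp add: LIM_zero tendsto_norm_zero)
  have "(\<lambda>n. d n) \<longlonglongrightarrow> 0"
    by (rule Lim_null_comparison[OF _ lim]) (use norm_le_bessel_map[OF db] \<mu>(1) in simp)
  then have "(\<lambda>n. abs_L2 (\<phi> n) - u) \<longlonglongrightarrow> 0" by (simp add: d_def)
  then have 1: "(\<lambda>n. abs_L2 (\<phi> n)) \<longlonglongrightarrow> u" by (rule LIM_zero_cancel)
  have "(\<lambda>n. frac_laplacian (\<mu> / 2) (d n)) \<longlonglongrightarrow> 0"
    by (rule Lim_null_comparison[OF _ lim])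
      (simp add: norm_frac_laplacian[OF db \<mu>(1)] frac_multiplier_bound(2)[OF db \<mu>(1)])
  moreover have "frac_laplacian (\<mu> / 2) (d n) = frac_laplacian (\<mu> / 2) (abs_L2 (\<phi> n)) - frac_laplacian (\<mu> / 2) u" for n
    unfolding d_def frac_laplacian_add[OF b mu \<mu>(1)] frac_laplacian_scaleR[OF u \<mu>(1)] by simp
  ultimately have "(\<lambda>n. frac_laplacian (\<mu> / 2) (abs_L2 (\<phi> n)) - frac_laplacian (\<mu> / 2) u) \<longlonglongrightarrow> 0" by (simp only:)
  then have 2: "(\<lambda>n. frac_laplacian (\<mu> / 2) (abs_L2 (\<phi> n))) \<longlonglongrightarrow> frac_laplacian (\<mu> / 2) u" by (rule LIM_zero_cancel)
  show ?thesis by (rule that[OF \<phi>(1) 1 2])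
qed

section \<open>Energy estimates\<close>

abbreviation frac_energy :: "real \<Rightarrow> ('a::euclidean_space \<Rightarrow> real) \<Rightarrow> real" where
  "frac_energy \<mu> f \<equiv> (norm (frac_laplacian (\<mu> / 2) (abs_L2 f)))\<^sup>2"

lemma frac_energy_fourier:
  fixes f :: "'a::euclidean_space \<Rightarrow> real"
  assumes f: "lip_compact_supp f" and \<mu>: "0 < \<mu>" "\<mu> \<le> 1"
  shows "ennreal (frac_energy \<mu> f) = (\<integral>\<^sup>+\<xi>. ennreal ((norm \<xi> powr \<mu>)\<^sup>2 * (norm (real_fourier f \<xi>))\<^sup>2) \<partial>lebesgue)"
proof -
  have b: "abs_L2 f \<in> bessel_space \<mu>" by (rule lip_in_bessel[OF f \<mu>(2)])
  have "ennreal (frac_energy \<mu> f) = ennreal ((norm (frac_multiplier \<mu> (abs_L2 f)))\<^sup>2)"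
    by (simp only: norm_frac_laplacian[OF b \<mu>(1)])
  also have "\<dots> = (\<integral>\<^sup>+\<xi>. ennreal ((norm ((norm \<xi> powr \<mu>) *\<^sub>R rep_L2 (rfourier (abs_L2 f)) \<xi>))\<^sup>2) \<partial>lebesgue)"
    unfolding frac_multiplier_def by (rule nn_integral_abs_L2[OF frac_multiplier_bound(1)[OF b \<mu>(1)], symmetric])
  also have "\<dots> = (\<integral>\<^sup>+\<xi>. ennreal ((norm \<xi> powr \<mu>)\<^sup>2 * (norm (real_fourier f \<xi>))\<^sup>2) \<partial>lebesgue)"
    by (rule nn_integral_cong_AE, use rep_rfourier_lip[OF f] in eventually_elim) (simp add: power_mult_distrib)
  finally show ?thesis .
qed

text \<open>Plancherel and \<open>norm_cis_minus_1_le\<close> compare the translation multiplier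
  with the symbol of the energy; 4 is the square of the constant 2 there. This is the only
  quantitative regularity of \<open>f\<close> that the potential estimates see.\<close>

lemma translation_estimate:
  fixes f :: "'a::euclidean_space \<Rightarrow> real"
  assumes f: "lip_compact_supp f" and \<mu>: "0 < \<mu>" "\<mu> \<le> 1"
  shows "(\<integral>\<^sup>+x. ennreal ((f (x + y) - f x)\<^sup>2) \<partial>lborel) \<le> ennreal (4 * (norm y powr \<mu>)\<^sup>2 * frac_energy \<mu> f)"
proof -
  have [measurable]: "real_fourier f \<in> borel_measurable borel" by (rule real_fourier_borel_lip[OF f])
  have "(\<integral>\<^sup>+x. ennreal ((f (x + y) - f x)\<^sup>2) \<partial>lborel)
      = (\<integral>\<^sup>+\<xi>. ennreal ((norm (cis (y \<bullet> \<xi>) - 1))\<^sup>2 * (norm (real_fourier f \<xi>))\<^sup>2) \<partial>lborel)"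
    using plancherel_translation[OF f, of y] by (simp only: nn_integral_completion)
  also have "\<dots> \<le> (\<integral>\<^sup>+\<xi>. ennreal (4 * (norm y powr \<mu>)\<^sup>2) * ennreal ((norm \<xi> powr \<mu>)\<^sup>2 * (norm (real_fourier f \<xi>))\<^sup>2) \<partial>lborel)"
  proof (rule nn_integral_mono)
    fix \<xi> :: 'a
    have "norm (cis (y \<bullet> \<xi>) - 1) \<le> 2 * \<bar>y \<bullet> \<xi>\<bar> powr \<mu>" by (rule norm_cis_minus_1_le[OF \<mu>])
    also have "\<dots> \<le> 2 * (norm y * norm \<xi>) powr \<mu>"
      using \<mu>(1) Cauchy_Schwarz_ineq2[of y \<xi>] by (intro mult_left_mono powr_mono2) auto
    finally have "(norm (cis (y \<bullet> \<xi>) - 1))\<^sup>2 \<le> (2 * (norm y powr \<mu> * norm \<xi> powr \<mu>))\<^sup>2"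
      by (intro power_mono) (auto simp: powr_mult)
    then have "(norm (cis (y \<bullet> \<xi>) - 1))\<^sup>2 * (norm (real_fourier f \<xi>))\<^sup>2
        \<le> (2 * (norm y powr \<mu> * norm \<xi> powr \<mu>))\<^sup>2 * (norm (real_fourier f \<xi>))\<^sup>2"
      by (intro mult_right_mono) auto
    also have "\<dots> = (4 * (norm y powr \<mu>)\<^sup>2) * ((norm \<xi> powr \<mu>)\<^sup>2 * (norm (real_fourier f \<xi>))\<^sup>2)"
      by (simp add: power_mult_distrib)
    finally show "ennreal ((norm (cis (y \<bullet> \<xi>) - 1))\<^sup>2 * (norm (real_fourier f \<xi>))\<^sup>2)
        \<le> ennreal (4 * (norm y powr \<mu>)\<^sup>2) * ennreal ((norm \<xi> powr \<mu>)\<^sup>2 * (norm (real_fourier f \<xi>))\<^sup>2)"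
      by (subst ennreal_mult[symmetric]) (auto intro: ennreal_leI)
  qed
  also have "\<dots> = ennreal (4 * (norm y powr \<mu>)\<^sup>2) * (\<integral>\<^sup>+\<xi>. ennreal ((norm \<xi> powr \<mu>)\<^sup>2 * (norm (real_fourier f \<xi>))\<^sup>2) \<partial>lborel)"
    by (rule nn_integral_cmult) measurable
  also have "(\<integral>\<^sup>+\<xi>. ennreal ((norm \<xi> powr \<mu>)\<^sup>2 * (norm (real_fourier f \<xi>))\<^sup>2) \<partial>lborel) = ennreal (frac_energy \<mu> f)"
    using frac_energy_fourier[OF f \<mu>] by (simp only: nn_integral_completion)
  also have "ennreal (4 * (norm y powr \<mu>)\<^sup>2) * ennreal (frac_energy \<mu> f) = ennreal (4 * (norm y powr \<mu>)\<^sup>2 * frac_energy \<mu> f)"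
    by (rule ennreal_mult[symmetric]) auto
  finally show ?thesis .
qed

text \<open>Frequencies are split at \<eta>: below, |\<xi>|^(2 \<mu>) is at most \<eta>^(2 \<mu>);
  above, as 2 \<mu> - 2 \<le> 0, it is at most \<eta>^(2 \<mu> - 2) |\<xi>|^2. A small \<eta> makes
  the first term a small multiple of the squared norm, and the second becomes negligible against
  that norm when a function is stretched.\<close>

lemma frac_energy_interpolation:
  fixes f :: "'a::euclidean_space \<Rightarrow> real"
  assumes f: "lip_compact_supp f" and \<mu>: "0 < \<mu>" "\<mu> \<le> 1" and \<eta>: "0 < \<eta>"
    and L: "0 \<le> L" "\<And>x y. \<bar>f x - f y\<bar> \<le> L * norm (x - y)"
    and supp: "\<And>x. f x \<noteq> 0 \<Longrightarrow> x \<in> ball x\<^sub>0 \<rho>"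
  shows "frac_energy \<mu> f \<le> \<eta> powr (2 * \<mu>) * (norm (abs_L2 f))\<^sup>2
    + \<eta> powr (2 * \<mu> - 2) * (real DIM('a) * L\<^sup>2 * measure lborel (ball x\<^sub>0 (\<rho> + 1)))"
proof -
  let ?F = "real_fourier f"
  have [measurable]: "?F \<in> borel_measurable borel" by (rule real_fourier_borel_lip[OF f])
  have pw: "(norm \<xi> powr \<mu>)\<^sup>2 \<le> \<eta> powr (2 * \<mu>) + \<eta> powr (2 * \<mu> - 2) * (norm \<xi>)\<^sup>2" for \<xi> :: 'a
  proof -
    have sq: "(norm \<xi> powr \<mu>)\<^sup>2 = norm \<xi> powr (2 * \<mu>)" by (simp add: power2_eq_square powr_add[symmetric])
    show ?thesis
    proof (cases "norm \<xi> \<le> \<eta>")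
      case True
      then have "norm \<xi> powr (2 * \<mu>) \<le> \<eta> powr (2 * \<mu>)" using \<mu>(1) by (intro powr_mono2) auto
      then show ?thesis unfolding sq by (simp add: add_increasing2)
    next
      case False
      then have n0: "norm \<xi> > 0" using \<eta> by linarith
      have "norm \<xi> powr (2 * \<mu>) = norm \<xi> powr (2 * \<mu> - 2) * norm \<xi> powr 2" by (simp only: powr_add[symmetric]) simp
      also have "norm \<xi> powr 2 = (norm \<xi>)\<^sup>2" using n0 by simp
      also have "norm \<xi> powr (2 * \<mu> - 2) * (norm \<xi>)\<^sup>2 \<le> \<eta> powr (2 * \<mu> - 2) * (norm \<xi>)\<^sup>2"
        using False \<eta> \<mu>(2) by (intro mult_right_mono powr_mono2') auto
      finally show ?thesis unfolding sq by (simp add: add_increasing)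
    qed
  qed
  have fin: "emeasure lborel (ball x\<^sub>0 (\<rho> + 1)) = ennreal (measure lborel (ball x\<^sub>0 (\<rho> + 1)))"
    using emeasure_lborel_ball_finite[of x\<^sub>0 "\<rho> + 1"] by (intro emeasure_eq_ennreal_measure) auto
  have "ennreal (frac_energy \<mu> f) = (\<integral>\<^sup>+\<xi>. ennreal ((norm \<xi> powr \<mu>)\<^sup>2 * (norm (?F \<xi>))\<^sup>2) \<partial>lborel)"
    using frac_energy_fourier[OF f \<mu>] by (simp only: nn_integral_completion)
  also have "\<dots> \<le> (\<integral>\<^sup>+\<xi>. ennreal (\<eta> powr (2 * \<mu>)) * ennreal ((norm (?F \<xi>))\<^sup>2)
      + ennreal (\<eta> powr (2 * \<mu> - 2)) * ennreal ((norm \<xi>)\<^sup>2 * (norm (?F \<xi>))\<^sup>2) \<partial>lborel)"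
  proof (rule nn_integral_mono)
    fix \<xi> :: 'a
    have "(norm \<xi> powr \<mu>)\<^sup>2 * (norm (?F \<xi>))\<^sup>2 \<le> (\<eta> powr (2 * \<mu>) + \<eta> powr (2 * \<mu> - 2) * (norm \<xi>)\<^sup>2) * (norm (?F \<xi>))\<^sup>2"
      by (intro mult_right_mono pw) simp
    also have "\<dots> = \<eta> powr (2 * \<mu>) * (norm (?F \<xi>))\<^sup>2 + \<eta> powr (2 * \<mu> - 2) * ((norm \<xi>)\<^sup>2 * (norm (?F \<xi>))\<^sup>2)"
      by (simp add: algebra_simps)
    finally show "ennreal ((norm \<xi> powr \<mu>)\<^sup>2 * (norm (?F \<xi>))\<^sup>2)
      \<le> ennreal (\<eta> powr (2 * \<mu>)) * ennreal ((norm (?F \<xi>))\<^sup>2) + ennreal (\<eta> powr (2 * \<mu> - 2)) * ennreal ((norm \<xi>)\<^sup>2 * (norm (?F \<xi>))\<^sup>2)"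
      by (simp only: ennreal_mult[symmetric] ennreal_plus[symmetric] zero_le_power2 powr_ge_zero mult_nonneg_nonneg ennreal_leI)
  qed
  also have "\<dots> = ennreal (\<eta> powr (2 * \<mu>)) * (\<integral>\<^sup>+\<xi>. ennreal ((norm (?F \<xi>))\<^sup>2) \<partial>lborel)
      + ennreal (\<eta> powr (2 * \<mu> - 2)) * (\<integral>\<^sup>+\<xi>. ennreal ((norm \<xi>)\<^sup>2 * (norm (?F \<xi>))\<^sup>2) \<partial>lborel)"
    by (subst nn_integral_add) (simp_all add: nn_integral_cmult)
  also have "(\<integral>\<^sup>+\<xi>. ennreal ((norm (?F \<xi>))\<^sup>2) \<partial>lborel) = ennreal ((norm (abs_L2 f))\<^sup>2)"
    using nn_integral_abs_L2[OF fourier_integral_sq_integrable[OF lip_integrable_lebesgue[OF f] lip_sq_integrable[OF f]]]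
      plancherel_L1_L2[OF lip_integrable_lebesgue[OF f] lip_sq_integrable[OF f]]
    by (simp only: nn_integral_completion)
  also have "ennreal (\<eta> powr (2 * \<mu> - 2)) * (\<integral>\<^sup>+\<xi>. ennreal ((norm \<xi>)\<^sup>2 * (norm (?F \<xi>))\<^sup>2) \<partial>lborel)
      \<le> ennreal (\<eta> powr (2 * \<mu> - 2)) * ennreal (real DIM('a) * L\<^sup>2 * measure lborel (ball x\<^sub>0 (\<rho> + 1)))"
  proof (rule mult_left_mono)
    have "(\<integral>\<^sup>+\<xi>. ennreal ((norm \<xi>)\<^sup>2 * (norm (?F \<xi>))\<^sup>2) \<partial>lborel)
      \<le> ennreal (real DIM('a) * L\<^sup>2) * emeasure lborel (ball x\<^sub>0 (\<rho> + 1))"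
      using dirichlet_energy_le[OF f L supp] by (simp only: nn_integral_completion) simp
    then show "(\<integral>\<^sup>+\<xi>. ennreal ((norm \<xi>)\<^sup>2 * (norm (?F \<xi>))\<^sup>2) \<partial>lborel)
      \<le> ennreal (real DIM('a) * L\<^sup>2 * measure lborel (ball x\<^sub>0 (\<rho> + 1)))"
      unfolding fin by (simp only: ennreal_mult zero_le_power2 of_nat_0_le_iff mult_nonneg_nonneg measure_nonneg)
  qed simp
  finally have "ennreal (frac_energy \<mu> f) \<le> ennreal (\<eta> powr (2 * \<mu>)) * ennreal ((norm (abs_L2 f))\<^sup>2)
     + ennreal (\<eta> powr (2 * \<mu> - 2)) * ennreal (real DIM('a) * L\<^sup>2 * measure lborel (ball x\<^sub>0 (\<rho> + 1)))"
    by (simp add: add_left_mono)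
  also have "\<dots> = ennreal (\<eta> powr (2 * \<mu>) * (norm (abs_L2 f))\<^sup>2
    + \<eta> powr (2 * \<mu> - 2) * (real DIM('a) * L\<^sup>2 * measure lborel (ball x\<^sub>0 (\<rho> + 1))))"
    by (simp only: ennreal_mult[symmetric] ennreal_plus[symmetric] zero_le_power2 powr_ge_zero mult_nonneg_nonneg
        of_nat_0_le_iff measure_nonneg)
  finally show ?thesis by (subst (asm) ennreal_le_iff) (auto intro!: add_nonneg_nonneg mult_nonneg_nonneg)
qed

section \<open>Form bounds for locally uniformly integrable potentials\<close>

lemma ball_borel [measurable]: "ball c r \<in> sets borel"
  by (rule borel_open) simp

lemma measure_ball_pos: "0 < r \<Longrightarrow> 0 < measure lborel (ball (x::'a::euclidean_space) r)"
  using content_ball_pos[of r x] by simp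

lemma measure_ball_formula:
  "0 \<le> r \<Longrightarrow> measure lborel (ball (x::'a::euclidean_space) r) = unit_ball_vol (real DIM('a)) * r ^ DIM('a)"
  using content_ball[of r x] by simp

lemma emeasure_ball_measure: "emeasure lborel (ball (x::'a::euclidean_space) r) = ennreal (measure lborel (ball x r))"
  using emeasure_lborel_ball_finite[of x r] by (intro emeasure_eq_ennreal_measure) auto

lemma indicator_ball_diff: "(indicator (ball 0 r) (p - x) :: ennreal) = indicator (ball p r) (x::'a::euclidean_space)"
  by (simp add: indicator_def dist_norm norm_minus_commute)

text \<open>Tonelli with \<open>p = x + y\<close>: for fixed \<open>p\<close> the potential is
  integrated over a ball centred at \<open>p\<close>.\<close>

lemma potential_shift_bound:
  fixes W \<Psi> :: "'a::euclidean_space \<Rightarrow> ennreal"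
  assumes [measurable]: "W \<in> borel_measurable borel" "\<Psi> \<in> borel_measurable borel"
    and K: "\<And>p. (\<integral>\<^sup>+x. W x * indicator (ball p r) x \<partial>lborel) \<le> K"
  shows "(\<integral>\<^sup>+x. W x * (\<integral>\<^sup>+y. indicator (ball 0 r) y * \<Psi> (x + y) \<partial>lborel) \<partial>lborel) \<le> K * (\<integral>\<^sup>+p. \<Psi> p \<partial>lborel)"
proof -
  have "(\<integral>\<^sup>+y. indicator (ball 0 r) y * \<Psi> (x + y) \<partial>lborel) = (\<integral>\<^sup>+p. indicator (ball 0 r) (p - x) * \<Psi> p \<partial>lborel)" for x
    using lborel_nn_integral_shift[of "\<lambda>p. indicator (ball 0 r) (p - x) * \<Psi> p" x] by simp
  then have "(\<integral>\<^sup>+x. W x * (\<integral>\<^sup>+y. indicator (ball 0 r) y * \<Psi> (x + y) \<partial>lborel) \<partial>lborel)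
      = (\<integral>\<^sup>+x. (\<integral>\<^sup>+p. W x * (indicator (ball 0 r) (p - x) * \<Psi> p) \<partial>lborel) \<partial>lborel)"
    by (simp add: nn_integral_cmult)
  also have "\<dots> = (\<integral>\<^sup>+p. (\<integral>\<^sup>+x. W x * (indicator (ball 0 r) (p - x) * \<Psi> p) \<partial>lborel) \<partial>lborel)"
    by (rule lborel_pair.Fubini') measurable
  also have "\<dots> = (\<integral>\<^sup>+p. (\<integral>\<^sup>+x. W x * indicator (ball p r) x \<partial>lborel) * \<Psi> p \<partial>lborel)"
  proof (rule nn_integral_cong)
    fix p
    have "(\<integral>\<^sup>+x. W x * (indicator (ball 0 r) (p - x) * \<Psi> p) \<partial>lborel) = (\<integral>\<^sup>+x. (W x * indicator (ball p r) x) * \<Psi> p \<partial>lborel)"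
      by (simp add: indicator_ball_diff mult.assoc)
    also have "\<dots> = (\<integral>\<^sup>+x. W x * indicator (ball p r) x \<partial>lborel) * \<Psi> p"
      by (rule nn_integral_multc) measurable
    finally show "(\<integral>\<^sup>+x. W x * (indicator (ball 0 r) (p - x) * \<Psi> p) \<partial>lborel) = (\<integral>\<^sup>+x. W x * indicator (ball p r) x \<partial>lborel) * \<Psi> p" .
  qed
  also have "\<dots> \<le> (\<integral>\<^sup>+p. K * \<Psi> p \<partial>lborel)"
    by (intro nn_integral_mono mult_right_mono K) simp
  also have "\<dots> = K * (\<integral>\<^sup>+p. \<Psi> p \<partial>lborel)" by (rule nn_integral_cmult) measurable
  finally show ?thesis .
qed

text \<open>Jensen for squares is the nonnegativity of the variance of \<open>g\<close> on the ball;
  \<open>m\<close> is the deviation of \<open>a\<close> from the mean.\<close>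

lemma jensen_ball:
  fixes g :: "'a::euclidean_space \<Rightarrow> real"
  assumes [measurable]: "g \<in> borel_measurable borel" and B: "\<And>z. \<bar>g z\<bar> \<le> B" and r: "0 < r"
  defines "v \<equiv> measure lborel (ball (0::'a) r)"
  shows "ennreal ((a - (\<integral>z. indicator (ball 0 r) z * g z \<partial>lborel) / v)\<^sup>2)
    \<le> ennreal (1 / v) * (\<integral>\<^sup>+z. indicator (ball 0 r) z * ennreal ((a - g z)\<^sup>2) \<partial>lborel)"
proof -
  let ?S = "ball (0::'a) r"
  have v: "v > 0" unfolding v_def by (rule measure_ball_pos[OF r])
  have i1: "integrable lborel (indicat_real ?S)"
    using emeasure_lborel_ball_finite[of "0::'a" r] by (intro integrable_real_indicator) auto
  have ig: "integrable lborel (\<lambda>z. indicat_real ?S z * g z)"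
  proof (rule Bochner_Integration.integrable_bound[OF integrable_mult_right[OF i1, of B]])
    show "AE z in lborel. norm (indicat_real ?S z * g z) \<le> norm (B * indicat_real ?S z)"
      using B by (intro AE_I2) (auto split: split_indicator intro: order_trans[OF B abs_ge_self])
  qed measurable
  have ig2: "integrable lborel (\<lambda>z. indicat_real ?S z * (g z)\<^sup>2)"
  proof (rule Bochner_Integration.integrable_bound[OF integrable_mult_right[OF i1, of "B\<^sup>2"]])
    have "(g z)\<^sup>2 \<le> B\<^sup>2" for z using power_mono[OF B[of z], of 2] by simp
    then show "AE z in lborel. norm (indicat_real ?S z * (g z)\<^sup>2) \<le> norm (B\<^sup>2 * indicat_real ?S z)"
      by (intro AE_I2) (auto split: split_indicator)
  qed measurable
  define m where "m = a - (\<integral>z. indicator ?S z * g z \<partial>lborel) / v"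
  have I1: "(\<integral>z. indicat_real ?S z \<partial>lborel) = v" by (simp add: v_def)
  have Ig: "(\<integral>z. indicat_real ?S z * g z \<partial>lborel) = (a - m) * v" using v by (simp add: m_def)
  have e: "indicat_real ?S z * ((a - g z) - m)\<^sup>2
     = (a - m)\<^sup>2 * indicat_real ?S z - 2 * (a - m) * (indicat_real ?S z * g z) + indicat_real ?S z * (g z)\<^sup>2" for z
    by (simp add: power2_eq_square algebra_simps)
  have e': "indicat_real ?S z * (a - g z)\<^sup>2
     = a\<^sup>2 * indicat_real ?S z - 2 * a * (indicat_real ?S z * g z) + indicat_real ?S z * (g z)\<^sup>2" for z
    by (simp add: power2_eq_square algebra_simps)
  have i2: "integrable lborel (\<lambda>z. indicat_real ?S z * (a - g z)\<^sup>2)"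
    unfolding e' by (intro Bochner_Integration.integrable_add Bochner_Integration.integrable_diff integrable_mult_right i1 ig ig2)
  have "0 \<le> (\<integral>z. indicat_real ?S z * ((a - g z) - m)\<^sup>2 \<partial>lborel)" by (rule integral_nonneg_AE) simp
  also have "\<dots> = (a - m)\<^sup>2 * v - 2 * (a - m) * ((a - m) * v) + (\<integral>z. indicat_real ?S z * (g z)\<^sup>2 \<partial>lborel)"
    unfolding e by (simp only: Bochner_Integration.integral_add Bochner_Integration.integral_diff
        Bochner_Integration.integrable_diff integrable_mult_right i1 ig ig2 integral_mult_right_zero I1 Ig)
  finally have 1: "0 \<le> (a - m)\<^sup>2 * v - 2 * (a - m) * ((a - m) * v) + (\<integral>z. indicat_real ?S z * (g z)\<^sup>2 \<partial>lborel)" .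
  have 2: "(\<integral>z. indicat_real ?S z * (a - g z)\<^sup>2 \<partial>lborel)
      = a\<^sup>2 * v - 2 * a * ((a - m) * v) + (\<integral>z. indicat_real ?S z * (g z)\<^sup>2 \<partial>lborel)"
    unfolding e' by (simp only: Bochner_Integration.integral_add Bochner_Integration.integral_diff
        Bochner_Integration.integrable_diff integrable_mult_right i1 ig ig2 integral_mult_right_zero I1 Ig)
  have "m\<^sup>2 * v \<le> (\<integral>z. indicat_real ?S z * (a - g z)\<^sup>2 \<partial>lborel)"
    using 1 unfolding 2 by (simp add: power2_eq_square algebra_simps)
  then have "m\<^sup>2 \<le> 1 / v * (\<integral>z. indicat_real ?S z * (a - g z)\<^sup>2 \<partial>lborel)"
    using v by (simp add: field_simps)
  then have "ennreal (m\<^sup>2) \<le> ennreal (1 / v * (\<integral>z. indicat_real ?S z * (a - g z)\<^sup>2 \<partial>lborel))" by (rule ennreal_leI)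
  also have "\<dots> = ennreal (1 / v) * ennreal (\<integral>z. indicat_real ?S z * (a - g z)\<^sup>2 \<partial>lborel)"
    using v by (intro ennreal_mult integral_nonneg_AE) auto
  also have "ennreal (\<integral>z. indicat_real ?S z * (a - g z)\<^sup>2 \<partial>lborel) = (\<integral>\<^sup>+z. ennreal (indicat_real ?S z * (a - g z)\<^sup>2) \<partial>lborel)"
    by (rule nn_integral_eq_integral[OF i2, symmetric]) simp
  also have "\<dots> = (\<integral>\<^sup>+z. indicator ?S z * ennreal ((a - g z)\<^sup>2) \<partial>lborel)"
    by (rule nn_integral_cong) (simp split: split_indicator)
  finally show ?thesis unfolding m_def .
qed

section \<open>Averages over dyadic balls\<close>

definition ball_avg :: "real \<Rightarrow> ('a::euclidean_space \<Rightarrow> real) \<Rightarrow> 'a \<Rightarrow> real" where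
  "ball_avg r f x = (\<integral>z. indicator (ball 0 r) z * f (x + z) \<partial>lborel) / measure lborel (ball (0::'a) r)"

lemma ball_avg_measurable [measurable (raw)]:
  assumes [measurable]: "f \<in> borel_measurable borel"
  shows "ball_avg r f \<in> borel_measurable borel"
  unfolding ball_avg_def[abs_def] by measurable

lemma jensen_ball_avg:
  fixes f :: "'a::euclidean_space \<Rightarrow> real"
  assumes f: "lip_compact_supp f" and r: "0 < r"
  shows "ennreal ((a - ball_avg r f x)\<^sup>2)
    \<le> ennreal (1 / measure lborel (ball (0::'a) r)) * (\<integral>\<^sup>+z. indicator (ball 0 r) z * ennreal ((a - f (x + z))\<^sup>2) \<partial>lborel)"
proof -
  have [measurable]: "f \<in> borel_measurable borel" by (rule lip_measurable[OF f])
  obtain B where B: "\<And>x. \<bar>f x\<bar> \<le> B" using lip_bounded[OF f] by metis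
  show ?thesis unfolding ball_avg_def by (rule jensen_ball[OF _ B r]) measurable
qed

text \<open>Jensen is applied to both averages. Their points \<open>y\<close> and \<open>z\<close>
  differ by less than \<open>2 * r\<close>, so the square is bounded by increments of
  \<open>f\<close> over such distances, based at \<open>x + y\<close> with \<open>y\<close> in the
  small ball: the potential meets only balls of radius \<open>r / 2\<close>, and the increments fall
  under the translation estimate.\<close>

lemma ball_avg_diff_bound:
  fixes f :: "'a::euclidean_space \<Rightarrow> real" and W :: "'a \<Rightarrow> ennreal"
  assumes f: "lip_compact_supp f" and \<mu>: "0 < \<mu>" "\<mu> \<le> 1" and r: "0 < r"
    and [measurable]: "W \<in> borel_measurable borel"
    and K: "\<And>p. (\<integral>\<^sup>+x. W x * indicator (ball p (r / 2)) x \<partial>lborel) \<le> K"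
  shows "(\<integral>\<^sup>+x. W x * ennreal ((ball_avg r f x - ball_avg (r / 2) f x)\<^sup>2) \<partial>lborel)
    \<le> ennreal (1 / measure lborel (ball (0::'a) (r / 2))) * (ennreal (1 / measure lborel (ball (0::'a) r)) *
        (K * ennreal (4 * ((2 * r) powr \<mu>)\<^sup>2 * frac_energy \<mu> f * measure lborel (ball (0::'a) (2 * r)))))"
proof -
  let ?c' = "ennreal (1 / measure lborel (ball (0::'a) (r / 2)))" and ?c = "ennreal (1 / measure lborel (ball (0::'a) r))"
  have [measurable]: "f \<in> borel_measurable borel" by (rule lip_measurable[OF f])
  \<comment> \<open>The local increments at \<open>p\<close>; averaging them over
    \<open>x + y\<close> brings the integral into the shape of
    \<open>potential_shift_bound\<close>.\<close>
  define \<Psi> where "\<Psi> p = (\<integral>\<^sup>+h. indicator (ball 0 (2 * r)) h * ennreal ((f (p + h) - f p)\<^sup>2) \<partial>lborel)" for p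
  have \<Psi>_meas [measurable]: "\<Psi> \<in> borel_measurable borel" unfolding \<Psi>_def[abs_def] by measurable
  have inner: "indicator (ball 0 (r / 2)) y * ennreal ((ball_avg r f x - f (x + y))\<^sup>2) \<le> ?c * (indicator (ball 0 (r / 2)) y * \<Psi> (x + y))" for x y
  proof (cases "y \<in> ball 0 (r / 2)")
    case True
    have "ennreal ((f (x + y) - ball_avg r f x)\<^sup>2) \<le> ?c * (\<integral>\<^sup>+z. indicator (ball 0 r) z * ennreal ((f (x + y) - f (x + z))\<^sup>2) \<partial>lborel)"
      by (rule jensen_ball_avg[OF f r])
    also have "(\<integral>\<^sup>+z. indicator (ball 0 r) z * ennreal ((f (x + y) - f (x + z))\<^sup>2) \<partial>lborel)
        = (\<integral>\<^sup>+h. indicator (ball 0 r) (y + h) * ennreal ((f (x + y) - f (x + (y + h)))\<^sup>2) \<partial>lborel)"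
      by (rule lborel_nn_integral_shift[symmetric]) measurable
    also have "\<dots> \<le> \<Psi> (x + y)"
      unfolding \<Psi>_def
    proof (rule nn_integral_mono)
      fix h :: 'a
      have "h \<in> ball 0 (2 * r)" if "y + h \<in> ball 0 r"
        using that True norm_triangle_ineq4[of "y + h" y] r by simp
      then show "indicator (ball 0 r) (y + h) * ennreal ((f (x + y) - f (x + (y + h)))\<^sup>2)
          \<le> indicator (ball 0 (2 * r)) h * ennreal ((f (x + y + h) - f (x + y))\<^sup>2)"
        by (auto simp: indicator_def power2_commute add.assoc)
    qed
    finally have "ennreal ((ball_avg r f x - f (x + y))\<^sup>2) \<le> ?c * \<Psi> (x + y)"
      by (simp add: power2_commute mult_left_mono)
    then show ?thesis using True by simp
  qed simp
  have pt: "ennreal ((ball_avg r f x - ball_avg (r / 2) f x)\<^sup>2) \<le> ?c' * (?c * (\<integral>\<^sup>+y. indicator (ball 0 (r / 2)) y * \<Psi> (x + y) \<partial>lborel))" for x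
  proof -
    have "ennreal ((ball_avg r f x - ball_avg (r / 2) f x)\<^sup>2)
      \<le> ?c' * (\<integral>\<^sup>+y. indicator (ball 0 (r / 2)) y * ennreal ((ball_avg r f x - f (x + y))\<^sup>2) \<partial>lborel)"
      using r by (intro jensen_ball_avg[OF f]) simp
    also have "\<dots> \<le> ?c' * (\<integral>\<^sup>+y. ?c * (indicator (ball 0 (r / 2)) y * \<Psi> (x + y)) \<partial>lborel)"
      by (intro mult_left_mono nn_integral_mono inner) simp
    also have "(\<integral>\<^sup>+y. ?c * (indicator (ball 0 (r / 2)) y * \<Psi> (x + y)) \<partial>lborel) = ?c * (\<integral>\<^sup>+y. indicator (ball 0 (r / 2)) y * \<Psi> (x + y) \<partial>lborel)"
      by (rule nn_integral_cmult) measurable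
    finally show ?thesis .
  qed
  have "(\<integral>\<^sup>+x. W x * ennreal ((ball_avg r f x - ball_avg (r / 2) f x)\<^sup>2) \<partial>lborel)
     \<le> (\<integral>\<^sup>+x. ?c' * (?c * (W x * (\<integral>\<^sup>+y. indicator (ball 0 (r / 2)) y * \<Psi> (x + y) \<partial>lborel))) \<partial>lborel)"
  proof (rule nn_integral_mono)
    fix x
    have "W x * ennreal ((ball_avg r f x - ball_avg (r / 2) f x)\<^sup>2)
      \<le> W x * (?c' * (?c * (\<integral>\<^sup>+y. indicator (ball 0 (r / 2)) y * \<Psi> (x + y) \<partial>lborel)))"
      by (intro mult_left_mono pt) simp
    then show "W x * ennreal ((ball_avg r f x - ball_avg (r / 2) f x)\<^sup>2)
      \<le> ?c' * (?c * (W x * (\<integral>\<^sup>+y. indicator (ball 0 (r / 2)) y * \<Psi> (x + y) \<partial>lborel)))"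
      by (simp only: mult.left_commute)
  qed
  also have "\<dots> = ?c' * (?c * (\<integral>\<^sup>+x. W x * (\<integral>\<^sup>+y. indicator (ball 0 (r / 2)) y * \<Psi> (x + y) \<partial>lborel) \<partial>lborel))"
    by (subst nn_integral_cmult, measurable)+
  also have "\<dots> \<le> ?c' * (?c * (K * (\<integral>\<^sup>+p. \<Psi> p \<partial>lborel)))"
    by (intro mult_left_mono potential_shift_bound K) auto
  also have "(\<integral>\<^sup>+p. \<Psi> p \<partial>lborel) \<le> ennreal (4 * ((2 * r) powr \<mu>)\<^sup>2 * frac_energy \<mu> f * measure lborel (ball (0::'a) (2 * r)))"
  proof -
    have "(\<integral>\<^sup>+p. \<Psi> p \<partial>lborel) = (\<integral>\<^sup>+h. (\<integral>\<^sup>+p. indicator (ball 0 (2 * r)) h * ennreal ((f (p + h) - f p)\<^sup>2) \<partial>lborel) \<partial>lborel)"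
      unfolding \<Psi>_def by (rule lborel_pair.Fubini') measurable
    also have "\<dots> \<le> (\<integral>\<^sup>+h. ennreal (4 * ((2 * r) powr \<mu>)\<^sup>2 * frac_energy \<mu> f) * indicator (ball (0::'a) (2 * r)) h \<partial>lborel)"
    proof (rule nn_integral_mono)
      fix h :: 'a
      show "(\<integral>\<^sup>+p. indicator (ball 0 (2 * r)) h * ennreal ((f (p + h) - f p)\<^sup>2) \<partial>lborel)
        \<le> ennreal (4 * ((2 * r) powr \<mu>)\<^sup>2 * frac_energy \<mu> f) * indicator (ball (0::'a) (2 * r)) h"
      proof (cases "h \<in> ball 0 (2 * r)")
        case True
        have "(\<integral>\<^sup>+p. ennreal ((f (p + h) - f p)\<^sup>2) \<partial>lborel) \<le> ennreal (4 * (norm h powr \<mu>)\<^sup>2 * frac_energy \<mu> f)"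
          by (rule translation_estimate[OF f \<mu>])
        also have "\<dots> \<le> ennreal (4 * ((2 * r) powr \<mu>)\<^sup>2 * frac_energy \<mu> f)"
          using True \<mu>(1) by (intro ennreal_leI mult_right_mono mult_left_mono power_mono powr_mono2) auto
        finally show ?thesis using True by simp
      qed simp
    qed
    also have "\<dots> = ennreal (4 * ((2 * r) powr \<mu>)\<^sup>2 * frac_energy \<mu> f) * emeasure lborel (ball (0::'a) (2 * r))"
      by (rule nn_integral_cmult_indicator) simp
    also have "\<dots> = ennreal (4 * ((2 * r) powr \<mu>)\<^sup>2 * frac_energy \<mu> f * measure lborel (ball (0::'a) (2 * r)))"
      unfolding emeasure_ball_measure by (rule ennreal_mult[symmetric]) auto
    finally show ?thesis .
  qed
  finally show ?thesis by (simp add: mult_left_mono)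
qed

text \<open>Cauchy-Schwarz with geometric factors: the square of a sum is traded for a sum of
  squares, at the price of a fixed constant and of the growing weights
  \<open>1 / (\<tau>\<^sup>2) ^ j\<close>.\<close>

lemma weighted_sum_squared_le:
  fixes d :: "nat \<Rightarrow> real"
  assumes \<tau>: "0 < \<tau>" "\<tau> < 1"
  shows "(\<Sum>j<n. d j)\<^sup>2 \<le> (1 / (1 - \<tau>\<^sup>2)) * (\<Sum>j<n. (d j)\<^sup>2 / (\<tau>\<^sup>2) ^ j)"
proof -
  have t2: "\<tau>\<^sup>2 < 1" using \<tau> by (simp add: power_less_one_iff)
  have "(\<Sum>j<n. d j) = (\<Sum>j<n. \<tau> ^ j * (d j / \<tau> ^ j))" using \<tau> by simp
  then have "(\<Sum>j<n. d j)\<^sup>2 \<le> (\<Sum>j<n. (\<tau> ^ j)\<^sup>2) * (\<Sum>j<n. (d j / \<tau> ^ j)\<^sup>2)"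
    using Cauchy_Schwarz_ineq_sum[of "\<lambda>j. \<tau> ^ j" "\<lambda>j. d j / \<tau> ^ j" "{..<n}"] by simp
  also have "\<dots> \<le> (1 / (1 - \<tau>\<^sup>2)) * (\<Sum>j<n. (d j / \<tau> ^ j)\<^sup>2)"
  proof (rule mult_right_mono)
    have "(\<Sum>j<n. (\<tau> ^ j)\<^sup>2) = (\<Sum>j<n. (\<tau>\<^sup>2) ^ j)" by (simp add: power_mult[symmetric] mult.commute)
    also have "\<dots> \<le> (\<Sum>j. (\<tau>\<^sup>2) ^ j)"
      using t2 by (intro sum_le_suminf summable_geometric) auto
    also have "\<dots> = 1 / (1 - \<tau>\<^sup>2)" using t2 by (intro suminf_geometric) simp
    finally show "(\<Sum>j<n. (\<tau> ^ j)\<^sup>2) \<le> 1 / (1 - \<tau>\<^sup>2)" .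
  qed (simp add: sum_nonneg)
  also have "(\<Sum>j<n. (d j / \<tau> ^ j)\<^sup>2) = (\<Sum>j<n. (d j)\<^sup>2 / (\<tau>\<^sup>2) ^ j)"
    by (simp add: power_divide power_mult[symmetric] mult.commute)
  finally show ?thesis .
qed

text \<open>Jensen and the Lipschitz bound keep the average over radius \<open>r\<close> within
  \<open>L * r\<close> of \<open>f x\<close>.\<close>

lemma ball_avg_tendsto:
  fixes f :: "'a::euclidean_space \<Rightarrow> real"
  assumes f: "lip_compact_supp f"
  shows "(\<lambda>n. ball_avg ((1 / 2) ^ n) f x) \<longlonglongrightarrow> f x"
proof -
  obtain L where L: "L \<ge> 0" "\<And>x y. \<bar>f x - f y\<bar> \<le> L * norm (x - y)"
    using f unfolding lip_compact_supp_def by blast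
  have le: "\<bar>f x - ball_avg r f x\<bar> \<le> L * r" if r: "0 < r" for r
  proof -
    let ?v = "measure lborel (ball (0::'a) r)"
    have v: "?v > 0" by (rule measure_ball_pos[OF r])
    have "ennreal ((f x - ball_avg r f x)\<^sup>2) \<le> ennreal (1 / ?v) * (\<integral>\<^sup>+z. indicator (ball 0 r) z * ennreal ((f x - f (x + z))\<^sup>2) \<partial>lborel)"
      by (rule jensen_ball_avg[OF f r])
    also have "\<dots> \<le> ennreal (1 / ?v) * (\<integral>\<^sup>+z. ennreal ((L * r)\<^sup>2) * indicator (ball (0::'a) r) z \<partial>lborel)"
    proof (intro mult_left_mono nn_integral_mono)
      fix z :: 'a
      show "indicator (ball 0 r) z * ennreal ((f x - f (x + z))\<^sup>2) \<le> ennreal ((L * r)\<^sup>2) * indicator (ball 0 r) z"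
      proof (cases "z \<in> ball 0 r")
        case True
        have "\<bar>f x - f (x + z)\<bar> \<le> L * norm z" using L(2)[of x "x + z"] by simp
        also have "\<dots> \<le> L * r" using True L(1) by (intro mult_left_mono) auto
        finally have "\<bar>f x - f (x + z)\<bar>\<^sup>2 \<le> (L * r)\<^sup>2" by (rule power_mono) simp
        then show ?thesis using True by (simp add: ennreal_leI)
      qed simp
    qed simp
    also have "\<dots> = ennreal (1 / ?v) * (ennreal ((L * r)\<^sup>2) * ennreal ?v)"
      by (subst nn_integral_cmult_indicator) (simp_all add: emeasure_ball_measure)
    also have "\<dots> = ennreal (1 / ?v * ((L * r)\<^sup>2 * ?v))"
      using v by (simp only: ennreal_mult zero_le_power2 less_imp_le zero_le_divide_1_iff mult_nonneg_nonneg)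
    also have "1 / ?v * ((L * r)\<^sup>2 * ?v) = (L * r)\<^sup>2" using v by (simp only: mult_1 times_divide_eq_left nonzero_mult_div_cancel_right less_imp_neq[symmetric] not_False_eq_True)
    finally have "(f x - ball_avg r f x)\<^sup>2 \<le> (L * r)\<^sup>2" by (simp only: ennreal_le_iff zero_le_power2)
    then have "\<bar>f x - ball_avg r f x\<bar> \<le> \<bar>L * r\<bar>" by (simp only: abs_le_square_iff)
    then show ?thesis using L(1) r by simp
  qed
  have "(\<lambda>n. ball_avg ((1 / 2) ^ n) f x - f x) \<longlonglongrightarrow> 0"
  proof (rule Lim_null_comparison)
    show "eventually (\<lambda>n. norm (ball_avg ((1 / 2) ^ n) f x - f x) \<le> L * (1 / 2) ^ n) sequentially"
      using le[of "(1 / 2) ^ _"] by (intro always_eventually allI) (simp add: abs_minus_commute)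
    show "(\<lambda>n. L * (1 / 2) ^ n) \<longlonglongrightarrow> 0"
      by (intro tendsto_mult_right_zero LIMSEQ_power_zero) simp
  qed
  then show ?thesis by (rule LIM_zero_cancel)
qed

lemma ennreal_le_mult_fold:
  "0 \<le> a \<Longrightarrow> 0 \<le> b \<Longrightarrow> ennreal a * ennreal b = ennreal (a * b)"
  by (rule ennreal_mult[symmetric])

text \<open>Telescoping over the averages on balls of radius \<open>2\<^sup>-\<^sup>j\<close>: the gain \<open>2 \<mu>\<close> from the energy beats the
  loss \<open>N - \<beta>\<close> from the concentration of the potential.\<close>

theorem form_bound:
  fixes W :: "'a::euclidean_space \<Rightarrow> real"
  assumes [measurable]: "W \<in> borel_measurable borel" and \<mu>: "0 < \<mu>" "\<mu> \<le> 1"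
    and A: "0 \<le> A" and \<beta>: "\<beta> > real DIM('a) - 2 * \<mu>"
    and conc: "\<And>p r. 0 < r \<Longrightarrow> r \<le> 1 \<Longrightarrow> (\<integral>\<^sup>+x. ennreal (W x) * indicator (ball p r) x \<partial>lborel) \<le> ennreal (A * r powr \<beta>)"
  obtains C where "0 \<le> C"
    "\<And>f. lip_compact_supp f \<Longrightarrow> (\<integral>\<^sup>+x. ennreal (W x) * ennreal ((f x)\<^sup>2) \<partial>lborel) \<le> ennreal (C * ((norm (abs_L2 f))\<^sup>2 + frac_energy \<mu> f))"
proof -
  let ?N = "DIM('a)"
  define \<omega> where "\<omega> = unit_ball_vol (real ?N)"
  have \<omega>: "\<omega> > 0" unfolding \<omega>_def by (rule unit_ball_vol_pos) simp
  have vol: "measure lborel (ball (0::'a) r) = \<omega> * r ^ ?N" if "0 \<le> r" for r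
    unfolding \<omega>_def by (rule measure_ball_formula[OF that])
  \<comment> \<open>The surplus exponent: passing from radius \<open>r\<close> to
    \<open>r / 2\<close> costs at most a multiple of r^\<delta> times the energy.\<close>
  define \<delta> where "\<delta> = \<beta> - real ?N + 2 * \<mu>"
  have \<delta>: "\<delta> > 0" using \<beta> by (simp add: \<delta>_def)
  \<comment> \<open>Chosen so that (1/2)^(j \<delta>) = \<tau>^(4j): one factor \<tau>^(2j) pays for
    the weights in \<open>weighted_sum_squared_le\<close>, the other sums to a geometric
    series.\<close>
  define \<tau> where "\<tau> = (1 / 2) powr (\<delta> / 4)"
  have \<tau>: "0 < \<tau>" "\<tau> < 1" using \<delta> powr_less_mono'[of "1/2" 0 "\<delta> / 4"] by (auto simp: \<tau>_def)
  have t2: "\<tau>\<^sup>2 < 1" "0 < \<tau>\<^sup>2" using \<tau> by (auto simp: power_less_one_iff)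
  have \<tau>4: "((1 / 2) ^ j) powr \<delta> = (\<tau>\<^sup>2) ^ j * (\<tau>\<^sup>2) ^ j" for j :: nat
  proof -
    have "((1 / 2 :: real) ^ j) powr \<delta> = (1 / 2) powr (real j * \<delta>)"
      by (simp add: powr_realpow[symmetric] powr_powr mult.commute)
    also have "\<dots> = ((1 / 2) powr (\<delta> / 4)) powr (real (4 * j))" by (simp add: powr_powr mult.commute)
    also have "\<dots> = \<tau> ^ (4 * j)" unfolding \<tau>_def by (rule powr_realpow) simp
    also have "\<dots> = (\<tau>\<^sup>2) ^ j * (\<tau>\<^sup>2) ^ j" by (simp add: power_mult[symmetric] power_add[symmetric])
    finally show ?thesis .
  qed
  \<comment> \<open>Collected from \<open>ball_avg_diff_bound\<close>: the volumes of the balls of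
    radii \<open>r / 2\<close>, \<open>r\<close> and \<open>2 * r\<close> leave the two powers of 2
    and 1/\<omega>, the translation estimate gives 4 and \<open>(2 powr \<mu>)\<^sup>2\<close>, and
    the concentration at radius \<open>r / 2\<close> gives \<open>A\<close> and
    \<open>(1 / 2) powr \<beta>\<close>.\<close>
  define K0 where "K0 = 2 ^ ?N * 2 ^ ?N * 4 * (2 powr \<mu>)\<^sup>2 * A * (1 / 2) powr \<beta> / \<omega>"
  have K0: "0 \<le> K0" unfolding K0_def using A \<omega> by simp
  \<comment> \<open>The factors 2 split the square of a difference; of the two factors
    \<open>1 / (1 - \<tau>\<^sup>2)\<close> one is the Cauchy-Schwarz constant, the other the
    geometric series.\<close>
  define C where "C = 2 * (A / \<omega>) + 2 * (1 / (1 - \<tau>\<^sup>2)) * (K0 * (1 / (1 - \<tau>\<^sup>2)))"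
  have C0: "0 \<le> C" unfolding C_def using A \<omega> K0 t2 by simp
  have main: "(\<integral>\<^sup>+x. ennreal (W x) * ennreal ((f x)\<^sup>2) \<partial>lborel) \<le> ennreal (C * ((norm (abs_L2 f))\<^sup>2 + frac_energy \<mu> f))"
    if f: "lip_compact_supp f" for f
  proof -
    have [measurable]: "f \<in> borel_measurable borel" by (rule lip_measurable[OF f])
    define E where "E = frac_energy \<mu> f"
    have E0: "0 \<le> E" by (simp add: E_def)
    define Av where "Av n = ball_avg ((1 / 2) ^ n) f" for n :: nat
    have Av_meas [measurable]: "Av n \<in> borel_measurable borel" for n unfolding Av_def by measurable
    define D where "D j x = Av j x - Av (Suc j) x" for j x
    have D_bound: "(\<integral>\<^sup>+x. ennreal (W x) * ennreal ((D j x)\<^sup>2) \<partial>lborel) \<le> ennreal (K0 * E * ((\<tau>\<^sup>2) ^ j * (\<tau>\<^sup>2) ^ j))" for j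
    proof -
      define r where "r = (1 / 2 :: real) ^ j"
      have r: "0 < r" "r \<le> 1" by (auto simp: r_def power_le_one)
      have "(\<integral>\<^sup>+x. ennreal (W x) * ennreal ((ball_avg r f x - ball_avg (r / 2) f x)\<^sup>2) \<partial>lborel)
        \<le> ennreal (1 / measure lborel (ball (0::'a) (r / 2))) * (ennreal (1 / measure lborel (ball (0::'a) r)) *
        (ennreal (A * (r / 2) powr \<beta>) * ennreal (4 * ((2 * r) powr \<mu>)\<^sup>2 * frac_energy \<mu> f * measure lborel (ball (0::'a) (2 * r)))))"
        by (rule ball_avg_diff_bound[OF f \<mu> r(1)]) (use r in \<open>auto intro!: conc\<close>)
      also have "\<dots> = ennreal (1 / (\<omega> * (r / 2) ^ ?N) * (1 / (\<omega> * r ^ ?N) * (A * (r / 2) powr \<beta> * (4 * ((2 * r) powr \<mu>)\<^sup>2 * E * (\<omega> * (2 * r) ^ ?N)))))"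
        unfolding E_def[symmetric] using r A E0 \<omega>
        by (subst (1 2 3) vol, simp, simp, simp) (simp add: ennreal_le_mult_fold)
      also have "1 / (\<omega> * (r / 2) ^ ?N) * (1 / (\<omega> * r ^ ?N) * (A * (r / 2) powr \<beta> * (4 * ((2 * r) powr \<mu>)\<^sup>2 * E * (\<omega> * (2 * r) ^ ?N))))
          = K0 * E * r powr \<delta>"
      proof -
        have 1: "(r / 2) powr \<beta> = r powr \<beta> * (1 / 2) powr \<beta>" 
          by (simp only: powr_mult[symmetric] times_divide_eq_right mult_1_right)
        have 2: "((2 * r) powr \<mu>)\<^sup>2 = (2 powr \<mu>)\<^sup>2 * r powr (2 * \<mu>)"
        proof -
          have "r powr (2 * \<mu>) = r powr \<mu> * r powr \<mu>" by (simp only: powr_add[symmetric] mult_2)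
          then show ?thesis using r by (simp add: powr_mult power2_eq_square)
        qed
        have 3: "r powr \<delta> = r powr \<beta> * r powr (2 * \<mu>) / r ^ ?N"
          using r by (simp add: \<delta>_def powr_add powr_diff powr_realpow)
        have rN: "r ^ ?N > 0" using r by simp
        have "1 / (w * (rn / t)) * (1 / (w * rn) * (A * (rb * hb) * (4 * (m * rm) * E * (w * (t * rn))))) = (t * t * 4 * m * A * hb / w) * E * (rb * rm / rn)"
          if "0 < w" "0 < rn" "0 < t" for w rn t rb hb m rm :: real
          using that by (simp add: divide_simps)
        note alg = this[OF \<omega> rN, of "2 ^ ?N"]
        show ?thesis unfolding 1 2 3 K0_def power_mult_distrib[of 2 r] power_divide
          by (rule alg) simp
      qed
      also have "r powr \<delta> = (\<tau>\<^sup>2) ^ j * (\<tau>\<^sup>2) ^ j" unfolding r_def by (rule \<tau>4)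
      finally show ?thesis by (simp add: D_def Av_def r_def)
    qed
    have A0_bound: "(\<integral>\<^sup>+x. ennreal (W x) * ennreal ((Av 0 x)\<^sup>2) \<partial>lborel) \<le> ennreal (A / \<omega> * (norm (abs_L2 f))\<^sup>2)"
    proof -
      have v1: "measure lborel (ball (0::'a) 1) = \<omega>" using vol[of 1] by simp
      have pt: "ennreal ((Av 0 x)\<^sup>2) \<le> ennreal (1 / \<omega>) * (\<integral>\<^sup>+z. indicator (ball 0 1) z * ennreal ((f (x + z))\<^sup>2) \<partial>lborel)" for x
        using jensen_ball_avg[OF f, of 1 0 x] by (simp add: v1 Av_def)
      have "(\<integral>\<^sup>+x. ennreal (W x) * ennreal ((Av 0 x)\<^sup>2) \<partial>lborel)
        \<le> (\<integral>\<^sup>+x. ennreal (1 / \<omega>) * (ennreal (W x) * (\<integral>\<^sup>+z. indicator (ball 0 1) z * ennreal ((f (x + z))\<^sup>2) \<partial>lborel)) \<partial>lborel)"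
      proof (rule nn_integral_mono)
        fix x
        have "ennreal (W x) * ennreal ((Av 0 x)\<^sup>2) \<le> ennreal (W x) * (ennreal (1 / \<omega>) * (\<integral>\<^sup>+z. indicator (ball 0 1) z * ennreal ((f (x + z))\<^sup>2) \<partial>lborel))"
          by (intro mult_left_mono pt) simp
        then show "ennreal (W x) * ennreal ((Av 0 x)\<^sup>2) \<le> ennreal (1 / \<omega>) * (ennreal (W x) * (\<integral>\<^sup>+z. indicator (ball 0 1) z * ennreal ((f (x + z))\<^sup>2) \<partial>lborel))"
          by (simp only: mult.left_commute)
      qed
      also have "\<dots> = ennreal (1 / \<omega>) * (\<integral>\<^sup>+x. ennreal (W x) * (\<integral>\<^sup>+z. indicator (ball 0 1) z * ennreal ((f (x + z))\<^sup>2) \<partial>lborel) \<partial>lborel)"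
        by (rule nn_integral_cmult) measurable
      also have "\<dots> \<le> ennreal (1 / \<omega>) * (ennreal (A * 1 powr \<beta>) * (\<integral>\<^sup>+p. ennreal ((f p)\<^sup>2) \<partial>lborel))"
        by (intro mult_left_mono potential_shift_bound conc) auto
      also have "(\<integral>\<^sup>+p. ennreal ((f p)\<^sup>2) \<partial>lborel) = ennreal ((norm (abs_L2 f))\<^sup>2)"
        using nn_integral_abs_L2[OF lip_sq_integrable[OF f]] by (simp add: nn_integral_completion)
      also have "ennreal (1 / \<omega>) * (ennreal (A * 1 powr \<beta>) * ennreal ((norm (abs_L2 f))\<^sup>2)) = ennreal (A / \<omega> * (norm (abs_L2 f))\<^sup>2)"
        using A \<omega> by (simp add: ennreal_le_mult_fold)
      finally show ?thesis .
    qed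
    have Av_bound: "(\<integral>\<^sup>+x. ennreal (W x) * ennreal ((Av n x)\<^sup>2) \<partial>lborel) \<le> ennreal (C * ((norm (abs_L2 f))\<^sup>2 + E))" for n
    proof -
      have tele: "Av n x = Av 0 x - (\<Sum>j<n. D j x)" for x by (induction n) (auto simp: D_def)
      have "(Av n x)\<^sup>2 \<le> 2 * (Av 0 x)\<^sup>2 + 2 * ((1 / (1 - \<tau>\<^sup>2)) * (\<Sum>j<n. (D j x)\<^sup>2 / (\<tau>\<^sup>2) ^ j))" for x
      proof -
        have "(Av 0 x - (\<Sum>j<n. D j x))\<^sup>2 \<le> 2 * (Av 0 x)\<^sup>2 + 2 * (\<Sum>j<n. D j x)\<^sup>2"
          using zero_le_power2[of "Av 0 x + (\<Sum>j<n. D j x)"] by (simp add: power2_eq_square algebra_simps)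
        then show ?thesis unfolding tele using weighted_sum_squared_le[OF \<tau>, of "\<lambda>j. D j x" n] by linarith
      qed
      then have pt: "ennreal ((Av n x)\<^sup>2) \<le> ennreal 2 * ennreal ((Av 0 x)\<^sup>2) + ennreal (2 * (1 / (1 - \<tau>\<^sup>2))) * (\<Sum>j<n. ennreal (1 / (\<tau>\<^sup>2) ^ j) * ennreal ((D j x)\<^sup>2))" for x
      proof -
        have "ennreal ((Av n x)\<^sup>2) \<le> ennreal (2 * (Av 0 x)\<^sup>2 + 2 * ((1 / (1 - \<tau>\<^sup>2)) * (\<Sum>j<n. (D j x)\<^sup>2 / (\<tau>\<^sup>2) ^ j)))"
          by (rule ennreal_leI) fact
        also have "\<dots> = ennreal 2 * ennreal ((Av 0 x)\<^sup>2) + ennreal (2 * (1 / (1 - \<tau>\<^sup>2))) * ennreal (\<Sum>j<n. (D j x)\<^sup>2 / (\<tau>\<^sup>2) ^ j)"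
        proof -
          have s0: "0 \<le> (\<Sum>j<n. (D j x)\<^sup>2 / (\<tau>\<^sup>2) ^ j)" by (intro sum_nonneg divide_nonneg_nonneg) auto
          have c0: "0 \<le> 2 * (1 / (1 - \<tau>\<^sup>2))" using t2 by simp
          show ?thesis using s0 c0
            by (simp only: ennreal_le_mult_fold zero_le_power2 zero_le_numeral mult.assoc[symmetric] mult_nonneg_nonneg ennreal_plus)
        qed
        also have "ennreal (\<Sum>j<n. (D j x)\<^sup>2 / (\<tau>\<^sup>2) ^ j) = (\<Sum>j<n. ennreal (1 / (\<tau>\<^sup>2) ^ j) * ennreal ((D j x)\<^sup>2))"
        proof -
          have "ennreal (1 / (\<tau>\<^sup>2) ^ j) * ennreal ((D j x)\<^sup>2) = ennreal ((D j x)\<^sup>2 / (\<tau>\<^sup>2) ^ j)" for j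
            by (subst ennreal_le_mult_fold) auto
          then show ?thesis by (simp add: sum_ennreal)
        qed
        finally show ?thesis .
      qed
      have "(\<integral>\<^sup>+x. ennreal (W x) * ennreal ((Av n x)\<^sup>2) \<partial>lborel)
        \<le> (\<integral>\<^sup>+x. ennreal 2 * (ennreal (W x) * ennreal ((Av 0 x)\<^sup>2))
            + ennreal (2 * (1 / (1 - \<tau>\<^sup>2))) * (\<Sum>j<n. ennreal (1 / (\<tau>\<^sup>2) ^ j) * (ennreal (W x) * ennreal ((D j x)\<^sup>2))) \<partial>lborel)"
      proof (rule nn_integral_mono)
        fix x
        have "ennreal (W x) * ennreal ((Av n x)\<^sup>2)
          \<le> ennreal (W x) * (ennreal 2 * ennreal ((Av 0 x)\<^sup>2) + ennreal (2 * (1 / (1 - \<tau>\<^sup>2))) * (\<Sum>j<n. ennreal (1 / (\<tau>\<^sup>2) ^ j) * ennreal ((D j x)\<^sup>2)))"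
          by (intro mult_left_mono pt) simp
        then show "ennreal (W x) * ennreal ((Av n x)\<^sup>2) \<le> ennreal 2 * (ennreal (W x) * ennreal ((Av 0 x)\<^sup>2))
            + ennreal (2 * (1 / (1 - \<tau>\<^sup>2))) * (\<Sum>j<n. ennreal (1 / (\<tau>\<^sup>2) ^ j) * (ennreal (W x) * ennreal ((D j x)\<^sup>2)))"
          by (simp only: distrib_left sum_distrib_left mult.left_commute)
      qed
      also have "\<dots> = ennreal 2 * (\<integral>\<^sup>+x. ennreal (W x) * ennreal ((Av 0 x)\<^sup>2) \<partial>lborel)
          + ennreal (2 * (1 / (1 - \<tau>\<^sup>2))) * (\<Sum>j<n. ennreal (1 / (\<tau>\<^sup>2) ^ j) * (\<integral>\<^sup>+x. ennreal (W x) * ennreal ((D j x)\<^sup>2) \<partial>lborel))"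
      proof -
        have Dm: "D j \<in> borel_measurable borel" for j
          using borel_measurable_diff[OF Av_meas[of j] Av_meas[of "Suc j"]] by (simp only: D_def[abs_def])
        have sum: "(\<integral>\<^sup>+x. a * g x + b * (\<Sum>j<n. c j * h j x) \<partial>lborel)
            = a * (\<integral>\<^sup>+x. g x \<partial>lborel) + b * (\<Sum>j<n. c j * (\<integral>\<^sup>+x. h j x \<partial>lborel))"
          if [measurable]: "g \<in> borel_measurable borel" "\<And>j. h j \<in> borel_measurable borel"
          for a b :: ennreal and c g and h :: "nat \<Rightarrow> 'a \<Rightarrow> ennreal"
          by (simp add: nn_integral_add nn_integral_cmult nn_integral_sum)
        have sq: "(\<lambda>x. ennreal (W x) * ennreal ((g x)\<^sup>2)) \<in> borel_measurable borel"
          if [measurable]: "g \<in> borel_measurable borel" for g by measurable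
        show ?thesis by (rule sum[OF sq[OF Av_meas] sq[OF Dm]])
      qed
      also have "\<dots> \<le> ennreal 2 * ennreal (A / \<omega> * (norm (abs_L2 f))\<^sup>2)
          + ennreal (2 * (1 / (1 - \<tau>\<^sup>2))) * (\<Sum>j<n. ennreal (1 / (\<tau>\<^sup>2) ^ j) * ennreal (K0 * E * ((\<tau>\<^sup>2) ^ j * (\<tau>\<^sup>2) ^ j)))"
        by (intro add_mono mult_left_mono sum_mono A0_bound D_bound) auto
      also have "(\<Sum>j<n. ennreal (1 / (\<tau>\<^sup>2) ^ j) * ennreal (K0 * E * ((\<tau>\<^sup>2) ^ j * (\<tau>\<^sup>2) ^ j))) \<le> ennreal (K0 * E * (1 / (1 - \<tau>\<^sup>2)))"
      proof -
        have "ennreal (1 / (\<tau>\<^sup>2) ^ j) * ennreal (K0 * E * ((\<tau>\<^sup>2) ^ j * (\<tau>\<^sup>2) ^ j)) = ennreal (K0 * E * (\<tau>\<^sup>2) ^ j)" for j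
          using K0 E0 \<tau>(1) by (subst ennreal_le_mult_fold) auto
        then have "(\<Sum>j<n. ennreal (1 / (\<tau>\<^sup>2) ^ j) * ennreal (K0 * E * ((\<tau>\<^sup>2) ^ j * (\<tau>\<^sup>2) ^ j))) = ennreal (\<Sum>j<n. K0 * E * (\<tau>\<^sup>2) ^ j)"
          using K0 E0 t2 by (simp add: sum_ennreal)
        also have "\<dots> \<le> ennreal (K0 * E * (1 / (1 - \<tau>\<^sup>2)))"
        proof (rule ennreal_leI)
          have "(\<Sum>j<n. (\<tau>\<^sup>2) ^ j) \<le> (\<Sum>j. (\<tau>\<^sup>2) ^ j)"
            using t2 by (intro sum_le_suminf summable_geometric) auto
          also have "\<dots> = 1 / (1 - \<tau>\<^sup>2)" using t2 by (intro suminf_geometric) simp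
          finally show "(\<Sum>j<n. K0 * E * (\<tau>\<^sup>2) ^ j) \<le> K0 * E * (1 / (1 - \<tau>\<^sup>2))"
            unfolding sum_distrib_left[symmetric] using K0 E0 by (intro mult_left_mono) auto
        qed
        finally show ?thesis .
      qed
      also have "ennreal 2 * ennreal (A / \<omega> * (norm (abs_L2 f))\<^sup>2) + ennreal (2 * (1 / (1 - \<tau>\<^sup>2))) * ennreal (K0 * E * (1 / (1 - \<tau>\<^sup>2)))
        = ennreal (2 * (A / \<omega> * (norm (abs_L2 f))\<^sup>2) + 2 * (1 / (1 - \<tau>\<^sup>2)) * (K0 * E * (1 / (1 - \<tau>\<^sup>2))))"
      proof -
        have "0 \<le> A / \<omega> * (norm (abs_L2 f))\<^sup>2" "0 \<le> K0 * E * (1 / (1 - \<tau>\<^sup>2))" "0 \<le> 2 * (1 / (1 - \<tau>\<^sup>2))"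
          using A \<omega> K0 E0 t2 by auto
        then show ?thesis by (simp only: ennreal_le_mult_fold ennreal_plus zero_le_numeral mult_nonneg_nonneg)
      qed
      also have "\<dots> \<le> ennreal (C * ((norm (abs_L2 f))\<^sup>2 + E))"
      proof (rule ennreal_leI)
        have "0 \<le> 2 * (A / \<omega>) * E" "0 \<le> 2 * (1 / (1 - \<tau>\<^sup>2)) * (K0 * (1 / (1 - \<tau>\<^sup>2))) * (norm (abs_L2 f))\<^sup>2"
          using A \<omega> K0 E0 t2 by auto
        moreover have "2 * (b * P) + c * (K0 * E * e) \<le> (2 * b + c * (K0 * e)) * (P + E)"
          if "0 \<le> 2 * b * E" "0 \<le> c * (K0 * e) * P" for b c e P :: real
          using that by (simp add: algebra_simps)
        ultimately show "2 * (A / \<omega> * (norm (abs_L2 f))\<^sup>2) + 2 * (1 / (1 - \<tau>\<^sup>2)) * (K0 * E * (1 / (1 - \<tau>\<^sup>2))) \<le> C * ((norm (abs_L2 f))\<^sup>2 + E)"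
          unfolding C_def by blast
      qed
      finally show ?thesis by (simp add: add_left_mono mult_left_mono)
    qed
    \<comment> \<open>Fatou as the radius tends to 0: the averages converge at every point and the
      bounds do not depend on \<open>n\<close>.\<close>
    have "(\<integral>\<^sup>+x. ennreal (W x) * ennreal ((f x)\<^sup>2) \<partial>lborel) = (\<integral>\<^sup>+x. liminf (\<lambda>n. ennreal (W x) * ennreal ((Av n x)\<^sup>2)) \<partial>lborel)"
    proof (rule nn_integral_cong)
      fix x
      have "(\<lambda>n. ennreal (W x) * ennreal ((Av n x)\<^sup>2)) \<longlonglongrightarrow> ennreal (W x) * ennreal ((f x)\<^sup>2)"
        unfolding Av_def by (intro ennreal_tendsto_cmult tendsto_ennrealI tendsto_power ball_avg_tendsto f) simp
      from lim_imp_Liminf[OF sequentially_bot this]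
      show "ennreal (W x) * ennreal ((f x)\<^sup>2) = liminf (\<lambda>n. ennreal (W x) * ennreal ((Av n x)\<^sup>2))" by simp
    qed
    also have "\<dots> \<le> liminf (\<lambda>n. \<integral>\<^sup>+x. ennreal (W x) * ennreal ((Av n x)\<^sup>2) \<partial>lborel)"
      by (rule nn_integral_liminf) measurable
    also have "\<dots> \<le> ennreal (C * ((norm (abs_L2 f))\<^sup>2 + E))"
      using Av_bound by (intro Liminf_le always_eventually allI) simp_all
    finally show ?thesis by (simp add: E_def)
  qed
  show ?thesis by (rule that[OF C0 main])
qed

section \<open>Coercivity for bounded potentials\<close>

text \<open>The mass of \<open>W\<close> around each point bounds the squared norm by a double
  integral of W(x+y) f(x)^2 over |y| < R. There f(x)^2 \<le> 2 f(x+y)^2 + 2 (f(x+y) - f(x))^2: the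
  first part gives the potential term times the volume of the ball, the second the bound of
  \<open>W\<close> times translation differences, hence times the energy.\<close>

theorem coercivity:
  fixes W :: "'a::euclidean_space \<Rightarrow> real"
  assumes [measurable]: "W \<in> borel_measurable borel" and \<mu>: "0 < \<mu>" "\<mu> \<le> 1"
    and M: "0 \<le> M" "\<And>x. W x \<le> M" and c: "0 < c" and R: "0 < R"
    and lower: "\<And>p. ennreal c \<le> (\<integral>\<^sup>+x. ennreal (W x) * indicator (ball p R) x \<partial>lborel)"
  obtains \<kappa> where "0 < \<kappa>" "\<And>f. lip_compact_supp f \<Longrightarrow>
    ennreal (\<kappa> * (norm (abs_L2 f))\<^sup>2) \<le> ennreal (frac_energy \<mu> f) + (\<integral>\<^sup>+x. ennreal (W x) * ennreal ((f x)\<^sup>2) \<partial>lborel)"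
proof -
  define v where "v = measure lborel (ball (0::'a) R)"
  have v: "v > 0" unfolding v_def by (rule measure_ball_pos[OF R])
  \<comment> \<open>The larger of the coefficients of the potential term and of the energy; 8 is 2
    times the 4 of the translation estimate.\<close>
  define H where "H = max (2 * v) (8 * M * (R powr \<mu>)\<^sup>2 * v)"
  have H: "H > 0" using v by (simp add: H_def)
  have main: "ennreal (c * (norm (abs_L2 f))\<^sup>2) \<le> ennreal H * (ennreal (frac_energy \<mu> f) + (\<integral>\<^sup>+x. ennreal (W x) * ennreal ((f x)\<^sup>2) \<partial>lborel))"
    if f: "lip_compact_supp f" for f
  proof -
    have [measurable]: "f \<in> borel_measurable borel" by (rule lip_measurable[OF f])
    define E where "E = frac_energy \<mu> f"
    define Q where "Q = (\<integral>\<^sup>+x. ennreal (W x) * ennreal ((f x)\<^sup>2) \<partial>lborel)"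
    have lower': "ennreal c \<le> (\<integral>\<^sup>+y. indicator (ball 0 R) y * ennreal (W (x + y)) \<partial>lborel)" for x
    proof -
      have "(\<integral>\<^sup>+y. indicator (ball 0 R) y * ennreal (W (x + y)) \<partial>lborel) = (\<integral>\<^sup>+p. indicator (ball 0 R) (p - x) * ennreal (W p) \<partial>lborel)"
        using lborel_nn_integral_shift[of "\<lambda>p. indicator (ball 0 R) (p - x) * ennreal (W p)" x] by simp
      also have "\<dots> = (\<integral>\<^sup>+p. ennreal (W p) * indicator (ball x R) p \<partial>lborel)"
        by (rule nn_integral_cong) (simp add: indicator_def dist_norm norm_minus_commute)
      finally show ?thesis using lower[of x] by simp
    qed
    have "ennreal (c * (norm (abs_L2 f))\<^sup>2) = ennreal c * (\<integral>\<^sup>+x. ennreal ((f x)\<^sup>2) \<partial>lborel)"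
      using nn_integral_abs_L2[OF lip_sq_integrable[OF f]] c by (simp add: nn_integral_completion ennreal_mult)
    also have "\<dots> = (\<integral>\<^sup>+x. ennreal c * ennreal ((f x)\<^sup>2) \<partial>lborel)"
      by (rule nn_integral_cmult[symmetric]) measurable
    also have "\<dots> \<le> (\<integral>\<^sup>+x. (\<integral>\<^sup>+y. indicator (ball 0 R) y * ennreal (W (x + y)) \<partial>lborel) * ennreal ((f x)\<^sup>2) \<partial>lborel)"
      by (intro nn_integral_mono mult_right_mono lower') simp
    also have "\<dots> = (\<integral>\<^sup>+x. (\<integral>\<^sup>+y. indicator (ball 0 R) y * ennreal (W (x + y)) * ennreal ((f x)\<^sup>2) \<partial>lborel) \<partial>lborel)"
      by (rule nn_integral_cong, rule nn_integral_multc[symmetric]) measurable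
    also have "\<dots> = (\<integral>\<^sup>+y. (\<integral>\<^sup>+x. indicator (ball 0 R) y * ennreal (W (x + y)) * ennreal ((f x)\<^sup>2) \<partial>lborel) \<partial>lborel)"
      by (rule lborel_pair.Fubini') measurable
    also have "\<dots> \<le> (\<integral>\<^sup>+y. (ennreal 2 * Q + ennreal (8 * M * (R powr \<mu>)\<^sup>2 * E)) * indicator (ball (0::'a) R) y \<partial>lborel)"
    proof (rule nn_integral_mono)
      fix y :: 'a
      show "(\<integral>\<^sup>+x. indicator (ball 0 R) y * ennreal (W (x + y)) * ennreal ((f x)\<^sup>2) \<partial>lborel)
        \<le> (ennreal 2 * Q + ennreal (8 * M * (R powr \<mu>)\<^sup>2 * E)) * indicator (ball (0::'a) R) y"
      proof (cases "y \<in> ball 0 R")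
        case True
        have "(\<integral>\<^sup>+x. ennreal (W (x + y)) * ennreal ((f x)\<^sup>2) \<partial>lborel)
          \<le> (\<integral>\<^sup>+x. ennreal 2 * (ennreal (W (x + y)) * ennreal ((f (x + y))\<^sup>2)) + ennreal (2 * M) * ennreal ((f (x + y) - f x)\<^sup>2) \<partial>lborel)"
        proof (rule nn_integral_mono)
          fix x
          have "(f x)\<^sup>2 \<le> 2 * (f (x + y))\<^sup>2 + 2 * (f (x + y) - f x)\<^sup>2"
            using zero_le_power2[of "2 * f (x + y) - f x"] by (simp add: power2_eq_square algebra_simps)
          then have "ennreal ((f x)\<^sup>2) \<le> ennreal (2 * (f (x + y))\<^sup>2 + 2 * (f (x + y) - f x)\<^sup>2)" by (rule ennreal_leI)
          also have "\<dots> = ennreal 2 * ennreal ((f (x + y))\<^sup>2) + ennreal 2 * ennreal ((f (x + y) - f x)\<^sup>2)"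
            by (simp only: ennreal_le_mult_fold ennreal_plus zero_le_power2 zero_le_numeral mult_nonneg_nonneg)
          finally have "ennreal (W (x + y)) * ennreal ((f x)\<^sup>2)
            \<le> ennreal (W (x + y)) * (ennreal 2 * ennreal ((f (x + y))\<^sup>2) + ennreal 2 * ennreal ((f (x + y) - f x)\<^sup>2))"
            by (rule mult_left_mono) simp
          also have "\<dots> = ennreal 2 * (ennreal (W (x + y)) * ennreal ((f (x + y))\<^sup>2)) + ennreal 2 * (ennreal (W (x + y)) * ennreal ((f (x + y) - f x)\<^sup>2))"
            by (simp only: distrib_left mult.left_commute)
          also have "\<dots> \<le> ennreal 2 * (ennreal (W (x + y)) * ennreal ((f (x + y))\<^sup>2)) + ennreal 2 * (ennreal M * ennreal ((f (x + y) - f x)\<^sup>2))"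
            by (intro add_left_mono mult_left_mono mult_right_mono ennreal_leI M) auto
          also have "ennreal 2 * (ennreal M * ennreal ((f (x + y) - f x)\<^sup>2)) = ennreal (2 * M) * ennreal ((f (x + y) - f x)\<^sup>2)"
            using M(1) by (simp only: ennreal_mult zero_le_numeral mult.assoc)
          finally show "ennreal (W (x + y)) * ennreal ((f x)\<^sup>2)
            \<le> ennreal 2 * (ennreal (W (x + y)) * ennreal ((f (x + y))\<^sup>2)) + ennreal (2 * M) * ennreal ((f (x + y) - f x)\<^sup>2)" .
        qed
        also have "\<dots> = ennreal 2 * (\<integral>\<^sup>+x. ennreal (W (x + y)) * ennreal ((f (x + y))\<^sup>2) \<partial>lborel) + ennreal (2 * M) * (\<integral>\<^sup>+x. ennreal ((f (x + y) - f x)\<^sup>2) \<partial>lborel)"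
          by (subst nn_integral_add, measurable, subst nn_integral_cmult, measurable, subst nn_integral_cmult, measurable)
        also have "(\<integral>\<^sup>+x. ennreal (W (x + y)) * ennreal ((f (x + y))\<^sup>2) \<partial>lborel) = Q"
          unfolding Q_def by (rule lborel_nn_integral_shift'[of "\<lambda>x. ennreal (W x) * ennreal ((f x)\<^sup>2)"]) measurable
        also have "(\<integral>\<^sup>+x. ennreal ((f (x + y) - f x)\<^sup>2) \<partial>lborel) \<le> ennreal (4 * (R powr \<mu>)\<^sup>2 * E)"
        proof (rule order_trans[OF translation_estimate[OF f \<mu>]])
          show "ennreal (4 * (norm y powr \<mu>)\<^sup>2 * frac_energy \<mu> f) \<le> ennreal (4 * (R powr \<mu>)\<^sup>2 * E)"
            unfolding E_def using True \<mu>(1) by (intro ennreal_leI mult_right_mono mult_left_mono power_mono powr_mono2) auto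
        qed
        also have "ennreal (2 * M) * ennreal (4 * (R powr \<mu>)\<^sup>2 * E) = ennreal (8 * M * (R powr \<mu>)\<^sup>2 * E)"
          using M(1) by (subst ennreal_le_mult_fold) (auto simp: E_def)
        finally have "(\<integral>\<^sup>+x. ennreal (W (x + y)) * ennreal ((f x)\<^sup>2) \<partial>lborel) \<le> ennreal 2 * Q + ennreal (8 * M * (R powr \<mu>)\<^sup>2 * E)"
          by (simp add: add_left_mono mult_left_mono)
        then show ?thesis using True by simp
      qed simp
    qed
    also have "\<dots> = (ennreal 2 * Q + ennreal (8 * M * (R powr \<mu>)\<^sup>2 * E)) * ennreal v"
      by (subst nn_integral_cmult_indicator) (simp_all add: emeasure_ball_measure v_def)
    also have "\<dots> = ennreal (2 * v) * Q + ennreal (8 * M * (R powr \<mu>)\<^sup>2 * v) * ennreal E"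
    proof -
      have "ennreal 2 * Q * ennreal v = ennreal (2 * v) * Q"
        using v by (simp only: ennreal_mult zero_le_numeral less_imp_le mult_ac)
      moreover have "ennreal (8 * M * (R powr \<mu>)\<^sup>2 * E) * ennreal v = ennreal (8 * M * (R powr \<mu>)\<^sup>2 * v) * ennreal E"
        using v M(1) by (subst (1 2) ennreal_le_mult_fold) (auto simp: E_def mult_ac)
      ultimately show ?thesis by (simp only: distrib_right)
    qed
    also have "\<dots> \<le> ennreal H * Q + ennreal H * ennreal E"
      by (intro add_mono mult_right_mono ennreal_leI) (auto simp: H_def)
    also have "\<dots> = ennreal H * (ennreal E + Q)" by (simp only: distrib_left add.commute)
    finally show ?thesis by (simp only: E_def Q_def)
  qed
  show ?thesis
  proof (rule that[of "c / H"])
    show "0 < c / H" using c H by simp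
    fix f :: "'a \<Rightarrow> real" assume f: "lip_compact_supp f"
    let ?X = "ennreal (frac_energy \<mu> f) + (\<integral>\<^sup>+x. ennreal (W x) * ennreal ((f x)\<^sup>2) \<partial>lborel)"
    have "ennreal (c / H * (norm (abs_L2 f))\<^sup>2) = ennreal (1 / H) * ennreal (c * (norm (abs_L2 f))\<^sup>2)"
      using c H by (subst ennreal_le_mult_fold) auto
    also have "\<dots> \<le> ennreal (1 / H) * (ennreal H * ?X)" by (intro mult_left_mono main f) simp
    also have "\<dots> = ?X" using H by (simp add: mult.assoc[symmetric] ennreal_le_mult_fold)
    finally show "ennreal (c / H * (norm (abs_L2 f))\<^sup>2) \<le> ?X" .
  qed
qed

section \<open>The Schroedinger form\<close>

text \<open>\<open>W\<close> is a nonnegative Borel version of \<open>V\<close>, on which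
  translations and Tonelli in \<open>lborel\<close> are available; the integrability class of
  \<open>V\<close> enters through the concentration bound.\<close>

locale schroedinger_potential =
  fixes \<mu> :: real and V W :: "'a::euclidean_space \<Rightarrow> real" and A \<beta> :: real
  assumes mu: "0 < \<mu>" "\<mu> \<le> 1"
    and V_measurable [measurable]: "V \<in> borel_measurable lebesgue"
    and W_borel [measurable]: "W \<in> borel_measurable borel"
    and V_eq_W: "AE x in lebesgue. V x = W x"
    and W_nonneg: "\<And>x. 0 \<le> W x"
    and A_nonneg: "0 \<le> A"
    and beta: "\<beta> > real DIM('a) - 2 * \<mu>"
    and concentration: "\<And>p r. 0 < r \<Longrightarrow> r \<le> 1 \<Longrightarrow>
      (\<integral>\<^sup>+x. ennreal (W x) * indicator (ball p r) x \<partial>lborel) \<le> ennreal (A * r powr \<beta>)"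
begin

lemma W_measurable [measurable]: "W \<in> borel_measurable lebesgue"
  by (rule measurable_completion) simp

text \<open>\<open>form_bound\<close> speaks of Lipschitz functions; approximation in the Bessel
  space and Fatou along an almost everywhere convergent subsequence carry it over.\<close>

lemma potential_term_bound:
  "\<exists>C\<ge>0. \<forall>u\<in>bessel_space \<mu>. (\<integral>\<^sup>+x. ennreal (W x * (rep_L2 u x)\<^sup>2) \<partial>lebesgue)
    \<le> ennreal (C * ((norm u)\<^sup>2 + (norm (frac_laplacian (\<mu> / 2) u))\<^sup>2))"
proof (rule form_bound[OF W_borel mu A_nonneg beta])
  show "(\<integral>\<^sup>+x. ennreal (W x) * indicator (ball p r) x \<partial>lborel) \<le> ennreal (A * r powr \<beta>)"
    if "0 < r" "r \<le> 1" for p r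
    using that by (rule concentration)
next
  fix C :: real
  assume C: "0 \<le> C" "\<And>f. lip_compact_supp f \<Longrightarrow>
      (\<integral>\<^sup>+x. ennreal (W x) * ennreal ((f x)\<^sup>2) \<partial>lborel) \<le> ennreal (C * ((norm (abs_L2 f))\<^sup>2 + frac_energy \<mu> f))"
  have "(\<integral>\<^sup>+x. ennreal (W x * (rep_L2 u x)\<^sup>2) \<partial>lebesgue) \<le> ennreal (C * ((norm u)\<^sup>2 + (norm (frac_laplacian (\<mu> / 2) u))\<^sup>2))"
    if u: "u \<in> bessel_space \<mu>" for u
  proof (rule bessel_approximation[OF u mu])
    fix \<phi> assume \<phi>: "\<And>n. \<phi> n \<in> test_functions" "(\<lambda>n. abs_L2 (\<phi> n)) \<longlonglongrightarrow> u"
      "(\<lambda>n. frac_laplacian (\<mu> / 2) (abs_L2 (\<phi> n))) \<longlonglongrightarrow> frac_laplacian (\<mu> / 2) u"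
    obtain r where r: "strict_mono r" "AE x in lebesgue. (\<lambda>n. rep_L2 (abs_L2 (\<phi> (r n))) x) \<longlonglongrightarrow> rep_L2 u x"
      by (rule L2_tendsto_AE_subseq[OF \<phi>(2)])
    define B where "B n = C * ((norm (abs_L2 (\<phi> (r n))))\<^sup>2 + frac_energy \<mu> (\<phi> (r n)))" for n
    have le: "(\<integral>\<^sup>+x. ennreal (W x * (rep_L2 (abs_L2 (\<phi> (r n))) x)\<^sup>2) \<partial>lebesgue) \<le> ennreal (B n)" for n
    proof -
      have lip: "lip_compact_supp (\<phi> (r n))" by (rule test_function_lip[OF \<phi>(1)])
      have "(\<integral>\<^sup>+x. ennreal (W x * (rep_L2 (abs_L2 (\<phi> (r n))) x)\<^sup>2) \<partial>lebesgue)
          = (\<integral>\<^sup>+x. ennreal (W x) * ennreal ((\<phi> (r n) x)\<^sup>2) \<partial>lebesgue)"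
        by (intro nn_integral_cong_AE, use rep_abs_L2[OF lip_sq_integrable[OF lip]] in eventually_elim) (simp add: ennreal_mult W_nonneg)
      then show ?thesis using C(2)[OF lip] by (simp add: nn_integral_completion B_def)
    qed
    have "(\<integral>\<^sup>+x. ennreal (W x * (rep_L2 u x)\<^sup>2) \<partial>lebesgue)
        = (\<integral>\<^sup>+x. liminf (\<lambda>n. ennreal (W x * (rep_L2 (abs_L2 (\<phi> (r n))) x)\<^sup>2)) \<partial>lebesgue)"
    proof (rule nn_integral_cong_AE)
      show "AE x in lebesgue. ennreal (W x * (rep_L2 u x)\<^sup>2)
          = liminf (\<lambda>n. ennreal (W x * (rep_L2 (abs_L2 (\<phi> (r n))) x)\<^sup>2))"
        using r(2)
      proof eventually_elim
        case (elim x)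
        then have "(\<lambda>n. ennreal (W x * (rep_L2 (abs_L2 (\<phi> (r n))) x)\<^sup>2)) \<longlonglongrightarrow> ennreal (W x * (rep_L2 u x)\<^sup>2)"
          by (intro tendsto_ennrealI tendsto_intros)
        from lim_imp_Liminf[OF sequentially_bot this] show ?case by simp
      qed
    qed
    also have "\<dots> \<le> liminf (\<lambda>n. \<integral>\<^sup>+x. ennreal (W x * (rep_L2 (abs_L2 (\<phi> (r n))) x)\<^sup>2) \<partial>lebesgue)"
      by (rule nn_integral_liminf) measurable
    also have "\<dots> \<le> liminf (\<lambda>n. ennreal (B n))"
      by (rule Liminf_mono) (simp add: le)
    also have "\<dots> = ennreal (C * ((norm u)\<^sup>2 + (norm (frac_laplacian (\<mu> / 2) u))\<^sup>2))"
    proof -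
      have "(\<lambda>n. ennreal (B n)) \<longlonglongrightarrow> ennreal (C * ((norm u)\<^sup>2 + (norm (frac_laplacian (\<mu> / 2) u))\<^sup>2))"
        unfolding B_def
        using LIMSEQ_subseq_LIMSEQ[OF \<phi>(2) r(1)] LIMSEQ_subseq_LIMSEQ[OF \<phi>(3) r(1)]
        by (intro tendsto_ennrealI tendsto_intros) (simp_all add: o_def)
      from lim_imp_Liminf[OF sequentially_bot this] show ?thesis .
    qed
    finally show ?thesis .
  qed
  then show ?thesis using C(1) by blast
qed

lemma integrable_potential_sq:
  assumes "u \<in> bessel_space \<mu>"
  shows "integrable lebesgue (\<lambda>x. W x * (rep_L2 u x)\<^sup>2)"
proof -
  obtain C where "0 \<le> C" "\<And>u. u \<in> bessel_space \<mu> \<Longrightarrow>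
    (\<integral>\<^sup>+x. ennreal (W x * (rep_L2 u x)\<^sup>2) \<partial>lebesgue) \<le> ennreal (C * ((norm u)\<^sup>2 + (norm (frac_laplacian (\<mu> / 2) u))\<^sup>2))"
    using potential_term_bound by blast
  from this(2)[OF assms] show ?thesis
    by (intro integrableI_nonneg) (auto simp: W_nonneg elim: le_less_trans)
qed

text \<open>A Bochner integral without integrability would silently be 0; this makes the potential
  part of the form genuine, and additive in each argument.\<close>

lemma integrable_potential:
  assumes u: "u \<in> bessel_space \<mu>" and v: "v \<in> bessel_space \<mu>"
  shows "integrable lebesgue (\<lambda>x. V x * rep_L2 u x * rep_L2 v x)"
proof (rule Bochner_Integration.integrable_bound)
  show "integrable lebesgue (\<lambda>x. W x * (rep_L2 u x)\<^sup>2 + W x * (rep_L2 v x)\<^sup>2)"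
    by (intro Bochner_Integration.integrable_add integrable_potential_sq u v)
  show "AE x in lebesgue. norm (V x * rep_L2 u x * rep_L2 v x) \<le> norm (W x * (rep_L2 u x)\<^sup>2 + W x * (rep_L2 v x)\<^sup>2)"
    using V_eq_W
  proof eventually_elim
    case (elim x)
    have "\<bar>a * b\<bar> \<le> a\<^sup>2 + b\<^sup>2" for a b :: real
      using sum_squares_bound[of "\<bar>a\<bar>" "\<bar>b\<bar>"] mult_nonneg_nonneg[of "\<bar>a\<bar>" "\<bar>b\<bar>"]
      unfolding abs_mult power2_abs by linarith
    from mult_left_mono[OF this W_nonneg[of x]]
    show ?case using elim W_nonneg[of x] by (simp add: abs_mult distrib_left mult.assoc)
  qed
qed measurable

abbreviation form where "form \<equiv> schroedinger_form \<mu> V"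

lemma form_alt:
  "form u v = frac_laplacian (\<mu> / 2) u \<bullet> frac_laplacian (\<mu> / 2) v + (\<integral>x. V x * rep_L2 u x * rep_L2 v x \<partial>lebesgue)"
  by (simp add: schroedinger_form_def inner_L2.rep_eq)

lemma form_commute: "form u v = form v u"
  by (simp add: schroedinger_form_def ac_simps)

lemma form_add_left:
  assumes u: "u \<in> bessel_space \<mu>" and v: "v \<in> bessel_space \<mu>" and w: "w \<in> bessel_space \<mu>"
  shows "form (u + v) w = form u w + form v w"
proof -
  have "(\<integral>x. V x * rep_L2 (u + v) x * rep_L2 w x \<partial>lebesgue)
      = (\<integral>x. V x * rep_L2 u x * rep_L2 w x + V x * rep_L2 v x * rep_L2 w x \<partial>lebesgue)"
  proof (rule integral_cong_AE)
    show "AE x in lebesgue. V x * rep_L2 (u + v) x * rep_L2 w x = V x * rep_L2 u x * rep_L2 w x + V x * rep_L2 v x * rep_L2 w x"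
      using rep_L2_add[of u v] by eventually_elim (simp add: algebra_simps)
  qed measurable
  also have "\<dots> = (\<integral>x. V x * rep_L2 u x * rep_L2 w x \<partial>lebesgue) + (\<integral>x. V x * rep_L2 v x * rep_L2 w x \<partial>lebesgue)"
    by (intro Bochner_Integration.integral_add integrable_potential u v w)
  finally show ?thesis
    by (simp add: form_alt frac_laplacian_add[OF u v mu(1)] inner_add_left)
qed

lemma form_scaleR_left:
  assumes u: "u \<in> bessel_space \<mu>"
  shows "form (c *\<^sub>R u) w = c * form u w"
proof -
  have "(\<integral>x. V x * rep_L2 (c *\<^sub>R u) x * rep_L2 w x \<partial>lebesgue) = (\<integral>x. c * (V x * rep_L2 u x * rep_L2 w x) \<partial>lebesgue)"
  proof (rule integral_cong_AE)
    show "AE x in lebesgue. V x * rep_L2 (c *\<^sub>R u) x * rep_L2 w x = c * (V x * rep_L2 u x * rep_L2 w x)"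
      using rep_L2_scaleR[of c u] by eventually_elim simp
  qed measurable
  then show ?thesis
    by (simp add: form_alt frac_laplacian_scaleR[OF u mu(1)] distrib_left)
qed

lemma form_self:
  "form u u = (norm (frac_laplacian (\<mu> / 2) u))\<^sup>2 + (\<integral>x. W x * (rep_L2 u x)\<^sup>2 \<partial>lebesgue)"
proof -
  have "(\<integral>x. V x * rep_L2 u x * rep_L2 u x \<partial>lebesgue) = (\<integral>x. W x * (rep_L2 u x)\<^sup>2 \<partial>lebesgue)"
  proof (rule integral_cong_AE)
    show "AE x in lebesgue. V x * rep_L2 u x * rep_L2 u x = W x * (rep_L2 u x)\<^sup>2"
      using V_eq_W by eventually_elim (simp add: power2_eq_square)
  qed measurable
  then show ?thesis by (simp add: form_alt power2_norm_eq_inner)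
qed

lemma form_nonneg: "0 \<le> form u u"
  unfolding form_self by (intro add_nonneg_nonneg integral_nonneg_AE AE_I2) (auto simp: W_nonneg)

lemma form_bounded:
  "\<exists>C. \<forall>u\<in>bessel_space \<mu>. form u u \<le> C * ((norm u)\<^sup>2 + (norm (frac_laplacian (\<mu> / 2) u))\<^sup>2)"
proof -
  obtain C where C: "0 \<le> C" "\<And>u. u \<in> bessel_space \<mu> \<Longrightarrow>
    (\<integral>\<^sup>+x. ennreal (W x * (rep_L2 u x)\<^sup>2) \<partial>lebesgue) \<le> ennreal (C * ((norm u)\<^sup>2 + (norm (frac_laplacian (\<mu> / 2) u))\<^sup>2))"
    using potential_term_bound by blast
  have "form u u \<le> (C + 1) * ((norm u)\<^sup>2 + (norm (frac_laplacian (\<mu> / 2) u))\<^sup>2)" if u: "u \<in> bessel_space \<mu>" for u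
  proof -
    have "ennreal (\<integral>x. W x * (rep_L2 u x)\<^sup>2 \<partial>lebesgue) = (\<integral>\<^sup>+x. ennreal (W x * (rep_L2 u x)\<^sup>2) \<partial>lebesgue)"
      by (rule nn_integral_eq_integral[symmetric, OF integrable_potential_sq[OF u]]) (simp add: W_nonneg)
    then have "(\<integral>x. W x * (rep_L2 u x)\<^sup>2 \<partial>lebesgue) \<le> C * ((norm u)\<^sup>2 + (norm (frac_laplacian (\<mu> / 2) u))\<^sup>2)"
      using C(2)[OF u] C(1) by (subst ennreal_le_iff[symmetric]) simp_all
    then show ?thesis unfolding form_self by (simp add: distrib_right add_increasing2)
  qed
  then show ?thesis by blast
qed

lemma form_Cauchy_Schwarz:
  assumes u: "u \<in> bessel_space \<mu>" and v: "v \<in> bessel_space \<mu>"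
  shows "(form u v)\<^sup>2 \<le> form u u * form v v"
proof (rule discriminant_le)
  fix c
  have cv: "c *\<^sub>R v \<in> bessel_space \<mu>" and s: "u + c *\<^sub>R v \<in> bessel_space \<mu>"
    using subspace_bessel u v by (auto intro: subspace_scale subspace_add)
  have "form (u + c *\<^sub>R v) (u + c *\<^sub>R v) = form u (u + c *\<^sub>R v) + c * form v (u + c *\<^sub>R v)"
    by (simp add: form_add_left[OF u cv s] form_scaleR_left[OF v])
  also have "form u (u + c *\<^sub>R v) = form u u + c * form u v"
    unfolding form_commute[of u "u + c *\<^sub>R v"] by (simp add: form_add_left[OF u cv u] form_scaleR_left[OF v] form_commute[of v u])
  also have "form v (u + c *\<^sub>R v) = form u v + c * form v v"
    unfolding form_commute[of v "u + c *\<^sub>R v"] by (simp add: form_add_left[OF u cv v] form_scaleR_left[OF v])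
  finally show "0 \<le> form u u + 2 * c * form u v + c\<^sup>2 * form v v"
    using form_nonneg[of "u + c *\<^sub>R v"] by (simp add: algebra_simps power2_eq_square)
qed (rule form_nonneg)

text \<open>With \<open>d n = X n - u\<close>, the value of the form on \<open>d n\<close> tends to
  0 by its boundedness, and the cross term by Cauchy-Schwarz.\<close>

lemma form_tendsto:
  assumes X: "\<And>n. X n \<in> bessel_space \<mu>" "X \<longlonglongrightarrow> u" and u: "u \<in> bessel_space \<mu>"
    and LX: "(\<lambda>n. frac_laplacian (\<mu> / 2) (X n)) \<longlonglongrightarrow> frac_laplacian (\<mu> / 2) u"
  shows "(\<lambda>n. form (X n) (X n)) \<longlonglongrightarrow> form u u"
proof -
  define d where "d n = X n - u" for n
  have d: "d n \<in> bessel_space \<mu>" for n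
    unfolding d_def by (rule subspace_diff[OF subspace_bessel X(1) u])
  have Xd: "X n = u + d n" for n by (simp add: d_def)
  have Ld: "frac_laplacian (\<mu> / 2) (d n) = frac_laplacian (\<mu> / 2) (X n) - frac_laplacian (\<mu> / 2) u" for n
    using frac_laplacian_add[OF u d mu(1), of n] by (simp add: Xd)
  obtain C where C: "\<And>u. u \<in> bessel_space \<mu> \<Longrightarrow> form u u \<le> C * ((norm u)\<^sup>2 + (norm (frac_laplacian (\<mu> / 2) u))\<^sup>2)"
    using form_bounded by blast
  have lim: "(\<lambda>n. C * ((norm (d n))\<^sup>2 + (norm (frac_laplacian (\<mu> / 2) (d n)))\<^sup>2)) \<longlonglongrightarrow> C * ((norm (u - u))\<^sup>2 + (norm (frac_laplacian (\<mu> / 2) u - frac_laplacian (\<mu> / 2) u))\<^sup>2)"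
    unfolding Ld unfolding d_def by (intro tendsto_intros X LX)
  have dd: "(\<lambda>n. form (d n) (d n)) \<longlonglongrightarrow> 0"
  proof (rule tendsto_sandwich[OF _ _ tendsto_const])
    show "(\<lambda>n. C * ((norm (d n))\<^sup>2 + (norm (frac_laplacian (\<mu> / 2) (d n)))\<^sup>2)) \<longlonglongrightarrow> 0"
      using lim by simp
  qed (auto intro: always_eventually C[OF d] form_nonneg)
  have ud: "(\<lambda>n. form u (d n)) \<longlonglongrightarrow> 0"
  proof (rule Lim_null_comparison)
    show "eventually (\<lambda>n. norm (form u (d n)) \<le> sqrt (form u u * form (d n) (d n))) sequentially"
      using form_Cauchy_Schwarz[OF u d] by (intro always_eventually allI) (simp add: real_le_rsqrt)
    show "(\<lambda>n. sqrt (form u u * form (d n) (d n))) \<longlonglongrightarrow> 0"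
      using tendsto_real_sqrt[OF tendsto_mult_right_zero[OF dd]] by simp
  qed
  have "form (X n) (X n) = form u u + 2 * form u (d n) + form (d n) (d n)" for n
  proof -
    have s: "u + d n \<in> bessel_space \<mu>" by (rule subspace_add[OF subspace_bessel u d])
    have "form (X n) (X n) = form u (u + d n) + form (d n) (u + d n)"
      unfolding Xd by (rule form_add_left[OF u d s])
    also have "form u (u + d n) = form u u + form u (d n)"
      unfolding form_commute[of u "u + d n"] form_add_left[OF u d u] by (simp add: form_commute[of "d n" u])
    also have "form (d n) (u + d n) = form u (d n) + form (d n) (d n)"
      unfolding form_commute[of "d n" "u + d n"] by (rule form_add_left[OF u d d])
    finally show ?thesis by simp
  qed
  moreover have "(\<lambda>n. form u u + 2 * form u (d n) + form (d n) (d n)) \<longlonglongrightarrow> form u u + 2 * 0 + 0"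
    by (intro tendsto_intros ud dd)
  ultimately show ?thesis by simp
qed

section \<open>The variational quantity and the exponential type\<close>

lemma test_in_bessel: "\<phi> \<in> test_functions \<Longrightarrow> abs_L2 \<phi> \<in> bessel_space \<mu>"
  by (rule lip_in_bessel[OF test_function_lip mu(2)])

definition energy_values :: "real set" where
  "energy_values = {form (abs_L2 \<phi>) (abs_L2 \<phi>) | \<phi>. \<phi> \<in> test_functions \<and> norm (abs_L2 \<phi>) = 1}"

text \<open>The potential term of \<open>a_star\<close> integrates \<open>\<phi>\<close> itself,
  that of the form a representative of its class; they agree almost everywhere.\<close>

lemma a_star_eq: "a_star \<mu> V = Inf energy_values"
proof -
  have eq: "(\<integral>x. \<bar>rep_L2 (frac_laplacian (\<mu> / 2) (abs_L2 \<phi>)) x\<bar>\<^sup>2 \<partial>lebesgue) + (\<integral>x. V x * \<bar>\<phi> x\<bar>\<^sup>2 \<partial>lebesgue)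
      = form (abs_L2 \<phi>) (abs_L2 \<phi>)" if "\<phi> \<in> test_functions" for \<phi>
  proof -
    have sq: "sq_integrable \<phi>" by (rule lip_sq_integrable[OF test_function_lip[OF that]])
    have [measurable]: "\<phi> \<in> borel_measurable lebesgue" by (rule sq_integrable_measurable[OF sq])
    have "(\<integral>x. V x * \<bar>\<phi> x\<bar>\<^sup>2 \<partial>lebesgue) = (\<integral>x. V x * rep_L2 (abs_L2 \<phi>) x * rep_L2 (abs_L2 \<phi>) x \<partial>lebesgue)"
    proof (rule integral_cong_AE)
      show "AE x in lebesgue. V x * \<bar>\<phi> x\<bar>\<^sup>2 = V x * rep_L2 (abs_L2 \<phi>) x * rep_L2 (abs_L2 \<phi>) x"
        using rep_abs_L2[OF sq] by eventually_elim (simp add: power2_eq_square)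
    qed measurable
    then show ?thesis by (simp add: schroedinger_form_def power2_eq_square)
  qed
  show ?thesis unfolding a_star_def energy_values_def
    by (intro arg_cong[where f = Inf] Collect_cong ex_cong1) (auto simp only: eq)
qed

lemma normalize_test:
  assumes \<phi>: "\<phi> \<in> test_functions" and n: "norm (abs_L2 \<phi>) \<noteq> 0"
  shows "form (abs_L2 \<phi>) (abs_L2 \<phi>) / (norm (abs_L2 \<phi>))\<^sup>2 \<in> energy_values"
proof -
  let ?c = "1 / norm (abs_L2 \<phi>)"
  have b: "abs_L2 \<phi> \<in> bessel_space \<mu>" by (rule test_in_bessel[OF \<phi>])
  have cb: "?c *\<^sub>R abs_L2 \<phi> \<in> bessel_space \<mu>" by (rule subspace_scale[OF subspace_bessel b])
  have eq: "abs_L2 (\<lambda>x. ?c * \<phi> x) = ?c *\<^sub>R abs_L2 \<phi>"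
    using abs_L2_scaleR[OF lip_sq_integrable[OF test_function_lip[OF \<phi>]], of ?c] by simp
  have "form (?c *\<^sub>R abs_L2 \<phi>) (?c *\<^sub>R abs_L2 \<phi>) = ?c * (?c * form (abs_L2 \<phi>) (abs_L2 \<phi>))"
    unfolding form_scaleR_left[OF b] form_commute[of "abs_L2 \<phi>" "?c *\<^sub>R abs_L2 \<phi>"] by (rule refl)
  then have "form (abs_L2 \<phi>) (abs_L2 \<phi>) / (norm (abs_L2 \<phi>))\<^sup>2 = form (abs_L2 (\<lambda>x. ?c * \<phi> x)) (abs_L2 (\<lambda>x. ?c * \<phi> x))"
    unfolding eq by (simp add: power2_eq_square)
  moreover have "norm (abs_L2 (\<lambda>x. ?c * \<phi> x)) = 1" unfolding eq using n by simp
  ultimately show ?thesis unfolding energy_values_def using test_functions_cmult[OF \<phi>, of ?c] by blast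
qed

text \<open>The bump is at least exp(-2) on the concentric ball of half the radius.\<close>

lemma bump_norm_ge:
  fixes x\<^sub>0 :: "'a" assumes R: "0 < R"
  shows "exp (- 4) * measure lborel (ball x\<^sub>0 (R / 2)) \<le> (norm (abs_L2 (\<lambda>x. bump ((1 / R) *\<^sub>R (x - x\<^sub>0)))))\<^sup>2"
proof -
  let ?f = "\<lambda>x. bump ((1 / R) *\<^sub>R (x - x\<^sub>0))"
  have lip: "lip_compact_supp ?f" by (rule test_function_lip[OF bump_test_function]) (use R in simp)
  have "ennreal (exp (- 4) * measure lborel (ball x\<^sub>0 (R / 2))) = (\<integral>\<^sup>+x. ennreal (exp (- 4)) * indicator (ball x\<^sub>0 (R / 2)) x \<partial>lborel)"
    by (subst nn_integral_cmult_indicator) (simp_all add: emeasure_ball_measure ennreal_mult)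
  also have "\<dots> \<le> (\<integral>\<^sup>+x. ennreal ((?f x)\<^sup>2) \<partial>lborel)"
  proof (rule nn_integral_mono)
    fix x
    show "ennreal (exp (- 4)) * indicator (ball x\<^sub>0 (R / 2)) x \<le> ennreal ((?f x)\<^sup>2)"
    proof (cases "x \<in> ball x\<^sub>0 (R / 2)")
      case True
      then have "norm ((1 / R) *\<^sub>R (x - x\<^sub>0)) \<le> 1 / 2"
        using R by (simp add: dist_norm norm_minus_commute del: scaleR_right_diff_distrib)
      from bump_ge[OF this] have "(exp (- 2))\<^sup>2 \<le> (?f x)\<^sup>2" by (intro power_mono) auto
      moreover have "(exp (- 2 :: real))\<^sup>2 = exp (- 4)" by (simp add: power2_eq_square exp_add[symmetric])
      ultimately show ?thesis using True by (simp add: ennreal_leI)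
    qed simp
  qed
  also have "\<dots> = ennreal ((norm (abs_L2 ?f))\<^sup>2)"
    using nn_integral_abs_L2[OF lip_sq_integrable[OF lip]] by (simp add: nn_integral_completion)
  finally show ?thesis by simp
qed

lemma energy_values_nonempty: "energy_values \<noteq> {}"
proof -
  let ?f = "\<lambda>x::'a. bump ((1 / 1) *\<^sub>R (x - 0))"
  have "0 < exp (- 4) * measure lborel (ball (0::'a) (1 / 2))"
    by (intro mult_pos_pos measure_ball_pos) simp_all
  also have "\<dots> \<le> (norm (abs_L2 ?f))\<^sup>2" by (rule bump_norm_ge) simp
  finally have "norm (abs_L2 ?f) \<noteq> 0" by (simp only: zero_less_power2 not_False_eq_True)
  from normalize_test[OF bump_test_function[OF divide_pos_pos[OF zero_less_one zero_less_one]] this] show ?thesis by blast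
qed

lemma energy_values_nonneg: "x \<in> energy_values \<Longrightarrow> 0 \<le> x"
  using form_nonneg by (auto simp: energy_values_def)

lemma a_star_nonneg: "0 \<le> a_star \<mu> V"
  unfolding a_star_eq by (rule cInf_greatest[OF energy_values_nonempty energy_values_nonneg])

lemma a_star_lower:
  assumes \<phi>: "\<phi> \<in> test_functions"
  shows "a_star \<mu> V * (norm (abs_L2 \<phi>))\<^sup>2 \<le> form (abs_L2 \<phi>) (abs_L2 \<phi>)"
proof (cases "norm (abs_L2 \<phi>) = 0")
  case False
  have "a_star \<mu> V \<le> form (abs_L2 \<phi>) (abs_L2 \<phi>) / (norm (abs_L2 \<phi>))\<^sup>2"
    unfolding a_star_eq
    by (rule cInf_lower[OF normalize_test[OF \<phi> False]]) (rule bdd_belowI[OF energy_values_nonneg])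
  then show ?thesis using False by (simp add: pos_le_divide_eq)
qed (simp add: form_nonneg)

lemma a_star_greatest:
  assumes "\<And>\<phi>. \<phi> \<in> test_functions \<Longrightarrow> \<kappa> * (norm (abs_L2 \<phi>))\<^sup>2 \<le> form (abs_L2 \<phi>) (abs_L2 \<phi>)"
  shows "\<kappa> \<le> a_star \<mu> V"
  unfolding a_star_eq
proof (rule cInf_greatest[OF energy_values_nonempty])
  fix x assume "x \<in> energy_values"
  then obtain \<phi> where "x = form (abs_L2 \<phi>) (abs_L2 \<phi>)" "\<phi> \<in> test_functions" "norm (abs_L2 \<phi>) = 1"
    by (auto simp: energy_values_def)
  then show "\<kappa> \<le> x" using assms[of \<phi>] by simp
qed

text \<open>The infimum runs over test functions only; continuity of the form under
  \<open>bessel_approximation\<close> extends the bound to the whole form domain, as the semigroup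
  argument requires.\<close>

lemma form_lower:
  assumes u: "u \<in> bessel_space \<mu>"
  shows "a_star \<mu> V * (norm u)\<^sup>2 \<le> form u u"
proof (rule bessel_approximation[OF u mu])
  fix \<phi> assume \<phi>: "\<And>n. \<phi> n \<in> test_functions" "(\<lambda>n. abs_L2 (\<phi> n)) \<longlonglongrightarrow> u"
    "(\<lambda>n. frac_laplacian (\<mu> / 2) (abs_L2 (\<phi> n))) \<longlonglongrightarrow> frac_laplacian (\<mu> / 2) u"
  have "(\<lambda>n. a_star \<mu> V * (norm (abs_L2 (\<phi> n)))\<^sup>2) \<longlonglongrightarrow> a_star \<mu> V * (norm u)\<^sup>2"
    by (intro tendsto_intros \<phi>(2))
  moreover have "(\<lambda>n. form (abs_L2 (\<phi> n)) (abs_L2 (\<phi> n))) \<longlonglongrightarrow> form u u"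
    by (rule form_tendsto[OF test_in_bessel[OF \<phi>(1)] \<phi>(2) u \<phi>(3)])
  ultimately show ?thesis
    by (rule LIMSEQ_le) (intro exI allI impI a_star_lower[OF \<phi>(1)])
qed

text \<open>Normalised test functions with energy close to the infimum are the near-minimisers that
  \<open>exponential_type_eq\<close> asks for.\<close>

theorem exponential_type_eq_a_star:
  assumes S: "is_schroedinger_semigroup \<mu> V S"
  shows "exponential_type S = ereal (a_star \<mu> V)"
proof -
  interpret form_semigroup S "bessel_space \<mu>" form "a_star \<mu> V"
  proof
    show "C0_semigroup S" using S by (simp add: is_schroedinger_semigroup_def)
    show "generator S = {(u, - f) | u f. (u, f) \<in> form_operator (bessel_space \<mu>) form}"
      using S by (simp add: is_schroedinger_semigroup_def schroedinger_operator_def)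
  qed (use subspace_bessel form_add_left form_scaleR_left form_commute form_lower a_star_nonneg in blast)+
  show ?thesis
  proof (rule exponential_type_eq)
    fix e :: real assume "e > 0"
    then have "Inf energy_values < a_star \<mu> V + e" by (simp add: a_star_eq)
    from cInf_lessD[OF energy_values_nonempty this]
    show "\<exists>\<phi>\<in>bessel_space \<mu>. norm \<phi> = 1 \<and> form \<phi> \<phi> < a_star \<mu> V + e"
      using test_in_bessel by (auto simp: energy_values_def)
  qed
qed

end

section \<open>Concentration of locally uniformly integrable potentials\<close>

text \<open>Above the level \<open>l\<close> the factor (w/l)^(q-1) is at least 1. Integrated with a
  level adapted to the radius, this plays the role of Hoelder's inequality.\<close>

lemma truncation_bound:
  fixes w l q :: real
  assumes "0 \<le> w" "0 < l" "1 < q"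
  shows "w \<le> l + l powr (1 - q) * w powr q"
proof (cases "w \<le> l")
  case False
  then have w: "0 < w" using assms by simp
  have "w = w powr (1 - q) * w powr q" using w by (simp add: powr_add[symmetric])
  also have "\<dots> \<le> l powr (1 - q) * w powr q"
    using assms False by (intro mult_right_mono powr_mono2') auto
  finally show ?thesis using assms by simp
qed (simp add: add_increasing2)

lemma L_U_measurable: "V \<in> L_U p \<Longrightarrow> V \<in> borel_measurable lebesgue"
  by (auto simp: L_U_def L_inf_def L_loc_def split: if_splits)

text \<open>An essentially bounded \<open>V\<close> has mass O(r^N) on small balls; for a finite
  exponent q the L^q norm over the unit ball with the same centre gives O(r^(N - N/q)). The
  hypothesis on the exponent places both powers above N - 2 \<mu>.\<close>

lemma L_U_concentration:
  fixes V W :: "'a::euclidean_space \<Rightarrow> real"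
  assumes V: "V \<in> L_U p\<^sub>0" and p0: "p\<^sub>0 > ereal (max (real DIM('a) / (2 * \<mu>)) 1)" and \<mu>: "0 < \<mu>"
    and [measurable]: "W \<in> borel_measurable borel" and ae: "AE x in lebesgue. V x = W x" and W: "\<And>x. 0 \<le> W x"
  shows "\<exists>A \<beta>. 0 \<le> A \<and> \<beta> > real DIM('a) - 2 * \<mu> \<and>
    (\<forall>p r. 0 < r \<longrightarrow> r \<le> 1 \<longrightarrow> (\<integral>\<^sup>+x. ennreal (W x) * indicator (ball p r) x \<partial>lborel) \<le> ennreal (A * r powr \<beta>))"
proof -
  let ?N = "DIM('a)"
  define \<omega> where "\<omega> = unit_ball_vol (real ?N)"
  have \<omega>: "\<omega> > 0" unfolding \<omega>_def by (rule unit_ball_vol_pos) simp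
  have vol: "emeasure lborel (ball p r) = ennreal (\<omega> * r powr real ?N)" if "0 < r" for p :: 'a and r
    using that by (simp only: emeasure_ball_measure measure_ball_formula less_imp_le \<omega>_def powr_realpow)
  show ?thesis
  proof (cases "p\<^sub>0 = \<infinity>")
    case True
    then obtain C where C: "AE x in lebesgue. \<bar>V x\<bar> \<le> C" using V by (auto simp: L_U_def L_inf_def)
    have "(\<integral>\<^sup>+x. ennreal (W x) * indicator (ball p r) x \<partial>lborel) \<le> ennreal (\<bar>C\<bar> * \<omega> * r powr real ?N)"
      if r: "0 < r" for p :: 'a and r
    proof -
      have "(\<integral>\<^sup>+x. ennreal (W x) * indicator (ball p r) x \<partial>lborel) = (\<integral>\<^sup>+x. ennreal (W x) * indicator (ball p r) x \<partial>lebesgue)"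
        by (simp only: nn_integral_completion)
      also have "\<dots> \<le> (\<integral>\<^sup>+x. ennreal \<bar>C\<bar> * indicator (ball p r) x \<partial>lebesgue)"
        by (intro nn_integral_mono_AE, use C ae in eventually_elim) (auto intro!: mult_right_mono ennreal_leI)
      also have "\<dots> = (\<integral>\<^sup>+x. ennreal \<bar>C\<bar> * indicator (ball p r) x \<partial>lborel)"
        by (simp only: nn_integral_completion)
      also have "\<dots> = ennreal \<bar>C\<bar> * ennreal (\<omega> * r powr real ?N)"
        unfolding vol[OF r, symmetric, of p] by (rule nn_integral_cmult_indicator) simp
      finally show ?thesis using \<omega> by (simp add: ennreal_mult[symmetric] mult.assoc)
    qed
    then show ?thesis using \<mu> \<omega>
      by (intro exI[of _ "\<bar>C\<bar> * \<omega>"] exI[of _ "real ?N"]) simp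
  next
    case False
    then obtain q where q: "p\<^sub>0 = ereal q" using p0 by (cases p\<^sub>0) auto
    then have q1: "1 < q" and qN: "real ?N / (2 * \<mu>) < q" using p0 by auto
    have Vloc: "V \<in> L_loc q" and bdd: "bdd_above (range (L_ball_norm q V))" using V q by (auto simp: L_U_def)
    obtain B where B: "\<And>x. L_ball_norm q V x \<le> B" using bdd by (auto simp: bdd_above_def)
    define K where "K = (max B 0) powr q"
    have Kb: "(\<integral>\<^sup>+x. ennreal (W x powr q) * indicator (ball p 1) x \<partial>lborel) \<le> ennreal K" for p
    proof -
      define J where "J = (\<integral>x. indicator (ball p 1) x *\<^sub>R (\<bar>V x\<bar> powr q) \<partial>lebesgue)"
      have "set_integrable lebesgue (cball p 1) (\<lambda>x. \<bar>V x\<bar> powr q)" using Vloc by (auto simp: L_loc_def)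
      then have "set_integrable lebesgue (ball p 1) (\<lambda>x. \<bar>V x\<bar> powr q)"
        by (rule set_integrable_subset) (auto simp: ball_subset_cball)
      then have i: "integrable lebesgue (\<lambda>x. indicator (ball p 1) x *\<^sub>R (\<bar>V x\<bar> powr q))"
        by (simp only: set_integrable_def)
      have J0: "0 \<le> J" unfolding J_def by (intro integral_nonneg_AE AE_I2) simp
      have "(\<integral>\<^sup>+x. ennreal (W x powr q) * indicator (ball p 1) x \<partial>lborel)
          = (\<integral>\<^sup>+x. ennreal (W x powr q) * indicator (ball p 1) x \<partial>lebesgue)"
        by (simp only: nn_integral_completion)
      also have "\<dots> = (\<integral>\<^sup>+x. ennreal (indicator (ball p 1) x *\<^sub>R (\<bar>V x\<bar> powr q)) \<partial>lebesgue)"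
        by (intro nn_integral_cong_AE, use ae in eventually_elim) (auto simp: indicator_def W)
      also have "\<dots> = ennreal J" unfolding J_def by (rule nn_integral_eq_integral[OF i]) simp
      \<comment> \<open>\<open>L_ball_norm\<close> contains a root of order \<open>q\<close>, which
        is undone here.\<close>
      also have "J = (J powr (1 / q)) powr q" using J0 q1 by (simp add: powr_powr)
      also have "J powr (1 / q) = L_ball_norm q V p" by (simp add: L_ball_norm_def J_def set_lebesgue_integral_def)
      also have "ennreal ((L_ball_norm q V p) powr q) \<le> ennreal K"
        unfolding K_def using q1 B[of p] by (intro ennreal_leI powr_mono2) (auto simp: L_ball_norm_def)
      finally show ?thesis .
    qed
    have main: "(\<integral>\<^sup>+x. ennreal (W x) * indicator (ball p r) x \<partial>lborel) \<le> ennreal ((\<omega> + K) * r powr (real ?N - real ?N / q))"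
      if r: "0 < r" "r \<le> 1" for p :: 'a and r
    proof -
      \<comment> \<open>The level that balances the two terms: l r^N and l^(1-q) both equal r^(N -
        N/q).\<close>
      define l where "l = r powr (- (real ?N / q))"
      have l: "0 < l" using r by (simp add: l_def)
      have K0: "0 \<le> K" by (simp add: K_def)
      have l1: "l * r powr real ?N = r powr (real ?N - real ?N / q)"
        unfolding l_def by (simp add: powr_add[symmetric])
      have "- (real ?N / q) * (1 - q) = real ?N - real ?N / q" using q1 by (simp add: field_simps)
      then have l2: "l powr (1 - q) = r powr (real ?N - real ?N / q)"
        unfolding l_def powr_powr by (simp only:)
      have "(\<integral>\<^sup>+x. ennreal (W x) * indicator (ball p r) x \<partial>lborel)
        \<le> (\<integral>\<^sup>+x. ennreal l * indicator (ball p r) x + ennreal (l powr (1 - q)) * (ennreal (W x powr q) * indicator (ball p 1) x) \<partial>lborel)"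
      proof (rule nn_integral_mono)
        fix x
        have "ennreal (W x) \<le> ennreal (l + l powr (1 - q) * W x powr q)"
          by (intro ennreal_leI truncation_bound W l q1)
        then have "ennreal (W x) \<le> ennreal l + ennreal (l powr (1 - q)) * ennreal (W x powr q)"
          using l by (simp add: ennreal_mult)
        then show "ennreal (W x) * indicator (ball p r) x \<le> ennreal l * indicator (ball p r) x
            + ennreal (l powr (1 - q)) * (ennreal (W x powr q) * indicator (ball p 1) x)"
          using r by (auto simp: indicator_def)
      qed
      also have "\<dots> = ennreal l * emeasure lborel (ball p r)
          + ennreal (l powr (1 - q)) * (\<integral>\<^sup>+x. ennreal (W x powr q) * indicator (ball p 1) x \<partial>lborel)"
        by (simp add: nn_integral_add nn_integral_cmult nn_integral_cmult_indicator)
      also have "\<dots> \<le> ennreal l * ennreal (\<omega> * r powr real ?N) + ennreal (l powr (1 - q)) * ennreal K"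
        unfolding vol[OF r(1)] by (intro add_left_mono mult_left_mono Kb) simp
      also have "\<dots> = ennreal (l * (\<omega> * r powr real ?N) + l powr (1 - q) * K)"
        using l \<omega> K0 by (simp add: ennreal_mult)
      also have "l * (\<omega> * r powr real ?N) + l powr (1 - q) * K = (\<omega> + K) * r powr (real ?N - real ?N / q)"
        unfolding l1[symmetric] unfolding l2 l1[symmetric] by (simp add: algebra_simps)
      finally show ?thesis .
    qed
    have "real ?N / q < 2 * \<mu>" using qN q1 \<mu> by (simp add: field_simps)
    then show ?thesis using main \<omega>
      by (intro exI[of _ "\<omega> + K"] exI[of _ "real ?N - real ?N / q"]) (simp add: K_def)
  qed
qed

section \<open>Positivity of the spectral bound\<close>

context schroedinger_potential
begin

lemma form_test_nn:
  assumes f: "\<phi> \<in> test_functions"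
  shows "ennreal (form (abs_L2 \<phi>) (abs_L2 \<phi>))
    = ennreal (frac_energy \<mu> \<phi>) + (\<integral>\<^sup>+x. ennreal (W x) * ennreal ((\<phi> x)\<^sup>2) \<partial>lborel)"
proof -
  have sq: "sq_integrable \<phi>" by (rule lip_sq_integrable[OF test_function_lip[OF f]])
  let ?I = "\<integral>x. W x * (rep_L2 (abs_L2 \<phi>) x)\<^sup>2 \<partial>lebesgue"
  have "ennreal ?I = (\<integral>\<^sup>+x. ennreal (W x * (rep_L2 (abs_L2 \<phi>) x)\<^sup>2) \<partial>lebesgue)"
    by (rule nn_integral_eq_integral[symmetric, OF integrable_potential_sq[OF test_in_bessel[OF f]]]) (simp add: W_nonneg)
  also have "\<dots> = (\<integral>\<^sup>+x. ennreal (W x) * ennreal ((\<phi> x)\<^sup>2) \<partial>lebesgue)"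
    by (intro nn_integral_cong_AE, use rep_abs_L2[OF sq] in eventually_elim) (simp add: ennreal_mult W_nonneg)
  finally have I: "ennreal ?I = (\<integral>\<^sup>+x. ennreal (W x) * ennreal ((\<phi> x)\<^sup>2) \<partial>lborel)"
    by (simp only: nn_integral_completion)
  have "0 \<le> ?I" by (intro integral_nonneg_AE AE_I2) (simp add: W_nonneg)
  then show ?thesis unfolding I[symmetric] form_self by (intro ennreal_plus) simp_all
qed

lemma nn_set_integral_V:
  "(\<integral>\<^sup>+x\<in>G. ennreal (V x) \<partial>lebesgue) = (\<integral>\<^sup>+x. ennreal (W x) * indicator G x \<partial>lborel)"
proof -
  have "(\<integral>\<^sup>+x\<in>G. ennreal (V x) \<partial>lebesgue) = (\<integral>\<^sup>+x. ennreal (W x) * indicator G x \<partial>lebesgue)"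
    by (intro nn_integral_cong_AE, use V_eq_W in eventually_elim) (simp)
  then show ?thesis by (simp only: nn_integral_completion)
qed

text \<open>A bump on a ball of radius R \<ge> 1 inside \<open>G\<close> has squared norm at least
  of order R^N, energy at most \<eta>^(2 \<mu>) times that norm plus O(R^(N-2)) for fixed \<eta>,
  and potential term at most the integral over \<open>G\<close>. Dividing by the squared norm gives
  \<open>a_star \<mu> V \<le> \<eta> powr (2 * \<mu>) + K \<eta> / R\<close>; \<eta> is chosen
  before R.\<close>

theorem integral_infinite_of_a_star_pos:
  assumes pos: "0 < a_star \<mu> V" and G: "G \<in> large_ball_sets"
  shows "(\<integral>\<^sup>+x\<in>G. ennreal (V x) \<partial>lebesgue) = \<infinity>"
proof (rule ccontr)
  assume "(\<integral>\<^sup>+x\<in>G. ennreal (V x) \<partial>lebesgue) \<noteq> \<infinity>"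
  then have "(\<integral>\<^sup>+x. ennreal (W x) * indicator G x \<partial>lborel) < \<infinity>" by (simp add: nn_set_integral_V less_top)
  then obtain i where i: "0 \<le> i" "(\<integral>\<^sup>+x. ennreal (W x) * indicator G x \<partial>lborel) = ennreal i"
    by (cases "\<integral>\<^sup>+x. ennreal (W x) * indicator G x \<partial>lborel") auto
  let ?N = "DIM('a)"
  define \<omega> where "\<omega> = unit_ball_vol (real ?N)"
  have \<omega>: "\<omega> > 0" unfolding \<omega>_def by (rule unit_ball_vol_pos) simp
  have vol: "measure lborel (ball x r) = \<omega> * r ^ ?N" if "0 \<le> r" for x :: 'a and r
    unfolding \<omega>_def by (rule measure_ball_formula[OF that])
  have "lip_compact_supp (\<lambda>x::'a. bump (1 *\<^sub>R (x - 0)))"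
    by (rule test_function_lip[OF bump_test_function]) simp
  then obtain L where L: "0 \<le> L" "\<And>x y::'a. \<bar>bump x - bump y\<bar> \<le> L * norm (x - y)"
    unfolding lip_compact_supp_def by auto
  \<comment> \<open>The constants of the two terms that vanish as \<open>R\<close> grows. The powers
    of 2 and \<open>exp 4\<close> come from comparing the volume of the ball of radius
    \<open>R + 1\<close> and the squared norm of the bump with R^N.\<close>
  define K where "K \<eta> = \<eta> powr (2 * \<mu> - 2) * (real ?N * L\<^sup>2 * (4 ^ ?N * exp 4)) + i * (2 ^ ?N * exp 4) / \<omega>" for \<eta>
  have est: "a_star \<mu> V \<le> \<eta> powr (2 * \<mu>) + K \<eta> / R" if \<eta>: "0 < \<eta>" and R: "1 \<le> R" for \<eta> R
  proof -
    obtain x\<^sub>0 where x0: "ball x\<^sub>0 R \<subseteq> G" using G R by (force simp: large_ball_sets_def)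
    define f where "f x = bump ((1 / R) *\<^sub>R (x - x\<^sub>0))" for x
    have f: "f \<in> test_functions" unfolding f_def[abs_def] by (rule bump_test_function) (use R in simp)
    have supp: "x \<in> ball x\<^sub>0 R" if "f x \<noteq> 0" for x
    proof (rule ccontr)
      assume "x \<notin> ball x\<^sub>0 R"
      then have "1 \<le> norm ((1 / R) *\<^sub>R (x - x\<^sub>0))"
        using R by (simp add: dist_norm norm_minus_commute del: scaleR_right_diff_distrib)
      then show False using that bump_eq_0 unfolding f_def by blast
    qed
    have Lf: "\<bar>f x - f y\<bar> \<le> (L / R) * norm (x - y)" for x y
    proof -
      have "(1 / R) *\<^sub>R (x - x\<^sub>0) - (1 / R) *\<^sub>R (y - x\<^sub>0) = (1 / R) *\<^sub>R (x - y)"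
        by (simp add: scaleR_right_diff_distrib)
      then show ?thesis using L(2)[of "(1 / R) *\<^sub>R (x - x\<^sub>0)" "(1 / R) *\<^sub>R (y - x\<^sub>0)"] R unfolding f_def by simp
    qed
    define m where "m = (norm (abs_L2 f))\<^sup>2"
    have R0: "0 < R" using R by simp
    have m: "exp (- 4) * (\<omega> * (R / 2) ^ ?N) \<le> m"
      unfolding m_def f_def[abs_def] using bump_norm_ge[OF R0, of x\<^sub>0] R by (simp add: vol)
    have E: "frac_energy \<mu> f \<le> \<eta> powr (2 * \<mu>) * m + \<eta> powr (2 * \<mu> - 2) * (real ?N * (L / R)\<^sup>2 * (\<omega> * (R + 1) ^ ?N))"
    proof -
      have "frac_energy \<mu> f \<le> \<eta> powr (2 * \<mu>) * (norm (abs_L2 f))\<^sup>2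
          + \<eta> powr (2 * \<mu> - 2) * (real ?N * (L / R)\<^sup>2 * measure lborel (ball x\<^sub>0 (R + 1)))"
        by (rule frac_energy_interpolation[OF test_function_lip[OF f] mu \<eta> _ Lf supp]) (use L R in auto)
      then show ?thesis using R by (simp add: vol m_def)
    qed
    have P: "(\<integral>\<^sup>+x. ennreal (W x) * ennreal ((f x)\<^sup>2) \<partial>lborel) \<le> ennreal i"
      unfolding i(2)[symmetric]
    proof (intro nn_integral_mono mult_left_mono)
      fix x show "ennreal ((f x)\<^sup>2) \<le> indicator G x"
      proof (cases "f x = 0")
        case False
        have "f x ^ 2 \<le> 1" unfolding f_def by (intro power_le_one bump_nonneg bump_le_1)
        then show ?thesis using supp[OF False] x0 by (auto simp: indicator_def)
      qed simp
    qed simp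
    have "ennreal (a_star \<mu> V * m) \<le> ennreal (form (abs_L2 f) (abs_L2 f))"
      unfolding m_def by (intro ennreal_leI a_star_lower f)
    also have "\<dots> \<le> ennreal (frac_energy \<mu> f) + ennreal i"
      unfolding form_test_nn[OF f] by (intro add_left_mono P)
    also have "\<dots> = ennreal (frac_energy \<mu> f + i)" using i(1) by (intro ennreal_plus[symmetric]) simp_all
    finally have "a_star \<mu> V * m \<le> frac_energy \<mu> f + i"
      by (simp only: ennreal_le_iff add_nonneg_nonneg zero_le_power2 i(1))
    also note E
    finally have am: "a_star \<mu> V * m \<le> \<eta> powr (2 * \<mu>) * m
        + \<eta> powr (2 * \<mu> - 2) * (real ?N * (L / R)\<^sup>2 * (\<omega> * (R + 1) ^ ?N)) + i" by simp
    define t where "t = (2::real) ^ ?N"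
    define \<rho> where "\<rho> = R ^ ?N"
    define h where "h = \<eta> powr (2 * \<mu> - 2) * (real ?N * L\<^sup>2)"
    have t: "0 < t" and h: "0 \<le> h" by (simp_all add: t_def h_def)
    \<comment> \<open>The dimension is at least 1, so the fixed potential term divided by a squared
      norm of order R^N is O(1/R).\<close>
    have \<rho>: "R \<le> \<rho>" unfolding \<rho>_def using R power_increasing[of 1 ?N R] DIM_positive[where 'a='a] by simp
    have m': "\<omega> * \<rho> \<le> t * exp 4 * m"
      using m by (simp add: t_def \<rho>_def exp_minus power_divide field_simps)
    have mpos: "0 < m"
    proof -
      have "0 < \<omega> * \<rho>" using \<omega> \<rho> R by simp
      then have "0 < t * exp 4 * m" using m' by linarith
      then show ?thesis by (rule zero_less_mult_pos) (use t in simp)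
    qed
    have "(R + 1) ^ ?N \<le> (2 * R) ^ ?N" using R by (intro power_mono) auto
    then have "(R + 1) ^ ?N \<le> t * \<rho>" by (simp add: t_def \<rho>_def power_mult_distrib)
    then have "h * (1 / R\<^sup>2) * (\<omega> * (R + 1) ^ ?N) \<le> h * (1 / R) * (\<omega> * (t * \<rho>))"
      using h \<omega> R \<rho> t by (intro mult_mono) (auto simp: power2_eq_square field_simps)
    also have "\<dots> = h * (1 / R) * t * (\<omega> * \<rho>)" by simp
    also have "\<dots> \<le> h * (1 / R) * t * (t * exp 4 * m)"
      using h R t by (intro mult_left_mono m') auto
    finally have 1: "\<eta> powr (2 * \<mu> - 2) * (real ?N * (L / R)\<^sup>2 * (\<omega> * (R + 1) ^ ?N)) \<le> h * (t * t * exp 4) / R * m"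
      by (simp add: h_def power_divide mult_ac)
    have "i * 1 \<le> i * (\<rho> / R)" using i(1) \<rho> R by (intro mult_left_mono) auto
    also have "\<dots> = i / (\<omega> * R) * (\<omega> * \<rho>)" using \<omega> by simp
    also have "\<dots> \<le> i / (\<omega> * R) * (t * exp 4 * m)" using i(1) \<omega> R by (intro mult_left_mono m') auto
    finally have 2: "i \<le> i * (t * exp 4) / \<omega> / R * m" by (simp add: field_simps)
    have "K \<eta> = h * (t * t * exp 4) + i * (t * exp 4) / \<omega>"
      by (simp add: K_def h_def t_def power_mult_distrib[symmetric] mult.assoc)
    then have "a_star \<mu> V * m \<le> (\<eta> powr (2 * \<mu>) + K \<eta> / R) * m"
      using am 1 2 by (simp add: distrib_right add_divide_distrib)
    then show ?thesis using mpos by simp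
  qed
  define a where "a = a_star \<mu> V"
  \<comment> \<open>This makes \<eta>^(2 \<mu>) half of \<open>a\<close>; \<open>R\<close> then
    makes the rest at most a quarter, leaving \<open>a \<le> 3 / 4 * a\<close>.\<close>
  define \<eta> where "\<eta> = (a / 2) powr (1 / (2 * \<mu>))"
  have \<eta>: "0 < \<eta>" using pos by (simp add: \<eta>_def a_def)
  have \<eta>2: "\<eta> powr (2 * \<mu>) = a / 2" using pos mu unfolding \<eta>_def by (simp add: powr_powr a_def)
  define R where "R = max 1 (4 * K \<eta> / a)"
  have R: "1 \<le> R" "4 * K \<eta> / a \<le> R" by (auto simp: R_def)
  have "K \<eta> / R \<le> a / 4" using R pos by (simp add: field_simps a_def)
  moreover have "a \<le> a / 2 + K \<eta> / R" using est[OF \<eta> R(1)] unfolding \<eta>2 a_def[symmetric] .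
  moreover have "0 < a" using pos by (simp only: a_def)
  ultimately show False by linarith
qed

lemma uniform_lower_bound:
  assumes inf: "\<And>G. G \<in> large_ball_sets \<Longrightarrow> (\<integral>\<^sup>+x\<in>G. ennreal (V x) \<partial>lebesgue) = \<infinity>"
  shows "\<exists>R>0. \<exists>c>0. \<forall>p. ennreal c \<le> (\<integral>\<^sup>+x. ennreal (W x) * indicator (ball p R) x \<partial>lborel)"
proof (rule ccontr)
  \<comment> \<open>As a measure, the mass of \<open>W\<close> is countably subadditive over the
    possibly overlapping balls.\<close>
  define \<nu> where "\<nu> = density lborel (\<lambda>x. ennreal (W x))"
  have \<nu>: "emeasure \<nu> S = (\<integral>\<^sup>+x. ennreal (W x) * indicator S x \<partial>lborel)" if "S \<in> sets borel" for S
    unfolding \<nu>_def by (rule emeasure_density) (use that in auto)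
  assume "\<not> ?thesis"
  then have "\<exists>p. emeasure \<nu> (ball p (real (Suc n))) < ennreal ((1 / 2) ^ n)" for n
    by (subst \<nu>) (auto simp: not_le dest!: spec[of _ "real (Suc n)"] spec[of _ "(1 / 2) ^ n :: real"])
  then obtain p where p: "\<And>n. emeasure \<nu> (ball (p n) (real (Suc n))) < ennreal ((1 / 2) ^ n)" by metis
  define G where "G = (\<Union>n. ball (p n) (real (Suc n)))"
  have "G \<in> large_ball_sets"
    unfolding large_ball_sets_def
  proof (intro CollectI conjI allI impI)
    show "open G" unfolding G_def by auto
    fix r :: real
    obtain n where "r \<le> real n" using real_arch_simple by blast
    then have "ball (p n) r \<subseteq> ball (p n) (real (Suc n))" by (intro subset_ball) simp
    then show "\<exists>x\<^sub>0. ball x\<^sub>0 r \<subseteq> G" unfolding G_def by blast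
  qed
  from inf[OF this] have "emeasure \<nu> G = \<infinity>" by (subst \<nu>) (simp_all add: nn_set_integral_V G_def)
  moreover have "emeasure \<nu> G \<le> (\<Sum>n. emeasure \<nu> (ball (p n) (real (Suc n))))"
    unfolding G_def by (rule emeasure_subadditive_countably) (auto simp: \<nu>_def)
  moreover have "\<dots> \<le> (\<Sum>n. ennreal ((1 / 2) ^ n))" by (intro suminf_le p less_imp_le) auto
  moreover have "\<dots> = ennreal (\<Sum>n. (1 / 2) ^ n)" by (intro suminf_ennreal2 summable_geometric) auto
  ultimately show False by (simp add: top_unique)
qed

text \<open>Since |w| \<le> M almost everywhere, W \<le> min(W, M) + |w - V|. A ball of radius
  \<open>R\<close> is covered by a fixed number of unit balls, so the error integrates over it to at
  most that number times the L^1_U distance; the truncation \<open>U\<close> keeps half of the lower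
  bound and \<open>coercivity\<close> applies to it.\<close>

theorem a_star_pos:
  assumes approx: "L1_U_approximable V"
    and inf: "\<And>G. G \<in> large_ball_sets \<Longrightarrow> (\<integral>\<^sup>+x\<in>G. ennreal (V x) \<partial>lebesgue) = \<infinity>"
  shows "0 < a_star \<mu> V"
proof -
  obtain R c where R: "0 < R" and c: "0 < c"
    and lower: "\<And>p. ennreal c \<le> (\<integral>\<^sup>+x. ennreal (W x) * indicator (ball p R) x \<partial>lborel)"
    using uniform_lower_bound[OF inf] by blast
  obtain F where F: "finite F" "cball (0::'a) R \<subseteq> (\<Union>q\<in>F. ball q 1)"
  proof (rule compactE_image[of "cball (0::'a) R" UNIV "\<lambda>q. ball q 1"])
    show "cball 0 R \<subseteq> (\<Union>q\<in>UNIV. ball q 1)" by (intro subsetI UN_I[OF UNIV_I]) (rule centre_in_ball[THEN iffD2, OF zero_less_one])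
  qed auto
  \<comment> \<open>Small enough that \<open>card F\<close> unit balls contribute at most
    \<open>c / 2\<close>; the added 1 makes the denominator evidently positive.\<close>
  define \<epsilon> where "\<epsilon> = c / (2 * (real (card F) + 1))"
  have \<epsilon>: "0 < \<epsilon>" using c by (simp add: \<epsilon>_def)
  obtain Wn where Wn: "\<And>n. Wn n \<in> L_inf" "(\<lambda>n. L_U_norm 1 (\<lambda>x. Wn n x - V x)) \<longlonglongrightarrow> 0"
    using approx by (auto simp: L1_U_approximable_def)
  have "eventually (\<lambda>n. L_U_norm 1 (\<lambda>x. Wn n x - V x) < \<epsilon>) sequentially"
    by (rule order_tendstoD(2)[OF Wn(2) \<epsilon>])
  then obtain n where n: "L_U_norm 1 (\<lambda>x. Wn n x - V x) < \<epsilon>" by (auto simp: eventually_sequentially)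
  define w where "w = Wn n"
  have [measurable]: "w \<in> borel_measurable lebesgue" using Wn(1)[of n] by (simp add: L_inf_def w_def)
  obtain M' where M': "AE x in lebesgue. \<bar>w x\<bar> \<le> M'" using Wn(1)[of n] by (auto simp: L_inf_def w_def)
  define M where "M = max M' 0"
  have M0: "0 \<le> M" by (simp add: M_def)
  have M: "AE x in lebesgue. \<bar>w x\<bar> \<le> M" using M' by eventually_elim (simp add: M_def)
  define g where "g p = (\<integral>\<^sup>+x. ennreal \<bar>w x - V x\<bar> * indicator (ball p 1) x \<partial>lebesgue)" for p
  define v where "v = measure lborel (ball (0::'a) 1)"
  have v0: "0 \<le> v" by (simp add: v_def)
  have v: "emeasure lborel (ball p 1) = ennreal v" for p :: 'a
    by (simp only: emeasure_ball_measure measure_ball_formula v_def zero_le_one)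
  \<comment> \<open>\<open>L_U_norm\<close> is a real supremum and \<open>enn2real\<close> maps
    \<infinity> to 0, so a uniform finite bound must precede any conclusion from the smallness of
    the norm. It comes from |w| \<le> M and the concentration of \<open>W\<close> on unit
    balls.\<close>
  have g_fin: "g p \<le> ennreal (M * v + A)" for p
  proof -
    have "g p \<le> (\<integral>\<^sup>+x. ennreal M * indicator (ball p 1) x + ennreal (W x) * indicator (ball p 1) x \<partial>lebesgue)"
      unfolding g_def
    proof (rule nn_integral_mono_AE)
      show "AE x in lebesgue. ennreal \<bar>w x - V x\<bar> * indicator (ball p 1) x
          \<le> ennreal M * indicator (ball p 1) x + ennreal (W x) * indicator (ball p 1) x"
        using M V_eq_W
      proof eventually_elim
        case (elim x)
        have "\<bar>w x - V x\<bar> \<le> M + W x" using elim W_nonneg[of x] by linarith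
        then have "ennreal \<bar>w x - V x\<bar> \<le> ennreal M + ennreal (W x)"
          using M0 W_nonneg[of x] by (metis ennreal_leI ennreal_plus)
        from mult_right_mono[OF this, of "indicator (ball p 1) x"] show ?case by (simp add: distrib_right)
      qed
    qed
    also have "\<dots> = (\<integral>\<^sup>+x. ennreal M * indicator (ball p 1) x + ennreal (W x) * indicator (ball p 1) x \<partial>lborel)"
      by (simp only: nn_integral_completion)
    also have "\<dots> = ennreal M * ennreal v + (\<integral>\<^sup>+x. ennreal (W x) * indicator (ball p 1) x \<partial>lborel)"
      unfolding v[symmetric, of p] by (simp add: nn_integral_add nn_integral_cmult_indicator)
    also have "\<dots> \<le> ennreal M * ennreal v + ennreal (A * 1 powr \<beta>)"
      by (intro add_left_mono concentration) auto
    finally show ?thesis using M0 v0 A_nonneg by (simp add: ennreal_mult)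
  qed
  have ball_norm: "L_ball_norm 1 (\<lambda>x. w x - V x) p = enn2real (g p)" for p
  proof -
    have "(LINT x:ball p 1|lebesgue. \<bar>w x - V x\<bar> powr 1) = (\<integral>x. \<bar>w x - V x\<bar> * indicator (ball p 1) x \<partial>lebesgue)"
      by (simp add: set_lebesgue_integral_def mult.commute)
    also have "\<dots> = enn2real (\<integral>\<^sup>+x. ennreal (\<bar>w x - V x\<bar> * indicator (ball p 1) x) \<partial>lebesgue)"
    proof (rule integral_eq_nn_integral)
      have [measurable]: "ball p 1 \<in> sets lebesgue" by simp
      show "(\<lambda>x. \<bar>w x - V x\<bar> * indicator (ball p 1) x) \<in> borel_measurable lebesgue" by measurable
    qed simp
    also have "\<dots> = enn2real (g p)"
      unfolding g_def by (intro arg_cong[where f = enn2real] nn_integral_cong) (auto simp: indicator_def)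
    finally show ?thesis by (simp add: L_ball_norm_def)
  qed
  have g: "g p \<le> ennreal \<epsilon>" for p
  proof -
    have "bdd_above (range (L_ball_norm 1 (\<lambda>x. w x - V x)))"
    proof (rule bdd_aboveI)
      fix y assume "y \<in> range (L_ball_norm 1 (\<lambda>x. w x - V x))"
      then obtain p where "y = enn2real (g p)" by (auto simp: ball_norm)
      then show "y \<le> M * v + A" using g_fin[of p] M0 v0 A_nonneg by (simp add: enn2real_leI)
    qed
    then have "L_ball_norm 1 (\<lambda>x. w x - V x) p \<le> L_U_norm 1 (\<lambda>x. w x - V x)"
      unfolding L_U_norm_def by (rule cSUP_upper[OF UNIV_I])
    then have "enn2real (g p) \<le> \<epsilon>" using n unfolding ball_norm w_def[symmetric] by linarith
    moreover have "g p < \<infinity>" using g_fin[of p] by (simp add: le_less_trans)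
    ultimately show ?thesis by (metis ennreal_enn2real ennreal_leI infinity_ennreal_def)
  qed
  define U where "U x = min (W x) M" for x
  have [measurable]: "U \<in> borel_measurable borel" unfolding U_def[abs_def] by measurable
  have U0: "0 \<le> U x" for x using W_nonneg M0 by (simp add: U_def)
  have lowU: "ennreal (c / 2) \<le> (\<integral>\<^sup>+x. ennreal (U x) * indicator (ball p R) x \<partial>lborel)" for p
  proof -
    let ?X = "\<integral>\<^sup>+x. ennreal (U x) * indicator (ball p R) x \<partial>lborel"
    \<comment> \<open>The cover of the ball at 0 is translated to \<open>p\<close>, so the number of
      unit balls does not depend on \<open>p\<close>.\<close>
    have cover: "indicator (ball p R) x \<le> (\<Sum>q\<in>F. indicator (ball (p + q) 1) x :: ennreal)" for x
    proof (cases "x \<in> ball p R")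
      case True
      then have "x - p \<in> cball 0 R" by (simp add: dist_norm norm_minus_commute)
      then obtain q where q: "q \<in> F" "x - p \<in> ball q 1" using F(2) by blast
      have "(1::ennreal) = indicator (ball (p + q) 1) x" using q(2) by (simp add: dist_norm algebra_simps)
      also have "\<dots> \<le> (\<Sum>q\<in>F. indicator (ball (p + q) 1) x)" by (rule member_le_sum[OF q(1)]) (simp_all add: F)
      finally show ?thesis using True by simp
    qed simp
    have "ennreal c \<le> (\<integral>\<^sup>+x. ennreal (W x) * indicator (ball p R) x \<partial>lebesgue)"
      using lower[of p] by (simp only: nn_integral_completion)
    also have "\<dots> \<le> (\<integral>\<^sup>+x. ennreal (U x) * indicator (ball p R) x
        + (\<Sum>q\<in>F. ennreal \<bar>w x - V x\<bar> * indicator (ball (p + q) 1) x) \<partial>lebesgue)"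
    proof (rule nn_integral_mono_AE)
      show "AE x in lebesgue. ennreal (W x) * indicator (ball p R) x \<le> ennreal (U x) * indicator (ball p R) x
        + (\<Sum>q\<in>F. ennreal \<bar>w x - V x\<bar> * indicator (ball (p + q) 1) x)"
        using M V_eq_W
      proof eventually_elim
        case (elim x)
        have "W x \<le> U x + \<bar>w x - V x\<bar>" using elim by (auto simp: U_def min_def)
        then have "ennreal (W x) \<le> ennreal (U x) + ennreal \<bar>w x - V x\<bar>"
          using U0[of x] by (metis abs_ge_zero ennreal_leI ennreal_plus)
        then have "ennreal (W x) * indicator (ball p R) x \<le> (ennreal (U x) + ennreal \<bar>w x - V x\<bar>) * indicator (ball p R) x"
          by (rule mult_right_mono) simp
        also have "\<dots> = ennreal (U x) * indicator (ball p R) x + ennreal \<bar>w x - V x\<bar> * indicator (ball p R) x"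
          by (rule distrib_right)
        also have "\<dots> \<le> ennreal (U x) * indicator (ball p R) x + ennreal \<bar>w x - V x\<bar> * (\<Sum>q\<in>F. indicator (ball (p + q) 1) x)"
          by (intro add_left_mono mult_left_mono cover) simp
        finally show ?case by (simp only: sum_distrib_left)
      qed
    qed
    also have "\<dots> = (\<integral>\<^sup>+x. ennreal (U x) * indicator (ball p R) x \<partial>lebesgue) + (\<Sum>q\<in>F. g (p + q))"
    proof -
      have [measurable]: "U \<in> borel_measurable lebesgue" by (rule measurable_completion) simp
      have [measurable]: "ball a r \<in> sets lebesgue" for a :: 'a and r by simp
      have sum: "(\<integral>\<^sup>+x. (\<Sum>q\<in>F. ennreal \<bar>w x - V x\<bar> * indicator (ball (p + q) 1) x) \<partial>lebesgue) = (\<Sum>q\<in>F. g (p + q))"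
        unfolding g_def by (rule nn_integral_sum) measurable
      show ?thesis unfolding sum[symmetric] by (rule nn_integral_add) measurable
    qed
    also have "\<dots> \<le> ?X + ennreal (c / 2)"
    proof (rule add_mono)
      have "(\<Sum>q\<in>F. g (p + q)) \<le> (\<Sum>q\<in>F. ennreal \<epsilon>)" by (intro sum_mono g)
      also have "\<dots> = ennreal (real (card F) * \<epsilon>)" using \<epsilon> by (simp add: ennreal_mult ennreal_of_nat_eq_real_of_nat)
      also have "\<dots> \<le> ennreal (c / 2)"
        using c by (intro ennreal_leI) (simp add: \<epsilon>_def field_simps)
      finally show "(\<Sum>q\<in>F. g (p + q)) \<le> ennreal (c / 2)" .
    qed (simp only: nn_integral_completion order_refl)
    finally have "ennreal (c / 2) + ennreal (c / 2) \<le> ennreal (c / 2) + ?X"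
      using c by (simp add: ennreal_plus[symmetric] add.commute del: ennreal_plus)
    then show ?thesis by (simp add: ennreal_add_left_cancel_le)
  qed
  have c2: "0 < c / 2" using c by simp
  have UM: "U x \<le> M" for x by (simp add: U_def)
  show ?thesis
  proof (rule coercivity[OF \<open>U \<in> borel_measurable borel\<close> mu M0 UM c2 R lowU])
    fix \<kappa> :: real
    assume \<kappa>: "0 < \<kappa>" "\<And>f. lip_compact_supp f \<Longrightarrow>
      ennreal (\<kappa> * (norm (abs_L2 f))\<^sup>2) \<le> ennreal (frac_energy \<mu> f) + (\<integral>\<^sup>+x. ennreal (U x) * ennreal ((f x)\<^sup>2) \<partial>lborel)"
    have "\<kappa> \<le> a_star \<mu> V"
    proof (rule a_star_greatest)
      fix \<phi> :: "'a \<Rightarrow> real" assume \<phi>: "\<phi> \<in> test_functions"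
      have "ennreal (\<kappa> * (norm (abs_L2 \<phi>))\<^sup>2) \<le> ennreal (frac_energy \<mu> \<phi>) + (\<integral>\<^sup>+x. ennreal (U x) * ennreal ((\<phi> x)\<^sup>2) \<partial>lborel)"
        by (rule \<kappa>(2)[OF test_function_lip[OF \<phi>]])
      also have "\<dots> \<le> ennreal (form (abs_L2 \<phi>) (abs_L2 \<phi>))"
        unfolding form_test_nn[OF \<phi>]
        by (intro add_left_mono nn_integral_mono mult_right_mono ennreal_leI) (auto simp: U_def)
      finally show "\<kappa> * (norm (abs_L2 \<phi>))\<^sup>2 \<le> form (abs_L2 \<phi>) (abs_L2 \<phi>)"
        by (simp add: ennreal_le_iff form_nonneg)
    qed
    then show "0 < a_star \<mu> V" using \<kappa>(1) by simp
  qed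
qed

end

theorem theorem4p9:
  fixes \<mu> :: real and p\<^sub>0 :: ereal and V :: "'a::euclidean_space \<Rightarrow> real"
  assumes "0 < \<mu>" and "\<mu> \<le> 1"
    and "AE x in lebesgue. 0 \<le> V x"
    and "V \<in> L_U p\<^sub>0"
    and "p\<^sub>0 > ereal (max (real DIM('a) / (2 * \<mu>)) 1)"
  shows "(\<forall>S. is_schroedinger_semigroup \<mu> V S \<longrightarrow> exponential_type S = ereal (a_star \<mu> V))
    \<and> a_star \<mu> V \<ge> 0
    \<and> (a_star \<mu> V > 0 \<longrightarrow>
         (\<forall>G\<in>large_ball_sets. (\<integral>\<^sup>+x\<in>G. ennreal (V x) \<partial>lebesgue) = \<infinity>))
    \<and> (L1_U_approximable V \<longrightarrow>
         (\<forall>G\<in>large_ball_sets. (\<integral>\<^sup>+x\<in>G. ennreal (V x) \<partial>lebesgue) = \<infinity>) \<longrightarrow>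
         a_star \<mu> V > 0)"
proof -
  have V: "V \<in> borel_measurable lebesgue" by (rule L_U_measurable[OF assms(4)])
  obtain W\<^sub>0 where W\<^sub>0: "W\<^sub>0 \<in> borel_measurable borel" "AE x in lebesgue. V x = W\<^sub>0 x"
    by (rule ex_borel_version_real[OF V])
  \<comment> \<open>The positive part makes the Borel version nonnegative everywhere; it still
    agrees with \<open>V\<close> almost everywhere because \<open>V\<close> is nonnegative almost
    everywhere.\<close>
  define W where "W x = max 0 (W\<^sub>0 x)" for x
  have W: "W \<in> borel_measurable borel" "\<And>x. 0 \<le> W x"
    unfolding W_def[abs_def] using W\<^sub>0(1) by auto
  have ae: "AE x in lebesgue. V x = W x"
    using assms(3) W\<^sub>0(2) by eventually_elim (simp add: W_def)
  obtain A \<beta> where A: "0 \<le> A" "\<beta> > real DIM('a) - 2 * \<mu>" "\<And>p r. 0 < r \<Longrightarrow> r \<le> 1 \<Longrightarrow>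
      (\<integral>\<^sup>+x. ennreal (W x) * indicator (ball p r) x \<partial>lborel) \<le> ennreal (A * r powr \<beta>)"
    using L_U_concentration[OF assms(4,5,1) W(1) ae W(2)] by blast
  interpret schroedinger_potential \<mu> V W A \<beta>
    by unfold_locales (fact assms V W ae A)+
  show ?thesis
    using exponential_type_eq_a_star a_star_nonneg integral_infinite_of_a_star_pos a_star_pos by blast
qed

end
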